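(* Let $k$ be an algebraically closed field, let $n\ge 2$, let $E\in GL(n,k)$, and let $q\in k^*$ be such that $$q^2+\operatorname{tr}\bigl(E\,({}^tE)^{-1}\bigr)\,q+1=0 .$$ Then there is an equivalence of monoidal categories $$\mathrm{Comod}(\mathcal B(E))\;\cong^{\otimes}\;\mathrm{Comod}(\mathcal O(SL_q(2)))$$ between the comodule categories of the Hopf algebras $\mathcal B(E)$ and $\mathcal O(SL_q(2))$.
   Context: ${}^tx$ denotes the transpose of a matrix $x$ (with entries in a possibly noncommutative algebra: $({}^tx)_{ij}=x_{ji}$). For $E\in GL(n,k)$, $\mathcal B(E)$ is the universal $k$-algebra with generators $a_{ij}$, $1\le i,j\le n$, and relations $E^{-1}\,{}^ta\,E\,a=I=a\,E^{-1}\,{}^ta\,E$, where $a=(a_{ij})$ and $I$ is the identity matrix. It is a Hopf algebra with $\Delta(a_{ij})=\sum_{l=1}^n a_{il}\otimes a_{lj}$, $\varepsilon(a_{ij})=\delta_{ij}$, and $S(a)=E^{-1}\,{}^ta\,E$. For $q\in k^*$, $\mathcal O(SL_q(2))$ is the $k$-algebra generated by $a,b,c,d$ with relations $ba=qab$, $db=qbd$, $ca=qac$, $dc=qcd$, $bc=cb$, $ad-da=(q^{-1}-q)bc$, $ad-q^{-1}bc=1$, with its usual Hopf algebra structure for which $\begin{pmatrix}a&b\\c&d\end{pmatrix}$ is a multiplicative matrix ($\Delta(x_{ij})=\sum_l x_{il}\otimes x_{lj}$, $\varepsilon(x_{ij})=\delta_{ij}$). It coincides with $\mathcal B(E_q)$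 for $E_q=\begin{pmatrix}0&1\\-q^{-1}&0\end{pmatrix}$. $\mathrm{Comod}(A)$ is the monoidal category of (right) comodules over the Hopf algebra $A$. *)

theory Defs
  imports
    "HOL-Analysis.Determinants"
    "HOL-Computational_Algebra.Polynomial"
    "HOL-Library.Poly_Mapping"
    "HOL-Algebra.QuotRing"
    "HOL-Algebra.Module"
begin

section \<open>Monoidal categories and monoidal equivalence\<close>

record ('o, 'm) category =
  Obj :: "'o set"
  Arr :: "'m set"
  Dom :: "'m \<Rightarrow> 'o"
  Cod :: "'m \<Rightarrow> 'o"
  Id :: "'o \<Rightarrow> 'm"
  Comp :: "'m \<Rightarrow> 'm \<Rightarrow> 'm"  (infixl \<open>\<cdot>\<index>\<close> 70)

text \<open>Composition is written in applicative order: \<open>g \<cdot> f\<close> is \<open>g\<close> after \<open>f\<close>.\<close>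

definition Hom :: "('o, 'm, 'x) category_scheme \<Rightarrow> 'o \<Rightarrow> 'o \<Rightarrow> 'm set" where
  "Hom C X Y = {f \<in> Arr C. Dom C f = X \<and> Cod C f = Y}"

locale category =
  fixes C :: "('o, 'm, 'x) category_scheme" (structure)
  assumes dom_obj: "f \<in> Arr C \<Longrightarrow> Dom C f \<in> Obj C"
    and cod_obj: "f \<in> Arr C \<Longrightarrow> Cod C f \<in> Obj C"
    and id_hom: "X \<in> Obj C \<Longrightarrow> Id C X \<in> Hom C X X"
    and comp_hom: "\<lbrakk>f \<in> Hom C X Y; g \<in> Hom C Y Z\<rbrakk> \<Longrightarrow> g \<cdot> f \<in> Hom C X Z"
    and comp_assoc: "\<lbrakk>f \<in> Hom C W X; g \<in> Hom C X Y; h \<in> Hom C Y Z\<rbrakk>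
          \<Longrightarrow> (h \<cdot> g) \<cdot> f = h \<cdot> (g \<cdot> f)"
    and comp_id_left: "f \<in> Hom C X Y \<Longrightarrow> Id C Y \<cdot> f = f"
    and comp_id_right: "f \<in> Hom C X Y \<Longrightarrow> f \<cdot> Id C X = f"

definition iso_arr :: "('o, 'm, 'x) category_scheme \<Rightarrow> 'o \<Rightarrow> 'o \<Rightarrow> 'm \<Rightarrow> bool" where
  "iso_arr C X Y f \<longleftrightarrow> f \<in> Hom C X Y \<and>
     (\<exists>g \<in> Hom C Y X. g \<cdot>\<^bsub>C\<^esub> f = Id C X \<and> f \<cdot>\<^bsub>C\<^esub> g = Id C Y)"

locale cat_functor = C: category C + D: category D
  for C :: "('o, 'm, 'x) category_scheme" and D :: "('p, 'n, 'y) category_scheme" +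
  fixes Fo :: "'o \<Rightarrow> 'p" and Fa :: "'m \<Rightarrow> 'n"
  assumes obj: "X \<in> Obj C \<Longrightarrow> Fo X \<in> Obj D"
    and arr: "f \<in> Hom C X Y \<Longrightarrow> Fa f \<in> Hom D (Fo X) (Fo Y)"
    and preserves_id: "X \<in> Obj C \<Longrightarrow> Fa (Id C X) = Id D (Fo X)"
    and preserves_comp: "\<lbrakk>f \<in> Hom C X Y; g \<in> Hom C Y Z\<rbrakk>
          \<Longrightarrow> Fa (g \<cdot>\<^bsub>C\<^esub> f) = Fa g \<cdot>\<^bsub>D\<^esub> Fa f"

definition natural_iso ::
  "('o, 'm, 'x) category_scheme \<Rightarrow> ('p, 'n, 'y) category_scheme \<Rightarrow>
   ('o \<Rightarrow> 'p) \<Rightarrow> ('m \<Rightarrow> 'n) \<Rightarrow> ('o \<Rightarrow> 'p) \<Rightarrow> ('m \<Rightarrow> 'n) \<Rightarrow> ('o \<Rightarrow> 'n) \<Rightarrow> bool" where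
  "natural_iso C D Fo Fa Go Ga \<eta> \<longleftrightarrow>
     (\<forall>X \<in> Obj C. iso_arr D (Fo X) (Go X) (\<eta> X)) \<and>
     (\<forall>X Y. \<forall>f \<in> Hom C X Y. \<eta> Y \<cdot>\<^bsub>D\<^esub> Fa f = Ga f \<cdot>\<^bsub>D\<^esub> \<eta> X)"

definition equivalence_functor ::
  "('o, 'm, 'x) category_scheme \<Rightarrow> ('p, 'n, 'y) category_scheme \<Rightarrow>
   ('o \<Rightarrow> 'p) \<Rightarrow> ('m \<Rightarrow> 'n) \<Rightarrow> bool" where
  "equivalence_functor C D Fo Fa \<longleftrightarrow> cat_functor C D Fo Fa \<and>
     (\<exists>Go Ga \<eta> \<epsilon>. cat_functor D C Go Ga \<and>
        natural_iso C C id id (Go \<circ> Fo) (Ga \<circ> Fa) \<eta> \<and>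
        natural_iso D D (Fo \<circ> Go) (Fa \<circ> Ga) id id \<epsilon>)"

record ('o, 'm) monoidal_category = "('o, 'm) category" +
  TensO :: "'o \<Rightarrow> 'o \<Rightarrow> 'o"  (infixr \<open>\<boxtimes>\<index>\<close> 75)
  TensA :: "'m \<Rightarrow> 'm \<Rightarrow> 'm"  (infixr \<open>\<boxdot>\<index>\<close> 75)
  Unit :: 'o
  Assoc :: "'o \<Rightarrow> 'o \<Rightarrow> 'o \<Rightarrow> 'm"
  LUnit :: "'o \<Rightarrow> 'm"
  RUnit :: "'o \<Rightarrow> 'm"

locale monoidal_category = category C
  for C :: "('o, 'm, 'x) monoidal_category_scheme" (structure) +
  assumes tens_obj: "\<lbrakk>X \<in> Obj C; Y \<in> Obj C\<rbrakk> \<Longrightarrow> X \<boxtimes> Y \<in> Obj C"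
    and tens_arr: "\<lbrakk>f \<in> Hom C X Y; g \<in> Hom C X' Y'\<rbrakk> \<Longrightarrow> f \<boxdot> g \<in> Hom C (X \<boxtimes> X') (Y \<boxtimes> Y')"
    and tens_id: "\<lbrakk>X \<in> Obj C; Y \<in> Obj C\<rbrakk> \<Longrightarrow> Id C X \<boxdot> Id C Y = Id C (X \<boxtimes> Y)"
    and tens_comp: "\<lbrakk>f \<in> Hom C X Y; g \<in> Hom C Y Z; f' \<in> Hom C X' Y'; g' \<in> Hom C Y' Z'\<rbrakk>
          \<Longrightarrow> (g \<cdot> f) \<boxdot> (g' \<cdot> f') = (g \<boxdot> g') \<cdot> (f \<boxdot> f')"
    and unit_obj: "Unit C \<in> Obj C"
    and assoc_iso: "\<lbrakk>X \<in> Obj C; Y \<in> Obj C; Z \<in> Obj C\<rbrakk>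
          \<Longrightarrow> iso_arr C ((X \<boxtimes> Y) \<boxtimes> Z) (X \<boxtimes> (Y \<boxtimes> Z)) (Assoc C X Y Z)"
    and assoc_natural: "\<lbrakk>f \<in> Hom C X X'; g \<in> Hom C Y Y'; h \<in> Hom C Z Z'\<rbrakk>
          \<Longrightarrow> Assoc C X' Y' Z' \<cdot> ((f \<boxdot> g) \<boxdot> h) = (f \<boxdot> (g \<boxdot> h)) \<cdot> Assoc C X Y Z"
    and lunit_iso: "X \<in> Obj C \<Longrightarrow> iso_arr C (Unit C \<boxtimes> X) X (LUnit C X)"
    and lunit_natural: "f \<in> Hom C X Y \<Longrightarrow> LUnit C Y \<cdot> (Id C (Unit C) \<boxdot> f) = f \<cdot> LUnit C X"
    and runit_iso: "X \<in> Obj C \<Longrightarrow> iso_arr C (X \<boxtimes> Unit C) X (RUnit C X)"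
    and runit_natural: "f \<in> Hom C X Y \<Longrightarrow> RUnit C Y \<cdot> (f \<boxdot> Id C (Unit C)) = f \<cdot> RUnit C X"
    and pentagon: "\<lbrakk>W \<in> Obj C; X \<in> Obj C; Y \<in> Obj C; Z \<in> Obj C\<rbrakk>
          \<Longrightarrow> Assoc C W X (Y \<boxtimes> Z) \<cdot> Assoc C (W \<boxtimes> X) Y Z
            = (Id C W \<boxdot> Assoc C X Y Z) \<cdot> Assoc C W (X \<boxtimes> Y) Z \<cdot> (Assoc C W X Y \<boxdot> Id C Z)"
    and triangle: "\<lbrakk>X \<in> Obj C; Y \<in> Obj C\<rbrakk>
          \<Longrightarrow> (Id C X \<boxdot> LUnit C Y) \<cdot> Assoc C X (Unit C) Y = RUnit C X \<boxdot> Id C Y"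

text \<open>A monoidal functor here is a strong one: its structure maps
  \<open>\<phi>\<^sub>0 : \<one> \<rightarrow> F \<one>\<close> and \<open>\<phi> X Y : F X \<boxtimes> F Y \<rightarrow> F (X \<boxtimes> Y)\<close> are isomorphisms.\<close>

locale monoidal_functor =
  C: monoidal_category C + D: monoidal_category D + cat_functor C D Fo Fa
  for C :: "('o, 'm, 'x) monoidal_category_scheme"
    and D :: "('p, 'n, 'y) monoidal_category_scheme"
    and Fo :: "'o \<Rightarrow> 'p" and Fa :: "'m \<Rightarrow> 'n" +
  fixes \<phi>\<^sub>0 :: 'n and \<phi> :: "'o \<Rightarrow> 'o \<Rightarrow> 'n"
  assumes unit_iso: "iso_arr D (Unit D) (Fo (Unit C)) \<phi>\<^sub>0"
    and tens_iso: "\<lbrakk>X \<in> Obj C; Y \<in> Obj C\<rbrakk>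
          \<Longrightarrow> iso_arr D (Fo X \<boxtimes>\<^bsub>D\<^esub> Fo Y) (Fo (X \<boxtimes>\<^bsub>C\<^esub> Y)) (\<phi> X Y)"
    and tens_natural: "\<lbrakk>f \<in> Hom C X X'; g \<in> Hom C Y Y'\<rbrakk>
          \<Longrightarrow> \<phi> X' Y' \<cdot>\<^bsub>D\<^esub> (Fa f \<boxdot>\<^bsub>D\<^esub> Fa g) = Fa (f \<boxdot>\<^bsub>C\<^esub> g) \<cdot>\<^bsub>D\<^esub> \<phi> X Y"
    and assoc_coherence: "\<lbrakk>X \<in> Obj C; Y \<in> Obj C; Z \<in> Obj C\<rbrakk>
          \<Longrightarrow> Fa (Assoc C X Y Z) \<cdot>\<^bsub>D\<^esub> \<phi> (X \<boxtimes>\<^bsub>C\<^esub> Y) Z \<cdot>\<^bsub>D\<^esub> (\<phi> X Y \<boxdot>\<^bsub>D\<^esub> Id D (Fo Z))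
            = \<phi> X (Y \<boxtimes>\<^bsub>C\<^esub> Z) \<cdot>\<^bsub>D\<^esub> (Id D (Fo X) \<boxdot>\<^bsub>D\<^esub> \<phi> Y Z) \<cdot>\<^bsub>D\<^esub> Assoc D (Fo X) (Fo Y) (Fo Z)"
    and lunit_coherence: "X \<in> Obj C
          \<Longrightarrow> Fa (LUnit C X) \<cdot>\<^bsub>D\<^esub> \<phi> (Unit C) X \<cdot>\<^bsub>D\<^esub> (\<phi>\<^sub>0 \<boxdot>\<^bsub>D\<^esub> Id D (Fo X)) = LUnit D (Fo X)"
    and runit_coherence: "X \<in> Obj C
          \<Longrightarrow> Fa (RUnit C X) \<cdot>\<^bsub>D\<^esub> \<phi> X (Unit C) \<cdot>\<^bsub>D\<^esub> (Id D (Fo X) \<boxdot>\<^bsub>D\<^esub> \<phi>\<^sub>0) = RUnit D (Fo X)"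

definition monoidally_equivalent ::
  "('o, 'm, 'x) monoidal_category_scheme \<Rightarrow> ('p, 'n, 'y) monoidal_category_scheme \<Rightarrow> bool" where
  "monoidally_equivalent C D \<longleftrightarrow> monoidal_category C \<and> monoidal_category D \<and>
     (\<exists>Fo Fa \<phi>\<^sub>0 \<phi>. monoidal_functor C D Fo Fa \<phi>\<^sub>0 \<phi> \<and> equivalence_functor C D Fo Fa)"


section \<open>Vector spaces and tensor products\<close>

text \<open>The ground field is a type \<open>'k\<close>.  Vector spaces and algebras over it are
  \<open>module\<close> records over the ring record \<open>univ_ring\<close>;
  for plain vector spaces the fields \<open>mult\<close> and \<open>one\<close> are ignored.\<close>

definition univ_ring :: "'r::ring_1 ring" where
  "univ_ring = \<lparr>carrier = UNIV, mult = (*), one = 1, zero = 0, add = (+)\<rparr>"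

abbreviation vec_space :: "('k::field, 'v, 'x) module_scheme \<Rightarrow> bool" where
  "vec_space V \<equiv> Module.module (univ_ring :: 'k ring) V"

definition scalar_algebra :: "('k::field, 'k) module" where
  "scalar_algebra = ring.extend univ_ring (module.fields (*))"

definition linear_map ::
  "('k, 'v, 'x) module_scheme \<Rightarrow> ('k, 'w, 'y) module_scheme \<Rightarrow> ('v \<Rightarrow> 'w) \<Rightarrow> bool" where
  "linear_map V W f \<longleftrightarrow> f \<in> carrier V \<rightarrow> carrier W \<and>
     (\<forall>u \<in> carrier V. \<forall>v \<in> carrier V. f (u \<oplus>\<^bsub>V\<^esub> v) = f u \<oplus>\<^bsub>W\<^esub> f v) \<and>
     (\<forall>c. \<forall>v \<in> carrier V. f (c \<odot>\<^bsub>V\<^esub> v) = c \<odot>\<^bsub>W\<^esub> f v)"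

text \<open>\<open>V \<otimes> W\<close> is the free vector space on \<open>V \<times> W\<close> modulo the span of the bilinearity
  relators; its elements are cosets of formal combinations of pairs.\<close>

definition formal_scale :: "'k::field \<Rightarrow> ('x \<Rightarrow>\<^sub>0 'k) \<Rightarrow> ('x \<Rightarrow>\<^sub>0 'k)" where
  "formal_scale c p = Poly_Mapping.map ((*) c) p"

type_synonym ('k, 'v, 'w) tens = "(('v \<times> 'w) \<Rightarrow>\<^sub>0 'k) set"

definition tensor_relators ::
  "('k::field, 'v, 'x) module_scheme \<Rightarrow> ('k, 'w, 'y) module_scheme \<Rightarrow> (('v \<times> 'w) \<Rightarrow>\<^sub>0 'k) set" where
  "tensor_relators V W =
     (let \<delta> = (\<lambda>v w. Poly_Mapping.single (v, w) (1::'k)) in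
       {\<delta> (v \<oplus>\<^bsub>V\<^esub> v') w - \<delta> v w - \<delta> v' w | v v' w.
          v \<in> carrier V \<and> v' \<in> carrier V \<and> w \<in> carrier W}
     \<union> {\<delta> v (w \<oplus>\<^bsub>W\<^esub> w') - \<delta> v w - \<delta> v w' | v w w'.
          v \<in> carrier V \<and> w \<in> carrier W \<and> w' \<in> carrier W}
     \<union> {\<delta> (c \<odot>\<^bsub>V\<^esub> v) w - formal_scale c (\<delta> v w) | c v w. v \<in> carrier V \<and> w \<in> carrier W}
     \<union> {\<delta> v (c \<odot>\<^bsub>W\<^esub> w) - formal_scale c (\<delta> v w) | c v w. v \<in> carrier V \<and> w \<in> carrier W})"

definition tensor_class ::
  "('k::field, 'v, 'x) module_scheme \<Rightarrow> ('k, 'w, 'y) module_scheme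
     \<Rightarrow> (('v \<times> 'w) \<Rightarrow>\<^sub>0 'k) \<Rightarrow> ('k, 'v, 'w) tens" where
  "tensor_class V W p = {p'. p' - p \<in> Modules.module.span formal_scale (tensor_relators V W)}"

definition rep :: "'a set \<Rightarrow> 'a" where
  "rep X = (SOME p. p \<in> X)"

definition tensor ::
  "('k::field, 'v, 'x) module_scheme \<Rightarrow> ('k, 'w, 'y) module_scheme \<Rightarrow> ('k, ('k, 'v, 'w) tens) module" where
  "tensor V W = \<lparr>
     carrier = tensor_class V W ` {p. Poly_Mapping.keys p \<subseteq> carrier V \<times> carrier W},
     mult = undefined, one = undefined,
     zero = tensor_class V W 0,
     add = (\<lambda>X Y. tensor_class V W (rep X + rep Y)),
     smult = (\<lambda>c X. tensor_class V W (formal_scale c (rep X)))\<rparr>"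

definition pure ::
  "('k::field, 'v, 'x) module_scheme \<Rightarrow> ('k, 'w, 'y) module_scheme \<Rightarrow> 'v \<Rightarrow> 'w \<Rightarrow> ('k, 'v, 'w) tens" where
  "pure V W v w = tensor_class V W (Poly_Mapping.single (v, w) 1)"

text \<open>The linear map \<open>V \<otimes> W \<rightarrow> U\<close> induced by a bilinear \<open>f\<close> is computed on a representative.\<close>

definition eval_tensor ::
  "('k::field, 'u, 'x) module_scheme \<Rightarrow> ('v \<Rightarrow> 'w \<Rightarrow> 'u) \<Rightarrow> (('v \<times> 'w) \<Rightarrow>\<^sub>0 'k) \<Rightarrow> 'u" where
  "eval_tensor U f p =
     (\<Oplus>\<^bsub>U\<^esub> x \<in> Poly_Mapping.keys p. Poly_Mapping.lookup p x \<odot>\<^bsub>U\<^esub> f (fst x) (snd x))"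

definition tensor_lift ::
  "('k::field, 'u, 'x) module_scheme \<Rightarrow> ('v \<Rightarrow> 'w \<Rightarrow> 'u) \<Rightarrow> ('k, 'v, 'w) tens \<Rightarrow> 'u" where
  "tensor_lift U f X = eval_tensor U f (rep X)"

definition tensor_map ::
  "('k::field, 'v, 'x) module_scheme \<Rightarrow> ('k, 'w, 'y) module_scheme \<Rightarrow> ('t \<Rightarrow> 'v) \<Rightarrow> ('s \<Rightarrow> 'w)
     \<Rightarrow> ('k, 't, 's) tens \<Rightarrow> ('k, 'v, 'w) tens" where
  "tensor_map V W f g = tensor_lift (tensor V W) (\<lambda>t s. pure V W (f t) (g s))"

definition tensor_assoc ::
  "('k::field, 'u, 'x) module_scheme \<Rightarrow> ('k, 'v, 'y) module_scheme \<Rightarrow> ('k, 'w, 'z) module_scheme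
     \<Rightarrow> ('k, ('k, 'u, 'v) tens, 'w) tens \<Rightarrow> ('k, 'u, ('k, 'v, 'w) tens) tens" where
  "tensor_assoc U V W =
     (let T = tensor U (tensor V W) in
      tensor_lift T (\<lambda>y w. tensor_lift T (\<lambda>u v. pure U (tensor V W) u (pure V W v w)) y))"

definition tensor_algebra ::
  "('k::field, 'a, 'x) module_scheme \<Rightarrow> ('k, 'b, 'y) module_scheme \<Rightarrow> ('k, ('k, 'a, 'b) tens) module" where
  "tensor_algebra A B = (tensor A B)\<lparr>
     mult := (\<lambda>X Y. tensor_lift (tensor A B) (\<lambda>a b.
               tensor_lift (tensor A B) (\<lambda>a' b'. pure A B (a \<otimes>\<^bsub>A\<^esub> a') (b \<otimes>\<^bsub>B\<^esub> b')) Y) X),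
     one := pure A B \<one>\<^bsub>A\<^esub> \<one>\<^bsub>B\<^esub>\<rparr>"


section \<open>Algebras presented by generators and relations\<close>

text \<open>The free algebra on \<open>'x\<close> is the monoid algebra of the free monoid on \<open>'x\<close>.  The wrapper
  type makes concatenation the (additively written) monoid operation that \<open>poly_mapping\<close>
  uses for its convolution product.\<close>

datatype 'x word = Word (letters: "'x list")

instantiation word :: (type) monoid_add
begin

definition zero_word :: "'a word" where
  "zero_word = Word []"

definition plus_word :: "'a word \<Rightarrow> 'a word \<Rightarrow> 'a word" where
  "plus_word u v = Word (letters u @ letters v)"

instance
  by standard (simp_all add: zero_word_def plus_word_def)

end

type_synonym ('x, 'k) free_algebra = "'x word \<Rightarrow>\<^sub>0 'k"

definition const :: "'k::field \<Rightarrow> ('x, 'k) free_algebra" where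
  "const c = Poly_Mapping.single 0 c"

definition var :: "'x \<Rightarrow> ('x, 'k::field) free_algebra" where
  "var x = Poly_Mapping.single (Word [x]) 1"

text \<open>The ideals of \<open>ideal\<close> and \<open>genideal\<close> are two-sided.\<close>

definition residue_class ::
  "('x, 'k::field) free_algebra set \<Rightarrow> ('x, 'k) free_algebra \<Rightarrow> ('x, 'k) free_algebra set" where
  "residue_class R p = (Idl\<^bsub>univ_ring\<^esub> R) +>\<^bsub>univ_ring\<^esub> p"

definition presented_algebra ::
  "('x, 'k::field) free_algebra set \<Rightarrow> ('k, ('x, 'k) free_algebra set) module" where
  "presented_algebra R =
     (let Q = univ_ring Quot (Idl\<^bsub>univ_ring\<^esub> R) in
      ring.extend Q (module.fields (\<lambda>c X. residue_class R (const c) \<otimes>\<^bsub>Q\<^esub> X)))"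

text \<open>\<open>induced_hom A f\<close> is the algebra homomorphism from a presented algebra to \<open>A\<close> with value
  \<open>f x\<close> at the class of each generator \<open>x\<close>, provided \<open>f\<close> respects the relators.\<close>

definition eval_free ::
  "('k::field, 'a, 'y) module_scheme \<Rightarrow> ('x \<Rightarrow> 'a) \<Rightarrow> ('x, 'k) free_algebra \<Rightarrow> 'a" where
  "eval_free A f p =
     (\<Oplus>\<^bsub>A\<^esub> w \<in> Poly_Mapping.keys p.
        Poly_Mapping.lookup p w \<odot>\<^bsub>A\<^esub> foldr (\<lambda>x y. f x \<otimes>\<^bsub>A\<^esub> y) (letters w) \<one>\<^bsub>A\<^esub>)"

definition induced_hom ::
  "('k::field, 'a, 'y) module_scheme \<Rightarrow> ('x \<Rightarrow> 'a) \<Rightarrow> ('x, 'k) free_algebra set \<Rightarrow> 'a" where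
  "induced_hom A f X = eval_free A f (rep X)"

definition opposite_algebra :: "('k, 'a) module \<Rightarrow> ('k, 'a) module" where
  "opposite_algebra A = A\<lparr>mult := (\<lambda>x y. y \<otimes>\<^bsub>A\<^esub> x)\<rparr>"


section \<open>The Hopf algebras\<close>

record (overloaded) ('k, 'a) hopf = "('k, 'a) module" +
  comult :: "'a \<Rightarrow> ('k, 'a, 'a) tens"
  counit :: "'a \<Rightarrow> 'k"
  antipode :: "'a \<Rightarrow> 'a"

definition presented_hopf ::
  "('x, 'k::field) free_algebra set
     \<Rightarrow> ('x \<Rightarrow> ('k, ('x, 'k) free_algebra set, ('x, 'k) free_algebra set) tens)
     \<Rightarrow> ('x \<Rightarrow> 'k) \<Rightarrow> ('x \<Rightarrow> ('x, 'k) free_algebra set)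
     \<Rightarrow> ('k, ('x, 'k) free_algebra set) hopf" where
  "presented_hopf R \<Delta> \<epsilon> S =
     (let A = presented_algebra R in
      module.extend A
        (hopf.fields (induced_hom (tensor_algebra A A) \<Delta>)
                     (induced_hom scalar_algebra \<epsilon>)
                     (induced_hom (opposite_algebra A) S)))"

definition generic_matrix :: "('n \<times> 'n, 'k::field) free_algebra ^ 'n ^ 'n" where
  "generic_matrix = (\<chi> i j. var (i, j))"

definition const_matrix :: "'k::field ^ 'n ^ 'n \<Rightarrow> ('x, 'k) free_algebra ^ 'n ^ 'n" where
  "const_matrix M = (\<chi> i j. const (M $ i $ j))"

definition B_antipode_matrix :: "'k::field ^ 'n ^ 'n \<Rightarrow> ('n \<times> 'n, 'k) free_algebra ^ 'n ^ 'n" where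
  "B_antipode_matrix E =
     const_matrix (matrix_inv E) ** transpose generic_matrix ** const_matrix E"

definition B_relators :: "'k::field ^ 'n ^ 'n \<Rightarrow> ('n \<times> 'n, 'k) free_algebra set" where
  "B_relators E =
     {(B_antipode_matrix E ** generic_matrix - mat 1) $ i $ j | i j. True} \<union>
     {(generic_matrix ** B_antipode_matrix E - mat 1) $ i $ j | i j. True}"

definition B_hopf :: "'k::field ^ 'n ^ 'n \<Rightarrow> ('k, ('n \<times> 'n, 'k) free_algebra set) hopf" where
  "B_hopf E =
     (let R = B_relators E; A = presented_algebra R; a = (\<lambda>i j. residue_class R (var (i, j))) in
      presented_hopf R
        (\<lambda>(i, j). \<Oplus>\<^bsub>tensor A A\<^esub> l \<in> UNIV. pure A A (a i l) (a l j))
        (\<lambda>(i, j). if i = j then 1 else 0)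
        (\<lambda>(i, j). residue_class R (B_antipode_matrix E $ i $ j)))"

datatype sl2_gen = GenA | GenB | GenC | GenD

definition SLq2_relators :: "'k::field \<Rightarrow> (sl2_gen, 'k) free_algebra set" where
  "SLq2_relators q =
     (let a = var GenA; b = var GenB; c = var GenC; d = var GenD in
      {b * a - const q * a * b,
       d * b - const q * b * d,
       c * a - const q * a * c,
       d * c - const q * c * d,
       b * c - c * b,
       a * d - d * a - const (inverse q - q) * b * c,
       a * d - const (inverse q) * b * c - 1})"

definition SLq2_hopf :: "'k::field \<Rightarrow> ('k, (sl2_gen, 'k) free_algebra set) hopf" where
  "SLq2_hopf q =
     (let R = SLq2_relators q; A = presented_algebra R; T = tensor A A;
          cls = residue_class R;
          a = cls (var GenA); b = cls (var GenB); c = cls (var GenC); d = cls (var GenD) in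
      presented_hopf R
        (\<lambda>g. case g of
            GenA \<Rightarrow> pure A A a a \<oplus>\<^bsub>T\<^esub> pure A A b c
          | GenB \<Rightarrow> pure A A a b \<oplus>\<^bsub>T\<^esub> pure A A b d
          | GenC \<Rightarrow> pure A A c a \<oplus>\<^bsub>T\<^esub> pure A A d c
          | GenD \<Rightarrow> pure A A c b \<oplus>\<^bsub>T\<^esub> pure A A d d)
        (\<lambda>g. case g of GenA \<Rightarrow> 1 | GenB \<Rightarrow> 0 | GenC \<Rightarrow> 0 | GenD \<Rightarrow> 1)
        (\<lambda>g. case g of
            GenA \<Rightarrow> d
          | GenB \<Rightarrow> cls (const (- q) * var GenB)
          | GenC \<Rightarrow> cls (const (- inverse q) * var GenC)
          | GenD \<Rightarrow> a))"


section \<open>The monoidal category of right comodules\<close>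

record (overloaded) ('k, 'v, 'a) comodule = "('k, 'v) module" +
  coact :: "'v \<Rightarrow> ('k, 'v, 'a) tens"

definition right_comodule ::
  "('k::field, 'a, 'x) hopf_scheme \<Rightarrow> ('k, 'v, 'a, 'y) comodule_scheme \<Rightarrow> bool" where
  "right_comodule H V \<longleftrightarrow> vec_space V \<and> linear_map V (tensor V H) (coact V) \<and>
     (\<forall>v \<in> carrier V.
        tensor_map V (tensor H H) id (comult H) (coact V v)
          = tensor_assoc V H H (tensor_map (tensor V H) H (coact V) id (coact V v))) \<and>
     (\<forall>v \<in> carrier V. tensor_lift V (\<lambda>u a. counit H a \<odot>\<^bsub>V\<^esub> u) (coact V v) = v)"

definition comodule_map ::
  "('k::field, 'a, 'x) hopf_scheme \<Rightarrow> ('k, 'v, 'a, 'y) comodule_scheme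
     \<Rightarrow> ('k, 'w, 'a, 'z) comodule_scheme \<Rightarrow> ('v \<Rightarrow> 'w) \<Rightarrow> bool" where
  "comodule_map H V W f \<longleftrightarrow> linear_map V W f \<and>
     (\<forall>v \<in> carrier V. coact W (f v) = tensor_map W H f id (coact V v))"

text \<open>The objects of the comodule category have underlying sets in a type \<open>'u\<close>, which plays the
  role of a universe.  To make it closed under tensor products and to have a unit object, we use
  injections \<open>sc :: 'k \<Rightarrow> 'u\<close> and \<open>tc :: ('u \<times> 'u \<Rightarrow>\<^sub>0 'k) \<Rightarrow> 'u\<close>, which exist as soon as \<open>'u\<close> is
  infinite and at least as large as \<open>'k\<close>.  An element of \<open>V \<otimes> W\<close> is coded by the
  \<open>tc\<close>-image of its chosen representative; the ground field is coded by \<open>sc\<close>.\<close>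

definition coded_tensor ::
  "((('u \<times> 'u) \<Rightarrow>\<^sub>0 'k) \<Rightarrow> 'u) \<Rightarrow> ('k::field, 'u, 'x) module_scheme
     \<Rightarrow> ('k, 'u, 'y) module_scheme \<Rightarrow> ('k, 'u) module" where
  "coded_tensor tc V W =
     (let T = tensor V W;
          encode = (\<lambda>X. tc (rep X));
          decode = (\<lambda>x. tensor_class V W (inv_into UNIV tc x)) in
      \<lparr>carrier = encode ` carrier T,
       mult = undefined, one = undefined,
       zero = encode \<zero>\<^bsub>T\<^esub>,
       add = (\<lambda>x y. encode (decode x \<oplus>\<^bsub>T\<^esub> decode y)),
       smult = (\<lambda>c x. encode (c \<odot>\<^bsub>T\<^esub> decode x))\<rparr>)"

definition coded_pure ::
  "((('u \<times> 'u) \<Rightarrow>\<^sub>0 'k) \<Rightarrow> 'u) \<Rightarrow> ('k::field, 'u, 'x) module_scheme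
     \<Rightarrow> ('k, 'u, 'y) module_scheme \<Rightarrow> 'u \<Rightarrow> 'u \<Rightarrow> 'u" where
  "coded_pure tc V W v w = tc (rep (pure V W v w))"

definition coded_lift ::
  "((('u \<times> 'u) \<Rightarrow>\<^sub>0 'k) \<Rightarrow> 'u) \<Rightarrow> ('k::field, 'v, 'x) module_scheme
     \<Rightarrow> ('u \<Rightarrow> 'u \<Rightarrow> 'v) \<Rightarrow> 'u \<Rightarrow> 'v" where
  "coded_lift tc U f x = eval_tensor U f (inv_into UNIV tc x)"

text \<open>The coaction \<open>v \<otimes> w \<mapsto> (v\<^sub>0 \<otimes> w\<^sub>0) \<otimes> v\<^sub>1 w\<^sub>1\<close>.\<close>

definition tensor_comodule ::
  "((('u \<times> 'u) \<Rightarrow>\<^sub>0 'k) \<Rightarrow> 'u) \<Rightarrow> ('k::field, 'a) hopf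
     \<Rightarrow> ('k, 'u, 'a) comodule \<Rightarrow> ('k, 'u, 'a) comodule \<Rightarrow> ('k, 'u, 'a) comodule" where
  "tensor_comodule tc H V W =
     (let M = coded_tensor tc V W; T = tensor M H in
      module.extend M (comodule.fields
        (coded_lift tc T (\<lambda>v w.
           tensor_lift T (\<lambda>v0 v1.
             tensor_lift T (\<lambda>w0 w1.
               pure M H (coded_pure tc V W v0 w0) (v1 \<otimes>\<^bsub>H\<^esub> w1))
             (coact W w))
           (coact V v)))))"

definition unit_comodule ::
  "('k \<Rightarrow> 'u) \<Rightarrow> ('k::field, 'a) hopf \<Rightarrow> ('k, 'u, 'a) comodule" where
  "unit_comodule sc H =
     (let M = \<lparr>carrier = range sc,
               mult = undefined, one = undefined,
               zero = sc 0,
               add = (\<lambda>x y. sc (inv_into UNIV sc x + inv_into UNIV sc y)),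
               smult = (\<lambda>c x. sc (c * inv_into UNIV sc x))\<rparr> in
      module.extend M (comodule.fields (\<lambda>x. pure M H x \<one>\<^bsub>H\<^esub>)))"

text \<open>An arrow is a triple of source, underlying map and target; the map is \<open>undefined\<close> outside
  the source, so that equality of arrows is equality of maps.\<close>

type_synonym ('k, 'u, 'a) comodule_arrow =
  "('k, 'u, 'a) comodule \<times> ('u \<Rightarrow> 'u) \<times> ('k, 'u, 'a) comodule"

definition Comod ::
  "('k \<Rightarrow> 'u) \<Rightarrow> ((('u \<times> 'u) \<Rightarrow>\<^sub>0 'k) \<Rightarrow> 'u) \<Rightarrow> ('k::field, 'a) hopf
     \<Rightarrow> (('k, 'u, 'a) comodule, ('k, 'u, 'a) comodule_arrow) monoidal_category" where
  "Comod sc tc H =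
     (let arrow = (\<lambda>V f W. (V, restrict f (carrier V), W));
          ten = tensor_comodule tc H;
          I = unit_comodule sc H in
      \<lparr>Obj = {V. right_comodule H V},
       Arr = {(V, f, W). right_comodule H V \<and> right_comodule H W \<and>
                         comodule_map H V W f \<and> f \<in> extensional (carrier V)},
       Dom = (\<lambda>(V, f, W). V),
       Cod = (\<lambda>(V, f, W). W),
       Id = (\<lambda>V. arrow V id V),
       Comp = (\<lambda>(V', g, W) (V, f, W'). arrow V (g \<circ> f) W),
       TensO = ten,
       TensA = (\<lambda>(V, f, V') (W, g, W').
         arrow (ten V W)
           (coded_lift tc (ten V' W') (\<lambda>v w. coded_pure tc V' W' (f v) (g w)))
           (ten V' W')),
       Unit = I,
       Assoc = (\<lambda>U V W.
         let T = ten U (ten V W) in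
         arrow (ten (ten U V) W)
           (coded_lift tc T (\<lambda>y w.
              coded_lift tc T (\<lambda>u v. coded_pure tc U (ten V W) u (coded_pure tc V W v w)) y))
           T),
       LUnit = (\<lambda>V. arrow (ten I V) (coded_lift tc V (\<lambda>x v. inv_into UNIV sc x \<odot>\<^bsub>V\<^esub> v)) V),
       RUnit = (\<lambda>V. arrow (ten V I) (coded_lift tc V (\<lambda>v x. inv_into UNIV sc x \<odot>\<^bsub>V\<^esub> v)) V)\<rparr>)"

end

theory Submission
  imports Defs
begin

text \<open>
  For invertible matrices \<open>E\<close> and \<open>F\<close>, of possibly different sizes, let \<open>B(E, F)\<close> be the algebra generated by
  the entries of a rectangular matrix \<open>u\<close> with \<open>\<^sup>tu E u = F\<close> and \<open>u F\<inverse> \<^sup>tu = E\<inverse>\<close>, that is, of a generic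
  isometry between two bilinear forms. Then \<open>B(E, E)\<close> is \<open>B(E)\<close>, and the quantum group \<open>SL\<^sub>q(2)\<close> is \<open>B(F, F)\<close> for
  the form \<open>F\<close> called \<open>sl_form q\<close> below. Isometries can be composed and inverted: multiplying
  generic matrices gives homomorphisms \<open>B(E, G) \<rightarrow> B(E, F) \<otimes> B(F, G)\<close> which are coassociative in every possible
  sense, and \<open>E\<inverse> \<^sup>ty F\<close> defines anti-homomorphisms \<open>S : B(E, F) \<rightarrow> B(F, E)\<close> which behave like an antipode.
  In this way \<open>Z = B(E, F)\<close> links the Hopf algebras \<open>H = B(E)\<close> and \<open>K = B(F)\<close>, and \<open>Y = B(F, E)\<close> is its
  inverse. The equivalence sends a right \<open>H\<close>-comodule \<open>V\<close> to the cotensor product of \<open>V\<close> and \<open>Z\<close>, the subspace of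
  \<open>V \<otimes> Z\<close> on which the coaction of \<open>V\<close> agrees with that of \<open>Z\<close>, with the coaction of \<open>K\<close> on \<open>Z\<close>.

  Suppose that \<open>Y \<noteq> 0\<close>. A linear functional \<open>\<omega>\<close> on \<open>Y\<close> with \<open>\<omega>(1) = 1\<close> makes everything explicit. In Sweedler
  notation, with \<open>z \<otimes> y\<close> for the image in \<open>Z \<otimes> Y\<close> of an element of \<open>H\<close>,
  the formula \<open>v \<otimes> a \<mapsto> v\<^sub>0 \<otimes> z \<omega>(y S(a))\<close> with \<open>z \<otimes> y\<close> coming from \<open>v\<^sub>1\<close> is a projection of \<open>V \<otimes> Z\<close> onto the
  cotensor product; the point is the identity \<open>galois_collapse\<close>. With this projection one writes down the
  coaction of \<open>K\<close>, the isomorphisms \<open>eta\<close> and \<open>theta\<close> between \<open>V\<close> and its double cotensor product, and the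
  isomorphism \<open>phi\<close> between the product of cotensor products and the cotensor product of a product,
  together with its inverse \<open>psi\<close>. The results
  are \<open>equivalence_F\<close> and \<open>monoidal_F\<close>, proved for abstract algebras \<open>Z\<close>, \<open>Y\<close> with maps that satisfy the
  identities listed in the locales \<open>galois\<close>, \<open>galois_pair\<close> and \<open>galois_monoidal\<close>; the locale
  \<open>form_torsor\<close> verifies these identities for \<open>B(E, F)\<close>.

  That \<open>Y \<noteq> 0\<close> is the arithmetic part of the proof, and this is where the equation for \<open>q\<close> is used. The matrix \<open>u\<close> of \<open>Y\<close>
  has two rows, and half of the relations move the
  generators \<open>y\<^sub>i\<close> of the second row of \<open>u\<close> to the right of the generators \<open>x\<^sub>i\<close> of the first. If the \<open>y\<^sub>i\<close> act at the
  end of a word by scalars \<open>\<eta>\<^sub>i\<close>, the free algebra acts on functionals on words in the \<open>x\<^sub>i\<close>; the other relations hold on an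
  invariant subspace provided that \<open>\<eta>\<close> is isotropic for \<open>E\<inverse>\<close> and \<open>q\<close> satisfies its equation, and a nonzero
  functional in this subspace is found by solving a recursion (\<open>exists_adm\<close>). Isotropic vectors
  \<open>\<eta> \<noteq> 0\<close> exist because the field is algebraically closed and \<open>E\<close> has size at least two.

  Identities between tensors are proved by pairing both sides with all multilinear
  functionals, which separate points over a field (\<open>vs_separation\<close>, \<open>tensor_class_eq_iff\<close>). This turns a
  computation in Sweedler notation, through arbitrarily nested tensor products, into the
  manipulation of finite sums of scalars.
\<close>

section \<open>Linear functionals\<close>

lemma univ_ring_simps [simp]:
  "carrier univ_ring = UNIV" "x \<otimes>\<^bsub>univ_ring\<^esub> y = x * y" "\<one>\<^bsub>univ_ring\<^esub> = 1"
  "\<zero>\<^bsub>univ_ring\<^esub> = 0" "x \<oplus>\<^bsub>univ_ring\<^esub> y = x + y"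
  by (simp_all add: univ_ring_def)

lemma ring_univ_ring: "ring (univ_ring :: 'r::ring_1 ring)"
proof (rule ringI)
  show "abelian_group (univ_ring :: 'r ring)"
  proof (rule abelian_groupI)
    fix x :: 'r assume "x \<in> carrier univ_ring"
    show "\<exists>y\<in>carrier univ_ring. y \<oplus>\<^bsub>univ_ring\<^esub> x = \<zero>\<^bsub>univ_ring\<^esub>"
      by (intro bexI[of _ "- x"]) simp_all
  qed (simp_all add: add.assoc add.commute)
  show "Group.monoid (univ_ring :: 'r ring)"
    by (rule monoidI) (simp_all add: mult.assoc)
qed (simp_all add: distrib_left distrib_right)

lemma cring_univ_ring: "cring (univ_ring :: 'k::field ring)"
proof -
  interpret ring "univ_ring :: 'k ring" by (rule ring_univ_ring)
  show ?thesis
    by unfold_locales (simp add: mult.commute)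
qed

text \<open>Linearity is required on the carrier only, so that a functional can be given by any formula that
  makes sense there.\<close>

definition linfun :: "('k::field, 'v, 'x) module_scheme => ('v => 'k) => bool" where
  "linfun V f \<longleftrightarrow> (\<forall>u\<in>carrier V. \<forall>v\<in>carrier V. f (u \<oplus>\<^bsub>V\<^esub> v) = f u + f v) \<and>
     (\<forall>c. \<forall>v\<in>carrier V. f (c \<odot>\<^bsub>V\<^esub> v) = c * f v)"

lemma lfI:
  assumes "\<And>u v. u \<in> carrier V ==> v \<in> carrier V ==> f (u \<oplus>\<^bsub>V\<^esub> v) = f u + f v"
    and "\<And>c v. v \<in> carrier V ==> f (c \<odot>\<^bsub>V\<^esub> v) = c * f v"
  shows "linfun V f"
  using assms by (simp add: linfun_def)

lemma lf_add: "linfun V f ==> u \<in> carrier V ==> v \<in> carrier V ==> f (u \<oplus>\<^bsub>V\<^esub> v) = f u + f v"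
  by (simp add: linfun_def)

lemma lf_smult: "linfun V f ==> v \<in> carrier V ==> f (c \<odot>\<^bsub>V\<^esub> v) = c * f v"
  by (simp add: linfun_def)

lemma lf_cong:
  fixes V :: "('k::field, 'v, 'x) module_scheme"
  shows "(\<And>v. v \<in> carrier V ==> f v = g v) ==> vec_space V ==> linfun V f \<longleftrightarrow> linfun V g"
proof -
  assume fg: "\<And>v. v \<in> carrier V ==> f v = g v" and V: "vec_space V"
  interpret V: Module.module "univ_ring :: 'k ring" V by (rule V)
  show ?thesis
    unfolding linfun_def by (simp add: fg)
qed

lemma vs_add: "vec_space V ==> u \<in> carrier V ==> v \<in> carrier V ==> u \<oplus>\<^bsub>V\<^esub> v \<in> carrier V"
  by (rule abelian_monoid.a_closed[OF abelian_group.axioms(1)[OF Module.module.axioms(2)]])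

lemma vs_smult: "vec_space V ==> v \<in> carrier V ==> c \<odot>\<^bsub>V\<^esub> v \<in> carrier V"
  using Module.module.smult_closed[of univ_ring V c v] by simp

lemma vs_zero: "vec_space V ==> \<zero>\<^bsub>V\<^esub> \<in> carrier V"
  by (rule abelian_monoid.zero_closed[OF abelian_group.axioms(1)[OF Module.module.axioms(2)]])

lemma vs_finsum:
  fixes V :: "('k::field, 'v, 'x) module_scheme"
  assumes V: "vec_space V" and f: "\<And>x. x \<in> A ==> f x \<in> carrier V"
  shows "finsum V f A \<in> carrier V"
proof -
  interpret V: Module.module "univ_ring :: 'k ring" V by (rule V)
  show ?thesis using f by (intro V.finsum_closed) auto
qed

lemma lf_zero:
  fixes V :: "('k::field, 'v, 'x) module_scheme" assumes V: "vec_space V" and f: "linfun V f" shows "f \<zero>\<^bsub>V\<^esub> = 0"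
proof -
  interpret V: Module.module "univ_ring :: 'k ring" V by (rule V)
  have "f (0 \<odot>\<^bsub>V\<^esub> \<zero>\<^bsub>V\<^esub>) = 0 * f \<zero>\<^bsub>V\<^esub>" by (rule lf_smult[OF f]) simp
  then show ?thesis using V.smult_r_null[of 0] by simp
qed

lemma lf_finsum:
  fixes V :: "('k::field, 'v, 'x) module_scheme"
  assumes V: "vec_space V" and f: "linfun V f" and g: "\<And>x. x \<in> A ==> g x \<in> carrier V" and fin: "finite A"
  shows "f (finsum V g A) = (\<Sum>x\<in>A. f (g x))"
proof -
  interpret V: Module.module "univ_ring :: 'k ring" V by (rule V)
  from fin g show ?thesis
  proof (induction A)
    case empty
    show ?case using lf_zero[OF V f] by simp
  next
    case (insert x A)
    have "f (finsum V g (insert x A)) = f (g x \<oplus>\<^bsub>V\<^esub> finsum V g A)"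
      using insert by (subst V.finsum_insert) auto
    also have "\<dots> = f (g x) + f (finsum V g A)"
      by (rule lf_add[OF f]) (use insert in \<open>auto intro: vs_finsum[OF V]\<close>)
    also have "\<dots> = (\<Sum>x\<in>insert x A. f (g x))"
      using insert by simp
    finally show ?case .
  qed
qed

text \<open>A structure on which enough additive and homogeneous scalar functions separate the points
  is a vector space: every axiom can be tested on them.\<close>

lemma vec_spaceI_sep:
  fixes V :: "('k::field, 'v, 'x) module_scheme"
  assumes closed: "\<zero>\<^bsub>V\<^esub> \<in> carrier V"
      "\<And>u v. u \<in> carrier V ==> v \<in> carrier V ==> u \<oplus>\<^bsub>V\<^esub> v \<in> carrier V"
      "\<And>c v. v \<in> carrier V ==> c \<odot>\<^bsub>V\<^esub> v \<in> carrier V"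
    and linfun: "\<And>f. f \<in> \<Phi> ==> linfun V f" and zero: "\<And>f. f \<in> \<Phi> ==> f \<zero>\<^bsub>V\<^esub> = 0"
    and sep: "\<And>u v. u \<in> carrier V ==> v \<in> carrier V ==> (\<And>f. f \<in> \<Phi> ==> f u = f v) ==> u = v"
  shows "vec_space V"
proof -
  note [simp] = closed zero lf_add[OF linfun] lf_smult[OF linfun]
  show ?thesis
  proof (rule moduleI)
    show "abelian_group V"
    proof (rule abelian_groupI)
      fix x assume x: "x \<in> carrier V"
      show "\<exists>y\<in>carrier V. y \<oplus>\<^bsub>V\<^esub> x = \<zero>\<^bsub>V\<^esub>"
        by (rule bexI[of _ "(- 1) \<odot>\<^bsub>V\<^esub> x"], rule sep) (simp_all add: x)
      show "\<zero>\<^bsub>V\<^esub> \<oplus>\<^bsub>V\<^esub> x = x" by (rule sep) (simp_all add: x)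
      fix y assume y: "y \<in> carrier V"
      show "x \<oplus>\<^bsub>V\<^esub> y = y \<oplus>\<^bsub>V\<^esub> x" by (rule sep) (simp_all add: x y)
      fix z assume z: "z \<in> carrier V"
      show "x \<oplus>\<^bsub>V\<^esub> y \<oplus>\<^bsub>V\<^esub> z = x \<oplus>\<^bsub>V\<^esub> (y \<oplus>\<^bsub>V\<^esub> z)" by (rule sep) (simp_all add: x y z)
    qed simp_all
  qed (simp_all add: cring_univ_ring, (rule sep; simp add: algebra_simps)+)
qed

abbreviation (input) "plk \<equiv> Poly_Mapping.lookup"
abbreviation (input) "pkeys \<equiv> Poly_Mapping.keys"

lemma lookup_formal_scale [simp]: "plk (formal_scale c p) x = c * plk p x"
  by (simp add: formal_scale_def mult_map_scale_conv_mult[symmetric])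
     (simp add: Poly_Mapping.map.rep_eq when_def)

lemma formal_scale_single: "formal_scale c (Poly_Mapping.single x d) = Poly_Mapping.single x (c * d)"
  by (rule poly_mapping_eqI) (simp add: lookup_single when_def)

interpretation formal: vector_space "formal_scale :: 'k::field => ('x \<Rightarrow>\<^sub>0 'k) => _"
  by unfold_locales (rule poly_mapping_eqI, simp add: lookup_add algebra_simps)+

interpretation formal_dual:
  vector_space_pair "formal_scale :: 'k::field => ('x \<Rightarrow>\<^sub>0 'k) => _" "(*) :: 'k => 'k => 'k"
  by unfold_locales (simp_all add: algebra_simps)

definition lin_ext :: "('x => 'k::field) => ('x \<Rightarrow>\<^sub>0 'k) => 'k" where
  "lin_ext f p = (\<Sum>x\<in>pkeys p. plk p x * f x)"

lemma lin_ext_superset: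
  assumes "finite A" "pkeys p \<subseteq> A" shows "lin_ext f p = (\<Sum>x\<in>A. plk p x * f x)"
  unfolding lin_ext_def using assms
  by (intro sum.mono_neutral_left) (auto simp: in_keys_iff)

lemma lin_ext_add: "lin_ext f (p + p') = lin_ext f p + lin_ext f p'"
proof -
  let ?A = "pkeys p \<union> pkeys p'"
  have "pkeys (p + p') \<subseteq> ?A" by (rule Poly_Mapping.keys_add)
  then show ?thesis
    by (subst (1 2 3) lin_ext_superset[of ?A]) (auto simp: lookup_add algebra_simps sum.distrib)
qed

lemma lin_ext_scale: "lin_ext f (formal_scale c p) = c * lin_ext f p"
proof -
  have "pkeys (formal_scale c p) \<subseteq> pkeys p" by (auto simp: in_keys_iff)
  then show ?thesis
    by (subst (1 2) lin_ext_superset[of "pkeys p"]) (auto simp: sum_distrib_left algebra_simps)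
qed

lemma lin_ext_zero [simp]: "lin_ext f 0 = 0"
  by (simp add: lin_ext_def)

lemma lin_ext_single [simp]: "lin_ext f (Poly_Mapping.single x c) = c * f x"
  by (cases "c = 0") (simp_all add: lin_ext_def)

lemma lin_ext_uminus: "lin_ext f (- p) = - lin_ext f p"
  using lin_ext_add[of f p "- p"] by (simp add: eq_neg_iff_add_eq_0 add.commute)

lemma lin_ext_diff: "lin_ext f (p - p') = lin_ext f p - lin_ext f p'"
  using lin_ext_add[of f p "- p'"] by (simp add: lin_ext_uminus)

lemma poly_mapping_sum_singles: "p = (\<Sum>x\<in>pkeys p. Poly_Mapping.single x (plk p x))"
proof (rule poly_mapping_eqI)
  fix y
  show "plk p y = plk (\<Sum>x\<in>pkeys p. Poly_Mapping.single x (plk p x)) y"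
    by (simp add: lookup_sum lookup_single when_def in_keys_iff)
qed

lemma linear_eq_lin_ext:
  assumes "Vector_Spaces.linear formal_scale (*) g"
  shows "g = lin_ext (\<lambda>x. g (Poly_Mapping.single x 1))"
proof
  fix p
  have "g p = g (\<Sum>x\<in>pkeys p. formal_scale (plk p x) (Poly_Mapping.single x 1))"
    by (subst poly_mapping_sum_singles[of p]) (simp add: formal_scale_single)
  also have "\<dots> = lin_ext (\<lambda>x. g (Poly_Mapping.single x 1)) p"
    unfolding lin_ext_def
    by (simp add: formal_dual.linear_sum[OF assms] formal_dual.linear_scale[OF assms])
  finally show "g p = lin_ext (\<lambda>x. g (Poly_Mapping.single x 1)) p" .
qed

lemma lin_ext_span:
  assumes "\<And>r. r \<in> R ==> lin_ext f r = 0" "p \<in> formal.span R"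
  shows "lin_ext f p = 0"
  using assms(2)
  by (induction rule: formal.span_induct_alt) (simp_all add: lin_ext_add lin_ext_scale assms(1))

text \<open>A basis of the span, enlarged by \<open>p\<close>, is independent, and the coordinate at \<open>p\<close> separates.\<close>

lemma span_separation:
  assumes "p \<notin> formal.span (R :: ('x \<Rightarrow>\<^sub>0 'k::field) set)"
  obtains f where "\<And>r. r \<in> R ==> lin_ext f r = 0" "lin_ext f p \<noteq> 0"
proof -
  obtain B where B: "B \<subseteq> R" "formal.independent B" "R \<subseteq> formal.span B"
    by (rule formal.maximal_independent_subset)
  have span: "formal.span R = formal.span B"
    using B by (meson formal.span_mono formal.span_minimal formal.subspace_span subset_antisym)
  have ind: "formal.independent (insert p B)"
    using assms B span by (simp add: formal.independent_insert)
  obtain g where g: "Vector_Spaces.linear formal_scale (*) g"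
    "\<forall>x\<in>insert p B. g x = (if x = p then 1 else 0 :: 'k)"
    using formal_dual.linear_independent_extend[OF ind, of "\<lambda>x. if x = p then 1 else 0"] by blast
  have gB: "g b = 0" if "b \<in> B" for b
    using g(2) that assms span formal.span_base[OF that] by auto
  let ?f = "\<lambda>x. g (Poly_Mapping.single x 1)"
  have geq: "g = lin_ext ?f" by (rule linear_eq_lin_ext[OF g(1)])
  have "lin_ext ?f r = 0" if "r \<in> R" for r
    by (rule lin_ext_span[of B]) (use gB geq B that in auto)
  moreover have "lin_ext ?f p \<noteq> 0" using g(2) geq by (metis insertI1 zero_neq_one)
  ultimately show ?thesis by (rule that)
qed

text \<open>\<open>V\<close> is the quotient of the free vector space on its elements by the span of all instances of linearity.
  There separating functionals are available from \<open>span_separation\<close>; what has to be shown is that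
  the difference of the basis vectors of \<open>u\<close> and \<open>v\<close> lies outside the span, and this follows by evaluating formal combinations in \<open>V\<close>.\<close>

lemma vs_separation:
  fixes V :: "('k::field, 'v, 'x) module_scheme"
  assumes V: "vec_space V" and uv: "u \<in> carrier V" "v \<in> carrier V" "u \<noteq> v"
  obtains f where "linfun V f" "f u \<noteq> f v"
proof -
  interpret V: Module.module "univ_ring :: 'k ring" V by (rule V)
  let ?d = "\<lambda>v. Poly_Mapping.single v (1::'k)"
  define R where "R = {?d (u \<oplus>\<^bsub>V\<^esub> v) - ?d u - ?d v | u v. u \<in> carrier V \<and> v \<in> carrier V}
    \<union> {?d (c \<odot>\<^bsub>V\<^esub> v) - formal_scale c (?d v) | c v. v \<in> carrier V}"
  \<comment> \<open>Formal combinations of vectors can be evaluated in \<open>V\<close>, and the relators evaluate to zero.\<close>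
  define ev where "ev p = (\<Oplus>\<^bsub>V\<^esub>x\<in>pkeys p. plk p x \<odot>\<^bsub>V\<^esub> x)" for p
  have ev_super: "ev p = (\<Oplus>\<^bsub>V\<^esub>x\<in>A. plk p x \<odot>\<^bsub>V\<^esub> x)" if "finite A" "pkeys p \<subseteq> A" "A \<subseteq> carrier V" for p A
    unfolding ev_def using that
    by (intro V.add.finprod_mono_neutral_cong_left) (auto simp: in_keys_iff V.smult_l_null[simplified])
  have ev_add: "ev (p + p') = ev p \<oplus>\<^bsub>V\<^esub> ev p'"
    if "pkeys p \<subseteq> carrier V" "pkeys p' \<subseteq> carrier V" for p p'
  proof -
    let ?A = "pkeys p \<union> pkeys p'"
    have k: "pkeys (p + p') \<subseteq> ?A" by (rule Poly_Mapping.keys_add)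
    have "ev (p + p') = (\<Oplus>\<^bsub>V\<^esub>x\<in>?A. plk (p + p') x \<odot>\<^bsub>V\<^esub> x)"
      by (rule ev_super) (use k that in auto)
    also have "\<dots> = (\<Oplus>\<^bsub>V\<^esub>x\<in>?A. plk p x \<odot>\<^bsub>V\<^esub> x \<oplus>\<^bsub>V\<^esub> plk p' x \<odot>\<^bsub>V\<^esub> x)"
      by (rule V.finsum_cong') (use that in \<open>auto simp: lookup_add V.smult_l_distr[simplified]\<close>)
    also have "\<dots> = (\<Oplus>\<^bsub>V\<^esub>x\<in>?A. plk p x \<odot>\<^bsub>V\<^esub> x) \<oplus>\<^bsub>V\<^esub> (\<Oplus>\<^bsub>V\<^esub>x\<in>?A. plk p' x \<odot>\<^bsub>V\<^esub> x)"
      by (rule V.finsum_addf) (use that in auto)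
    also have "\<dots> = ev p \<oplus>\<^bsub>V\<^esub> ev p'"
      by (subst (1 2) ev_super[of ?A]) (use that in auto)
    finally show ?thesis .
  qed
  have ev_single: "ev (Poly_Mapping.single x c) = c \<odot>\<^bsub>V\<^esub> x" if "x \<in> carrier V" for x c
  proof -
    have "ev (Poly_Mapping.single x c) = (\<Oplus>\<^bsub>V\<^esub>y\<in>{x}. plk (Poly_Mapping.single x c) y \<odot>\<^bsub>V\<^esub> y)"
      by (rule ev_super) (use that in auto)
    then show ?thesis using that by simp
  qed
  have key: "pkeys p \<subseteq> carrier V \<and> ev p = \<zero>\<^bsub>V\<^esub>" if "p \<in> formal.span R" for p
    using that
  proof (induction rule: formal.span_induct_alt)
    case base
    show ?case by (simp add: ev_def)
  next
    case (step c r p)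
    have "pkeys (formal_scale c r) \<subseteq> carrier V \<and> ev (formal_scale c r) = \<zero>\<^bsub>V\<^esub>"
      using step(1) unfolding R_def
    proof (elim UnE CollectE exE conjE)
      fix u v assume r: "r = ?d (u \<oplus>\<^bsub>V\<^esub> v) - ?d u - ?d v" and u: "u \<in> carrier V" and v: "v \<in> carrier V"
      have eq: "formal_scale c r = Poly_Mapping.single (u \<oplus>\<^bsub>V\<^esub> v) c +
        (Poly_Mapping.single u (- c) + Poly_Mapping.single v (- c))"
        unfolding r by (rule poly_mapping_eqI) (simp add: lookup_minus lookup_add lookup_single when_def)
      have k: "pkeys (Poly_Mapping.single u (- c) + Poly_Mapping.single v (- c)) \<subseteq> carrier V"
        using Poly_Mapping.keys_add[of "Poly_Mapping.single u (- c)" "Poly_Mapping.single v (- c)"] u v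
        by (auto split: if_splits)
      have "pkeys (formal_scale c r) \<subseteq> carrier V"
        unfolding eq using Poly_Mapping.keys_add k u v by (force split: if_splits)
      moreover have "ev (formal_scale c r) = c \<odot>\<^bsub>V\<^esub> (u \<oplus>\<^bsub>V\<^esub> v) \<oplus>\<^bsub>V\<^esub> ((- c) \<odot>\<^bsub>V\<^esub> u \<oplus>\<^bsub>V\<^esub> (- c) \<odot>\<^bsub>V\<^esub> v)"
        unfolding eq using k u v by (subst ev_add) (auto simp: ev_single ev_add)
      moreover have "\<dots> = c \<odot>\<^bsub>V\<^esub> (u \<oplus>\<^bsub>V\<^esub> v) \<oplus>\<^bsub>V\<^esub> (- c) \<odot>\<^bsub>V\<^esub> (u \<oplus>\<^bsub>V\<^esub> v)"
        using u v by (simp add: V.smult_r_distr[simplified])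
      moreover have "\<dots> = \<zero>\<^bsub>V\<^esub>"
        using u v V.smult_l_distr[of c "- c" "u \<oplus>\<^bsub>V\<^esub> v"] V.smult_l_null[of "u \<oplus>\<^bsub>V\<^esub> v"] by simp
      ultimately show ?thesis by simp
    next
      fix d v assume r: "r = ?d (d \<odot>\<^bsub>V\<^esub> v) - formal_scale d (?d v)" and v: "v \<in> carrier V"
      have eq: "formal_scale c r = Poly_Mapping.single (d \<odot>\<^bsub>V\<^esub> v) c + Poly_Mapping.single v (- (c * d))"
        unfolding r by (rule poly_mapping_eqI) (simp add: lookup_minus lookup_add lookup_single when_def algebra_simps)
      have "pkeys (formal_scale c r) \<subseteq> carrier V"
        unfolding eq using Poly_Mapping.keys_add v by (force split: if_splits)
      moreover have "ev (formal_scale c r) = c \<odot>\<^bsub>V\<^esub> (d \<odot>\<^bsub>V\<^esub> v) \<oplus>\<^bsub>V\<^esub> (- (c * d)) \<odot>\<^bsub>V\<^esub> v"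
        unfolding eq using v by (subst ev_add) (auto simp: ev_single)
      moreover have "\<dots> = \<zero>\<^bsub>V\<^esub>"
        using v V.smult_l_distr[of "c * d" "- (c * d)" v] V.smult_l_null[of v]
        by (simp add: V.smult_assoc1[simplified])
      ultimately show ?thesis by simp
    qed
    then show ?case
      using step(2) Poly_Mapping.keys_add[of "formal_scale c r" p] ev_add by auto
  qed
  have notin: "?d u - ?d v \<notin> formal.span R"
  proof
    assume "?d u - ?d v \<in> formal.span R"
    from key[OF this] have z: "ev (?d u - ?d v) = \<zero>\<^bsub>V\<^esub>" by simp
    have d: "?d u - ?d v = Poly_Mapping.single u 1 + Poly_Mapping.single v (- 1)"
      by (simp add: single_uminus)
    have "ev (?d u - ?d v) = 1 \<odot>\<^bsub>V\<^esub> u \<oplus>\<^bsub>V\<^esub> (- 1) \<odot>\<^bsub>V\<^esub> v"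
      unfolding d using uv by (subst ev_add) (simp_all add: ev_single)
    with z have *: "u \<oplus>\<^bsub>V\<^esub> (- 1) \<odot>\<^bsub>V\<^esub> v = \<zero>\<^bsub>V\<^esub>" using uv V.smult_one by simp
    have "v \<oplus>\<^bsub>V\<^esub> (- 1) \<odot>\<^bsub>V\<^esub> v = \<zero>\<^bsub>V\<^esub>"
      using uv V.smult_l_distr[of 1 "- 1" v] V.smult_l_null[of v] V.smult_one by simp
    with * uv show False
      by (metis V.add.right_cancel V.smult_closed UNIV_I univ_ring_simps(1))
  qed
  from span_separation[OF this] obtain f where f: "\<And>r. r \<in> R ==> lin_ext f r = 0"
    "lin_ext f (?d u - ?d v) \<noteq> 0" by blast
  have "linfun V f"
  proof (rule lfI)
    fix u v assume "u \<in> carrier V" "v \<in> carrier V"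
    then have "?d (u \<oplus>\<^bsub>V\<^esub> v) - ?d u - ?d v \<in> R" unfolding R_def by blast
    from f(1)[OF this] show "f (u \<oplus>\<^bsub>V\<^esub> v) = f u + f v" by (simp add: lin_ext_add lin_ext_diff algebra_simps)
  next
    fix c v assume "v \<in> carrier V"
    then have "?d (c \<odot>\<^bsub>V\<^esub> v) - formal_scale c (?d v) \<in> R" unfolding R_def by blast
    from f(1)[OF this] show "f (c \<odot>\<^bsub>V\<^esub> v) = c * f v" by (simp add: lin_ext_add lin_ext_diff lin_ext_scale algebra_simps)
  qed
  moreover have "f u \<noteq> f v" using f(2) by (simp add: lin_ext_add lin_ext_diff algebra_simps)
  ultimately show ?thesis by (rule that)
qed

lemma vs_eqI:
  "vec_space V ==> u \<in> carrier V ==> v \<in> carrier V ==> (\<And>f. linfun V f ==> f u = f v) ==> u = v"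
  by (metis vs_separation)

lemma linear_mapI_lf:
  assumes V: "vec_space V" and W: "vec_space W"
    and L: "\<And>v. v \<in> carrier V ==> L v \<in> carrier W"
    and lin: "\<And>f. linfun W f ==> linfun V (\<lambda>v. f (L v))"
  shows "linear_map V W L"
  unfolding linear_map_def
proof (intro conjI ballI allI)
  show "L \<in> carrier V \<rightarrow> carrier W" using L by blast
  fix u assume u: "u \<in> carrier V"
  { fix v assume v: "v \<in> carrier V"
    show "L (u \<oplus>\<^bsub>V\<^esub> v) = L u \<oplus>\<^bsub>W\<^esub> L v"
      by (rule vs_eqI[OF W])
         (simp_all add: u v L vs_add[OF V] vs_add[OF W] lf_add lf_add[OF lin]) }
  fix c show "L (c \<odot>\<^bsub>V\<^esub> u) = c \<odot>\<^bsub>W\<^esub> L u"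
    by (rule vs_eqI[OF W])
       (simp_all add: u L vs_smult[OF V] vs_smult[OF W] lf_smult lf_smult[OF lin])
qed

lemma linear_map_closed: "linear_map V W L ==> v \<in> carrier V ==> L v \<in> carrier W"
  by (auto simp: linear_map_def)

lemma lf_linear_map: "linear_map V W L ==> linfun W f ==> linfun V (\<lambda>v. f (L v))"
  by (rule lfI) (auto simp: linear_map_def lf_add lf_smult Pi_def)

section \<open>Pairing tensors with multilinear functionals\<close>

text \<open>For a bilinear \<open>F\<close> this is the value of the induced functional on the tensor represented by the formal sum \<open>p\<close>
  of pairs. The abbreviation \<open>sw\<close> applies it to the chosen representative of a tensor: if \<open>d x\<close> is a
  comultiplication or a coaction, \<open>sw (d x) (\<lambda>a b. F a b)\<close> is what Sweedler notation writes as
  \<open>F(x\<^sub>0, x\<^sub>1)\<close>.\<close>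

definition psum :: "(('v \<times> 'w) \<Rightarrow>\<^sub>0 'k::field) => ('v => 'w => 'k) => 'k" where
  "psum p F = lin_ext (\<lambda>x. F (fst x) (snd x)) p"

abbreviation sw :: "(('v \<times> 'w) \<Rightarrow>\<^sub>0 'k::field) set => ('v => 'w => 'k) => 'k" where
  "sw t \<equiv> psum (rep t)"

lemma psum_eq_sum: "psum p F = (\<Sum>x\<in>pkeys p. plk p x * F (fst x) (snd x))"
  by (simp add: psum_def lin_ext_def)

definition pol :: "('k::field, 'v, 'x) module_scheme => ('k, 'w, 'y) module_scheme => (('v \<times> 'w) \<Rightarrow>\<^sub>0 'k) set"
  where "pol V W = {p. pkeys p \<subseteq> carrier V \<times> carrier W}"

definition bilin :: "('k::field, 'v, 'x) module_scheme => ('k, 'w, 'y) module_scheme => ('v => 'w => 'k) => bool"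
  where "bilin V W F \<longleftrightarrow> (\<forall>w\<in>carrier W. linfun V (\<lambda>v. F v w)) \<and> (\<forall>v\<in>carrier V. linfun W (\<lambda>w. F v w))"

definition trilin :: "('k::field, 'u, 'x) module_scheme => ('k, 'v, 'y) module_scheme => ('k, 'w, 'z) module_scheme
    => ('u => 'v => 'w => 'k) => bool"
  where "trilin U V W F \<longleftrightarrow> (\<forall>v\<in>carrier V. \<forall>w\<in>carrier W. linfun U (\<lambda>u. F u v w)) \<and>
    (\<forall>u\<in>carrier U. \<forall>w\<in>carrier W. linfun V (\<lambda>v. F u v w)) \<and>
    (\<forall>u\<in>carrier U. \<forall>v\<in>carrier V. linfun W (\<lambda>w. F u v w))"

lemma blI:
  assumes "\<And>w. w \<in> carrier W ==> linfun V (\<lambda>v. F v w)" "\<And>v. v \<in> carrier V ==> linfun W (\<lambda>w. F v w)"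
  shows "bilin V W F"
  using assms by (simp add: bilin_def)

lemma blD1: "bilin V W F ==> w \<in> carrier W ==> linfun V (\<lambda>v. F v w)"
  and blD2: "bilin V W F ==> v \<in> carrier V ==> linfun W (\<lambda>w. F v w)"
  by (simp_all add: bilin_def)

lemma tlI:
  assumes "\<And>v w. v \<in> carrier V ==> w \<in> carrier W ==> linfun U (\<lambda>u. F u v w)"
    "\<And>u w. u \<in> carrier U ==> w \<in> carrier W ==> linfun V (\<lambda>v. F u v w)"
    "\<And>u v. u \<in> carrier U ==> v \<in> carrier V ==> linfun W (\<lambda>w. F u v w)"
  shows "trilin U V W F"
  using assms by (simp add: trilin_def)

lemma tlD1: "trilin U V W F ==> v \<in> carrier V ==> w \<in> carrier W ==> linfun U (\<lambda>u. F u v w)"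
  and tlD2: "trilin U V W F ==> u \<in> carrier U ==> w \<in> carrier W ==> linfun V (\<lambda>v. F u v w)"
  and tlD3: "trilin U V W F ==> u \<in> carrier U ==> v \<in> carrier V ==> linfun W (\<lambda>w. F u v w)"
  by (simp_all add: trilin_def)

lemma polD: "p \<in> pol V W ==> x \<in> pkeys p ==> fst x \<in> carrier V"
  "p \<in> pol V W ==> x \<in> pkeys p ==> snd x \<in> carrier W"
  by (auto simp: pol_def)

lemma psum_cong:
  "p \<in> pol V W ==> (\<And>v w. v \<in> carrier V ==> w \<in> carrier W ==> F v w = G v w) ==> psum p F = psum p G"
  unfolding psum_eq_sum by (rule sum.cong) (auto simp: pol_def)

lemma psum_add: "psum p (\<lambda>v w. F v w + G v w) = psum p F + psum p G"
  by (simp add: psum_eq_sum algebra_simps sum.distrib)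

lemma psum_mult_left: "psum p (\<lambda>v w. c * F v w) = c * psum p F"
  by (simp add: psum_eq_sum sum_distrib_left mult.left_commute)

lemma psum_mult_right: "psum p (\<lambda>v w. F v w * c) = psum p F * c"
  by (simp add: psum_eq_sum sum_distrib_right mult.assoc)

lemma psum_swap: "psum p (\<lambda>a b. psum p' (\<lambda>c d. F a b c d)) = psum p' (\<lambda>c d. psum p (\<lambda>a b. F a b c d))"
proof -
  have "psum p (\<lambda>a b. psum p' (\<lambda>c d. F a b c d)) =
    (\<Sum>x\<in>pkeys p. \<Sum>y\<in>pkeys p'. plk p x * (plk p' y * F (fst x) (snd x) (fst y) (snd y)))"
    unfolding psum_eq_sum sum_distrib_left ..
  also have "\<dots> = (\<Sum>y\<in>pkeys p'. \<Sum>x\<in>pkeys p. plk p' y * (plk p x * F (fst x) (snd x) (fst y) (snd y)))"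
    by (subst sum.swap) (simp only: mult.left_commute)
  also have "\<dots> = psum p' (\<lambda>c d. psum p (\<lambda>a b. F a b c d))"
    unfolding psum_eq_sum sum_distrib_left ..
  finally show ?thesis .
qed

lemma psum_sum: "psum p (\<lambda>v w. \<Sum>i\<in>I. F i v w) = (\<Sum>i\<in>I. psum p (F i))"
  unfolding psum_eq_sum sum_distrib_left by (rule sum.swap)

lemma psum_poly_add: "psum (p + p') F = psum p F + psum p' F"
  and psum_poly_scale: "psum (formal_scale c p) F = c * psum p F"
  and psum_poly_zero [simp]: "psum 0 F = 0"
  and psum_poly_single [simp]: "psum (Poly_Mapping.single (v, w) c) F = c * F v w"
  by (simp_all add: psum_def lin_ext_add lin_ext_scale)

lemma pol_add: "p \<in> pol V W ==> p' \<in> pol V W ==> p + p' \<in> pol V W"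
  by (auto simp: pol_def dest!: subsetD[OF Poly_Mapping.keys_add])

lemma pol_scale: "p \<in> pol V W ==> formal_scale c p \<in> pol V W"
  by (auto simp: pol_def in_keys_iff)

lemma pol_zero: "0 \<in> pol V W"
  by (simp add: pol_def)

lemma pol_single: "v \<in> carrier V ==> w \<in> carrier W ==> Poly_Mapping.single (v, w) c \<in> pol V W"
  by (auto simp: pol_def)

lemma tensor_relators_vanish:
  assumes "bilin V W F" "r \<in> tensor_relators V W" shows "psum r F = 0"
proof -
  note F = lf_add[OF blD1[OF assms(1)]] lf_add[OF blD2[OF assms(1)]]
    lf_smult[OF blD1[OF assms(1)]] lf_smult[OF blD2[OF assms(1)]]
  show ?thesis
    using assms(2) unfolding tensor_relators_def Let_def
    by (elim UnE CollectE exE conjE)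
      (simp_all add: psum_def lin_ext_diff lin_ext_scale F)
qed

text \<open>A functional on formal sums of pairs kills the relators exactly when it comes from a bilinear map.\<close>

lemma span_relators_iff:
  fixes V :: "('k::field, 'v, 'x) module_scheme" and W :: "('k, 'w, 'y) module_scheme"
  shows "p \<in> formal.span (tensor_relators V W) \<longleftrightarrow> (\<forall>F. bilin V W F \<longrightarrow> psum p F = 0)"
proof
  assume "p \<in> formal.span (tensor_relators V W)"
  then show "\<forall>F. bilin V W F \<longrightarrow> psum p F = 0"
    using lin_ext_span tensor_relators_vanish unfolding psum_def by blast
next
  assume *: "\<forall>F. bilin V W F \<longrightarrow> psum p F = 0"
  show "p \<in> formal.span (tensor_relators V W)"
  proof (rule ccontr)
    assume "p \<notin> formal.span (tensor_relators V W)"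
    then obtain f where f: "\<And>r. r \<in> tensor_relators V W ==> lin_ext f r = 0" "lin_ext f p \<noteq> 0"
      using span_separation by blast
    let ?d = "\<lambda>v w. Poly_Mapping.single (v, w) (1::'k)"
    have "bilin V W (\<lambda>v w. f (v, w))"
    proof (intro blI lfI)
      fix v v' w assume "w \<in> carrier W" "v \<in> carrier V" "v' \<in> carrier V"
      then have "?d (v \<oplus>\<^bsub>V\<^esub> v') w - ?d v w - ?d v' w \<in> tensor_relators V W"
        unfolding tensor_relators_def Let_def by blast
      from f(1)[OF this] show "f (v \<oplus>\<^bsub>V\<^esub> v', w) = f (v, w) + f (v', w)" by (simp add: lin_ext_add lin_ext_diff algebra_simps)
    next
      fix c v w assume "w \<in> carrier W" "v \<in> carrier V"
      then have "?d (c \<odot>\<^bsub>V\<^esub> v) w - formal_scale c (?d v w) \<in> tensor_relators V W"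
        unfolding tensor_relators_def Let_def by blast
      from f(1)[OF this] show "f (c \<odot>\<^bsub>V\<^esub> v, w) = c * f (v, w)" by (simp add: lin_ext_add lin_ext_diff lin_ext_scale algebra_simps)
    next
      fix v w w' assume "v \<in> carrier V" "w \<in> carrier W" "w' \<in> carrier W"
      then have "?d v (w \<oplus>\<^bsub>W\<^esub> w') - ?d v w - ?d v w' \<in> tensor_relators V W"
        unfolding tensor_relators_def Let_def by blast
      from f(1)[OF this] show "f (v, w \<oplus>\<^bsub>W\<^esub> w') = f (v, w) + f (v, w')" by (simp add: lin_ext_add lin_ext_diff algebra_simps)
    next
      fix c v w assume "v \<in> carrier V" "w \<in> carrier W"
      then have "?d v (c \<odot>\<^bsub>W\<^esub> w) - formal_scale c (?d v w) \<in> tensor_relators V W"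
        unfolding tensor_relators_def Let_def by blast
      from f(1)[OF this] show "f (v, c \<odot>\<^bsub>W\<^esub> w) = c * f (v, w)" by (simp add: lin_ext_add lin_ext_diff lin_ext_scale algebra_simps)
    qed
    with * have "psum p (\<lambda>v w. f (v, w)) = 0" by blast
    then have "lin_ext f p = 0" by (simp add: psum_def)
    with f(2) show False by simp
  qed
qed

text \<open>The test by which every identity between tensors is proved: bilinear functionals separate tensors.\<close>

lemma tensor_class_eq_iff:
  "tensor_class V W p = tensor_class V W p' \<longleftrightarrow> (\<forall>F. bilin V W F \<longrightarrow> psum p F = psum p' F)"
proof -
  let ?S = "formal.span (tensor_relators V W)"
  have "tensor_class V W p = tensor_class V W p' \<longleftrightarrow> p' - p \<in> ?S"
  proof
    assume "tensor_class V W p = tensor_class V W p'"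
    moreover have "p' \<in> tensor_class V W p'" by (simp add: tensor_class_def formal.span_zero)
    ultimately have "p' \<in> tensor_class V W p" by simp
    then show "p' - p \<in> ?S" by (simp only: tensor_class_def mem_Collect_eq)
  next
    assume d: "p' - p \<in> ?S"
    have "r - p \<in> ?S \<longleftrightarrow> r - p' \<in> ?S" for r
      using formal.span_add_eq[OF d, of "r - p'"] formal.span_add_eq2[OF d, of "r - p'"] by simp
    then show "tensor_class V W p = tensor_class V W p'" by (simp add: tensor_class_def)
  qed
  also have "\<dots> \<longleftrightarrow> (\<forall>F. bilin V W F \<longrightarrow> psum p F = psum p' F)"
    unfolding span_relators_iff psum_def by (auto simp: lin_ext_diff)
  finally show ?thesis .
qed

lemma rep_in: "X \<noteq> {} ==> rep X \<in> X"
  unfolding rep_def by (rule someI_ex) blast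

lemma keys_relators:
  assumes V: "vec_space V" and W: "vec_space W" and r: "r \<in> tensor_relators V W"
  shows "r \<in> pol V W"
proof -
  have sub: "p - p' \<in> pol V W" if "p \<in> pol V W" "p' \<in> pol V W" for p p'
  proof -
    have "p - p' = p + formal_scale (- 1) p'"
      by (rule poly_mapping_eqI) (simp add: lookup_add lookup_minus)
    then show ?thesis by (simp only:) (intro pol_add pol_scale that)
  qed
  show ?thesis
    using r unfolding tensor_relators_def Let_def
    by (auto intro!: sub pol_single pol_scale simp: vs_add[OF V] vs_add[OF W] vs_smult[OF V] vs_smult[OF W])
qed

text \<open>The class of a tensor consists of formal sums of elements of the carriers, since the relators do; hence a
  representative chosen arbitrarily in the class can still be evaluated.\<close>

lemma tensor_class_pol:
  assumes V: "vec_space V" and W: "vec_space W" and p: "p \<in> pol V W"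
  shows "rep (tensor_class V W p) \<in> pol V W"
    and "tensor_class V W (rep (tensor_class V W p)) = tensor_class V W p"
proof -
  let ?r = "rep (tensor_class V W p)"
  have "p \<in> tensor_class V W p" by (simp add: tensor_class_def formal.span_zero)
  then have "?r \<in> tensor_class V W p" by (intro rep_in) auto
  then have d: "?r - p \<in> formal.span (tensor_relators V W)" by (simp add: tensor_class_def)
  have "q \<in> pol V W" if "q \<in> formal.span (tensor_relators V W)" for q
    using that by (induction rule: formal.span_induct_alt)
      (auto intro: pol_add pol_scale pol_zero keys_relators[OF V W])
  from pol_add[OF this[OF d] p] show "?r \<in> pol V W" by simp
  show "tensor_class V W ?r = tensor_class V W p"
    unfolding tensor_class_eq_iff using d
    by (auto simp: span_relators_iff psum_def lin_ext_diff)
qed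

locale two_spaces =
  fixes V :: "('k::field, 'v, 'x) module_scheme" and W :: "('k, 'w, 'y) module_scheme"
  assumes V: "vec_space V" and W: "vec_space W"
begin

lemma rep_pol: "t \<in> carrier (tensor V W) ==> rep t \<in> pol V W"
  by (auto simp: tensor_def tensor_class_pol[OF V W] pol_def[symmetric])

lemma class_rep: "t \<in> carrier (tensor V W) ==> tensor_class V W (rep t) = t"
  by (auto simp: tensor_def tensor_class_pol[OF V W] pol_def[symmetric])

lemma psum_class: "p \<in> pol V W ==> bilin V W F ==> sw (tensor_class V W p) F = psum p F"
  using tensor_class_pol(2)[OF V W] tensor_class_eq_iff by blast

lemma class_closed: "p \<in> pol V W ==> tensor_class V W p \<in> carrier (tensor V W)"
  by (auto simp: tensor_def pol_def)

lemma tensor_eqI: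
  assumes "t \<in> carrier (tensor V W)" "t' \<in> carrier (tensor V W)"
    "\<And>F. bilin V W F ==> sw t F = sw t' F"
  shows "t = t'"
  using assms(3) class_rep[OF assms(1)] class_rep[OF assms(2)] tensor_class_eq_iff by metis

lemma pure_closed: "v \<in> carrier V ==> w \<in> carrier W ==> pure V W v w \<in> carrier (tensor V W)"
  unfolding pure_def by (rule class_closed) (rule pol_single)

lemma psum_pure: "v \<in> carrier V ==> w \<in> carrier W ==> bilin V W F ==> sw (pure V W v w) F = F v w"
  unfolding pure_def by (simp add: psum_class pol_single)

lemma tensor_ops_closed:
  "\<zero>\<^bsub>tensor V W\<^esub> \<in> carrier (tensor V W)"
  "t \<in> carrier (tensor V W) ==> t' \<in> carrier (tensor V W) ==> t \<oplus>\<^bsub>tensor V W\<^esub> t' \<in> carrier (tensor V W)"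
  "t \<in> carrier (tensor V W) ==> c \<odot>\<^bsub>tensor V W\<^esub> t \<in> carrier (tensor V W)"
proof -
  have "\<zero>\<^bsub>tensor V W\<^esub> = tensor_class V W 0"
    "t \<oplus>\<^bsub>tensor V W\<^esub> t' = tensor_class V W (rep t + rep t')"
    "c \<odot>\<^bsub>tensor V W\<^esub> t = tensor_class V W (formal_scale c (rep t))"
    by (simp_all add: tensor_def)
  then show "\<zero>\<^bsub>tensor V W\<^esub> \<in> carrier (tensor V W)"
    "t \<in> carrier (tensor V W) ==> t' \<in> carrier (tensor V W) ==> t \<oplus>\<^bsub>tensor V W\<^esub> t' \<in> carrier (tensor V W)"
    "t \<in> carrier (tensor V W) ==> c \<odot>\<^bsub>tensor V W\<^esub> t \<in> carrier (tensor V W)"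
    by (simp_all add: class_closed pol_add pol_scale rep_pol pol_zero)
qed

lemma lf_psum_rep: "bilin V W F ==> linfun (tensor V W) (\<lambda>t. sw t F)"
proof (rule lfI)
  assume F: "bilin V W F"
  show "sw (t \<oplus>\<^bsub>tensor V W\<^esub> t') F = sw t F + sw t' F"
    if t: "t \<in> carrier (tensor V W)" "t' \<in> carrier (tensor V W)" for t t'
  proof -
    have "t \<oplus>\<^bsub>tensor V W\<^esub> t' = tensor_class V W (rep t + rep t')" by (simp add: tensor_def)
    then show ?thesis using F t by (simp add: psum_class pol_add rep_pol psum_poly_add)
  qed
  show "sw (c \<odot>\<^bsub>tensor V W\<^esub> t) F = c * sw t F" if t: "t \<in> carrier (tensor V W)" for c t
  proof -
    have "c \<odot>\<^bsub>tensor V W\<^esub> t = tensor_class V W (formal_scale c (rep t))" by (simp add: tensor_def)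
    then show ?thesis using F t by (simp add: psum_class pol_scale rep_pol psum_poly_scale)
  qed
qed

lemma psum_zero: "bilin V W F ==> sw \<zero>\<^bsub>tensor V W\<^esub> F = 0"
proof -
  assume F: "bilin V W F"
  have "\<zero>\<^bsub>tensor V W\<^esub> = tensor_class V W 0" by (simp add: tensor_def)
  then show ?thesis using F by (simp add: psum_class pol_zero)
qed

lemma vec_space_tensor: "vec_space (tensor V W)"
proof (rule vec_spaceI_sep[where \<Phi> = "{\<lambda>t. sw t F | F. bilin V W F}"])
  fix t t' assume t: "t \<in> carrier (tensor V W)" "t' \<in> carrier (tensor V W)"
    and "\<And>f. f \<in> {\<lambda>t. sw t F | F. bilin V W F} ==> f t = f t'"
  then show "t = t'" by (intro tensor_eqI) blast+
qed (auto simp: tensor_ops_closed lf_psum_rep psum_zero)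

lemma bl_pure: "bilin V W (\<lambda>v w. f (pure V W v w))" if f: "linfun (tensor V W) f"
proof -
  have eq1: "pure V W (v \<oplus>\<^bsub>V\<^esub> v') w = pure V W v w \<oplus>\<^bsub>tensor V W\<^esub> pure V W v' w"
    if "v \<in> carrier V" "v' \<in> carrier V" "w \<in> carrier W" for v v' w
    using that by (intro tensor_eqI)
      (simp_all add: pure_closed tensor_ops_closed psum_pure vs_add[OF V] lf_add[OF lf_psum_rep] lf_add[OF blD1])
  have eq2: "pure V W v (w \<oplus>\<^bsub>W\<^esub> w') = pure V W v w \<oplus>\<^bsub>tensor V W\<^esub> pure V W v w'"
    if "v \<in> carrier V" "w \<in> carrier W" "w' \<in> carrier W" for v w w'
    using that by (intro tensor_eqI)
      (simp_all add: pure_closed tensor_ops_closed psum_pure vs_add[OF W] lf_add[OF lf_psum_rep] lf_add[OF blD2])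
  have eq3: "pure V W (c \<odot>\<^bsub>V\<^esub> v) w = c \<odot>\<^bsub>tensor V W\<^esub> pure V W v w"
    if "v \<in> carrier V" "w \<in> carrier W" for c v w
    using that by (intro tensor_eqI)
      (simp_all add: pure_closed tensor_ops_closed psum_pure vs_smult[OF V] lf_smult[OF lf_psum_rep] lf_smult[OF blD1])
  have eq4: "pure V W v (c \<odot>\<^bsub>W\<^esub> w) = c \<odot>\<^bsub>tensor V W\<^esub> pure V W v w"
    if "v \<in> carrier V" "w \<in> carrier W" for c v w
    using that by (intro tensor_eqI)
      (simp_all add: pure_closed tensor_ops_closed psum_pure vs_smult[OF W] lf_smult[OF lf_psum_rep] lf_smult[OF blD2])
  show ?thesis
    by (intro blI lfI) (simp_all add: eq1 eq2 eq3 eq4 pure_closed lf_add[OF f] lf_smult[OF f])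
qed

end

lemma eval_tensor_closed:
  assumes U: "vec_space U" and p: "p \<in> pol V W"
    and G: "\<And>v w. v \<in> carrier V ==> w \<in> carrier W ==> G v w \<in> carrier U"
  shows "eval_tensor U G p \<in> carrier U"
  unfolding eval_tensor_def using G p
  by (intro vs_finsum[OF U] vs_smult[OF U]) (auto simp: pol_def)

lemma lf_eval_tensor:
  assumes U: "vec_space U" and p: "p \<in> pol V W" and f: "linfun U f"
    and G: "\<And>v w. v \<in> carrier V ==> w \<in> carrier W ==> G v w \<in> carrier U"
  shows "f (eval_tensor U G p) = psum p (\<lambda>v w. f (G v w))"
proof -
  have *: "G (fst x) (snd x) \<in> carrier U" if "x \<in> pkeys p" for x
    using G p that by (auto simp: pol_def)
  show ?thesis
    unfolding eval_tensor_def psum_eq_sum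
    by (subst lf_finsum[OF U f]) (auto simp: * vs_smult[OF U] lf_smult[OF f])
qed

lemma (in two_spaces) lf_tensor_eq:
  assumes f: "linfun (tensor V W) f" and t: "t \<in> carrier (tensor V W)"
  shows "f t = sw t (\<lambda>v w. f (pure V W v w))"
proof -
  have "t = eval_tensor (tensor V W) (pure V W) (rep t)"
    using t by (intro tensor_eqI)
      (auto simp: eval_tensor_closed[OF vec_space_tensor rep_pol] pure_closed
        lf_eval_tensor[OF vec_space_tensor rep_pol lf_psum_rep, of t] psum_pure
        intro!: psum_cong[OF rep_pol, symmetric])
  then have "f t = f (eval_tensor (tensor V W) (pure V W) (rep t))" by simp
  also have "\<dots> = sw t (\<lambda>v w. f (pure V W v w))"
    by (rule lf_eval_tensor[OF vec_space_tensor rep_pol[OF t] f]) (rule pure_closed)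
  finally show ?thesis .
qed

subsection \<open>Coded tensor products\<close>

text \<open>The cotensor product is a subspace of \<open>V \<otimes> Z\<close> for a comodule \<open>V\<close> in the universe and an algebra \<open>Z\<close>
  outside it, so the coding of tensor products is generalised to factors of different types.\<close>

definition coded :: "((('v \<times> 'w) \<Rightarrow>\<^sub>0 'k) => 'u) => ('k::field, 'v, 'x) module_scheme
     => ('k, 'w, 'y) module_scheme => ('k, 'u) module" where
  "coded e V W =
     (let T = tensor V W;
          encode = (\<lambda>X. e (rep X));
          decode = (\<lambda>x. tensor_class V W (inv_into UNIV e x)) in
      \<lparr>carrier = encode ` carrier T,
       mult = undefined, one = undefined,
       zero = encode \<zero>\<^bsub>T\<^esub>,
       add = (\<lambda>x y. encode (decode x \<oplus>\<^bsub>T\<^esub> decode y)),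
       smult = (\<lambda>c x. encode (c \<odot>\<^bsub>T\<^esub> decode x))\<rparr>)"

lemma coded_tensor_eq_coded: "coded_tensor tc V W = coded tc V W"
  by (simp add: coded_tensor_def coded_def)

definition cpure :: "((('v \<times> 'w) \<Rightarrow>\<^sub>0 'k) => 'u) => ('k::field, 'v, 'x) module_scheme
     => ('k, 'w, 'y) module_scheme => 'v => 'w => 'u" where
  "cpure e V W v w = e (rep (pure V W v w))"

lemma coded_pure_eq_cpure: "coded_pure tc V W = cpure tc V W"
  by (simp add: coded_pure_def cpure_def fun_eq_iff)

text \<open>The elements of a presented algebra are sets, and the type of all such sets can be too large for
  an injection into the universe. It suffices that formal sums are recovered from their codes if
  their second entries lie in the carrier.\<close>

definition codes :: "('k::field, 'w, 'y) module_scheme => (('v \<times> 'w \<Rightarrow>\<^sub>0 'k) => 'u) => bool" where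
  "codes W e \<longleftrightarrow> (\<forall>p. (\<forall>x\<in>pkeys p. snd x \<in> carrier W) \<longrightarrow> inv_into UNIV e (e p) = p)"

lemma codes_inj: "inj e ==> codes W e"
  by (simp add: codes_def)

locale coding = two_spaces V W
  for V :: "('k::field, 'v, 'x) module_scheme" and W :: "('k, 'w, 'y) module_scheme" +
  fixes e :: "(('v \<times> 'w) \<Rightarrow>\<^sub>0 'k) => 'u"
  assumes e: "codes W e"
begin

abbreviation "M \<equiv> coded e V W"
abbreviation "dec \<equiv> inv_into UNIV e"
abbreviation "cp \<equiv> cpure e V W"

lemma decode: "t \<in> carrier (tensor V W) ==> dec (e (rep t)) = rep t"
  using e rep_pol[of t] polD(2) unfolding codes_def by blast

lemma carrier_coded: "carrier M = (\<lambda>t. e (rep t)) ` carrier (tensor V W)"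
  by (simp add: coded_def Let_def)

lemma coded_cases:
  assumes "x \<in> carrier M"
  obtains t where "t \<in> carrier (tensor V W)" "x = e (rep t)" "dec x = rep t" "tensor_class V W (dec x) = t"
  using assms unfolding carrier_coded by (auto simp: decode class_rep)

lemma encode_closed: "t \<in> carrier (tensor V W) ==> e (rep t) \<in> carrier M"
  by (simp add: carrier_coded)

lemma dec_pol: "x \<in> carrier M ==> dec x \<in> pol V W"
  by (erule coded_cases) (simp add: rep_pol)

lemma coded_eqI:
  assumes "x \<in> carrier M" "y \<in> carrier M" "\<And>F. bilin V W F ==> psum (dec x) F = psum (dec y) F"
  shows "x = y"
proof -
  obtain s where s: "s \<in> carrier (tensor V W)" "x = e (rep s)" "dec x = rep s"
    by (rule coded_cases[OF assms(1)])
  moreover obtain t where t: "t \<in> carrier (tensor V W)" "y = e (rep t)" "dec y = rep t"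
    by (rule coded_cases[OF assms(2)])
  ultimately have "s = t" using assms(3) by (intro tensor_eqI) simp_all
  then show ?thesis using s t by simp
qed

lemma cp_closed: "v \<in> carrier V ==> w \<in> carrier W ==> cp v w \<in> carrier M"
  by (simp add: cpure_def encode_closed pure_closed)

lemma psum_cp: "v \<in> carrier V ==> w \<in> carrier W ==> bilin V W F ==> psum (dec (cp v w)) F = F v w"
  by (simp add: cpure_def decode pure_closed psum_pure)

lemma coded_ops_closed:
  "\<zero>\<^bsub>M\<^esub> \<in> carrier M"
  "x \<in> carrier M ==> y \<in> carrier M ==> x \<oplus>\<^bsub>M\<^esub> y \<in> carrier M"
  "x \<in> carrier M ==> c \<odot>\<^bsub>M\<^esub> x \<in> carrier M"
    apply (simp add: coded_def Let_def tensor_ops_closed)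
   apply (elim coded_cases, simp add: coded_def Let_def decode class_rep tensor_ops_closed)
  apply (elim coded_cases, simp add: coded_def Let_def decode class_rep tensor_ops_closed)
  done

lemma lf_psum_dec: "bilin V W F ==> linfun M (\<lambda>x. psum (dec x) F)"
proof (rule lfI)
  assume F: "bilin V W F"
  show "psum (dec (x \<oplus>\<^bsub>M\<^esub> y)) F = psum (dec x) F + psum (dec y) F"
    if x: "x \<in> carrier M" and y: "y \<in> carrier M" for x y
  proof -
    obtain s where s: "s \<in> carrier (tensor V W)" "dec x = rep s" "tensor_class V W (dec x) = s"
      by (rule coded_cases[OF x])
    obtain t where t: "t \<in> carrier (tensor V W)" "dec y = rep t" "tensor_class V W (dec y) = t"
      by (rule coded_cases[OF y])
    have "x \<oplus>\<^bsub>M\<^esub> y = e (rep (s \<oplus>\<^bsub>tensor V W\<^esub> t))"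
      by (simp add: coded_def Let_def s t class_rep)
    then show ?thesis by (simp add: decode tensor_ops_closed s t lf_add[OF lf_psum_rep[OF F]])
  qed
  show "psum (dec (c \<odot>\<^bsub>M\<^esub> x)) F = c * psum (dec x) F" if x: "x \<in> carrier M" for c x
  proof -
    obtain s where s: "s \<in> carrier (tensor V W)" "dec x = rep s" "tensor_class V W (dec x) = s"
      by (rule coded_cases[OF x])
    have "c \<odot>\<^bsub>M\<^esub> x = e (rep (c \<odot>\<^bsub>tensor V W\<^esub> s))"
      by (simp add: coded_def Let_def s class_rep)
    then show ?thesis by (simp add: decode tensor_ops_closed s lf_smult[OF lf_psum_rep[OF F]])
  qed
qed

lemma psum_dec_zero: "bilin V W F ==> psum (dec \<zero>\<^bsub>M\<^esub>) F = 0"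
  by (simp add: coded_def Let_def decode tensor_ops_closed psum_zero)

lemma vec_space_coded: "vec_space M"
proof (rule vec_spaceI_sep[where \<Phi> = "{\<lambda>t. psum (dec t) F | F. bilin V W F}"])
  fix t t' assume t: "t \<in> carrier M" "t' \<in> carrier M"
    and "\<And>f. f \<in> {\<lambda>t. psum (dec t) F | F. bilin V W F} ==> f t = f t'"
  then show "t = t'" by (intro coded_eqI) blast+
qed (auto simp: coded_ops_closed lf_psum_dec psum_dec_zero)

lemma bl_cp: "bilin V W (\<lambda>v w. f (cp v w))" if f: "linfun M f"
proof -
  have eq1: "cp (v \<oplus>\<^bsub>V\<^esub> v') w = cp v w \<oplus>\<^bsub>M\<^esub> cp v' w"
    if "v \<in> carrier V" "v' \<in> carrier V" "w \<in> carrier W" for v v' w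
    using that by (intro coded_eqI)
      (simp_all add: cp_closed coded_ops_closed psum_cp vs_add[OF V] lf_add[OF lf_psum_dec] lf_add[OF blD1])
  have eq2: "cp v (w \<oplus>\<^bsub>W\<^esub> w') = cp v w \<oplus>\<^bsub>M\<^esub> cp v w'"
    if "v \<in> carrier V" "w \<in> carrier W" "w' \<in> carrier W" for v w w'
    using that by (intro coded_eqI)
      (simp_all add: cp_closed coded_ops_closed psum_cp vs_add[OF W] lf_add[OF lf_psum_dec] lf_add[OF blD2])
  have eq3: "cp (c \<odot>\<^bsub>V\<^esub> v) w = c \<odot>\<^bsub>M\<^esub> cp v w"
    if "v \<in> carrier V" "w \<in> carrier W" for c v w
    using that by (intro coded_eqI)
      (simp_all add: cp_closed coded_ops_closed psum_cp vs_smult[OF V] lf_smult[OF lf_psum_dec] lf_smult[OF blD1])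
  have eq4: "cp v (c \<odot>\<^bsub>W\<^esub> w) = c \<odot>\<^bsub>M\<^esub> cp v w"
    if "v \<in> carrier V" "w \<in> carrier W" for c v w
    using that by (intro coded_eqI)
      (simp_all add: cp_closed coded_ops_closed psum_cp vs_smult[OF W] lf_smult[OF lf_psum_dec] lf_smult[OF blD2])
  show ?thesis
    by (intro blI lfI) (simp_all add: eq1 eq2 eq3 eq4 cp_closed lf_add[OF f] lf_smult[OF f])
qed

lemma eval_coded_id: "x \<in> carrier M ==> eval_tensor M cp (dec x) = x"
  by (intro coded_eqI)
    (auto simp: eval_tensor_closed[OF vec_space_coded dec_pol] cp_closed
      lf_eval_tensor[OF vec_space_coded dec_pol lf_psum_dec, of x] psum_cp
      intro!: psum_cong[OF dec_pol])

lemma lf_coded_eq: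
  assumes f: "linfun M f" and x: "x \<in> carrier M"
  shows "f x = psum (dec x) (\<lambda>v w. f (cp v w))"
proof -
  have "f x = f (eval_tensor M cp (dec x))" using x by (simp add: eval_coded_id)
  also have "\<dots> = psum (dec x) (\<lambda>v w. f (cp v w))"
    by (rule lf_eval_tensor[OF vec_space_coded dec_pol[OF x] f]) (rule cp_closed)
  finally show ?thesis .
qed

end

section \<open>Multilinearity\<close>

lemma vec_space_same:
  fixes V :: "('k::field, 'v, 'x) module_scheme" and V' :: "('k, 'v, 'y) module_scheme"
  assumes V: "vec_space V" and same: "carrier V' = carrier V" "add V' = add V" "smult V' = smult V" "zero V' = zero V"
  shows "vec_space V'"
proof (rule vec_spaceI_sep[where \<Phi> = "{f. linfun V f}"])
  fix u v assume "u \<in> carrier V'" "v \<in> carrier V'" "\<And>f. f \<in> {f. linfun V f} ==> f u = f v"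
  then show "u = v" by (intro vs_eqI[OF V]) (simp_all add: same)
qed (auto simp: same vs_add[OF V] vs_smult[OF V] vs_zero[OF V] lf_zero[OF V] linfun_def)

lemma lf_psum_inner:
  assumes "p \<in> pol A B" "\<And>a b. a \<in> carrier A ==> b \<in> carrier B ==> linfun V (\<lambda>v. E v a b)"
  shows "linfun V (\<lambda>v. psum p (\<lambda>a b. E v a b))"
proof (rule lfI)
  show "psum p (\<lambda>a b. E (u \<oplus>\<^bsub>V\<^esub> v) a b) = psum p (\<lambda>a b. E u a b) + psum p (\<lambda>a b. E v a b)"
    if "u \<in> carrier V" "v \<in> carrier V" for u v
    unfolding psum_add[symmetric] using that
    by (intro psum_cong[OF assms(1)]) (rule lf_add[OF assms(2)])
  show "psum p (\<lambda>a b. E (c \<odot>\<^bsub>V\<^esub> v) a b) = c * psum p (\<lambda>a b. E v a b)"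
    if "v \<in> carrier V" for c v
    unfolding psum_mult_left[symmetric] using that
    by (intro psum_cong[OF assms(1)]) (rule lf_smult[OF assms(2)])
qed

lemma lf_mult_const: "linfun V E ==> linfun V (\<lambda>v. E v * c)" "linfun V E ==> linfun V (\<lambda>v. c * E v)"
  by (auto simp: linfun_def algebra_simps)

text \<open>A bilinear map is one whose composites with functionals are bilinear functionals; this form lets one
  substitute it inside a pairing.\<close>

definition bmap :: "('k::field, 'v, 'x) module_scheme => ('k, 'w, 'y) module_scheme => ('k, 'u, 'z) module_scheme
    => ('v => 'w => 'u) => bool" where
  "bmap V W U G \<longleftrightarrow> (\<forall>v\<in>carrier V. \<forall>w\<in>carrier W. G v w \<in> carrier U) \<and>
    (\<forall>f. linfun U f \<longrightarrow> bilin V W (\<lambda>v w. f (G v w)))"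

lemma bmapI:
  assumes "\<And>v w. v \<in> carrier V ==> w \<in> carrier W ==> G v w \<in> carrier U"
    "\<And>f w. linfun U f ==> w \<in> carrier W ==> linfun V (\<lambda>v. f (G v w))"
    "\<And>f v. linfun U f ==> v \<in> carrier V ==> linfun W (\<lambda>w. f (G v w))"
  shows "bmap V W U G"
  using assms by (simp add: bmap_def bilin_def)

lemma bmap_closed: "bmap V W U G ==> v \<in> carrier V ==> w \<in> carrier W ==> G v w \<in> carrier U"
  and bmap_bl: "bmap V W U G ==> linfun U f ==> bilin V W (\<lambda>v w. f (G v w))"
  by (auto simp: bmap_def)

lemma lf_bmap1: "bmap V W U G ==> linfun U f ==> w \<in> carrier W ==> linfun V (\<lambda>v. f (G v w))"
  and lf_bmap2: "bmap V W U G ==> linfun U f ==> v \<in> carrier V ==> linfun W (\<lambda>w. f (G v w))"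
  by (auto simp: bmap_def bilin_def)

lemma bmap_comp: "bmap V W U G ==> linear_map V' V f ==> linear_map W' W g ==> bmap V' W' U (\<lambda>v w. G (f v) (g w))"
  by (intro bmapI) (auto intro: bmap_closed linear_map_closed
      lf_linear_map[where f = "\<lambda>v. _ (G v _)"] lf_linear_map[where f = "\<lambda>w. _ (G _ w)"] lf_bmap1 lf_bmap2)

lemma linear_map_bmap1:
  assumes "vec_space V" "vec_space U" "bmap V W U G" "w \<in> carrier W" shows "linear_map V U (\<lambda>v. G v w)"
  by (rule linear_mapI_lf[OF assms(1,2)]) (use assms in \<open>auto intro: bmap_closed lf_bmap1\<close>)

lemma linear_map_bmap2:
  assumes "vec_space W" "vec_space U" "bmap V W U G" "v \<in> carrier V" shows "linear_map W U (\<lambda>w. G v w)"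
  by (rule linear_mapI_lf[OF assms(1,2)]) (use assms in \<open>auto intro: bmap_closed lf_bmap2\<close>)

lemma linear_map_comp: "linear_map V W f ==> linear_map W U g ==> linear_map V U (\<lambda>v. g (f v))"
  by (auto simp: linear_map_def Pi_def)

lemma linear_map_id: "linear_map V V (\<lambda>v. v)"
  by (auto simp: linear_map_def)

lemma linear_map_cong:
  assumes "vec_space V" "\<And>v. v \<in> carrier V ==> f v = g v" shows "linear_map V W f \<longleftrightarrow> linear_map V W g"
  using assms vs_add[OF assms(1)] vs_smult[OF assms(1)] by (auto simp: linear_map_def Pi_def)

lemma smult_bmap:
  fixes V :: "('k::field, 'v, 'x) module_scheme"
  assumes "vec_space V" "linfun U f" shows "bmap U V V (\<lambda>u v. f u \<odot>\<^bsub>V\<^esub> v)"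
  using assms by (intro bmapI) (auto simp: vs_smult linfun_def algebra_simps vs_add)

section \<open>Algebras, bialgebras and comodules in terms of functionals\<close>

locale kalg =
  fixes A :: "('k::field, 'a, 'x) module_scheme" (structure)
  assumes vs: "vec_space A"
    and one_closed: "\<one> \<in> carrier A"
    and mult_bmap: "bmap A A A (\<lambda>a b. a \<otimes> b)"
    and assoc: "\<lbrakk>a \<in> carrier A; b \<in> carrier A; c \<in> carrier A\<rbrakk> \<Longrightarrow> (a \<otimes> b) \<otimes> c = a \<otimes> (b \<otimes> c)"
    and l_one: "a \<in> carrier A ==> \<one> \<otimes> a = a"
    and r_one: "a \<in> carrier A ==> a \<otimes> \<one> = a"
begin

lemma mult_closed: "a \<in> carrier A ==> b \<in> carrier A ==> a \<otimes> b \<in> carrier A"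
  by (rule bmap_closed[OF mult_bmap])

lemma lf_mult1: "linfun A (\<lambda>x. E x) ==> b \<in> carrier A ==> linfun A (\<lambda>a. E (a \<otimes> b))"
  by (rule lf_bmap1[OF mult_bmap])

lemma lf_mult2: "linfun A (\<lambda>x. E x) ==> a \<in> carrier A ==> linfun A (\<lambda>b. E (a \<otimes> b))"
  by (rule lf_bmap2[OF mult_bmap])

end

text \<open>The axioms say that both sides of each identity have the same pairing with all multilinear
  functionals.\<close>

locale bialgebra = kalg H for H :: "('k::field, 'a) hopf" (structure) +
  assumes comult_lin: "linear_map H (tensor H H) (comult H)"
    and comult_coassoc: "\<lbrakk>a \<in> carrier H; trilin H H H F\<rbrakk> \<Longrightarrow>
      sw (comult H a) (\<lambda>x z. sw (comult H x) (\<lambda>u v. F u v z)) =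
      sw (comult H a) (\<lambda>x y. sw (comult H y) (\<lambda>v w. F x v w))"
    and counit_lf: "linfun H (counit H)"
    and counit_l: "\<lbrakk>a \<in> carrier H; linfun H f\<rbrakk> \<Longrightarrow> sw (comult H a) (\<lambda>x y. counit H x * f y) = f a"
    and counit_r: "\<lbrakk>a \<in> carrier H; linfun H f\<rbrakk> \<Longrightarrow> sw (comult H a) (\<lambda>x y. counit H y * f x) = f a"
    and comult_mult: "\<lbrakk>a \<in> carrier H; b \<in> carrier H; bilin H H G\<rbrakk> \<Longrightarrow> sw (comult H (a \<otimes> b)) G =
      sw (comult H a) (\<lambda>x y. sw (comult H b) (\<lambda>x' y'. G (x \<otimes> x') (y \<otimes> y')))"
    and comult_one: "bilin H H G ==> sw (comult H \<one>) G = G \<one> \<one>"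
    and counit_mult: "\<lbrakk>a \<in> carrier H; b \<in> carrier H\<rbrakk> \<Longrightarrow> counit H (a \<otimes> b) = counit H a * counit H b"
    and counit_one: "counit H \<one> = 1"
begin

lemma comult_closed: "a \<in> carrier H ==> comult H a \<in> carrier (tensor H H)"
  by (rule linear_map_closed[OF comult_lin])

sublocale HH: two_spaces H H
  by (rule two_spaces.intro) (rule vs)+

lemma comult_pol: "a \<in> carrier H ==> rep (comult H a) \<in> pol H H"
  by (rule HH.rep_pol[OF comult_closed])

lemma lf_comult: "(\<And>b. b \<in> carrier H ==> linfun H (\<lambda>a. F a b)) ==> (\<And>a. a \<in> carrier H ==> linfun H (\<lambda>b. F a b)) ==>
    linfun H (\<lambda>a. sw (comult H a) (\<lambda>x y. F x y))"
  by (rule lf_linear_map[OF comult_lin HH.lf_psum_rep]) (rule blI)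

end

context bialgebra
begin

text \<open>Pairing with functionals removes the reassociation of nested tensor products from coassociativity: both
  sides become iterated sums.\<close>

lemma right_comodule_iff:
  fixes V :: "('k, 'v, 'a, 'y) comodule_scheme"
  shows "right_comodule H V \<longleftrightarrow> vec_space V \<and> linear_map V (tensor V H) (coact V) \<and>
     (\<forall>v\<in>carrier V. \<forall>F. trilin V H H F \<longrightarrow>
        sw (coact V v) (\<lambda>x z. sw (coact V x) (\<lambda>u a. F u a z)) =
        sw (coact V v) (\<lambda>u y. sw (comult H y) (\<lambda>a b. F u a b))) \<and>
     (\<forall>v\<in>carrier V. \<forall>f. linfun V f \<longrightarrow> sw (coact V v) (\<lambda>u a. counit H a * f u) = f v)"
proof (cases "vec_space V \<and> linear_map V (tensor V H) (coact V)")
  case False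
  then show ?thesis by (auto simp: right_comodule_def)
next
  case True
  then have V: "vec_space V" and lin: "linear_map V (tensor V H) (coact V)" by auto
  interpret VH: two_spaces V H by (rule two_spaces.intro) (rule V, rule vs)
  have vHH: "vec_space (tensor H H)" by (rule HH.vec_space_tensor)
  have vVH: "vec_space (tensor V H)" by (rule VH.vec_space_tensor)
  interpret VHH: two_spaces V "tensor H H" by (rule two_spaces.intro) (rule V, rule vHH)
  interpret VHH': two_spaces "tensor V H" H by (rule two_spaces.intro) (rule vVH, rule vs)
  note cl = linear_map_closed[OF lin]
  have rp: "v \<in> carrier V ==> rep (coact V v) \<in> pol V H" for v by (rule VH.rep_pol[OF cl])
  let ?L = "\<lambda>v. tensor_map V (tensor H H) id (comult H) (coact V v)"
  let ?R = "\<lambda>v. tensor_map (tensor V H) H (coact V) id (coact V v)"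
  have Lc: "?L v \<in> carrier (tensor V (tensor H H))" if "v \<in> carrier V" for v
    unfolding tensor_map_def tensor_lift_def id_apply
    by (rule eval_tensor_closed[OF VHH.vec_space_tensor rp[OF that]]) (intro VHH.pure_closed comult_closed)
  have L: "sw (?L v) G = sw (coact V v) (\<lambda>u y. G u (comult H y))"
    if "v \<in> carrier V" "bilin V (tensor H H) G" for v G
    unfolding tensor_map_def tensor_lift_def id_apply
    by (subst lf_eval_tensor[OF VHH.vec_space_tensor rp[OF that(1)] VHH.lf_psum_rep[OF that(2)]])
      (auto intro!: psum_cong[OF rp] VHH.pure_closed VHH.psum_pure comult_closed simp: that)
  have Rc: "?R v \<in> carrier (tensor (tensor V H) H)" if "v \<in> carrier V" for v
    unfolding tensor_map_def tensor_lift_def id_apply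
    by (rule eval_tensor_closed[OF VHH'.vec_space_tensor rp[OF that]]) (intro VHH'.pure_closed cl)
  have R: "sw (?R v) G = sw (coact V v) (\<lambda>x z. G (coact V x) z)"
    if "v \<in> carrier V" "bilin (tensor V H) H G" for v G
    unfolding tensor_map_def tensor_lift_def id_apply
    by (subst lf_eval_tensor[OF VHH'.vec_space_tensor rp[OF that(1)] VHH'.lf_psum_rep[OF that(2)]])
      (auto intro!: psum_cong[OF rp] VHH'.pure_closed VHH'.psum_pure cl simp: that)
  let ?A = "\<lambda>t. tensor_assoc V H H t"
  have in1: "tensor_lift (tensor V (tensor H H)) (\<lambda>u v. pure V (tensor H H) u (pure H H v w)) y
      \<in> carrier (tensor V (tensor H H))"
    if "y \<in> carrier (tensor V H)" "w \<in> carrier H" for y w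
    unfolding tensor_lift_def
    by (rule eval_tensor_closed[OF VHH.vec_space_tensor VH.rep_pol[OF that(1)]])
       (intro VHH.pure_closed HH.pure_closed that)
  have Ac: "?A t \<in> carrier (tensor V (tensor H H))" if "t \<in> carrier (tensor (tensor V H) H)" for t
    unfolding tensor_assoc_def Let_def
    by (subst tensor_lift_def, rule eval_tensor_closed[OF VHH.vec_space_tensor VHH'.rep_pol[OF that]])
       (rule in1)
  have A: "sw (?A t) G = sw t (\<lambda>y w. sw y (\<lambda>u v. G u (pure H H v w)))"
    if "t \<in> carrier (tensor (tensor V H) H)" "bilin V (tensor H H) G" for t G
    unfolding tensor_assoc_def Let_def
    apply (subst tensor_lift_def, subst lf_eval_tensor[OF VHH.vec_space_tensor VHH'.rep_pol[OF that(1)] VHH.lf_psum_rep[OF that(2)]])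
     apply (rule in1, assumption+)
    apply (rule psum_cong[OF VHH'.rep_pol[OF that(1)]])
    apply (subst tensor_lift_def, subst lf_eval_tensor[OF VHH.vec_space_tensor VH.rep_pol VHH.lf_psum_rep[OF that(2)]])
      apply (auto intro!: VHH.pure_closed HH.pure_closed psum_cong[OF VH.rep_pol] VHH.psum_pure simp: that)
    done
  have coassoc: "?L v = ?A (?R v) \<longleftrightarrow> (\<forall>F. trilin V H H F \<longrightarrow>
        sw (coact V v) (\<lambda>x z. sw (coact V x) (\<lambda>u a. F u a z)) =
        sw (coact V v) (\<lambda>u y. sw (comult H y) (\<lambda>a b. F u a b)))"
    if v: "v \<in> carrier V" for v
  proof -
    have ARG: "sw (?A (?R v)) G = sw (coact V v) (\<lambda>x z. sw (coact V x) (\<lambda>u a. G u (pure H H a z)))"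
      if G: "bilin V (tensor H H) G" for G
    proof -
      have "bilin (tensor V H) H (\<lambda>y w. sw y (\<lambda>u v. G u (pure H H v w)))"
      proof (rule blI)
        fix w assume "w \<in> carrier H"
        then show "linfun (tensor V H) (\<lambda>y. sw y (\<lambda>u v. G u (pure H H v w)))"
          by (intro VH.lf_psum_rep blI) (auto intro: blD1[OF G] HH.pure_closed blD1[OF HH.bl_pure[OF blD2[OF G]]])
      next
        fix y assume "y \<in> carrier (tensor V H)"
        then show "linfun H (\<lambda>w. sw y (\<lambda>u v. G u (pure H H v w)))"
          by (intro lf_psum_inner[OF VH.rep_pol]) (auto intro: blD2[OF HH.bl_pure[OF blD2[OF G]]])
      qed
      then show ?thesis
        by (simp add: A[OF Rc[OF v] G] R[OF v])
    qed
    show ?thesis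
    proof (intro iffI allI impI)
      fix F assume eq: "?L v = ?A (?R v)" and F: "trilin V H H F"
      let ?G = "\<lambda>u s. sw s (\<lambda>a b. F u a b)"
      have bF: "bilin H H (\<lambda>a b. F u a b)" if "u \<in> carrier V" for u
        using that by (intro blI) (auto intro: tlD2[OF F] tlD3[OF F])
      have G: "bilin V (tensor H H) ?G"
        by (intro blI lf_psum_inner[OF HH.rep_pol] HH.lf_psum_rep) (auto intro: tlD1[OF F] tlD2[OF F] tlD3[OF F])
      have "sw (?L v) ?G = sw (?A (?R v)) ?G" by (simp only: eq)
      then have "sw (coact V v) (\<lambda>u y. sw (comult H y) (\<lambda>a b. F u a b)) =
         sw (coact V v) (\<lambda>x z. sw (coact V x) (\<lambda>u a. sw (pure H H a z) (\<lambda>a b. F u a b)))"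
        by (simp add: L[OF v G] ARG[OF G])
      also have "\<dots> = sw (coact V v) (\<lambda>x z. sw (coact V x) (\<lambda>u a. F u a z))"
        by (intro psum_cong[OF rp[OF v]] psum_cong[OF rp] HH.psum_pure bF)
      finally show "sw (coact V v) (\<lambda>x z. sw (coact V x) (\<lambda>u a. F u a z)) =
        sw (coact V v) (\<lambda>u y. sw (comult H y) (\<lambda>a b. F u a b))" by (rule sym)
    next
      assume *: "\<forall>F. trilin V H H F \<longrightarrow>
        sw (coact V v) (\<lambda>x z. sw (coact V x) (\<lambda>u a. F u a z)) =
        sw (coact V v) (\<lambda>u y. sw (comult H y) (\<lambda>a b. F u a b))"
      show "?L v = ?A (?R v)"
      proof (rule VHH.tensor_eqI[OF Lc[OF v] Ac[OF Rc[OF v]]])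
        fix G assume G: "bilin V (tensor H H) G"
        have tG: "trilin V H H (\<lambda>u a b. G u (pure H H a b))"
          by (intro tlI blD1[OF G] HH.pure_closed blD1[OF HH.bl_pure[OF blD2[OF G]]] blD2[OF HH.bl_pure[OF blD2[OF G]]])
        have "sw (?A (?R v)) G = sw (coact V v) (\<lambda>u y. sw (comult H y) (\<lambda>a b. G u (pure H H a b)))"
          by (simp add: ARG[OF G] *[rule_format, OF tG])
        also have "\<dots> = sw (coact V v) (\<lambda>u y. G u (comult H y))"
          by (intro psum_cong[OF rp[OF v]] HH.lf_tensor_eq[symmetric] blD2[OF G] comult_closed)
        finally show "sw (?L v) G = sw (?A (?R v)) G" by (simp add: L[OF v G])
      qed
    qed
  qed
  let ?E = "\<lambda>v. tensor_lift V (\<lambda>u a. counit H a \<odot>\<^bsub>V\<^esub> u) (coact V v)"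
  have counit: "?E v = v \<longleftrightarrow> (\<forall>f. linfun V f \<longrightarrow> sw (coact V v) (\<lambda>u a. counit H a * f u) = f v)"
    if v: "v \<in> carrier V" for v
  proof -
    have Ec: "?E v \<in> carrier V"
      unfolding tensor_lift_def by (rule eval_tensor_closed[OF V rp[OF v]]) (rule vs_smult[OF V])
    have E: "f (?E v) = sw (coact V v) (\<lambda>u a. counit H a * f u)" if f: "linfun V f" for f
      unfolding tensor_lift_def
      by (subst lf_eval_tensor[OF V rp[OF v] f])
        (auto simp: vs_smult[OF V] lf_smult[OF f] intro!: psum_cong[OF rp[OF v]])
    show ?thesis
      using vs_eqI[OF V Ec v] E by metis
  qed
  show ?thesis
    using V lin by (simp add: right_comodule_def coassoc counit)
qed

end

locale rcomodule = bialgebra H for H :: "('k::field, 'a) hopf" (structure) +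
  fixes V :: "('k, 'v, 'a, 'y) comodule_scheme"
  assumes comodule: "right_comodule H V"
begin

lemma V_vs: "vec_space V"
  and coact_lin: "linear_map V (tensor V H) (coact V)"
  and coact_coassoc: "\<lbrakk>v \<in> carrier V; trilin V H H F\<rbrakk> \<Longrightarrow>
        sw (coact V v) (\<lambda>x z. sw (coact V x) (\<lambda>u a. F u a z)) =
        sw (coact V v) (\<lambda>u y. sw (comult H y) (\<lambda>a b. F u a b))"
  and coact_counit: "\<lbrakk>v \<in> carrier V; linfun V f\<rbrakk> \<Longrightarrow> sw (coact V v) (\<lambda>u a. counit H a * f u) = f v"
  using comodule unfolding right_comodule_iff by auto

sublocale VH: two_spaces V H
  by (rule two_spaces.intro) (rule V_vs, rule vs)

lemma coact_closed: "v \<in> carrier V ==> coact V v \<in> carrier (tensor V H)"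
  by (rule linear_map_closed[OF coact_lin])

lemma coact_pol: "v \<in> carrier V ==> rep (coact V v) \<in> pol V H"
  by (rule VH.rep_pol[OF coact_closed])

lemma lf_coact: "(\<And>a. a \<in> carrier H ==> linfun V (\<lambda>u. F u a)) ==> (\<And>u. u \<in> carrier V ==> linfun H (\<lambda>a. F u a)) ==>
    linfun V (\<lambda>v. sw (coact V v) (\<lambda>u a. F u a))"
  by (rule lf_linear_map[OF coact_lin VH.lf_psum_rep]) (rule blI)

end

context bialgebra
begin

lemma rcomoduleI: "right_comodule H V ==> rcomodule H V"
  by (intro rcomodule.intro rcomodule_axioms.intro bialgebra_axioms)

lemmas com_vs = rcomodule.V_vs[OF rcomoduleI]
lemmas com_coassoc = rcomodule.coact_coassoc[OF rcomoduleI]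
lemmas com_counit = rcomodule.coact_counit[OF rcomoduleI]
lemmas com_pol = rcomodule.coact_pol[OF rcomoduleI]
lemmas lf_com = rcomodule.lf_coact[OF rcomoduleI]

lemma comodule_map_iff:
  fixes V :: "('k, 'v, 'a, 'y) comodule_scheme" and W :: "('k, 'w, 'a, 'z) comodule_scheme"
  assumes V: "right_comodule H V" and W: "right_comodule H W"
  shows "comodule_map H V W f \<longleftrightarrow> linear_map V W f \<and> (\<forall>v\<in>carrier V. \<forall>F. bilin W H F \<longrightarrow>
     sw (coact W (f v)) F = sw (coact V v) (\<lambda>u a. F (f u) a))"
proof (cases "linear_map V W f")
  case False
  then show ?thesis by (simp add: comodule_map_def)
next
  case True
  note cl = linear_map_closed[OF True]
  interpret W: rcomodule H W by (rule rcomoduleI[OF W])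
  have tm: "tensor_map W H f id (coact V v) \<in> carrier (tensor W H)"
     "bilin W H F ==> sw (tensor_map W H f id (coact V v)) F = sw (coact V v) (\<lambda>u a. F (f u) a)"
    if v: "v \<in> carrier V" for v F
    unfolding tensor_map_def tensor_lift_def
     apply (rule eval_tensor_closed[OF W.VH.vec_space_tensor com_pol[OF V v]])
     apply (simp add: W.VH.pure_closed cl)
    apply (subst lf_eval_tensor[OF W.VH.vec_space_tensor com_pol[OF V v] W.VH.lf_psum_rep])
      apply (auto intro!: psum_cong[OF com_pol[OF V v]] W.VH.psum_pure W.VH.pure_closed cl)
    done
  have "coact W (f v) = tensor_map W H f id (coact V v) \<longleftrightarrow> (\<forall>F. bilin W H F \<longrightarrow>
     sw (coact W (f v)) F = sw (coact V v) (\<lambda>u a. F (f u) a))" if v: "v \<in> carrier V" for v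
    using W.VH.tensor_eqI[OF W.coact_closed[OF cl[OF v]] tm(1)[OF v]] tm(2)[OF v] by metis
  then show ?thesis using True by (simp add: comodule_map_def)
qed

end

section \<open>The monoidal category of comodules\<close>

lemma tensor_class_same:
  assumes "carrier V' = carrier V" "add V' = add V" "smult V' = smult V"
  shows "tensor_class V' W = tensor_class V W"
  by (rule ext) (simp add: tensor_class_def tensor_relators_def assms)

lemma tensor_same:
  assumes "carrier V' = carrier V" "add V' = add V" "smult V' = smult V"
  shows "tensor V' W = tensor V W" "pure V' W = pure V W"
  by (simp_all add: tensor_def pure_def tensor_class_same[OF assms] assms fun_eq_iff)

lemma lf_same:
  assumes "carrier V' = carrier V" "add V' = add V" "smult V' = smult V"
  shows "linfun V' f \<longleftrightarrow> linfun V f"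
  by (simp add: linfun_def assms)

locale comod_cat = bialgebra H for H :: "('k::field, 'a) hopf" (structure) +
  fixes sc :: "'k => 'u" and tc :: "(('u \<times> 'u) \<Rightarrow>\<^sub>0 'k) => 'u"
  assumes sc: "inj sc" and tc: "inj tc"
begin

abbreviation rc :: "('k, 'u, 'a) comodule => bool" where "rc V \<equiv> right_comodule H V"
abbreviation "ten \<equiv> tensor_comodule tc H"
abbreviation tp :: "('k, 'u, 'a) comodule => ('k, 'u, 'a) comodule => 'u => 'u => 'u" where "tp \<equiv> coded_pure tc"
abbreviation "de \<equiv> inv_into UNIV tc"
abbreviation I :: "('k, 'u, 'a) comodule" where "I \<equiv> unit_comodule sc H"

lemma ten_sel:
  "carrier (ten V W) = carrier (coded tc V W)" "add (ten V W) = add (coded tc V W)"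
  "smult (ten V W) = smult (coded tc V W)" "zero (ten V W) = zero (coded tc V W)"
  by (simp_all add: tensor_comodule_def Let_def module.defs coded_tensor_eq_coded)

lemma coding: "rc V ==> rc W ==> coding V W tc"
  by (intro coding.intro two_spaces.intro coding_axioms.intro com_vs codes_inj[OF tc])

lemma lf_ten: "linfun (ten V W) f \<longleftrightarrow> linfun (coded tc V W) f"
  by (rule lf_same) (rule ten_sel)+

context
  fixes V W assumes rV: "rc V" and rW: "rc W"
begin

interpretation coding V W tc by (rule coding[OF rV rW])

lemma vs_ten: "vec_space (ten V W)"
  by (rule vec_space_same[OF vec_space_coded]) (rule ten_sel)+

lemma ten_dec_pol: "x \<in> carrier (ten V W) ==> de x \<in> pol V W"
  by (simp add: ten_sel dec_pol)

lemma tp_closed: "v \<in> carrier V ==> w \<in> carrier W ==> tp V W v w \<in> carrier (ten V W)"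
  by (simp add: ten_sel cp_closed coded_pure_eq_cpure)

lemma ten_psum_tp: "v \<in> carrier V ==> w \<in> carrier W ==> bilin V W F ==> psum (de (tp V W v w)) F = F v w"
  by (simp add: psum_cp coded_pure_eq_cpure)

lemma lf_de: "bilin V W F ==> linfun (ten V W) (\<lambda>x. psum (de x) F)"
  by (simp add: lf_ten lf_psum_dec)

lemma lf_tp1: "linfun (ten V W) (\<lambda>x. E x) ==> w \<in> carrier W ==> linfun V (\<lambda>v. E (tp V W v w))"
  by (simp add: lf_ten coded_pure_eq_cpure blD1[OF bl_cp])

lemma lf_tp2: "linfun (ten V W) (\<lambda>x. E x) ==> v \<in> carrier V ==> linfun W (\<lambda>w. E (tp V W v w))"
  by (simp add: lf_ten coded_pure_eq_cpure blD2[OF bl_cp])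

lemma bmap_tp: "bmap V W (ten V W) (tp V W)"
  by (intro bmapI tp_closed lf_tp1 lf_tp2)

lemma lf_ten_eq: "linfun (ten V W) f ==> x \<in> carrier (ten V W) ==> f x = psum (de x) (\<lambda>v w. f (tp V W v w))"
  by (simp add: lf_ten coded_pure_eq_cpure ten_sel lf_coded_eq)

lemma lf_ten_eqI:
  assumes "linfun (ten V W) f" "linfun (ten V W) g"
    "\<And>v w. v \<in> carrier V ==> w \<in> carrier W ==> f (tp V W v w) = g (tp V W v w)"
    and x: "x \<in> carrier (ten V W)"
  shows "f x = g x"
  by (simp add: lf_ten_eq[OF assms(1) x] lf_ten_eq[OF assms(2) x] psum_cong[OF ten_dec_pol[OF x] assms(3)])

text \<open>Pure tensors span, so that maps out of a coded tensor product can be compared on them.\<close>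

lemma ten_lin_eqI:
  assumes "linear_map (ten V W) U L" "linear_map (ten V W) U L'" "vec_space U"
    "\<And>v w. v \<in> carrier V ==> w \<in> carrier W ==> L (tp V W v w) = L' (tp V W v w)"
    and x: "x \<in> carrier (ten V W)"
  shows "L x = L' x"
proof (rule vs_eqI[OF assms(3)])
  fix f assume f: "linfun U f"
  show "f (L x) = f (L' x)"
    by (rule lf_ten_eqI[OF lf_linear_map[OF assms(1) f] lf_linear_map[OF assms(2) f]]) (simp_all add: assms)
qed (simp_all add: linear_map_closed[OF assms(1)] linear_map_closed[OF assms(2)] x)

context
  fixes U :: "('k, 'c, 'z) module_scheme" and G
  assumes U: "vec_space U" and G: "bmap V W U G"
begin

lemma ten_lift_closed: "x \<in> carrier (ten V W) ==> coded_lift tc U G x \<in> carrier U"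
  unfolding coded_lift_def by (rule eval_tensor_closed[OF U ten_dec_pol]) (auto intro: bmap_closed[OF G])

lemma lf_ten_lift: "x \<in> carrier (ten V W) ==> linfun U f ==> f (coded_lift tc U G x) = psum (de x) (\<lambda>v w. f (G v w))"
  unfolding coded_lift_def by (rule lf_eval_tensor[OF U ten_dec_pol]) (auto intro: bmap_closed[OF G])

lemma ten_lift_lin: "linear_map (ten V W) U (coded_lift tc U G)"
proof (rule linear_mapI_lf[OF vs_ten U ten_lift_closed])
  fix f assume f: "linfun U f"
  show "linfun (ten V W) (\<lambda>x. f (coded_lift tc U G x))"
    by (subst lf_cong[OF lf_ten_lift[OF _ f] vs_ten]) (auto intro!: lf_de bmap_bl[OF G] f)
qed

lemma ten_lift_tp: "v \<in> carrier V ==> w \<in> carrier W ==> coded_lift tc U G (tp V W v w) = G v w"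
  by (rule vs_eqI[OF U])
    (auto intro: ten_lift_closed tp_closed bmap_closed[OF G] simp: lf_ten_lift tp_closed ten_psum_tp bmap_bl[OF G])

end

abbreviation "coten \<equiv> (\<lambda>v w.
           tensor_lift (tensor (ten V W) H) (\<lambda>v0 v1.
             tensor_lift (tensor (ten V W) H) (\<lambda>w0 w1.
               pure (ten V W) H (tp V W v0 w0) (v1 \<otimes> w1))
             (coact W w))
           (coact V v))"

lemma coact_ten_def: "coact (ten V W) = coded_lift tc (tensor (ten V W) H) coten"
  by (simp add: tensor_comodule_def Let_def module.defs comodule.defs coded_tensor_eq_coded
      tensor_same[of "ten V W" "coded tc V W", unfolded tensor_comodule_def Let_def module.defs comodule.defs coded_tensor_eq_coded])

interpretation tenH: two_spaces "ten V W" H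
  by (rule two_spaces.intro) (rule vs_ten, rule vs)

lemma coten_closed: "v \<in> carrier V ==> w \<in> carrier W ==> coten v w \<in> carrier (tensor (ten V W) H)"
  unfolding tensor_lift_def
  by (assumption | rule eval_tensor_closed[OF tenH.vec_space_tensor com_pol[OF rV]]
      eval_tensor_closed[OF tenH.vec_space_tensor com_pol[OF rW]] tenH.pure_closed tp_closed mult_closed)+

lemma lf_coten: "v \<in> carrier V ==> w \<in> carrier W ==> linfun (tensor (ten V W) H) f ==>
   f (coten v w) = sw (coact V v) (\<lambda>v0 v1. sw (coact W w) (\<lambda>w0 w1.
      f (pure (ten V W) H (tp V W v0 w0) (v1 \<otimes> w1))))"
  unfolding tensor_lift_def
  apply (subst lf_eval_tensor[OF tenH.vec_space_tensor com_pol[OF rV]], assumption, assumption)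
   apply (rule eval_tensor_closed[OF tenH.vec_space_tensor com_pol[OF rW]], assumption)
   apply (intro tenH.pure_closed tp_closed mult_closed; assumption)
  apply (intro psum_cong[OF com_pol[OF rV]], assumption)
  apply (subst lf_eval_tensor[OF tenH.vec_space_tensor com_pol[OF rW]], assumption, assumption)
   apply (intro tenH.pure_closed tp_closed mult_closed; assumption)
  apply (rule refl)
  done

lemma lf_pure1: "linfun (tensor (ten V W) H) (\<lambda>x. E x) ==> a \<in> carrier H ==> linfun (ten V W) (\<lambda>v. E (pure (ten V W) H v a))"
  by (rule blD1[OF tenH.bl_pure])

lemma lf_pure2: "linfun (tensor (ten V W) H) (\<lambda>x. E x) ==> v \<in> carrier (ten V W) ==> linfun H (\<lambda>a. E (pure (ten V W) H v a))"
  by (rule blD2[OF tenH.bl_pure])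

lemma bmap_coten: "bmap V W (tensor (ten V W) H) coten"
proof (rule bmapI[OF coten_closed])
  note V0 = com_vs[OF rV] and W0 = com_vs[OF rW]
  fix f assume f: "linfun (tensor (ten V W) H) f"
  show "linfun V (\<lambda>v. f (coten v w))" if "w \<in> carrier W" for w
    apply (subst lf_cong[OF lf_coten[OF _ that f] V0], assumption)
    apply (assumption | rule f that lf_com[OF rV] lf_psum_inner[OF com_pol[OF rW]] lf_tp1 lf_pure1 lf_pure2 tp_closed
        lf_mult1 mult_closed)+
    done
  show "linfun W (\<lambda>w. f (coten v w))" if "v \<in> carrier V" for v
    apply (subst lf_cong[OF lf_coten[OF that _ f] W0], assumption)
    apply (assumption | rule f that lf_com[OF rW] lf_psum_inner[OF com_pol[OF rV]] lf_tp2 lf_pure1 lf_pure2 tp_closed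
        lf_mult2 mult_closed)+
    done
qed

lemma coact_ten_lin: "linear_map (ten V W) (tensor (ten V W) H) (coact (ten V W))"
  unfolding coact_ten_def by (rule ten_lift_lin[OF tenH.vec_space_tensor bmap_coten])

lemma lf_coact_ten: "(\<And>a. a \<in> carrier H ==> linfun (ten V W) (\<lambda>u. F u a)) ==>
    (\<And>u. u \<in> carrier (ten V W) ==> linfun H (\<lambda>a. F u a)) ==>
    linfun (ten V W) (\<lambda>v. sw (coact (ten V W) v) (\<lambda>u a. F u a))"
  by (rule lf_linear_map[OF coact_ten_lin tenH.lf_psum_rep]) (rule blI)

lemma ten_coact_tp:
  assumes v: "v \<in> carrier V" and w: "w \<in> carrier W"
    and G1: "\<And>a. a \<in> carrier H ==> linfun (ten V W) (\<lambda>m. G m a)" and G2: "\<And>m. m \<in> carrier (ten V W) ==> linfun H (\<lambda>a. G m a)"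
  shows "sw (coact (ten V W) (tp V W v w)) (\<lambda>m a. G m a) =
    sw (coact V v) (\<lambda>v0 v1. sw (coact W w) (\<lambda>w0 w1. G (tp V W v0 w0) (v1 \<otimes> w1)))"
proof -
  have G: "bilin (ten V W) H G" by (rule blI[OF G1 G2])
  show ?thesis
    unfolding coact_ten_def ten_lift_tp[OF tenH.vec_space_tensor bmap_coten v w]
      lf_coten[OF v w tenH.lf_psum_rep[OF G]]
    by (intro psum_cong[OF com_pol[OF rV v]] psum_cong[OF com_pol[OF rW w]] tenH.psum_pure tp_closed mult_closed G)
qed

lemma coact_ten_pol: "x \<in> carrier (ten V W) ==> rep (coact (ten V W) x) \<in> pol (ten V W) H"
  by (rule tenH.rep_pol[OF linear_map_closed[OF coact_ten_lin]])

lemma rc_ten: "rc (ten V W)"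
  unfolding right_comodule_iff
proof (intro conjI ballI allI impI vs_ten coact_ten_lin)
  fix x F assume x: "x \<in> carrier (ten V W)" and F: "trilin (ten V W) H H F"
  note F1 = tlD1[OF F] and F2 = tlD2[OF F] and F3 = tlD3[OF F]
  let ?L = "\<lambda>x. sw (coact (ten V W) x) (\<lambda>x z. sw (coact (ten V W) x) (\<lambda>u a. F u a z))"
  let ?R = "\<lambda>x. sw (coact (ten V W) x) (\<lambda>u y. sw (comult H y) (\<lambda>a b. F u a b))"
  have lfL: "linfun (ten V W) ?L"
    by (assumption | rule lf_coact_ten lf_psum_inner[OF coact_ten_pol] F1 F2 F3)+
  have lfR: "linfun (ten V W) ?R"
    by (assumption | rule lf_coact_ten lf_psum_inner[OF comult_pol] lf_comult F1 F2 F3)+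
  show "?L x = ?R x"
  proof (rule lf_ten_eqI[OF lfL lfR _ x])
    fix v w assume v: "v \<in> carrier V" and w: "w \<in> carrier W"
    note pV = com_pol[OF rV] and pW = com_pol[OF rW]
    note rules = lf_coact_ten lf_psum_inner[OF coact_ten_pol] lf_psum_inner[OF com_pol[OF rV]] lf_psum_inner[OF com_pol[OF rW]]
      lf_psum_inner[OF comult_pol] lf_comult lf_com[OF rV] lf_com[OF rW] lf_tp1 lf_tp2 lf_mult1 lf_mult2 mult_closed tp_closed
    have "?L (tp V W v w) = sw (coact V v) (\<lambda>v0 v1. sw (coact W w) (\<lambda>w0 w1.
        sw (coact (ten V W) (tp V W v0 w0)) (\<lambda>u a. F u a (v1 \<otimes> w1))))"
      by (rule ten_coact_tp[OF v w]) (assumption | rule F1 F2 F3 rules)+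
    also have "\<dots> = sw (coact V v) (\<lambda>v0 v1. sw (coact W w) (\<lambda>w0 w1.
        sw (coact V v0) (\<lambda>v00 v01. sw (coact W w0) (\<lambda>w00 w01. F (tp V W v00 w00) (v01 \<otimes> w01) (v1 \<otimes> w1)))))"
      by (intro psum_cong[OF pV[OF v]] psum_cong[OF pW[OF w]] ten_coact_tp) (assumption | rule F1 F2 F3 rules)+
    also have "\<dots> = sw (coact V v) (\<lambda>v0 v1. sw (coact V v0) (\<lambda>v00 v01. sw (coact W w) (\<lambda>w0 w1.
         sw (coact W w0) (\<lambda>w00 w01. F (tp V W v00 w00) (v01 \<otimes> w01) (v1 \<otimes> w1)))))"
      by (intro psum_cong[OF pV[OF v]] psum_swap)
    also have "\<dots> = sw (coact V v) (\<lambda>v0 y. sw (comult H y) (\<lambda>a b. sw (coact W w) (\<lambda>w0 w1.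
         sw (coact W w0) (\<lambda>w00 w01. F (tp V W v0 w00) (a \<otimes> w01) (b \<otimes> w1)))))"
      by (rule com_coassoc[OF rV v], rule tlI) (assumption | rule w F1 F2 F3 rules)+
    also have "\<dots> = sw (coact V v) (\<lambda>v0 y. sw (comult H y) (\<lambda>a b. sw (coact W w) (\<lambda>w0 y'.
         sw (comult H y') (\<lambda>a' b'. F (tp V W v0 w0) (a \<otimes> a') (b \<otimes> b')))))"
      by (intro psum_cong[OF pV[OF v]] psum_cong[OF comult_pol] com_coassoc[OF rW w] tlI) (assumption | rule F1 F2 F3 rules)+
    also have "\<dots> = sw (coact V v) (\<lambda>v0 y. sw (coact W w) (\<lambda>w0 y'. sw (comult H y) (\<lambda>a b.
         sw (comult H y') (\<lambda>a' b'. F (tp V W v0 w0) (a \<otimes> a') (b \<otimes> b')))))"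
      by (intro psum_cong[OF pV[OF v]] psum_swap)
    also have "\<dots> = sw (coact V v) (\<lambda>v0 y. sw (coact W w) (\<lambda>w0 y'. sw (comult H (y \<otimes> y')) (\<lambda>a b.
         F (tp V W v0 w0) a b)))"
      by (intro psum_cong[OF pV[OF v]] psum_cong[OF pW[OF w]] comult_mult[symmetric] blI) (assumption | rule F1 F2 F3 rules)+
    also have "\<dots> = ?R (tp V W v w)"
      by (rule ten_coact_tp[OF v w, symmetric]) (assumption | rule F1 F2 F3 rules)+
    finally show "?L (tp V W v w) = ?R (tp V W v w)" .
  qed
next
  fix x f assume x: "x \<in> carrier (ten V W)" and f: "linfun (ten V W) f"
  note rules = lf_mult_const counit_lf f lf_tp1 lf_tp2
  show "sw (coact (ten V W) x) (\<lambda>u a. counit H a * f u) = f x"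
  proof (rule lf_ten_eqI[OF _ f _ x])
    show "linfun (ten V W) (\<lambda>x. sw (coact (ten V W) x) (\<lambda>u a. counit H a * f u))"
      by (assumption | rule lf_coact_ten rules)+
    fix v w assume v: "v \<in> carrier V" and w: "w \<in> carrier W"
    have "sw (coact (ten V W) (tp V W v w)) (\<lambda>u a. counit H a * f u) =
       sw (coact V v) (\<lambda>v0 v1. sw (coact W w) (\<lambda>w0 w1. counit H (v1 \<otimes> w1) * f (tp V W v0 w0)))"
      by (rule ten_coact_tp[OF v w]) (assumption | rule rules)+
    also have "\<dots> = sw (coact V v) (\<lambda>v0 v1. counit H v1 * sw (coact W w) (\<lambda>w0 w1. counit H w1 * f (tp V W v0 w0)))"
      unfolding psum_mult_left[symmetric]
      by (intro psum_cong[OF com_pol[OF rV v]] psum_cong[OF com_pol[OF rW w]]) (simp add: counit_mult)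
    also have "\<dots> = sw (coact V v) (\<lambda>v0 v1. counit H v1 * f (tp V W v0 w))"
      by (intro psum_cong[OF com_pol[OF rV v]] arg_cong2[where f = "(*)"] refl com_counit[OF rW w] lf_tp2 f)
    also have "\<dots> = f (tp V W v w)"
      by (intro com_counit[OF rV v] lf_tp1 f w)
    finally show "sw (coact (ten V W) (tp V W v w)) (\<lambda>u a. counit H a * f u) = f (tp V W v w)" .
  qed
qed

text \<open>Colinearity is an identity between linear maps, so it suffices to test it on pure tensors, where the coaction
  of a tensor product is given by its defining formula.\<close>

lemma comodule_map_tenI:
  fixes U :: "('k, 'u, 'a) comodule"
  assumes U: "rc U" and L: "linear_map (ten V W) U L"
    and eq: "\<And>v w F. v \<in> carrier V ==> w \<in> carrier W ==> bilin U H F ==>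
      sw (coact U (L (tp V W v w))) (\<lambda>u a. F u a) = sw (coact V v) (\<lambda>v0 v1. sw (coact W w)
        (\<lambda>w0 w1. F (L (tp V W v0 w0)) (v1 \<otimes> w1)))"
  shows "comodule_map H (ten V W) U L"
  unfolding comodule_map_iff[OF rc_ten U]
proof (intro conjI L ballI allI impI)
  fix x F assume x: "x \<in> carrier (ten V W)" and F: "bilin U H F"
  note lfL = lf_linear_map[OF L]
  show "sw (coact U (L x)) F = sw (coact (ten V W) x) (\<lambda>u a. F (L u) a)"
  proof (rule lf_ten_eqI[OF _ _ _ x])
    show "linfun (ten V W) (\<lambda>x. sw (coact U (L x)) F)"
      by (rule lfL[OF lf_com[OF U]]) (use F in \<open>auto simp: bilin_def\<close>)
    show "linfun (ten V W) (\<lambda>x. sw (coact (ten V W) x) (\<lambda>u a. F (L u) a))"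
      by (rule lf_coact_ten) (use F in \<open>auto intro: lfL blD1 blD2 linear_map_closed[OF L]\<close>)
    fix v w assume v: "v \<in> carrier V" and w: "w \<in> carrier W"
    show "sw (coact U (L (tp V W v w))) F = sw (coact (ten V W) (tp V W v w)) (\<lambda>u a. F (L u) a)"
      by (subst ten_coact_tp[OF v w]) (use F in \<open>auto intro: lfL blD1 blD2 linear_map_closed[OF L] eq[OF v w]\<close>)
  qed
qed

end

lemma I_sel: "carrier I = range sc" "zero I = sc 0" "add I = (\<lambda>x y. sc (inv_into UNIV sc x + inv_into UNIV sc y))"
  "smult I = (\<lambda>c x. sc (c * inv_into UNIV sc x))"
  by (simp_all add: unit_comodule_def Let_def module.defs)

lemma inv_sc: "inv_into UNIV sc (sc c) = c"
  by (simp add: sc)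

lemma sc_closed: "sc c \<in> carrier I"
  by (simp add: I_sel)

lemma lf_inv_sc: "linfun I (inv_into UNIV sc)"
  by (auto simp: linfun_def I_sel sc)

lemma vs_I: "vec_space I"
  by (rule vec_spaceI_sep[where \<Phi> = "{inv_into UNIV sc}"]) (auto simp: I_sel sc linfun_def)

lemma lf_I: "linfun I f ==> x \<in> carrier I ==> f x = inv_into UNIV sc x * f (sc 1)"
  using lf_smult[of I f "sc 1" "inv_into UNIV sc x"] by (auto simp: I_sel sc)

interpretation IH: two_spaces I H
  by (rule two_spaces.intro) (rule vs_I, rule vs)

lemma coact_I: "coact I x = pure I H x \<one>"
proof -
  define M :: "('k, 'u) module" where "M = \<lparr>carrier = range sc,
               mult = undefined, one = undefined,
               zero = sc 0,
               add = (\<lambda>x y. sc (inv_into UNIV sc x + inv_into UNIV sc y)),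
               smult = (\<lambda>c x. sc (c * inv_into UNIV sc x))\<rparr>"
  have "coact I x = pure M H x \<one>"
    by (simp add: unit_comodule_def Let_def module.defs comodule.defs M_def)
  also have "pure I H = pure M H"
    by (rule tensor_same) (simp_all add: I_sel M_def)
  then have "pure M H x \<one> = pure I H x \<one>" by simp
  finally show ?thesis .
qed

lemma psum_coact_I:
  assumes x: "x \<in> carrier I" and G: "\<And>a. a \<in> carrier H ==> linfun I (\<lambda>m. G m a)" "\<And>m. m \<in> carrier I ==> linfun H (\<lambda>a. G m a)"
  shows "sw (coact I x) (\<lambda>m a. G m a) = G x \<one>"
  unfolding coact_I by (rule IH.psum_pure[OF x one_closed]) (rule blI[OF G])

lemma rc_I: "rc I"
  unfolding right_comodule_iff
proof (intro conjI ballI allI impI vs_I)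
  show lin: "linear_map I (tensor I H) (coact I)"
    unfolding coact_I
    by (rule linear_mapI_lf[OF vs_I IH.vec_space_tensor]) (auto intro: IH.pure_closed one_closed blD1[OF IH.bl_pure])
  fix x assume x: "x \<in> carrier I"
  { fix F assume F: "trilin I H H F"
    have "sw (coact I x) (\<lambda>x z. sw (coact I x) (\<lambda>u a. F u a z)) =
      sw (coact I x) (\<lambda>x z. F x \<one> z)"
      by (intro psum_cong[OF IH.rep_pol[OF linear_map_closed[OF lin x]]] psum_coact_I tlD1[OF F] tlD2[OF F])
    also have "\<dots> = F x \<one> \<one>"
      by (intro psum_coact_I x tlD1[OF F] tlD3[OF F] one_closed)
    also have "\<dots> = sw (coact I x) (\<lambda>u y. sw (comult H y) (\<lambda>a b. F u a b))"
      apply (subst psum_coact_I[OF x])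
        apply (rule lf_psum_inner[OF comult_pol], assumption, rule tlD1[OF F], assumption, assumption)
       apply (rule lf_comult, rule tlD2[OF F], assumption, assumption, rule tlD3[OF F], assumption, assumption)
      apply (rule comult_one[symmetric], rule blI, rule tlD2[OF F x], assumption, rule tlD3[OF F x], assumption)
      done
    finally show "sw (coact I x) (\<lambda>x z. sw (coact I x) (\<lambda>u a. F u a z)) =
      sw (coact I x) (\<lambda>u y. sw (comult H y) (\<lambda>a b. F u a b))" . }
  { fix f assume f: "linfun I f"
    show "sw (coact I x) (\<lambda>u a. counit H a * f u) = f x"
      by (subst psum_coact_I[OF x]) (auto intro: lf_mult_const f counit_lf simp: counit_one) }
qed

end

context comod_cat
begin

abbreviation "CC \<equiv> Comod sc tc H"

text \<open>An arrow is determined by the values of its function on the source (\<open>ar_eqI\<close>), so that arrows can be written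
  with any formula for the function and compared pointwise.\<close>

definition arrow :: "('k, 'u, 'a) comodule => ('u => 'u) => ('k, 'u, 'a) comodule => ('k, 'u, 'a) comodule_arrow" where
  "arrow V f W = (V, restrict f (carrier V), W)"

definition colin :: "('k, 'u, 'a) comodule => ('u => 'u) => ('k, 'u, 'a) comodule => bool" where
  "colin V f W \<longleftrightarrow> rc V \<and> rc W \<and> comodule_map H V W f"

definition tmap :: "('k, 'u, 'a) comodule => ('k, 'u, 'a) comodule => ('u => 'u) => ('u => 'u) => 'u => 'u" where
  "tmap V' W' f g = coded_lift tc (ten V' W') (\<lambda>v w. tp V' W' (f v) (g w))"

definition asc :: "('k, 'u, 'a) comodule => ('k, 'u, 'a) comodule => ('k, 'u, 'a) comodule => 'u => 'u" where
  "asc U V W = coded_lift tc (ten U (ten V W)) (\<lambda>y w.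
     coded_lift tc (ten U (ten V W)) (\<lambda>u v. tp U (ten V W) u (tp V W v w)) y)"

definition asc' :: "('k, 'u, 'a) comodule => ('k, 'u, 'a) comodule => ('k, 'u, 'a) comodule => 'u => 'u" where
  "asc' U V W = coded_lift tc (ten (ten U V) W) (\<lambda>u z.
     coded_lift tc (ten (ten U V) W) (\<lambda>v w. tp (ten U V) W (tp U V u v) w) z)"

definition lun :: "('k, 'u, 'a) comodule => 'u => 'u" where
  "lun V = coded_lift tc V (\<lambda>x v. inv_into UNIV sc x \<odot>\<^bsub>V\<^esub> v)"

definition run :: "('k, 'u, 'a) comodule => 'u => 'u" where
  "run V = coded_lift tc V (\<lambda>v x. inv_into UNIV sc x \<odot>\<^bsub>V\<^esub> v)"

lemma ar_eqI: "(\<And>x. x \<in> carrier V ==> f x = g x) ==> arrow V f W = arrow V g W"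
  by (simp add: arrow_def restrict_def fun_eq_iff)

lemma comodule_map_cong:
  assumes "rc V" "rc W" "\<And>x. x \<in> carrier V ==> f x = g x"
  shows "comodule_map H V W f \<longleftrightarrow> comodule_map H V W g"
proof -
  have "sw (coact V v) (\<lambda>u a. F (f u) a) = sw (coact V v) (\<lambda>u a. F (g u) a)"
    if "v \<in> carrier V" for v and F :: "'u => 'a => 'k"
    using that assms(3) by (intro psum_cong[OF com_pol[OF assms(1)]]) simp_all
  moreover have "linear_map V W f \<longleftrightarrow> linear_map V W g"
    by (rule linear_map_cong[OF com_vs[OF assms(1)] assms(3)])
  ultimately show ?thesis
    unfolding comodule_map_iff[OF assms(1,2)] using assms(3) by auto
qed

lemma cm_cong: "(\<And>x. x \<in> carrier V ==> f x = g x) ==> colin V f W \<longleftrightarrow> colin V g W"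
  unfolding colin_def using comodule_map_cong by blast

lemma cm_rc: "colin V f W ==> rc V" "colin V f W ==> rc W"
  by (simp_all add: colin_def)

lemma cm_lin: "colin V f W ==> linear_map V W f"
  unfolding colin_def comodule_map_def by blast

lemma cm_smult: "colin V f W ==> v \<in> carrier V ==> f (c \<odot>\<^bsub>V\<^esub> v) = c \<odot>\<^bsub>W\<^esub> f v"
  using cm_lin by (auto simp: linear_map_def)

lemma cm_closed: "colin V f W ==> x \<in> carrier V ==> f x \<in> carrier W"
  by (rule linear_map_closed[OF cm_lin])

lemma cm_coact: "colin V f W ==> v \<in> carrier V ==> (\<And>a. a \<in> carrier H ==> linfun W (\<lambda>w. F w a)) ==>
   (\<And>w. w \<in> carrier W ==> linfun H (\<lambda>a. F w a)) ==>
   sw (coact W (f v)) (\<lambda>w a. F w a) = sw (coact V v) (\<lambda>u a. F (f u) a)"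
  by (auto simp: colin_def comodule_map_iff bilin_def)

lemma cmI:
  assumes "rc V" "rc W" "linear_map V W f" "\<And>v F. v \<in> carrier V ==> bilin W H F ==>
     sw (coact W (f v)) (\<lambda>w a. F w a) = sw (coact V v) (\<lambda>u a. F (f u) a)"
  shows "colin V f W"
  using assms by (simp add: colin_def comodule_map_iff)

lemma cm_id: "rc V ==> colin V (\<lambda>x. x) V"
  by (simp add: cmI linear_map_id)

lemma cm_comp: "colin V f W ==> colin W g U ==> colin V (\<lambda>x. g (f x)) U"
proof (rule cmI)
  assume f: "colin V f W" and g: "colin W g U"
  show "rc V" "rc U" "linear_map V U (\<lambda>x. g (f x))"
    using f g by (auto intro: cm_rc linear_map_comp[OF cm_lin cm_lin])
  fix v F assume v: "v \<in> carrier V" and F: "bilin U H F"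
  have "sw (coact U (g (f v))) (\<lambda>w a. F w a) = sw (coact W (f v)) (\<lambda>u a. F (g u) a)"
    by (rule cm_coact[OF g cm_closed[OF f v]]) (auto intro: blD1[OF F] blD2[OF F])
  also have "\<dots> = sw (coact V v) (\<lambda>u a. F (g (f u)) a)"
    by (rule cm_coact[OF f v]) (auto intro: lf_linear_map[OF cm_lin[OF g]] blD1[OF F] blD2[OF F] cm_closed[OF g])
  finally show "sw (coact U (g (f v))) (\<lambda>w a. F w a) = sw (coact V v) (\<lambda>u a. F (g (f u)) a)" .
qed

lemma Obj_CC: "Obj CC = {V. rc V}"
  by (simp add: Comod_def Let_def)

lemma Hom_CC: "Hom CC V W = {arrow V f W | f. colin V f W}"
proof -
  have "(\<exists>f. A = arrow V f W \<and> colin V f W) \<longleftrightarrow> A \<in> Arr CC \<and> Dom CC A = V \<and> Cod CC A = W" for A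
  proof
    assume "\<exists>f. A = arrow V f W \<and> colin V f W"
    then obtain f where f: "A = arrow V f W" "colin V f W" by blast
    then have "colin V (restrict f (carrier V)) W" using cm_cong[of V f "restrict f (carrier V)" W] by simp
    then show "A \<in> Arr CC \<and> Dom CC A = V \<and> Cod CC A = W"
      using f(1) by (simp add: Comod_def Let_def arrow_def colin_def)
  next
    assume "A \<in> Arr CC \<and> Dom CC A = V \<and> Cod CC A = W"
    then obtain f where f: "A = (V, f, W)" "colin V f W" "f \<in> extensional (carrier V)"
      by (auto simp: Comod_def Let_def colin_def)
    then have "A = arrow V f W" by (simp add: arrow_def extensional_restrict)
    then show "\<exists>f. A = arrow V f W \<and> colin V f W" using f by blast
  qed
  then show ?thesis unfolding Hom_def by blast
qed

lemma HomI: "colin V f W ==> arrow V f W \<in> Hom CC V W"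
  by (auto simp: Hom_CC)

lemma HomE: assumes "A \<in> Hom CC V W" obtains f where "A = arrow V f W" "colin V f W"
  using assms by (auto simp: Hom_CC)

lemma Id_CC: "Id CC V = arrow V (\<lambda>x. x) V"
  by (auto simp: Comod_def Let_def arrow_def restrict_def fun_eq_iff)

lemma Comp_CC: "colin V f V' ==> Comp CC (arrow V' g W) (arrow V f V') = arrow V (\<lambda>x. g (f x)) W"
  by (auto simp: Comod_def Let_def arrow_def restrict_def fun_eq_iff cm_closed)

lemma TensO_CC: "TensO CC V W = ten V W" and Unit_CC: "Unit CC = I"
  by (simp_all add: Comod_def Let_def)

lemma Assoc_CC: "Assoc CC U V W = arrow (ten (ten U V) W) (asc U V W) (ten U (ten V W))"
  and LUnit_CC: "LUnit CC V = arrow (ten I V) (lun V) V"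
  and RUnit_CC: "RUnit CC V = arrow (ten V I) (run V) V"
  by (simp_all add: Comod_def Let_def arrow_def asc_def lun_def run_def)

lemma category_CC: "category CC"
proof (rule category.intro)
  show "Dom CC f \<in> Obj CC" "Cod CC f \<in> Obj CC" if "f \<in> Arr CC" for f
    using that by (auto simp: Comod_def Let_def)
  show "Id CC Y \<cdot>\<^bsub>CC\<^esub> f = f" "f \<cdot>\<^bsub>CC\<^esub> Id CC X = f" if "f \<in> Hom CC X Y" for f X Y
    using that by (auto elim!: HomE simp: Id_CC Comp_CC Comp_CC[OF cm_id[OF cm_rc(1)]])
qed (auto simp: Obj_CC Id_CC HomI cm_id elim!: HomE simp: Comp_CC cm_comp)

lemma iso_arrI:
  assumes f: "colin X f Y" and g: "\<And>y. y \<in> carrier Y ==> g y \<in> carrier X"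
    and gf: "\<And>x. x \<in> carrier X ==> g (f x) = x" and fg: "\<And>y. y \<in> carrier Y ==> f (g y) = y"
  shows "iso_arr CC X Y (arrow X f Y)" "colin Y g X"
proof -
  note X = cm_rc(1)[OF f] and Y = cm_rc(2)[OF f]
  note vX = com_vs[OF X] and vY = com_vs[OF Y]
  have lin: "linear_map Y X g"
    unfolding linear_map_def
  proof (intro conjI ballI allI)
    show "g \<in> carrier Y \<rightarrow> carrier X" using g by blast
    fix u c assume u: "u \<in> carrier Y"
    show "g (c \<odot>\<^bsub>Y\<^esub> u) = c \<odot>\<^bsub>X\<^esub> g u"
      using cm_lin[OF f] gf[of "c \<odot>\<^bsub>X\<^esub> g u"] fg[OF u] g[OF u] vs_smult[OF vX]
      by (auto simp: linear_map_def)
    fix v assume v: "v \<in> carrier Y"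
    show "g (u \<oplus>\<^bsub>Y\<^esub> v) = g u \<oplus>\<^bsub>X\<^esub> g v"
      using cm_lin[OF f] gf[of "g u \<oplus>\<^bsub>X\<^esub> g v"] fg[OF u] g[OF u] fg[OF v] g[OF v] vs_add[OF vX]
      by (auto simp: linear_map_def)
  qed
  show cg: "colin Y g X"
  proof (rule cmI[OF Y X lin])
    fix y F assume y: "y \<in> carrier Y" and F: "bilin X H F"
    have "sw (coact Y (f (g y))) (\<lambda>u a. F (g u) a) = sw (coact X (g y)) (\<lambda>u a. F (g (f u)) a)"
      by (rule cm_coact[OF f g[OF y]]) (use F in \<open>auto simp: bilin_def intro: lf_linear_map[OF lin] g\<close>)
    also have "\<dots> = sw (coact X (g y)) F"
      by (rule psum_cong[OF com_pol[OF X g[OF y]]]) (simp add: gf)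
    finally show "sw (coact X (g y)) (\<lambda>w a. F w a) = sw (coact Y y) (\<lambda>u a. F (g u) a)"
      by (simp add: fg[OF y])
  qed
  show "iso_arr CC X Y (arrow X f Y)"
    unfolding iso_arr_def
    by (intro conjI HomI f bexI[of _ "arrow Y g X"] cg)
      (auto simp: Comp_CC[OF f] Comp_CC[OF cg] Id_CC gf fg intro: ar_eqI)
qed

lemma tmap_bmap:
  assumes "rc V'" "rc W'" "linear_map V V' f" "linear_map W W' g"
  shows "bmap V W (ten V' W') (\<lambda>v w. tp V' W' (f v) (g w))"
  by (rule bmap_comp[OF bmap_tp[OF assms(1,2)] assms(3,4)])

lemma tmap_lin:
  assumes "rc V" "rc W" "rc V'" "rc W'" "linear_map V V' f" "linear_map W W' g"
  shows "linear_map (ten V W) (ten V' W') (tmap V' W' f g)"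
  unfolding tmap_def by (intro ten_lift_lin assms vs_ten tmap_bmap)

lemma tmap_tp:
  assumes "rc V" "rc W" "rc V'" "rc W'" "linear_map V V' f" "linear_map W W' g" "v \<in> carrier V" "w \<in> carrier W"
  shows "tmap V' W' f g (tp V W v w) = tp V' W' (f v) (g w)"
  unfolding tmap_def by (intro ten_lift_tp assms vs_ten tmap_bmap)

lemma cm_tmap:
  assumes f: "colin V f V'" and g: "colin W g W'"
  shows "colin (ten V W) (tmap V' W' f g) (ten V' W')"
  unfolding colin_def
proof (intro conjI comodule_map_tenI)
  note [intro] = cm_rc[OF f] cm_rc[OF g]
  show *: "linear_map (ten V W) (ten V' W') (tmap V' W' f g)"
    by (rule tmap_lin) (auto simp: cm_lin[OF f] cm_lin[OF g])
  show "rc (ten V W)" "rc V" "rc W" "rc (ten V' W')" "rc (ten V' W')" by (auto intro: rc_ten)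
  fix v w F assume v: "v \<in> carrier V" and w: "w \<in> carrier W" and F: "bilin (ten V' W') H F"
  note F1 = blD1[OF F] and F2 = blD2[OF F]
  note R = cm_rc[OF f] cm_rc[OF g]
  note tm = tmap_tp[OF R(1,3,2,4) cm_lin[OF f] cm_lin[OF g]]
  note rules = F1 F2 lf_tp1[OF R(2,4)] lf_tp2[OF R(2,4)] lf_com[OF R(2)] lf_com[OF R(4)] lf_com[OF R(1)] lf_com[OF R(3)]
    lf_psum_inner[OF com_pol[OF R(1)]] lf_psum_inner[OF com_pol[OF R(2)]] lf_psum_inner[OF com_pol[OF R(3)]]
    lf_psum_inner[OF com_pol[OF R(4)]] lf_mult1 lf_mult2 tp_closed[OF R(2,4)] mult_closed cm_closed[OF f] cm_closed[OF g]
  have "sw (coact (ten V' W') (tmap V' W' f g (tp V W v w))) (\<lambda>u a. F u a) =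
    sw (coact V' (f v)) (\<lambda>v0 v1. sw (coact W' (g w)) (\<lambda>w0 w1. F (tp V' W' v0 w0) (v1 \<otimes> w1)))"
    unfolding tm[OF v w] by (rule ten_coact_tp) (assumption | rule v w R rules)+
  also have "\<dots> = sw (coact V v) (\<lambda>v0 v1. sw (coact W' (g w)) (\<lambda>w0 w1. F (tp V' W' (f v0) w0) (v1 \<otimes> w1)))"
    by (rule cm_coact[OF f v]) (assumption | rule w rules)+
  also have "\<dots> = sw (coact V v) (\<lambda>v0 v1. sw (coact W w) (\<lambda>w0 w1. F (tp V' W' (f v0) (g w0)) (v1 \<otimes> w1)))"
    by (intro psum_cong[OF com_pol[OF R(1) v]] cm_coact[OF g w]) (assumption | rule rules)+
  also have "\<dots> = sw (coact V v) (\<lambda>v0 v1. sw (coact W w) (\<lambda>w0 w1. F (tmap V' W' f g (tp V W v0 w0)) (v1 \<otimes> w1)))"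
    by (intro psum_cong[OF com_pol[OF R(1) v]] psum_cong[OF com_pol[OF R(3) w]]) (simp add: tm)
  finally show "sw (coact (ten V' W') (tmap V' W' f g (tp V W v w))) (\<lambda>u a. F u a) =
    sw (coact V v) (\<lambda>v0 v1. sw (coact W w) (\<lambda>w0 w1. F (tmap V' W' f g (tp V W v0 w0)) (v1 \<otimes> w1)))" .
qed

lemma TensA_CC:
  assumes f: "colin V f V'" and g: "colin W g W'"
  shows "TensA CC (arrow V f V') (arrow W g W') = arrow (ten V W) (tmap V' W' f g) (ten V' W')"
proof -
  note R = cm_rc[OF f] cm_rc[OF g]
  let ?f = "restrict f (carrier V)" and ?g = "restrict g (carrier W)"
  have f': "colin V ?f V'" and g': "colin W ?g W'"
    using f g cm_cong[of V ?f f V'] cm_cong[of W ?g g W'] by auto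
  have "TensA CC (arrow V f V') (arrow W g W') = arrow (ten V W) (tmap V' W' ?f ?g) (ten V' W')"
    by (simp add: Comod_def Let_def arrow_def tmap_def)
  also have "\<dots> = arrow (ten V W) (tmap V' W' f g) (ten V' W')"
  proof (rule ar_eqI)
    fix x assume x: "x \<in> carrier (ten V W)"
    show "tmap V' W' ?f ?g x = tmap V' W' f g x"
      by (rule ten_lin_eqI[OF R(1,3) cm_lin[OF cm_tmap[OF f' g']] cm_lin[OF cm_tmap[OF f g]] vs_ten[OF R(2,4)] _ x])
        (simp add: tmap_tp R cm_lin[OF f] cm_lin[OF g] cm_lin[OF f'] cm_lin[OF g'])
  qed
  finally show ?thesis .
qed

lemma ten3_lin_eqI:
  assumes R: "rc U" "rc V" "rc W"
    and L: "linear_map (ten (ten U V) W) T L" "linear_map (ten (ten U V) W) T L'" and T: "vec_space T"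
    and eq: "\<And>u v w. u \<in> carrier U ==> v \<in> carrier V ==> w \<in> carrier W ==>
      L (tp (ten U V) W (tp U V u v) w) = L' (tp (ten U V) W (tp U V u v) w)"
    and x: "x \<in> carrier (ten (ten U V) W)"
  shows "L x = L' x"
proof (rule ten_lin_eqI[OF rc_ten[OF R(1,2)] R(3) L T _ x])
  fix y w assume y: "y \<in> carrier (ten U V)" and w: "w \<in> carrier W"
  have "bmap (ten U V) W (ten (ten U V) W) (tp (ten U V) W)" by (intro bmap_tp rc_ten R)
  then have lin: "linear_map (ten U V) (ten (ten U V) W) (\<lambda>y. tp (ten U V) W y w)"
    by (rule linear_map_bmap1[rotated 2]) (intro vs_ten rc_ten R w)+
  show "L (tp (ten U V) W y w) = L' (tp (ten U V) W y w)"
    by (rule ten_lin_eqI[OF R(1,2) linear_map_comp[OF lin L(1)] linear_map_comp[OF lin L(2)] T _ y]) (rule eq[OF _ _ w])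
qed

lemma ten4_lin_eqI:
  assumes R: "rc U" "rc V" "rc W" "rc X"
    and L: "linear_map (ten (ten (ten U V) W) X) T L" "linear_map (ten (ten (ten U V) W) X) T L'" and T: "vec_space T"
    and eq: "\<And>u v w z. u \<in> carrier U ==> v \<in> carrier V ==> w \<in> carrier W ==> z \<in> carrier X ==>
      L (tp (ten (ten U V) W) X (tp (ten U V) W (tp U V u v) w) z) = L' (tp (ten (ten U V) W) X (tp (ten U V) W (tp U V u v) w) z)"
    and x: "x \<in> carrier (ten (ten (ten U V) W) X)"
  shows "L x = L' x"
proof (rule ten_lin_eqI[OF rc_ten[OF rc_ten[OF R(1,2)] R(3)] R(4) L T _ x])
  fix y z assume y: "y \<in> carrier (ten (ten U V) W)" and z: "z \<in> carrier X"
  have "bmap (ten (ten U V) W) X (ten (ten (ten U V) W) X) (tp (ten (ten U V) W) X)" by (intro bmap_tp rc_ten R)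
  then have lin: "linear_map (ten (ten U V) W) (ten (ten (ten U V) W) X) (\<lambda>y. tp (ten (ten U V) W) X y z)"
    by (rule linear_map_bmap1[rotated 2]) (intro vs_ten rc_ten R z)+
  show "L (tp (ten (ten U V) W) X y z) = L' (tp (ten (ten U V) W) X y z)"
    by (rule ten3_lin_eqI[OF R(1,2,3) linear_map_comp[OF lin L(1)] linear_map_comp[OF lin L(2)] T _ y]) (rule eq[OF _ _ _ z])
qed

context
  fixes U V W assumes R: "rc U" "rc V" "rc W"
begin

lemma asc_inner: "w \<in> carrier W ==> bmap U V (ten U (ten V W)) (\<lambda>u v. tp U (ten V W) u (tp V W v w))"
  by (intro bmapI tp_closed rc_ten R lf_tp1[OF R(1) rc_ten[OF R(2,3)]]
      lf_tp1[OF R(2,3), where E = "\<lambda>x. _ (tp _ _ _ x)"] lf_tp2[OF R(1) rc_ten[OF R(2,3)]])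

lemma asc_outer: "bmap (ten U V) W (ten U (ten V W)) (\<lambda>y w.
     coded_lift tc (ten U (ten V W)) (\<lambda>u v. tp U (ten V W) u (tp V W v w)) y)"
proof (rule bmapI)
  have T: "vec_space (ten U (ten V W))" by (intro vs_ten rc_ten R)
  note lin = ten_lift_lin[OF R(1,2) T asc_inner]
  fix f w assume f: "linfun (ten U (ten V W)) f" and w: "w \<in> carrier W"
  show "linfun (ten U V) (\<lambda>y. f (coded_lift tc (ten U (ten V W)) (\<lambda>u v. tp U (ten V W) u (tp V W v w)) y))"
    by (rule lf_linear_map[OF lin[OF w] f])
next
  have T: "vec_space (ten U (ten V W))" by (intro vs_ten rc_ten R)
  fix f y assume f: "linfun (ten U (ten V W)) f" and y: "y \<in> carrier (ten U V)"
  show "linfun W (\<lambda>w. f (coded_lift tc (ten U (ten V W)) (\<lambda>u v. tp U (ten V W) u (tp V W v w)) y))"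
    apply (subst lf_cong[OF lf_ten_lift[OF R(1,2) T asc_inner y f] com_vs[OF R(3)]], assumption)
    apply (rule lf_psum_inner[OF ten_dec_pol[OF R(1,2) y]])
    apply (rule lf_tp2[OF R(2,3), where E = "\<lambda>x. f (tp _ _ _ x)"])
     apply (rule lf_tp2[OF R(1) rc_ten[OF R(2,3)] f], assumption+)
    done
next
  have T: "vec_space (ten U (ten V W))" by (intro vs_ten rc_ten R)
  fix y w assume "y \<in> carrier (ten U V)" "w \<in> carrier W"
  then show "coded_lift tc (ten U (ten V W)) (\<lambda>u v. tp U (ten V W) u (tp V W v w)) y \<in> carrier (ten U (ten V W))"
    by (intro ten_lift_closed[OF R(1,2) T asc_inner])
qed

lemma asc_lin: "linear_map (ten (ten U V) W) (ten U (ten V W)) (asc U V W)"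
  unfolding asc_def by (intro ten_lift_lin asc_outer rc_ten vs_ten R)

lemma asc_tp: "u \<in> carrier U ==> v \<in> carrier V ==> w \<in> carrier W ==>
   asc U V W (tp (ten U V) W (tp U V u v) w) = tp U (ten V W) u (tp V W v w)"
  unfolding asc_def
  by (subst ten_lift_tp[OF rc_ten[OF R(1,2)] R(3) vs_ten[OF R(1) rc_ten[OF R(2,3)]] asc_outer])
    (auto intro!: ten_lift_tp vs_ten rc_ten R asc_inner tp_closed)

lemma asc'_inner: "u \<in> carrier U ==> bmap V W (ten (ten U V) W) (\<lambda>v w. tp (ten U V) W (tp U V u v) w)"
  by (intro bmapI tp_closed rc_ten R lf_tp2[OF rc_ten[OF R(1,2)] R(3)]
      lf_tp2[OF R(1,2), where E = "\<lambda>x. _ (tp _ _ x _)"] lf_tp1[OF rc_ten[OF R(1,2)] R(3)])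

lemma asc'_outer: "bmap U (ten V W) (ten (ten U V) W) (\<lambda>u z.
     coded_lift tc (ten (ten U V) W) (\<lambda>v w. tp (ten U V) W (tp U V u v) w) z)"
proof (rule bmapI)
  have T: "vec_space (ten (ten U V) W)" by (intro vs_ten rc_ten R)
  note lin = ten_lift_lin[OF R(2,3) T asc'_inner]
  fix f u assume f: "linfun (ten (ten U V) W) f" and u: "u \<in> carrier U"
  show "linfun (ten V W) (\<lambda>z. f (coded_lift tc (ten (ten U V) W) (\<lambda>v w. tp (ten U V) W (tp U V u v) w) z))"
    by (rule lf_linear_map[OF lin[OF u] f])
next
  have T: "vec_space (ten (ten U V) W)" by (intro vs_ten rc_ten R)
  fix f z assume f: "linfun (ten (ten U V) W) f" and z: "z \<in> carrier (ten V W)"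
  show "linfun U (\<lambda>u. f (coded_lift tc (ten (ten U V) W) (\<lambda>v w. tp (ten U V) W (tp U V u v) w) z))"
    apply (subst lf_cong[OF lf_ten_lift[OF R(2,3) T asc'_inner z f] com_vs[OF R(1)]], assumption)
    apply (rule lf_psum_inner[OF ten_dec_pol[OF R(2,3) z]])
    apply (rule lf_tp1[OF R(1,2), where E = "\<lambda>x. f (tp _ _ x _)"])
     apply (rule lf_tp1[OF rc_ten[OF R(1,2)] R(3) f], assumption+)
    done
next
  have T: "vec_space (ten (ten U V) W)" by (intro vs_ten rc_ten R)
  fix u z assume "u \<in> carrier U" "z \<in> carrier (ten V W)"
  then show "coded_lift tc (ten (ten U V) W) (\<lambda>v w. tp (ten U V) W (tp U V u v) w) z \<in> carrier (ten (ten U V) W)"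
    by (intro ten_lift_closed[OF R(2,3) T asc'_inner])
qed

lemma asc'_lin: "linear_map (ten U (ten V W)) (ten (ten U V) W) (asc' U V W)"
  unfolding asc'_def by (intro ten_lift_lin asc'_outer rc_ten vs_ten R)

lemma asc'_tp: "u \<in> carrier U ==> v \<in> carrier V ==> w \<in> carrier W ==>
   asc' U V W (tp U (ten V W) u (tp V W v w)) = tp (ten U V) W (tp U V u v) w"
  unfolding asc'_def
  by (subst ten_lift_tp[OF R(1) rc_ten[OF R(2,3)] vs_ten[OF rc_ten[OF R(1,2)] R(3)] asc'_outer])
    (auto intro!: ten_lift_tp vs_ten rc_ten R asc'_inner tp_closed)

lemma asc'_asc: "x \<in> carrier (ten (ten U V) W) ==> asc' U V W (asc U V W x) = x"
  by (rule ten3_lin_eqI[OF R linear_map_comp[OF asc_lin asc'_lin] linear_map_id])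
    (simp_all add: asc_tp asc'_tp vs_ten rc_ten R)

lemma asc_asc':
  assumes x: "x \<in> carrier (ten U (ten V W))" shows "asc U V W (asc' U V W x) = x"
proof (rule ten_lin_eqI[OF R(1) rc_ten[OF R(2,3)] linear_map_comp[OF asc'_lin asc_lin] linear_map_id _ _ x])
  show T: "vec_space (ten U (ten V W))" by (intro vs_ten rc_ten R)
  fix u z assume u: "u \<in> carrier U" and z: "z \<in> carrier (ten V W)"
  have lin: "linear_map (ten V W) (ten U (ten V W)) (\<lambda>z. tp U (ten V W) u z)"
    by (rule linear_map_bmap2[OF _ T bmap_tp u]) (intro vs_ten rc_ten R)+
  show "asc U V W (asc' U V W (tp U (ten V W) u z)) = tp U (ten V W) u z"
    by (rule ten_lin_eqI[OF R(2,3) linear_map_comp[OF lin linear_map_comp[OF asc'_lin asc_lin]] lin T _ z])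
      (simp add: asc_tp asc'_tp u)
qed

lemma cm_asc: "colin (ten (ten U V) W) (asc U V W) (ten U (ten V W))"
  unfolding colin_def
proof (intro conjI comodule_map_tenI asc_lin)
  show "rc (ten (ten U V) W)" "rc (ten U (ten V W))" "rc (ten U (ten V W))" "rc (ten U V)" "rc W" by (intro rc_ten R)+
  note R2 = rc_ten[OF R(1,2)] rc_ten[OF R(2,3)]
  fix y w F assume y: "y \<in> carrier (ten U V)" and w: "w \<in> carrier W" and F: "bilin (ten U (ten V W)) H F"
  note F1 = blD1[OF F] and F2 = blD2[OF F]
  let ?L = "\<lambda>y. sw (coact (ten U (ten V W)) (asc U V W (tp (ten U V) W y w))) (\<lambda>u a. F u a)"
  let ?Rr = "\<lambda>y. sw (coact (ten U V) y) (\<lambda>v0 v1. sw (coact W w) (\<lambda>w0 w1.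
     F (asc U V W (tp (ten U V) W v0 w0)) (v1 \<otimes> w1)))"
  have lfasc1: "linfun (ten U (ten V W)) (\<lambda>x. E x) ==> w \<in> carrier W ==> linfun (ten U V) (\<lambda>y. E (asc U V W (tp (ten U V) W y w)))" for E w
    by (rule lf_tp1[OF R2(1) R(3) lf_linear_map[OF asc_lin]])
  have lfasc2: "linfun (ten U (ten V W)) (\<lambda>x. E x) ==> y \<in> carrier (ten U V) ==> linfun W (\<lambda>w. E (asc U V W (tp (ten U V) W y w)))" for E y
    by (rule lf_tp2[OF R2(1) R(3) lf_linear_map[OF asc_lin]])
  have asc_cl: "y \<in> carrier (ten U V) ==> w \<in> carrier W ==> asc U V W (tp (ten U V) W y w) \<in> carrier (ten U (ten V W))" for y w
    by (intro linear_map_closed[OF asc_lin] tp_closed R R2)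
  note rules = F1 F2 lfasc1 lfasc2 asc_cl lf_mult1 lf_mult2 mult_closed lf_coact_ten[OF R(1,2)] lf_coact_ten[OF R(1) R2(2)] lf_com[OF R(1)] lf_com[OF R(2)] lf_com[OF R(3)]
    lf_psum_inner[OF com_pol[OF R(1)]] lf_psum_inner[OF com_pol[OF R(2)]] lf_psum_inner[OF com_pol[OF R(3)]]
    tp_closed[OF R(1,2)] tp_closed[OF R(2,3)] tp_closed[OF R(1) R2(2)] tp_closed[OF R2(1) R(3)]
    lf_tp1[OF R(1) R2(2)] lf_tp2[OF R(1) R2(2)] lf_tp1[OF R(1,2)] lf_tp2[OF R(1,2)]
    lf_tp1[OF R(2,3)] lf_tp2[OF R(2,3)] 
  show "?L y = ?Rr y"
  proof (rule lf_ten_eqI[OF R(1,2) _ _ _ y])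
    show "linfun (ten U V) ?L"
      by (rule lfasc1[where E = "\<lambda>x. sw (coact _ x) _", OF lf_coact_ten[OF R(1) R2(2)]]) (assumption | rule w rules)+
    show "linfun (ten U V) ?Rr"
      by (assumption | rule w rules)+
    fix u v assume u: "u \<in> carrier U" and v: "v \<in> carrier V"
    have "?L (tp U V u v) = sw (coact U u) (\<lambda>u0 u1. sw (coact (ten V W) (tp V W v w))
       (\<lambda>z0 z1. F (tp U (ten V W) u0 z0) (u1 \<otimes> z1)))"
      unfolding asc_tp[OF u v w] by (rule ten_coact_tp[OF R(1) R2(2)]) (assumption | rule u v w rules)+
    also have "\<dots> = sw (coact U u) (\<lambda>u0 u1. sw (coact V v) (\<lambda>v0 v1. sw (coact W w)
       (\<lambda>w0 w1. F (tp U (ten V W) u0 (tp V W v0 w0)) (u1 \<otimes> (v1 \<otimes> w1)))))"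
      by (intro psum_cong[OF com_pol[OF R(1) u]] ten_coact_tp[OF R(2,3) v w]) (assumption | rule rules)+
    also have "\<dots> = sw (coact U u) (\<lambda>u0 u1. sw (coact V v) (\<lambda>v0 v1. sw (coact W w)
       (\<lambda>w0 w1. F (asc U V W (tp (ten U V) W (tp U V u0 v0) w0)) ((u1 \<otimes> v1) \<otimes> w1))))"
      by (intro psum_cong[OF com_pol[OF R(1) u]] psum_cong[OF com_pol[OF R(2) v]] psum_cong[OF com_pol[OF R(3) w]])
        (simp add: asc_tp assoc)
    also have "\<dots> = ?Rr (tp U V u v)"
      by (rule ten_coact_tp[OF R(1,2) u v, symmetric]) (assumption | rule w rules)+
    finally show "?L (tp U V u v) = ?Rr (tp U V u v)" .
  qed
qed

end

lemma iso_asc: "rc U ==> rc V ==> rc W ==> iso_arr CC (ten (ten U V) W) (ten U (ten V W)) (Assoc CC U V W)"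
  unfolding Assoc_CC
  by (rule iso_arrI(1)[OF cm_asc, of _ _ _ "asc' U V W"])
    (auto intro: linear_map_closed[OF asc'_lin] asc'_asc asc_asc')

lemma bmap_lun: "rc V ==> bmap I V V (\<lambda>x v. inv_into UNIV sc x \<odot>\<^bsub>V\<^esub> v)"
  by (rule smult_bmap[OF com_vs lf_inv_sc])

lemma bmap_flip: "bmap V W U G ==> bmap W V U (\<lambda>w v. G v w)"
  by (auto simp: bmap_def bilin_def)

lemma bmap_run: "rc V ==> bmap V I V (\<lambda>v x. inv_into UNIV sc x \<odot>\<^bsub>V\<^esub> v)"
  by (rule bmap_flip[OF bmap_lun])

context
  fixes V assumes R: "rc V"
begin

lemma lun_lin: "linear_map (ten I V) V (lun V)"
  unfolding lun_def by (rule ten_lift_lin[OF rc_I R com_vs[OF R] bmap_lun[OF R]])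

lemma run_lin: "linear_map (ten V I) V (run V)"
  unfolding run_def by (rule ten_lift_lin[OF R rc_I com_vs[OF R] bmap_run[OF R]])

lemma lun_tp: "x \<in> carrier I ==> v \<in> carrier V ==> lun V (tp I V x v) = inv_into UNIV sc x \<odot>\<^bsub>V\<^esub> v"
  unfolding lun_def by (rule ten_lift_tp[OF rc_I R com_vs[OF R] bmap_lun[OF R]])

lemma run_tp: "x \<in> carrier I ==> v \<in> carrier V ==> run V (tp V I v x) = inv_into UNIV sc x \<odot>\<^bsub>V\<^esub> v"
  unfolding run_def by (rule ten_lift_tp[OF R rc_I com_vs[OF R] bmap_run[OF R]])

lemma cm_lun: "colin (ten I V) (lun V) V"
  unfolding colin_def
proof (intro conjI comodule_map_tenI lun_lin rc_ten rc_I R)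
  fix x v F assume x: "x \<in> carrier I" and v: "v \<in> carrier V" and F: "bilin V H F"
  note F1 = blD1[OF F] and F2 = blD2[OF F]
  have "sw (coact V (lun V (tp I V x v))) (\<lambda>u a. F u a) = inv_into UNIV sc x * sw (coact V v) (\<lambda>u a. F u a)"
    unfolding lun_tp[OF x v] by (rule lf_smult[OF lf_com[OF R] v]) (rule F1 F2, assumption)+
  also have "\<dots> = sw (coact V v) (\<lambda>w0 w1. F (lun V (tp I V x w0)) (\<one> \<otimes> w1))"
    unfolding psum_mult_left[symmetric]
    by (rule psum_cong[OF com_pol[OF R v]]) (simp add: lun_tp x l_one lf_smult[OF F1])
  also have "\<dots> = sw (coact I x) (\<lambda>v0 v1. sw (coact V v) (\<lambda>w0 w1. F (lun V (tp I V v0 w0)) (v1 \<otimes> w1)))"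
    by (rule psum_coact_I[OF x, symmetric])
      (assumption | rule lf_psum_inner[OF com_pol[OF R v]] F1 F2 lf_mult1 mult_closed
        lf_tp1[OF rc_I R lf_linear_map[OF lun_lin]] linear_map_closed[OF lun_lin] tp_closed rc_I R)+
  finally show "sw (coact V (lun V (tp I V x v))) (\<lambda>u a. F u a) =
     sw (coact I x) (\<lambda>v0 v1. sw (coact V v) (\<lambda>w0 w1. F (lun V (tp I V v0 w0)) (v1 \<otimes> w1)))" .
qed

lemma cm_run: "colin (ten V I) (run V) V"
  unfolding colin_def
proof (intro conjI comodule_map_tenI run_lin rc_ten rc_I R)
  fix x v F assume x: "x \<in> carrier I" and v: "v \<in> carrier V" and F: "bilin V H F"
  note F1 = blD1[OF F] and F2 = blD2[OF F]
  have "sw (coact V (run V (tp V I v x))) (\<lambda>u a. F u a) = inv_into UNIV sc x * sw (coact V v) (\<lambda>u a. F u a)"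
    unfolding run_tp[OF x v] by (rule lf_smult[OF lf_com[OF R] v]) (rule F1 F2, assumption)+
  also have "\<dots> = sw (coact V v) (\<lambda>v0 v1. F (run V (tp V I v0 x)) (v1 \<otimes> \<one>))"
    unfolding psum_mult_left[symmetric]
    by (rule psum_cong[OF com_pol[OF R v]]) (simp add: run_tp x r_one lf_smult[OF F1])
  also have "\<dots> = sw (coact V v) (\<lambda>v0 v1. sw (coact I x) (\<lambda>w0 w1. F (run V (tp V I v0 w0)) (v1 \<otimes> w1)))"
    by (intro psum_cong[OF com_pol[OF R v]] psum_coact_I[OF x, symmetric])
      (assumption | rule F1 F2 lf_mult2 mult_closed
        lf_tp2[OF R rc_I lf_linear_map[OF run_lin]] linear_map_closed[OF run_lin] tp_closed rc_I R)+
  finally show "sw (coact V (run V (tp V I v x))) (\<lambda>u a. F u a) =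
     sw (coact V v) (\<lambda>v0 v1. sw (coact I x) (\<lambda>w0 w1. F (run V (tp V I v0 w0)) (v1 \<otimes> w1)))" .
qed

lemma smult_one: "v \<in> carrier V ==> 1 \<odot>\<^bsub>V\<^esub> v = v"
  using Module.module.smult_one[OF com_vs[OF R]] by simp

lemma iso_lun: "iso_arr CC (ten I V) V (LUnit CC V)"
  unfolding LUnit_CC
proof (rule iso_arrI(1)[OF cm_lun, where g = "tp I V (sc 1)"])
  show "tp I V (sc 1) v \<in> carrier (ten I V)" if "v \<in> carrier V" for v
    using that by (intro tp_closed rc_I R sc_closed)
  show "lun V (tp I V (sc 1) v) = v" if "v \<in> carrier V" for v
    using that by (simp add: lun_tp sc_closed inv_sc smult_one)
  show "tp I V (sc 1) (lun V x) = x" if x: "x \<in> carrier (ten I V)" for x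
  proof (rule ten_lin_eqI[OF rc_I R linear_map_comp[OF lun_lin] linear_map_id vs_ten _ x])
    show "linear_map V (ten I V) (tp I V (sc 1))"
      by (rule linear_map_bmap2[OF com_vs[OF R] vs_ten bmap_tp sc_closed]) (intro rc_I R)+
    fix z v assume z: "z \<in> carrier I" and v: "v \<in> carrier V"
    show "tp I V (sc 1) (lun V (tp I V z v)) = tp I V z v"
    proof (rule vs_eqI[OF vs_ten[OF rc_I R]])
      fix f assume f: "linfun (ten I V) f"
      show "f (tp I V (sc 1) (lun V (tp I V z v))) = f (tp I V z v)"
        unfolding lun_tp[OF z v] using lf_I[OF lf_tp1[OF rc_I R f v] z]
        by (simp add: lf_smult[OF lf_tp2[OF rc_I R f sc_closed] v])
    qed (use z v in \<open>auto intro!: tp_closed rc_I R sc_closed linear_map_closed[OF lun_lin]\<close>)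
  qed (rule rc_I R)+
qed

lemma iso_run: "iso_arr CC (ten V I) V (RUnit CC V)"
  unfolding RUnit_CC
proof (rule iso_arrI(1)[OF cm_run, where g = "\<lambda>v. tp V I v (sc 1)"])
  show "tp V I v (sc 1) \<in> carrier (ten V I)" if "v \<in> carrier V" for v
    using that by (intro tp_closed rc_I R sc_closed)
  show "run V (tp V I v (sc 1)) = v" if "v \<in> carrier V" for v
    using that by (simp add: run_tp sc_closed inv_sc smult_one)
  show "tp V I (run V x) (sc 1) = x" if x: "x \<in> carrier (ten V I)" for x
  proof (rule ten_lin_eqI[OF R rc_I linear_map_comp[OF run_lin] linear_map_id vs_ten _ x])
    show "linear_map V (ten V I) (\<lambda>v. tp V I v (sc 1))"
      by (rule linear_map_bmap1[OF com_vs[OF R] vs_ten bmap_tp sc_closed]) (intro rc_I R)+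
    fix v z assume z: "z \<in> carrier I" and v: "v \<in> carrier V"
    show "tp V I (run V (tp V I v z)) (sc 1) = tp V I v z"
    proof (rule vs_eqI[OF vs_ten[OF R rc_I]])
      fix f assume f: "linfun (ten V I) f"
      show "f (tp V I (run V (tp V I v z)) (sc 1)) = f (tp V I v z)"
        unfolding run_tp[OF z v] using lf_I[OF lf_tp2[OF R rc_I f v] z]
        by (simp add: lf_smult[OF lf_tp1[OF R rc_I f sc_closed] v])
    qed (use z v in \<open>auto intro!: tp_closed rc_I R sc_closed linear_map_closed[OF run_lin]\<close>)
  qed (rule rc_I R)+
qed

end

lemma lin_id: "linear_map V V (\<lambda>x. x)"
  by (rule linear_map_id)

text \<open>Each coherence diagram consists of linear maps out of an iterated tensor product, and on pure tensors
  both ways around it visibly give the same result.\<close>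

theorem monoidal_category_CC: "monoidal_category CC"
proof (intro monoidal_category.intro monoidal_category_axioms.intro category_CC)
  note sel = Obj_CC TensO_CC Unit_CC
  show "X \<boxtimes>\<^bsub>CC\<^esub> Y \<in> Obj CC" if "X \<in> Obj CC" "Y \<in> Obj CC" for X Y
    using that by (simp add: sel rc_ten)
  show "Unit CC \<in> Obj CC" by (simp add: sel rc_I)
  show "f \<boxdot>\<^bsub>CC\<^esub> g \<in> Hom CC (X \<boxtimes>\<^bsub>CC\<^esub> X') (Y \<boxtimes>\<^bsub>CC\<^esub> Y')" if "f \<in> Hom CC X Y" "g \<in> Hom CC X' Y'" for f g X Y X' Y'
    using that by (auto elim!: HomE simp: TensA_CC sel intro!: HomI cm_tmap)
  show "Id CC X \<boxdot>\<^bsub>CC\<^esub> Id CC Y = Id CC (X \<boxtimes>\<^bsub>CC\<^esub> Y)" if "X \<in> Obj CC" "Y \<in> Obj CC" for X Y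
  proof -
    have R: "rc X" "rc Y" using that by (simp_all add: sel)
    have pw: "tmap X Y (\<lambda>x. x) (\<lambda>x. x) x = x" if x: "x \<in> carrier (ten X Y)" for x
      by (rule ten_lin_eqI[OF R tmap_lin[OF R R lin_id lin_id] lin_id vs_ten[OF R] _ x])
        (simp add: tmap_tp R lin_id)
    show ?thesis
      unfolding sel Id_CC TensA_CC[OF cm_id[OF R(1)] cm_id[OF R(2)]] by (rule ar_eqI) (rule pw)
  qed
  show "(g \<cdot>\<^bsub>CC\<^esub> f) \<boxdot>\<^bsub>CC\<^esub> (g' \<cdot>\<^bsub>CC\<^esub> f') = (g \<boxdot>\<^bsub>CC\<^esub> g') \<cdot>\<^bsub>CC\<^esub> (f \<boxdot>\<^bsub>CC\<^esub> f')"
    if H: "f \<in> Hom CC X Y" "g \<in> Hom CC Y Z" "f' \<in> Hom CC X' Y'" "g' \<in> Hom CC Y' Z'" for f g f' g' X Y Z X' Y' Z'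
  proof -
    obtain a b a' b' where e: "f = arrow X a Y" "colin X a Y" "g = arrow Y b Z" "colin Y b Z" "f' = arrow X' a' Y'" "colin X' a' Y'"
      "g' = arrow Y' b' Z'" "colin Y' b' Z'" using H by (auto elim!: HomE)
    note R = cm_rc[OF e(2)] cm_rc[OF e(4)] cm_rc[OF e(6)] cm_rc[OF e(8)]
    note l = cm_lin[OF e(2)] cm_lin[OF e(4)] cm_lin[OF e(6)] cm_lin[OF e(8)]
      cm_lin[OF cm_comp[OF e(2,4)]] cm_lin[OF cm_comp[OF e(6,8)]]
    have pw: "tmap Z Z' (\<lambda>x. b (a x)) (\<lambda>x. b' (a' x)) x = tmap Z Z' b b' (tmap Y Y' a a' x)" if x: "x \<in> carrier (ten X X')" for x
      by (rule ten_lin_eqI[OF R(1,5) cm_lin[OF cm_tmap[OF cm_comp[OF e(2,4)] cm_comp[OF e(6,8)]]]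
            cm_lin[OF cm_comp[OF cm_tmap[OF e(2,6)] cm_tmap[OF e(4,8)]]] vs_ten[OF R(4,8)] _ x])
        (simp only: tmap_tp[OF R(1,5) R(4,8) l(5,6)] tmap_tp[OF R(1,5) R(2,6) l(1,3)] tmap_tp[OF R(2,6) R(4,8) l(2,4)]
          cm_closed[OF e(2)] cm_closed[OF e(6)])
    show ?thesis
      unfolding e by (simp add: Comp_CC e TensA_CC cm_comp[OF e(2,4)] cm_comp[OF e(6,8)] cm_tmap, rule ar_eqI, erule pw)
  qed
  show "iso_arr CC ((X \<boxtimes>\<^bsub>CC\<^esub> Y) \<boxtimes>\<^bsub>CC\<^esub> Z) (X \<boxtimes>\<^bsub>CC\<^esub> Y \<boxtimes>\<^bsub>CC\<^esub> Z) (Assoc CC X Y Z)"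
    if "X \<in> Obj CC" "Y \<in> Obj CC" "Z \<in> Obj CC" for X Y Z using that by (simp add: sel iso_asc)
  show "iso_arr CC (Unit CC \<boxtimes>\<^bsub>CC\<^esub> X) X (LUnit CC X)" "iso_arr CC (X \<boxtimes>\<^bsub>CC\<^esub> Unit CC) X (RUnit CC X)"
    if "X \<in> Obj CC" for X using that by (simp_all add: sel iso_lun iso_run)
  show "Assoc CC X' Y' Z' \<cdot>\<^bsub>CC\<^esub> ((f \<boxdot>\<^bsub>CC\<^esub> g) \<boxdot>\<^bsub>CC\<^esub> h) = (f \<boxdot>\<^bsub>CC\<^esub> g \<boxdot>\<^bsub>CC\<^esub> h) \<cdot>\<^bsub>CC\<^esub> Assoc CC X Y Z"
    if H: "f \<in> Hom CC X X'" "g \<in> Hom CC Y Y'" "h \<in> Hom CC Z Z'" for f g h X X' Y Y' Z Z'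
  proof -
    obtain a b c where e: "f = arrow X a X'" "colin X a X'" "g = arrow Y b Y'" "colin Y b Y'" "h = arrow Z c Z'" "colin Z c Z'"
      using H by (auto elim!: HomE)
    note R = cm_rc[OF e(2)] cm_rc[OF e(4)] cm_rc[OF e(6)]
    note cms = cm_tmap[OF cm_tmap[OF e(2,4)] e(6)] cm_asc[OF R(1,3,5)] cm_tmap[OF e(2) cm_tmap[OF e(4,6)]] cm_asc[OF R(2,4,6)]
    note l = cm_lin[OF e(2)] cm_lin[OF e(4)] cm_lin[OF e(6)] cm_lin[OF cm_tmap[OF e(2,4)]] cm_lin[OF cm_tmap[OF e(4,6)]]
    have pw: "asc X' Y' Z' (tmap (ten X' Y') Z' (tmap X' Y' a b) c x) = tmap X' (ten Y' Z') a (tmap Y' Z' b c) (asc X Y Z x)" if x: "x \<in> carrier (ten (ten X Y) Z)" for x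
      by (rule ten3_lin_eqI[OF R(1,3,5) cm_lin[OF cm_comp[OF cms(1,4)]] cm_lin[OF cm_comp[OF cms(2,3)]] _ _ x])
        (auto simp: R l tmap_tp asc_tp rc_ten vs_ten tp_closed cm_closed[OF e(2)] cm_closed[OF e(4)] cm_closed[OF e(6)])
    show ?thesis
      unfolding e by (simp add: Comp_CC e TensA_CC cm_tmap Assoc_CC Comp_CC[OF cms(1)] Comp_CC[OF cms(2)], rule ar_eqI, erule pw)
  qed
  show "LUnit CC Y \<cdot>\<^bsub>CC\<^esub> (Id CC (Unit CC) \<boxdot>\<^bsub>CC\<^esub> f) = f \<cdot>\<^bsub>CC\<^esub> LUnit CC X" if H: "f \<in> Hom CC X Y" for f X Y
  proof -
    obtain a where e: "f = arrow X a Y" "colin X a Y" using H by (auto elim!: HomE)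
    note R = cm_rc[OF e(2)]
    note cmt = cm_tmap[OF cm_id[OF rc_I] e(2)]
    have pw: "lun Y (tmap I Y (\<lambda>x. x) a x) = a (lun X x)" if x: "x \<in> carrier (ten I X)" for x
      by (rule ten_lin_eqI[OF rc_I R(1) cm_lin[OF cm_comp[OF cmt cm_lun[OF R(2)]]] cm_lin[OF cm_comp[OF cm_lun[OF R(1)] e(2)]] _ _ x])
        (auto simp: R tmap_tp rc_I lin_id lun_tp com_vs cm_lin[OF e(2)] cm_closed[OF e(2)] cm_smult[OF e(2)])
    show ?thesis
      unfolding e Id_CC Unit_CC LUnit_CC
      by (simp add: TensA_CC cm_id rc_I e Comp_CC[OF cmt] Comp_CC[OF cm_lun[OF R(1)]], rule ar_eqI, erule pw)
  qed
  show "RUnit CC Y \<cdot>\<^bsub>CC\<^esub> (f \<boxdot>\<^bsub>CC\<^esub> Id CC (Unit CC)) = f \<cdot>\<^bsub>CC\<^esub> RUnit CC X" if H: "f \<in> Hom CC X Y" for f X Y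
  proof -
    obtain a where e: "f = arrow X a Y" "colin X a Y" using H by (auto elim!: HomE)
    note R = cm_rc[OF e(2)]
    note cmt = cm_tmap[OF e(2) cm_id[OF rc_I]]
    have pw: "run Y (tmap Y I a (\<lambda>x. x) x) = a (run X x)" if x: "x \<in> carrier (ten X I)" for x
      by (rule ten_lin_eqI[OF R(1) rc_I cm_lin[OF cm_comp[OF cmt cm_run[OF R(2)]]] cm_lin[OF cm_comp[OF cm_run[OF R(1)] e(2)]] _ _ x])
        (auto simp: R tmap_tp rc_I lin_id run_tp com_vs cm_lin[OF e(2)] cm_closed[OF e(2)] cm_smult[OF e(2)])
    show ?thesis
      unfolding e Id_CC Unit_CC RUnit_CC
      by (simp add: TensA_CC cm_id rc_I e Comp_CC[OF cmt] Comp_CC[OF cm_run[OF R(1)]], rule ar_eqI, erule pw)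
  qed
  show "Assoc CC W X (Y \<boxtimes>\<^bsub>CC\<^esub> Z) \<cdot>\<^bsub>CC\<^esub> Assoc CC (W \<boxtimes>\<^bsub>CC\<^esub> X) Y Z =
      (Id CC W \<boxdot>\<^bsub>CC\<^esub> Assoc CC X Y Z) \<cdot>\<^bsub>CC\<^esub> Assoc CC W (X \<boxtimes>\<^bsub>CC\<^esub> Y) Z \<cdot>\<^bsub>CC\<^esub> (Assoc CC W X Y \<boxdot>\<^bsub>CC\<^esub> Id CC Z)"
    if "W \<in> Obj CC" "X \<in> Obj CC" "Y \<in> Obj CC" "Z \<in> Obj CC" for W X Y Z
  proof -
    have R: "rc W" "rc X" "rc Y" "rc Z" using that by (simp_all add: sel)
    note Rt = rc_ten[OF R(1,2)] rc_ten[OF R(2,3)] rc_ten[OF R(3,4)]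
    note c1 = cm_asc[OF Rt(1) R(3,4)] and c2 = cm_asc[OF R(1,2) Rt(3)]
    note c3 = cm_tmap[OF cm_asc[OF R(1,2,3)] cm_id[OF R(4)]] and c4 = cm_asc[OF R(1) Rt(2) R(4)]
      and c5 = cm_tmap[OF cm_id[OF R(1)] cm_asc[OF R(2,3,4)]]
    have pw: "asc W X (ten Y Z) (asc (ten W X) Y Z x) =
       tmap W (ten X (ten Y Z)) (\<lambda>x. x) (asc X Y Z) (asc W (ten X Y) Z (tmap (ten W (ten X Y)) Z (asc W X Y) (\<lambda>x. x) x))" if x: "x \<in> carrier (ten (ten (ten W X) Y) Z)" for x
      by (rule ten4_lin_eqI[OF R cm_lin[OF cm_comp[OF c1 c2]] cm_lin[OF cm_comp[OF cm_comp[OF c3 c4] c5]] _ _ x])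
        (auto simp: R Rt rc_ten vs_ten tmap_tp asc_tp tp_closed asc_lin lin_id)
    show ?thesis
      unfolding TensO_CC Id_CC Assoc_CC
      by (simp add: TensA_CC cm_id R cm_asc Comp_CC[OF c1] Comp_CC[OF c3] Comp_CC[OF c4] Comp_CC[OF cm_comp[OF c3 c4]], rule ar_eqI, erule pw)
  qed
  show "(Id CC X \<boxdot>\<^bsub>CC\<^esub> LUnit CC Y) \<cdot>\<^bsub>CC\<^esub> Assoc CC X (Unit CC) Y = RUnit CC X \<boxdot>\<^bsub>CC\<^esub> Id CC Y"
    if "X \<in> Obj CC" "Y \<in> Obj CC" for X Y
  proof -
    have R: "rc X" "rc Y" using that by (simp_all add: sel)
    note c1 = cm_asc[OF R(1) rc_I R(2)] and c2 = cm_tmap[OF cm_id[OF R(1)] cm_lun[OF R(2)]]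
      and c3 = cm_tmap[OF cm_run[OF R(1)] cm_id[OF R(2)]]
    have pw: "tmap X Y (\<lambda>x. x) (lun Y) (asc X I Y x) = tmap X Y (run X) (\<lambda>x. x) x" if x: "x \<in> carrier (ten (ten X I) Y)" for x
    proof (rule ten3_lin_eqI[OF R(1) rc_I R(2) cm_lin[OF cm_comp[OF c1 c2]] cm_lin[OF c3] vs_ten[OF R] _ x])
      fix u v w assume u: "u \<in> carrier X" and v: "v \<in> carrier I" and w: "w \<in> carrier Y"
      have "tp X Y u (inv_into UNIV sc v \<odot>\<^bsub>Y\<^esub> w) = tp X Y (inv_into UNIV sc v \<odot>\<^bsub>X\<^esub> u) w"
        by (rule vs_eqI[OF vs_ten[OF R]])
          (auto intro!: tp_closed R vs_smult com_vs u w simp: lf_smult[OF lf_tp1[OF R _ w] u] lf_smult[OF lf_tp2[OF R _ u] w])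
      then show "tmap X Y (\<lambda>x. x) (lun Y) (asc X I Y (tp (ten X I) Y (tp X I u v) w)) =
         tmap X Y (run X) (\<lambda>x. x) (tp (ten X I) Y (tp X I u v) w)"
        by (simp add: R rc_I rc_ten asc_tp tmap_tp u v w tp_closed lun_lin run_lin lin_id lun_tp run_tp)
    qed
    show ?thesis
      unfolding TensO_CC Id_CC Assoc_CC Unit_CC LUnit_CC RUnit_CC
      by (simp add: TensA_CC cm_id R cm_lun cm_run Comp_CC[OF c1], rule ar_eqI, erule pw)
  qed
qed

end

section \<open>The cotensor functor of a Galois object\<close>

text \<open>Comultiplications, coactions and the maps that link different algebras are all of this kind.\<close>

locale tensor_valued = two_spaces B C
  for B :: "('k::field, 'b, 'x) module_scheme" and C :: "('k, 'c, 'y) module_scheme"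
    and A :: "('k, 'a, 'z) module_scheme" and d :: "'a => ('k, 'b, 'c) tens" +
  assumes lin: "linear_map A (tensor B C) d"
begin

lemma closed: "a \<in> carrier A ==> d a \<in> carrier (tensor B C)"
  by (rule linear_map_closed[OF lin])

lemma pol: "a \<in> carrier A ==> rep (d a) \<in> pol B C"
  by (rule rep_pol[OF closed])

lemma linfun: "(\<And>c. c \<in> carrier C ==> linfun B (\<lambda>b. F b c)) ==> (\<And>b. b \<in> carrier B ==> linfun C (\<lambda>c. F b c)) ==>
    linfun A (\<lambda>a. sw (d a) (\<lambda>b c. F b c))"
  by (rule lf_linear_map[OF lin lf_psum_rep]) (rule blI)

end

text \<open>Here \<open>lZ\<close> and \<open>rZ\<close> are the coactions of \<open>H\<close> and \<open>K\<close> on \<open>Z\<close>, while \<open>gH : H \<rightarrow> Z \<otimes> Y\<close> and \<open>gK : K \<rightarrow> Y \<otimes> Z\<close>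
  say that \<open>Y\<close> is inverse to \<open>Z\<close>. Axioms such as \<open>H_HZY\<close>, which
  compares the two ways from \<open>H\<close> to \<open>H \<otimes> Z \<otimes> Y\<close>, are coassociativity laws. The map \<open>S\<close> plays the role of the antipode, and
  \<open>\<omega>\<close> witnesses that \<open>Y\<close> is not zero.\<close>

locale galois = H: comod_cat H sc tc + K: comod_cat K sc tc + Z: kalg Z + Y: kalg Y
    + lZ: tensor_valued H Z Z lZ + rZ: tensor_valued Z K Z rZ
    + gH: tensor_valued Z Y H gH + gK: tensor_valued Y Z K gK
  for H :: "('k::field, 'a) hopf" and K :: "('k, 'b) hopf"
    and Z :: "('k, 'z) module" and Y :: "('k, 'y) module"
    and sc :: "'k => 'u" and tc :: "(('u \<times> 'u) \<Rightarrow>\<^sub>0 'k) => 'u"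
    and lZ rZ gH gK +
  fixes S :: "'z => 'y" and \<omega> :: "'y => 'k" and eZ :: "(('u \<times> 'z) \<Rightarrow>\<^sub>0 'k) => 'u"
  assumes eZ: "codes Z eZ" and S_lin: "linear_map Z Y S"
    and \<omega>_lf: "linfun Y \<omega>" and \<omega>_one: "\<omega> \<one>\<^bsub>Y\<^esub> = 1"
    and H_HZY: "\<lbrakk>c \<in> carrier H; trilin H Z Y F\<rbrakk> \<Longrightarrow>
      sw (gH c) (\<lambda>z y. sw (lZ z) (\<lambda>h z. F h z y)) =
      sw (comult H c) (\<lambda>h h'. sw (gH h') (\<lambda>z y. F h z y))"
    and Z_ZYZ: "\<lbrakk>a \<in> carrier Z; trilin Z Y Z F'\<rbrakk> \<Longrightarrow>
      sw (lZ a) (\<lambda>h b. sw (gH h) (\<lambda>z y. F' z y b)) =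
      sw (rZ a) (\<lambda>z k. sw (gK k) (\<lambda>y b. F' z y b))"
    and Z_HZK: "\<lbrakk>a \<in> carrier Z; trilin H Z K F''\<rbrakk> \<Longrightarrow>
      sw (rZ a) (\<lambda>b k. sw (lZ b) (\<lambda>h c. F'' h c k)) =
      sw (lZ a) (\<lambda>h b. sw (rZ b) (\<lambda>c k. F'' h c k))"
    and Z_ZKK: "\<lbrakk>a \<in> carrier Z; trilin Z K K F3\<rbrakk> \<Longrightarrow>
      sw (rZ a) (\<lambda>b k'. sw (rZ b) (\<lambda>c k. F3 c k k')) =
      sw (rZ a) (\<lambda>c x. sw (comult K x) (\<lambda>k k'. F3 c k k'))"
    and Z_counit: "\<lbrakk>a \<in> carrier Z; linfun Z f\<rbrakk> \<Longrightarrow> sw (rZ a) (\<lambda>b k. counit K k * f b) = f a"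
    and K_antipode: "\<lbrakk>k \<in> carrier K; linfun Y g\<rbrakk> \<Longrightarrow>
      sw (gK k) (\<lambda>y z. g (y \<otimes>\<^bsub>Y\<^esub> S z)) = counit K k * g \<one>\<^bsub>Y\<^esub>"
begin

lemma lf_S: "linfun Y (\<lambda>y. E y) ==> linfun Z (\<lambda>z. E (S z))"
  by (rule lf_linear_map[OF S_lin])

lemma S_closed: "z \<in> carrier Z ==> S z \<in> carrier Y"
  by (rule linear_map_closed[OF S_lin])

lemma lf_\<omega>1: "s \<in> carrier Y ==> linfun Y (\<lambda>y. \<omega> (y \<otimes>\<^bsub>Y\<^esub> s))"
  by (rule Y.lf_mult1[OF \<omega>_lf])

lemma lf_\<omega>2: "y \<in> carrier Y ==> linfun Z (\<lambda>a. \<omega> (y \<otimes>\<^bsub>Y\<^esub> S a))"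
  by (rule lf_S[OF Y.lf_mult2[OF \<omega>_lf]])

text \<open>For \<open>a\<close> in \<open>Z\<close> with left coaction \<open>h \<otimes> b\<close> and \<open>gH h = z \<otimes> y\<close> this is the identity \<open>z \<omega>(y S(b)) = a\<close>. By
  coassociativity \<open>z \<otimes> y \<otimes> b\<close> can be obtained from the right coaction and \<open>gK\<close> instead; then \<open>y S(b)\<close>
  collapses to a counit.\<close>

lemma galois_collapse:
  assumes a: "a \<in> carrier Z" and f: "linfun Z f"
  shows "sw (lZ a) (\<lambda>h b. sw (gH h) (\<lambda>z y. \<omega> (y \<otimes>\<^bsub>Y\<^esub> S b) * f z)) = f a"
proof -
  note rules = lf_mult_const f \<omega>_lf Y.lf_mult1 Y.lf_mult2 lf_S S_closed Y.lf_mult2[THEN lf_S]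
  have "sw (lZ a) (\<lambda>h b. sw (gH h) (\<lambda>z y. \<omega> (y \<otimes>\<^bsub>Y\<^esub> S b) * f z)) =
    sw (rZ a) (\<lambda>z k. sw (gK k) (\<lambda>y b. \<omega> (y \<otimes>\<^bsub>Y\<^esub> S b) * f z))"
    by (rule Z_ZYZ[OF a], rule tlI) (assumption | rule rules)+
  also have "\<dots> = sw (rZ a) (\<lambda>z k. counit K k * f z)"
    unfolding psum_mult_right using K_antipode[OF _ \<omega>_lf]
    by (intro psum_cong[OF rZ.pol[OF a]]) (simp add: \<omega>_one)
  also have "\<dots> = f a" by (rule Z_counit[OF a f])
  finally show ?thesis .
qed

text \<open>The relation that defines the cotensor product as an equaliser in \<open>V \<otimes> Z\<close>.\<close>

definition cotrel :: "('k, 'u, 'a) comodule => (('u \<times> 'z) \<Rightarrow>\<^sub>0 'k) => bool" where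
  "cotrel V p \<longleftrightarrow> (\<forall>F. trilin V H Z F \<longrightarrow>
     psum p (\<lambda>v a. sw (coact V v) (\<lambda>u h. F u h a)) = psum p (\<lambda>v a. sw (lZ a) (\<lambda>h b. F v h b)))"

abbreviation "amb V \<equiv> coded eZ V Z"
abbreviation "dZ \<equiv> inv_into UNIV eZ"
abbreviation zp :: "('k, 'u, 'a) comodule => 'u => 'z => 'u" where "zp V \<equiv> cpure eZ V Z"

definition cot :: "('k, 'u, 'a) comodule => ('k, 'u) module" where
  "cot V = \<lparr>carrier = {x \<in> carrier (amb V). cotrel V (dZ x)}, mult = undefined, one = undefined,
     zero = zero (amb V), add = add (amb V), smult = smult (amb V)\<rparr>"

text \<open>The projection \<open>v \<otimes> a \<mapsto> v\<^sub>0 \<otimes> z \<omega>(y S(a))\<close> with \<open>z \<otimes> y\<close> the image of \<open>v\<^sub>1\<close>, in the ambient coded tensor product.\<close>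

definition Pr :: "('k, 'u, 'a) comodule => 'u => 'z => 'u" where
  "Pr V v a = eval_tensor (amb V) (\<lambda>u h. eval_tensor (amb V)
     (\<lambda>z y. \<omega> (y \<otimes>\<^bsub>Y\<^esub> S a) \<odot>\<^bsub>amb V\<^esub> zp V u z) (rep (gH h))) (rep (coact V v))"

text \<open>The coaction on \<open>v \<otimes> a\<close> is \<open>v \<otimes> a\<^sub>0 \<otimes> a\<^sub>1\<close>. Its first two legs need not lie in the cotensor product for
  each summand separately; applying the projection to them puts them there and leaves the
  sum unchanged (\<open>coact_FO_amb\<close>).\<close>

definition FO :: "('k, 'u, 'a) comodule => ('k, 'u, 'b) comodule" where
  "FO V = module.extend (cot V) (comodule.fields
     (\<lambda>x. eval_tensor (tensor (cot V) K) (\<lambda>v a. eval_tensor (tensor (cot V) K)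
        (\<lambda>b k. pure (cot V) K (Pr V v b) k) (rep (rZ a))) (dZ x)))"

definition fm :: "('k, 'u, 'a) comodule => ('u => 'u) => 'u => 'u" where
  "fm W f x = eval_tensor (amb W) (\<lambda>v a. zp W (f v) a) (dZ x)"

definition FA :: "('k, 'u, 'a) comodule_arrow => ('k, 'u, 'b) comodule_arrow" where
  "FA A = (case A of (V, f, W) => K.arrow (FO V) (fm W f) (FO W))"

lemma FO_sel: "carrier (FO V) = {x \<in> carrier (amb V). cotrel V (dZ x)}" "zero (FO V) = zero (amb V)"
  "add (FO V) = add (amb V)" "smult (FO V) = smult (amb V)"
  by (simp_all add: FO_def cot_def module.defs)

lemma FO_cot: "tensor (cot V) X = tensor (FO V) X" "pure (cot V) X = pure (FO V) X"
  by (rule tensor_same; simp add: FO_sel cot_def)+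

lemma coact_FO_def: "coact (FO V) x = eval_tensor (tensor (FO V) K) (\<lambda>v a. eval_tensor (tensor (FO V) K)
        (\<lambda>b k. pure (FO V) K (Pr V v b) k) (rep (rZ a))) (dZ x)"
  unfolding FO_cot[symmetric] by (simp add: FO_def module.defs comodule.defs)

context
  fixes V assumes rV: "H.rc V"
begin

interpretation c: coding V Z eZ
  by (intro coding.intro two_spaces.intro coding_axioms.intro H.com_vs rV eZ Z.vs)

lemma zp_closed: "v \<in> carrier V ==> a \<in> carrier Z ==> zp V v a \<in> carrier (amb V)"
  by (rule c.cp_closed)

lemma dZ_pol: "x \<in> carrier (FO V) ==> dZ x \<in> pol V Z"
  by (simp add: FO_sel c.dec_pol)

lemma FO_eqI:
  assumes "x \<in> carrier (FO V)" "y \<in> carrier (FO V)"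
    "\<And>F. (\<And>a. a \<in> carrier Z ==> linfun V (\<lambda>v. F v a)) ==> (\<And>v. v \<in> carrier V ==> linfun Z (\<lambda>a. F v a)) ==>
      psum (dZ x) (\<lambda>v a. F v a) = psum (dZ y) (\<lambda>v a. F v a)"
  shows "x = y"
  using assms by (intro c.coded_eqI) (auto simp: FO_sel bilin_def)

lemma lf_dZ: "(\<And>a. a \<in> carrier Z ==> linfun V (\<lambda>v. F v a)) ==> (\<And>v. v \<in> carrier V ==> linfun Z (\<lambda>a. F v a)) ==>
   linfun (FO V) (\<lambda>x. psum (dZ x) (\<lambda>v a. F v a))"
  using c.lf_psum_dec[OF blI, of F] by (auto simp: linfun_def FO_sel)

lemma FO_cotrel:
  assumes "x \<in> carrier (FO V)"
    "\<And>h a. h \<in> carrier H ==> a \<in> carrier Z ==> linfun V (\<lambda>v. F v h a)"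
    "\<And>v a. v \<in> carrier V ==> a \<in> carrier Z ==> linfun H (\<lambda>h. F v h a)"
    "\<And>v h. v \<in> carrier V ==> h \<in> carrier H ==> linfun Z (\<lambda>a. F v h a)"
  shows "psum (dZ x) (\<lambda>v a. sw (coact V v) (\<lambda>u h. F u h a)) =
    psum (dZ x) (\<lambda>v a. sw (lZ a) (\<lambda>h b. F v h b))"
  using assms tlI[of H Z V F] by (simp add: FO_sel cotrel_def)

lemma vs_FO: "vec_space (FO V)"
proof (rule vec_spaceI_sep[where \<Phi> = "{\<lambda>x. psum (dZ x) F | F. bilin V Z F}"])
  have bls: "bilin V Z (\<lambda>v a. sw (coact V v) (\<lambda>u h. F u h a))" "bilin V Z (\<lambda>v a. sw (lZ a) (\<lambda>h b. F v h b))"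
    if F: "trilin V H Z F" for F
    by (rule blI; (assumption | rule tlD1[OF F] tlD2[OF F] tlD3[OF F] H.lf_com[OF rV] lf_psum_inner[OF H.com_pol[OF rV]]
        lf_psum_inner[OF lZ.pol] lZ.linfun)+)+
  show "\<zero>\<^bsub>FO V\<^esub> \<in> carrier (FO V)"
    by (simp add: FO_sel cotrel_def c.coded_ops_closed c.psum_dec_zero bls)
  show "x \<oplus>\<^bsub>FO V\<^esub> y \<in> carrier (FO V)" if "x \<in> carrier (FO V)" "y \<in> carrier (FO V)" for x y
    using that by (auto simp: FO_sel cotrel_def c.coded_ops_closed lf_add[OF c.lf_psum_dec] bls)
  show "a \<odot>\<^bsub>FO V\<^esub> y \<in> carrier (FO V)" if "y \<in> carrier (FO V)" for a y
    using that by (auto simp: FO_sel cotrel_def c.coded_ops_closed lf_smult[OF c.lf_psum_dec] bls)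
  show "x = y" if "x \<in> carrier (FO V)" "y \<in> carrier (FO V)" "\<And>f. f \<in> {\<lambda>x. psum (dZ x) F | F. bilin V Z F} ==> f x = f y" for x y
    using that(3) by (intro FO_eqI[OF that(1,2)]) (auto simp: bilin_def)
qed (auto simp: lf_dZ bilin_def FO_sel c.psum_dec_zero)

lemma Pr_term: "u \<in> carrier V ==> h \<in> carrier H ==> a \<in> carrier Z ==> eval_tensor (amb V)
     (\<lambda>z y. \<omega> (y \<otimes>\<^bsub>Y\<^esub> S a) \<odot>\<^bsub>amb V\<^esub> zp V u z) (rep (gH h)) \<in> carrier (amb V)"
  by (rule eval_tensor_closed[OF c.vec_space_coded gH.pol]) (auto intro: vs_smult c.vec_space_coded zp_closed)

lemma Pr_amb: "v \<in> carrier V ==> a \<in> carrier Z ==> Pr V v a \<in> carrier (amb V)"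
  unfolding Pr_def by (rule eval_tensor_closed[OF c.vec_space_coded H.com_pol[OF rV]]) (assumption | rule Pr_term)+

lemma lf_Pr_amb:
  assumes v: "v \<in> carrier V" and a: "a \<in> carrier Z" and f: "linfun (amb V) f"
  shows "f (Pr V v a) = sw (coact V v) (\<lambda>u h. sw (gH h) (\<lambda>z y. \<omega> (y \<otimes>\<^bsub>Y\<^esub> S a) * f (zp V u z)))"
  unfolding Pr_def
  apply (subst lf_eval_tensor[OF c.vec_space_coded H.com_pol[OF rV v] f])
   apply (rule Pr_term, assumption, assumption, rule a)
  apply (rule psum_cong[OF H.com_pol[OF rV v]])
  apply (subst lf_eval_tensor[OF c.vec_space_coded gH.pol f], assumption)
   apply (intro vs_smult c.vec_space_coded zp_closed, assumption, assumption)
  apply (rule psum_cong[OF gH.pol], assumption)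
  apply (rule lf_smult[OF f zp_closed], assumption, assumption)
  done

lemma psum_Pr:
  assumes v: "v \<in> carrier V" and a: "a \<in> carrier Z"
    and F: "\<And>a. a \<in> carrier Z ==> linfun V (\<lambda>v. F v a)" "\<And>v. v \<in> carrier V ==> linfun Z (\<lambda>a. F v a)"
  shows "psum (dZ (Pr V v a)) (\<lambda>v a. F v a) =
    sw (coact V v) (\<lambda>u h. sw (gH h) (\<lambda>z y. \<omega> (y \<otimes>\<^bsub>Y\<^esub> S a) * F u z))"
proof -
  have b: "bilin V Z F" by (rule blI[OF F])
  show ?thesis
    unfolding lf_Pr_amb[OF v a c.lf_psum_dec[OF b]]
    by (intro psum_cong[OF H.com_pol[OF rV v]] psum_cong[OF gH.pol]) (simp_all add: c.psum_cp b)
qed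

text \<open>By coassociativity for \<open>V\<close>, the coaction applied to \<open>v\<^sub>0\<close> splits off a factor of \<open>v\<^sub>1\<close>, and \<open>H_HZY\<close> lets the left
  coaction of \<open>Z\<close> split off the same factor.\<close>

lemma Pr_closed: assumes v: "v \<in> carrier V" and a: "a \<in> carrier Z" shows "Pr V v a \<in> carrier (FO V)"
proof -
  have "cotrel V (dZ (Pr V v a))"
    unfolding cotrel_def
  proof (intro allI impI)
    fix F assume F: "trilin V H Z F"
    note rules = tlD1[OF F] tlD2[OF F] tlD3[OF F] lf_\<omega>1 lf_\<omega>2 S_closed a lf_mult_const H.lf_com[OF rV]
      lf_psum_inner[OF H.com_pol[OF rV]] lf_psum_inner[OF lZ.pol] lf_psum_inner[OF gH.pol] lZ.linfun gH.linfun
    have "psum (dZ (Pr V v a)) (\<lambda>v a. sw (coact V v) (\<lambda>u h. F u h a)) =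
      sw (coact V v) (\<lambda>u h. sw (gH h) (\<lambda>z y. \<omega> (y \<otimes>\<^bsub>Y\<^esub> S a) * sw (coact V u) (\<lambda>u h. F u h z)))"
      by (rule psum_Pr[OF v a]) (assumption | rule rules)+
    also have "\<dots> = sw (coact V v) (\<lambda>u h. sw (coact V u) (\<lambda>u' h'. sw (gH h) (\<lambda>z y. \<omega> (y \<otimes>\<^bsub>Y\<^esub> S a) * F u' h' z)))"
      unfolding psum_mult_left[symmetric] by (intro psum_cong[OF H.com_pol[OF rV v]] psum_swap)
    also have "\<dots> = sw (coact V v) (\<lambda>u x. sw (comult H x) (\<lambda>h' h. sw (gH h) (\<lambda>z y. \<omega> (y \<otimes>\<^bsub>Y\<^esub> S a) * F u h' z)))"
      by (rule H.com_coassoc[OF rV v], rule tlI) (assumption | rule rules)+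
    also have "\<dots> = sw (coact V v) (\<lambda>u x. sw (gH x) (\<lambda>z y. sw (lZ z) (\<lambda>h z. \<omega> (y \<otimes>\<^bsub>Y\<^esub> S a) * F u h z)))"
      by (intro psum_cong[OF H.com_pol[OF rV v]] H_HZY[symmetric] tlI) (assumption | rule rules)+
    also have "\<dots> = psum (dZ (Pr V v a)) (\<lambda>v a. sw (lZ a) (\<lambda>h b. F v h b))"
      unfolding psum_mult_left by (rule psum_Pr[OF v a, symmetric]) (assumption | rule rules)+
    finally show "psum (dZ (Pr V v a)) (\<lambda>v a. sw (coact V v) (\<lambda>u h. F u h a)) =
      psum (dZ (Pr V v a)) (\<lambda>v a. sw (lZ a) (\<lambda>h b. F v h b))" .
  qed
  then show ?thesis using Pr_amb[OF v a] by (simp add: FO_sel)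
qed

lemma bmap_Pr: "bmap V Z (FO V) (Pr V)"
proof (rule bmapI[OF Pr_closed])
  note rules = lf_\<omega>1 lf_\<omega>2 S_closed lf_mult_const H.lf_com[OF rV] blD1[OF c.bl_cp] blD2[OF c.bl_cp]
      lf_psum_inner[OF H.com_pol[OF rV]] lf_psum_inner[OF gH.pol] gH.linfun
  have bm: "bmap V Z (amb V) (Pr V)"
  proof (rule bmapI[OF Pr_amb])
    show "linfun V (\<lambda>v. f (Pr V v a))" if f: "linfun (amb V) f" and a: "a \<in> carrier Z" for f a
      by (subst lf_cong[OF lf_Pr_amb[OF _ a f] c.V], assumption) (assumption | rule rules a f)+
    show "linfun Z (\<lambda>a. f (Pr V v a))" if f: "linfun (amb V) f" and v: "v \<in> carrier V" for f v
      by (subst lf_cong[OF lf_Pr_amb[OF v _ f] Z.vs], assumption) (assumption | rule rules v f)+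
  qed
  fix f assume f: "linfun (FO V) f"
  show "linfun V (\<lambda>v. f (Pr V v a))" if a: "a \<in> carrier Z" for a
  proof -
    have "linear_map V (FO V) (\<lambda>v. Pr V v a)"
      using linear_map_bmap1[OF c.V c.vec_space_coded bm a] Pr_closed[OF _ a] by (auto simp: linear_map_def FO_sel)
    then show ?thesis by (rule lf_linear_map[OF _ f])
  qed
  show "linfun Z (\<lambda>a. f (Pr V v a))" if v: "v \<in> carrier V" for v
  proof -
    have "linear_map Z (FO V) (\<lambda>a. Pr V v a)"
      using linear_map_bmap2[OF Z.vs c.vec_space_coded bm v] Pr_closed[OF v] by (auto simp: linear_map_def FO_sel)
    then show ?thesis by (rule lf_linear_map[OF _ f])
  qed
qed

lemmas lf_Pr1 = lf_bmap1[OF bmap_Pr]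
lemmas lf_Pr2 = lf_bmap2[OF bmap_Pr]

text \<open>On the cotensor product the coaction of \<open>V\<close> may be replaced by that of \<open>Z\<close>, and then \<open>galois_collapse\<close> shows that
  the projection acts as the identity, here after the right coaction of \<open>Z\<close> as well.\<close>

lemma Pr_collapse:
  assumes x: "x \<in> carrier (FO V)" and F: "trilin V Z K F"
  shows "psum (dZ x) (\<lambda>v a. sw (rZ a) (\<lambda>b k. psum (dZ (Pr V v b)) (\<lambda>v a. F v a k))) =
    psum (dZ x) (\<lambda>v a. sw (rZ a) (\<lambda>b k. F v b k))"
proof -
  note rules = tlD1[OF F] tlD2[OF F] tlD3[OF F] lf_\<omega>1 lf_\<omega>2 S_closed lf_mult_const H.lf_com[OF rV]
      lf_psum_inner[OF H.com_pol[OF rV]] lf_psum_inner[OF lZ.pol] lf_psum_inner[OF rZ.pol] lf_psum_inner[OF gH.pol] lZ.linfun rZ.linfun gH.linfun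
  have "psum (dZ x) (\<lambda>v a. sw (rZ a) (\<lambda>b k. psum (dZ (Pr V v b)) (\<lambda>v a. F v a k))) =
    psum (dZ x) (\<lambda>v a. sw (rZ a) (\<lambda>b k. sw (coact V v) (\<lambda>u h. sw (gH h) (\<lambda>z y. \<omega> (y \<otimes>\<^bsub>Y\<^esub> S b) * F u z k))))"
    by (intro psum_cong[OF dZ_pol[OF x]] psum_cong[OF rZ.pol] psum_Pr) (assumption | rule rules)+
  also have "\<dots> = psum (dZ x) (\<lambda>v a. sw (coact V v) (\<lambda>u h. sw (rZ a) (\<lambda>b k. sw (gH h) (\<lambda>z y. \<omega> (y \<otimes>\<^bsub>Y\<^esub> S b) * F u z k))))"
    by (intro psum_cong[OF dZ_pol[OF x]] psum_swap)
  also have "\<dots> = psum (dZ x) (\<lambda>v a. sw (lZ a) (\<lambda>h a'. sw (rZ a') (\<lambda>b k. sw (gH h) (\<lambda>z y. \<omega> (y \<otimes>\<^bsub>Y\<^esub> S b) * F v z k))))"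
    by (rule FO_cotrel[OF x]) (assumption | rule rules)+
  also have "\<dots> = psum (dZ x) (\<lambda>v a. sw (rZ a) (\<lambda>a' k. sw (lZ a') (\<lambda>h b. sw (gH h) (\<lambda>z y. \<omega> (y \<otimes>\<^bsub>Y\<^esub> S b) * F v z k))))"
    by (intro psum_cong[OF dZ_pol[OF x]] Z_HZK[symmetric] tlI) (assumption | rule rules)+
  also have "\<dots> = psum (dZ x) (\<lambda>v a. sw (rZ a) (\<lambda>b k. F v b k))"
    by (intro psum_cong[OF dZ_pol[OF x]] psum_cong[OF rZ.pol] galois_collapse) (assumption | rule rules)+
  finally show ?thesis .
qed

lemma Pr_collapse':
  assumes x: "x \<in> carrier (FO V)" and F: "bilin V Z F"
  shows "psum (dZ x) (\<lambda>v a. psum (dZ (Pr V v a)) (\<lambda>v a. F v a)) = psum (dZ x) (\<lambda>v a. F v a)"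
proof -
  note rules = blD1[OF F] blD2[OF F] lf_\<omega>1 lf_\<omega>2 S_closed lf_mult_const H.lf_com[OF rV]
      lf_psum_inner[OF H.com_pol[OF rV]] lf_psum_inner[OF lZ.pol] lf_psum_inner[OF gH.pol] lZ.linfun gH.linfun
  have "psum (dZ x) (\<lambda>v a. psum (dZ (Pr V v a)) (\<lambda>v a. F v a)) =
    psum (dZ x) (\<lambda>v a. sw (coact V v) (\<lambda>u h. sw (gH h) (\<lambda>z y. \<omega> (y \<otimes>\<^bsub>Y\<^esub> S a) * F u z)))"
    by (intro psum_cong[OF dZ_pol[OF x]] psum_Pr) (assumption | rule rules)+
  also have "\<dots> = psum (dZ x) (\<lambda>v a. sw (lZ a) (\<lambda>h b. sw (gH h) (\<lambda>z y. \<omega> (y \<otimes>\<^bsub>Y\<^esub> S b) * F v z)))"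
    by (rule FO_cotrel[OF x]) (assumption | rule rules)+
  also have "\<dots> = psum (dZ x) (\<lambda>v a. F v a)"
    by (intro psum_cong[OF dZ_pol[OF x]] galois_collapse) (assumption | rule rules)+
  finally show ?thesis .
qed

text \<open>Consequently an element of the cotensor product is a sum of projected pure tensors, and functionals on the
  cotensor product are determined by their values there (\<open>lf_FO_eq\<close>).\<close>

lemma eval_Pr: assumes x: "x \<in> carrier (FO V)" shows "eval_tensor (FO V) (Pr V) (dZ x) = x"
proof (rule FO_eqI[OF _ x])
  show "eval_tensor (FO V) (Pr V) (dZ x) \<in> carrier (FO V)"
    by (rule eval_tensor_closed[OF vs_FO dZ_pol[OF x] Pr_closed])
  fix F assume F: "\<And>a. a \<in> carrier Z ==> linfun V (\<lambda>v. F v a)" "\<And>v. v \<in> carrier V ==> linfun Z (\<lambda>a. F v a)"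
  have "psum (dZ (eval_tensor (FO V) (Pr V) (dZ x))) (\<lambda>v a. F v a) = psum (dZ x) (\<lambda>v a. psum (dZ (Pr V v a)) (\<lambda>v a. F v a))"
    by (rule lf_eval_tensor[OF vs_FO dZ_pol[OF x] lf_dZ[OF F] Pr_closed])
  also have "\<dots> = psum (dZ x) (\<lambda>v a. F v a)" by (rule Pr_collapse'[OF x blI[OF F]])
  finally show "psum (dZ (eval_tensor (FO V) (Pr V) (dZ x))) (\<lambda>v a. F v a) = psum (dZ x) (\<lambda>v a. F v a)" .
qed

lemma lf_FO_eq: assumes x: "x \<in> carrier (FO V)" and f: "linfun (FO V) f"
  shows "f x = psum (dZ x) (\<lambda>v a. f (Pr V v a))"
proof -
  have "f x = f (eval_tensor (FO V) (Pr V) (dZ x))" by (simp add: eval_Pr[OF x])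
  also have "\<dots> = psum (dZ x) (\<lambda>v a. f (Pr V v a))" by (rule lf_eval_tensor[OF vs_FO dZ_pol[OF x] f Pr_closed])
  finally show ?thesis .
qed

interpretation FK: two_spaces "FO V" K
  by (rule two_spaces.intro) (rule vs_FO, rule K.vs)

lemma coact_FO_term: "v \<in> carrier V ==> a \<in> carrier Z ==>
   eval_tensor (tensor (FO V) K) (\<lambda>b k. pure (FO V) K (Pr V v b) k) (rep (rZ a)) \<in> carrier (tensor (FO V) K)"
  by (rule eval_tensor_closed[OF FK.vec_space_tensor rZ.pol]) (auto intro: FK.pure_closed Pr_closed)

lemma coact_FO_closed: "x \<in> carrier (FO V) ==> coact (FO V) x \<in> carrier (tensor (FO V) K)"
  unfolding coact_FO_def by (rule eval_tensor_closed[OF FK.vec_space_tensor dZ_pol coact_FO_term])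

lemma coact_FO:
  assumes x: "x \<in> carrier (FO V)" and G: "\<And>k. k \<in> carrier K ==> linfun (FO V) (\<lambda>m. G m k)" "\<And>m. m \<in> carrier (FO V) ==> linfun K (\<lambda>k. G m k)"
  shows "sw (coact (FO V) x) (\<lambda>m k. G m k) = psum (dZ x) (\<lambda>v a. sw (rZ a) (\<lambda>b k. G (Pr V v b) k))"
proof -
  have b: "bilin (FO V) K G" by (rule blI[OF G])
  note l = FK.lf_psum_rep[OF b]
  show ?thesis
    unfolding coact_FO_def
    apply (subst lf_eval_tensor[OF FK.vec_space_tensor dZ_pol[OF x] l coact_FO_term], assumption, assumption)
    apply (rule psum_cong[OF dZ_pol[OF x]])
    apply (subst lf_eval_tensor[OF FK.vec_space_tensor rZ.pol l], assumption)
     apply (rule FK.pure_closed[OF Pr_closed], assumption+)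
    apply (rule psum_cong[OF rZ.pol], assumption)
    apply (rule FK.psum_pure[OF Pr_closed _ b], assumption+)
    done
qed

lemma coact_FO_lin: "linear_map (FO V) (tensor (FO V) K) (coact (FO V))"
proof (rule linear_mapI_lf[OF vs_FO FK.vec_space_tensor coact_FO_closed])
  fix f assume f: "linfun (tensor (FO V) K) f"
  have b: "bilin (FO V) K (\<lambda>m k. f (pure (FO V) K m k))" by (rule FK.bl_pure[OF f])
  have eq: "f (coact (FO V) x) = psum (dZ x) (\<lambda>v a. sw (rZ a) (\<lambda>c k. f (pure (FO V) K (Pr V v c) k)))"
    if x: "x \<in> carrier (FO V)" for x
    unfolding FK.lf_tensor_eq[OF f coact_FO_closed[OF x]]
    by (rule coact_FO[OF x]) (rule blD1[OF b], assumption, rule blD2[OF b], assumption)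
  show "linfun (FO V) (\<lambda>x. f (coact (FO V) x))"
    apply (subst lf_cong[OF eq vs_FO], assumption)
    apply (rule lf_dZ)
     apply (rule lf_psum_inner[OF rZ.pol], assumption, rule lf_Pr1[OF blD1[OF b]], assumption, assumption)
    apply (rule rZ.linfun, rule lf_Pr2[OF blD1[OF b]], assumption, assumption, rule blD2[OF b Pr_closed], assumption, assumption)
    done
qed

lemma lf_coact_FO: "(\<And>k. k \<in> carrier K ==> linfun (FO V) (\<lambda>m. G m k)) ==> (\<And>m. m \<in> carrier (FO V) ==> linfun K (\<lambda>k. G m k)) ==>
    linfun (FO V) (\<lambda>x. sw (coact (FO V) x) (\<lambda>m k. G m k))"
  by (rule lf_linear_map[OF coact_FO_lin FK.lf_psum_rep]) (rule blI)

lemma coact_FO_pol: "x \<in> carrier (FO V) ==> rep (coact (FO V) x) \<in> pol (FO V) K"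
  by (rule FK.rep_pol[OF coact_FO_closed])

text \<open>In \<open>V \<otimes> Z \<otimes> K\<close> the projection inside the coaction disappears.\<close>

lemma coact_FO_amb:
  assumes x: "x \<in> carrier (FO V)"
    and F: "\<And>a k. a \<in> carrier Z ==> k \<in> carrier K ==> linfun V (\<lambda>v. F v a k)"
      "\<And>v k. v \<in> carrier V ==> k \<in> carrier K ==> linfun Z (\<lambda>a. F v a k)"
      "\<And>v a. v \<in> carrier V ==> a \<in> carrier Z ==> linfun K (\<lambda>k. F v a k)"
  shows "sw (coact (FO V) x) (\<lambda>m k. psum (dZ m) (\<lambda>v a. F v a k)) =
    psum (dZ x) (\<lambda>v a. sw (rZ a) (\<lambda>b k. F v b k))"
proof -
  have "sw (coact (FO V) x) (\<lambda>m k. psum (dZ m) (\<lambda>v a. F v a k)) =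
    psum (dZ x) (\<lambda>v a. sw (rZ a) (\<lambda>b k. psum (dZ (Pr V v b)) (\<lambda>v a. F v a k)))"
    by (rule coact_FO[OF x]) (assumption | rule lf_dZ F lf_psum_inner[OF dZ_pol])+
  also have "\<dots> = psum (dZ x) (\<lambda>v a. sw (rZ a) (\<lambda>b k. F v b k))"
    by (rule Pr_collapse[OF x], rule tlI) (assumption | rule F)+
  finally show ?thesis .
qed

lemma rc_FO: "K.rc (FO V)"
  unfolding K.right_comodule_iff
proof (intro conjI ballI allI impI vs_FO coact_FO_lin)
  fix x F assume x: "x \<in> carrier (FO V)" and F: "trilin (FO V) K K F"
  note rules = tlD1[OF F] tlD2[OF F] tlD3[OF F] lf_Pr1 lf_Pr2 lf_coact_FO lf_psum_inner[OF coact_FO_pol] Pr_closed rZ.linfun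
    lf_psum_inner[OF rZ.pol] K.lf_comult lf_psum_inner[OF K.comult_pol]
  have "sw (coact (FO V) x) (\<lambda>m k'. sw (coact (FO V) m) (\<lambda>m' k. F m' k k')) =
    sw (coact (FO V) x) (\<lambda>m k'. psum (dZ m) (\<lambda>v a. sw (rZ a) (\<lambda>b k. F (Pr V v b) k k')))"
    by (intro psum_cong[OF coact_FO_pol[OF x]] coact_FO) (assumption | rule rules)+
  also have "\<dots> = psum (dZ x) (\<lambda>v a. sw (rZ a) (\<lambda>b k'. sw (rZ b) (\<lambda>c k. F (Pr V v c) k k')))"
    by (rule coact_FO_amb[OF x]) (assumption | rule rules)+
  also have "\<dots> = psum (dZ x) (\<lambda>v a. sw (rZ a) (\<lambda>c y. sw (comult K y) (\<lambda>k k'. F (Pr V v c) k k')))"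
    by (intro psum_cong[OF dZ_pol[OF x]] Z_ZKK tlI) (assumption | rule rules)+
  also have "\<dots> = sw (coact (FO V) x) (\<lambda>m y. sw (comult K y) (\<lambda>k k'. F m k k'))"
    by (rule coact_FO[OF x, symmetric]) (assumption | rule rules)+
  finally show "sw (coact (FO V) x) (\<lambda>m k'. sw (coact (FO V) m) (\<lambda>m' k. F m' k k')) =
    sw (coact (FO V) x) (\<lambda>m y. sw (comult K y) (\<lambda>k k'. F m k k'))" .
next
  fix x f assume x: "x \<in> carrier (FO V)" and f: "linfun (FO V) f"
  have "sw (coact (FO V) x) (\<lambda>m k. counit K k * f m) = psum (dZ x) (\<lambda>v a. sw (rZ a) (\<lambda>b k. counit K k * f (Pr V v b)))"
    by (rule coact_FO[OF x]) (assumption | rule lf_mult_const f K.counit_lf)+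
  also have "\<dots> = psum (dZ x) (\<lambda>v a. f (Pr V v a))"
    by (intro psum_cong[OF dZ_pol[OF x]] Z_counit lf_Pr2[OF f])
  also have "\<dots> = f x" by (rule lf_FO_eq[OF x f, symmetric])
  finally show "sw (coact (FO V) x) (\<lambda>u a. counit K a * f u) = f x" .
qed

end

context
  fixes V f W assumes f: "H.colin V f W"
begin

interpretation rV: coding V Z eZ
  by (intro coding.intro two_spaces.intro coding_axioms.intro H.com_vs H.cm_rc(1)[OF f] eZ Z.vs)

interpretation cW: coding W Z eZ
  by (intro coding.intro two_spaces.intro coding_axioms.intro H.com_vs H.cm_rc(2)[OF f] eZ Z.vs)

lemma fm_amb: "x \<in> carrier (FO V) ==> fm W f x \<in> carrier (amb W)"
  unfolding fm_def
  by (rule eval_tensor_closed[OF cW.vec_space_coded dZ_pol[OF H.cm_rc(1)[OF f]]])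
     (auto intro: cW.cp_closed H.cm_closed[OF f])

lemma psum_fm:
  assumes x: "x \<in> carrier (FO V)" and F: "\<And>a. a \<in> carrier Z ==> linfun W (\<lambda>v. F v a)" "\<And>v. v \<in> carrier W ==> linfun Z (\<lambda>a. F v a)"
  shows "psum (dZ (fm W f x)) (\<lambda>v a. F v a) = psum (dZ x) (\<lambda>v a. F (f v) a)"
proof -
  have b: "bilin W Z F" by (rule blI[OF F])
  show ?thesis
    unfolding fm_def
    apply (subst lf_eval_tensor[OF cW.vec_space_coded dZ_pol[OF H.cm_rc(1)[OF f] x] cW.lf_psum_dec[OF b]])
     apply (rule cW.cp_closed[OF H.cm_closed[OF f]], assumption, assumption)
    apply (rule psum_cong[OF dZ_pol[OF H.cm_rc(1)[OF f] x]])
    apply (rule cW.psum_cp[OF H.cm_closed[OF f] _ b], assumption, assumption)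
    done
qed

lemma fm_closed: assumes x: "x \<in> carrier (FO V)" shows "fm W f x \<in> carrier (FO W)"
proof -
  note R = H.cm_rc[OF f]
  have "cotrel W (dZ (fm W f x))"
    unfolding cotrel_def
  proof (intro allI impI)
    fix F assume F: "trilin W H Z F"
    note rules = tlD1[OF F] tlD2[OF F] tlD3[OF F] H.lf_com[OF R(1)] H.lf_com[OF R(2)] lf_psum_inner[OF H.com_pol[OF R(1)]]
      lf_psum_inner[OF H.com_pol[OF R(2)]] lZ.linfun lf_psum_inner[OF lZ.pol] H.cm_closed[OF f]
      lf_linear_map[OF H.cm_lin[OF f], where f = "\<lambda>v. F v _ _"]
    have "psum (dZ (fm W f x)) (\<lambda>v a. sw (coact W v) (\<lambda>u h. F u h a)) =
      psum (dZ x) (\<lambda>v a. sw (coact W (f v)) (\<lambda>u h. F u h a))"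
      by (rule psum_fm[OF x]) (assumption | rule rules)+
    also have "\<dots> = psum (dZ x) (\<lambda>v a. sw (coact V v) (\<lambda>u h. F (f u) h a))"
      by (intro psum_cong[OF dZ_pol[OF R(1) x]] H.cm_coact[OF f]) (assumption | rule rules)+
    also have "\<dots> = psum (dZ x) (\<lambda>v a. sw (lZ a) (\<lambda>h b. F (f v) h b))"
      by (rule FO_cotrel[OF R(1) x]) (assumption | rule rules)+
    also have "\<dots> = psum (dZ (fm W f x)) (\<lambda>v a. sw (lZ a) (\<lambda>h b. F v h b))"
      by (rule psum_fm[OF x, symmetric]) (assumption | rule rules)+
    finally show "psum (dZ (fm W f x)) (\<lambda>v a. sw (coact W v) (\<lambda>u h. F u h a)) =
      psum (dZ (fm W f x)) (\<lambda>v a. sw (lZ a) (\<lambda>h b. F v h b))" .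
  qed
  then show ?thesis using fm_amb[OF x] by (simp add: FO_sel)
qed

lemma fm_lin: "linear_map (FO V) (FO W) (fm W f)"
proof -
  note R = H.cm_rc[OF f]
  have add: "fm W f (x \<oplus>\<^bsub>FO V\<^esub> y) = fm W f x \<oplus>\<^bsub>FO W\<^esub> fm W f y" if x: "x \<in> carrier (FO V)" and y: "y \<in> carrier (FO V)" for x y
  proof (rule FO_eqI[OF R(2)])
    fix F assume F: "\<And>a. a \<in> carrier Z ==> linfun W (\<lambda>v. F v a)" "\<And>v. v \<in> carrier W ==> linfun Z (\<lambda>a. F v a)"
    have l: "linfun (FO V) (\<lambda>x. psum (dZ x) (\<lambda>v a. F (f v) a))"
      by (intro lf_dZ[OF R(1)] lf_linear_map[OF H.cm_lin[OF f] F(1)] F(2) H.cm_closed[OF f])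
    show "psum (dZ (fm W f (x \<oplus>\<^bsub>FO V\<^esub> y))) (\<lambda>v a. F v a) = psum (dZ (fm W f x \<oplus>\<^bsub>FO W\<^esub> fm W f y)) (\<lambda>v a. F v a)"
      using x y by (simp add: lf_add[OF lf_dZ[OF R(2) F]] fm_closed psum_fm F vs_add[OF vs_FO[OF R(1)]] lf_add[OF l])
  qed (simp_all add: x y fm_closed vs_add[OF vs_FO[OF R(1)]] vs_add[OF vs_FO[OF R(2)]])
  have sm: "fm W f (c \<odot>\<^bsub>FO V\<^esub> x) = c \<odot>\<^bsub>FO W\<^esub> fm W f x" if x: "x \<in> carrier (FO V)" for c x
  proof (rule FO_eqI[OF R(2)])
    fix F assume F: "\<And>a. a \<in> carrier Z ==> linfun W (\<lambda>v. F v a)" "\<And>v. v \<in> carrier W ==> linfun Z (\<lambda>a. F v a)"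
    have l: "linfun (FO V) (\<lambda>x. psum (dZ x) (\<lambda>v a. F (f v) a))"
      by (intro lf_dZ[OF R(1)] lf_linear_map[OF H.cm_lin[OF f] F(1)] F(2) H.cm_closed[OF f])
    show "psum (dZ (fm W f (c \<odot>\<^bsub>FO V\<^esub> x))) (\<lambda>v a. F v a) = psum (dZ (c \<odot>\<^bsub>FO W\<^esub> fm W f x)) (\<lambda>v a. F v a)"
      using x by (simp add: lf_smult[OF lf_dZ[OF R(2) F]] fm_closed psum_fm F vs_smult[OF vs_FO[OF R(1)]] lf_smult[OF l])
  qed (simp_all add: x fm_closed vs_smult[OF vs_FO[OF R(1)]] vs_smult[OF vs_FO[OF R(2)]])
  show ?thesis using add sm fm_closed by (auto simp: linear_map_def)
qed

lemma fm_Pr: assumes v: "v \<in> carrier V" and a: "a \<in> carrier Z" shows "fm W f (Pr V v a) = Pr W (f v) a"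
proof (rule FO_eqI[OF H.cm_rc(2)[OF f]])
  note R = H.cm_rc[OF f]
  fix F assume F: "\<And>a. a \<in> carrier Z ==> linfun W (\<lambda>v. F v a)" "\<And>v. v \<in> carrier W ==> linfun Z (\<lambda>a. F v a)"
  note rules = F lf_linear_map[OF H.cm_lin[OF f] F(1)] H.cm_closed[OF f] lf_mult_const lf_psum_inner[OF gH.pol] gH.linfun
    lf_\<omega>1 S_closed a
  have "psum (dZ (fm W f (Pr V v a))) (\<lambda>v a. F v a) = psum (dZ (Pr V v a)) (\<lambda>v a. F (f v) a)"
    by (rule psum_fm[OF Pr_closed[OF R(1) v a]]) (rule F, assumption)+
  also have "\<dots> = sw (coact V v) (\<lambda>u h. sw (gH h) (\<lambda>z y. \<omega> (y \<otimes>\<^bsub>Y\<^esub> S a) * F (f u) z))"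
    by (rule psum_Pr[OF R(1) v a]) (assumption | rule rules)+
  also have "\<dots> = sw (coact W (f v)) (\<lambda>u h. sw (gH h) (\<lambda>z y. \<omega> (y \<otimes>\<^bsub>Y\<^esub> S a) * F u z))"
    by (rule H.cm_coact[OF f v, symmetric]) (assumption | rule rules)+
  also have "\<dots> = psum (dZ (Pr W (f v) a)) (\<lambda>v a. F v a)"
    by (rule psum_Pr[OF R(2) H.cm_closed[OF f v] a, symmetric]) (assumption | rule rules)+
  finally show "psum (dZ (fm W f (Pr V v a))) (\<lambda>v a. F v a) = psum (dZ (Pr W (f v) a)) (\<lambda>v a. F v a)" .
qed (simp_all add: fm_closed Pr_closed H.cm_rc[OF f] v a H.cm_closed[OF f])

lemma cm_fm: "K.colin (FO V) (fm W f) (FO W)"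
proof (rule K.cmI)
  note R = H.cm_rc[OF f]
  show "K.rc (FO V)" "K.rc (FO W)" "linear_map (FO V) (FO W) (fm W f)" by (simp_all add: rc_FO R fm_lin)
  fix x G assume x: "x \<in> carrier (FO V)" and G: "bilin (FO W) K G"
  note rules = blD1[OF G] blD2[OF G] lf_Pr1[OF R(2)] lf_Pr2[OF R(2)] Pr_closed[OF R(2)] rZ.linfun lf_psum_inner[OF rZ.pol]
    lf_linear_map[OF fm_lin] fm_closed
  have "sw (coact (FO W) (fm W f x)) (\<lambda>w k. G w k) = psum (dZ (fm W f x)) (\<lambda>v a. sw (rZ a) (\<lambda>b k. G (Pr W v b) k))"
    by (rule coact_FO[OF R(2) fm_closed[OF x]]) (assumption | rule rules)+
  also have "\<dots> = psum (dZ x) (\<lambda>v a. sw (rZ a) (\<lambda>b k. G (Pr W (f v) b) k))"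
    by (rule psum_fm[OF x]) (assumption | rule rules)+
  also have "\<dots> = psum (dZ x) (\<lambda>v a. sw (rZ a) (\<lambda>b k. G (fm W f (Pr V v b)) k))"
    by (intro psum_cong[OF dZ_pol[OF R(1) x]] psum_cong[OF rZ.pol]) (simp_all add: fm_Pr)
  also have "\<dots> = sw (coact (FO V) x) (\<lambda>u k. G (fm W f u) k)"
    by (rule coact_FO[OF R(1) x, symmetric]) (assumption | rule rules)+
  finally show "sw (coact (FO W) (fm W f x)) (\<lambda>w k. G w k) = sw (coact (FO V) x) (\<lambda>u k. G (fm W f u) k)" .
qed

end

lemma FA_ar: assumes f: "H.colin V f W" shows "FA (H.arrow V f W) = K.arrow (FO V) (fm W f) (FO W)"
proof -
  let ?f = "restrict f (carrier V)"
  have f': "H.colin V ?f W" using f H.cm_cong[of V ?f f W] by simp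
  note R = H.cm_rc[OF f]
  have pw: "fm W ?f x = fm W f x" if x: "x \<in> carrier (FO V)" for x
    by (rule FO_eqI[OF R(2) fm_closed[OF f' x] fm_closed[OF f x]])
      (auto simp: psum_fm[OF f' x] psum_fm[OF f x] intro!: psum_cong[OF dZ_pol[OF R(1) x]])
  show ?thesis unfolding FA_def H.arrow_def prod.case by (rule K.ar_eqI) (rule pw)
qed

theorem functor_F: "cat_functor H.CC K.CC FO FA"
proof (intro cat_functor.intro cat_functor_axioms.intro H.category_CC K.category_CC)
  show "FO V \<in> Obj K.CC" if "V \<in> Obj H.CC" for V using that by (simp add: H.Obj_CC K.Obj_CC rc_FO)
  show "FA A \<in> Hom K.CC (FO V) (FO W)" if "A \<in> Hom H.CC V W" for A V W
    using that by (auto elim!: H.HomE simp: FA_ar intro!: K.HomI cm_fm)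
  show "FA (Id H.CC V) = Id K.CC (FO V)" if "V \<in> Obj H.CC" for V
  proof -
    have R: "H.rc V" using that by (simp add: H.Obj_CC)
    have "fm V (\<lambda>x. x) x = x" if x: "x \<in> carrier (FO V)" for x
      by (rule FO_eqI[OF R fm_closed[OF H.cm_id[OF R] x] x]) (simp add: psum_fm[OF H.cm_id[OF R] x])
    then show ?thesis
      unfolding H.Id_CC K.Id_CC FA_ar[OF H.cm_id[OF R]] by (rule K.ar_eqI)
  qed
  show "FA (B \<cdot>\<^bsub>H.CC\<^esub> A) = FA B \<cdot>\<^bsub>K.CC\<^esub> FA A" if A: "A \<in> Hom H.CC V W" and B: "B \<in> Hom H.CC W U" for A B V W U
  proof -
    obtain f where f: "A = H.arrow V f W" "H.colin V f W" using A by (rule H.HomE)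
    obtain g where g: "B = H.arrow W g U" "H.colin W g U" using B by (rule H.HomE)
    note R = H.cm_rc[OF f(2)] H.cm_rc[OF g(2)]
    note gf = H.cm_comp[OF f(2) g(2)]
    have pw: "fm U (\<lambda>x. g (f x)) x = fm U g (fm W f x)" if x: "x \<in> carrier (FO V)" for x
    proof (rule FO_eqI[OF R(4) fm_closed[OF gf x] fm_closed[OF g(2) fm_closed[OF f(2) x]]])
      fix F assume F: "\<And>a. a \<in> carrier Z ==> linfun U (\<lambda>v. F v a)" "\<And>v. v \<in> carrier U ==> linfun Z (\<lambda>a. F v a)"
      have "psum (dZ (fm W f x)) (\<lambda>v a. F (g v) a) = psum (dZ x) (\<lambda>v a. F (g (f v)) a)"
        by (rule psum_fm[OF f(2) x]) (auto intro: F H.cm_closed[OF g(2)] lf_linear_map[OF H.cm_lin[OF g(2)] F(1)])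
      then show "psum (dZ (fm U (\<lambda>x. g (f x)) x)) (\<lambda>v a. F v a) = psum (dZ (fm U g (fm W f x))) (\<lambda>v a. F v a)"
        by (simp add: psum_fm[OF gf x F] psum_fm[OF g(2) fm_closed[OF f(2) x] F])
    qed
    show ?thesis
      unfolding f g H.Comp_CC[OF f(2)] FA_ar[OF gf] FA_ar[OF f(2)] FA_ar[OF g(2)] K.Comp_CC[OF cm_fm[OF f(2)]]
      by (rule K.ar_eqI) (rule pw)
  qed
qed

end

context galois
begin

context
  fixes V assumes rV: "H.rc V"
begin

text \<open>The projection is also the identity on \<open>v\<^sub>0 \<otimes> z\<close> when \<open>z \<otimes> y\<close> comes from \<open>v\<^sub>1\<close>: this tensor lies in the cotensor product
  up to the remaining factor \<open>y\<close>.\<close>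

lemma Pr_collapse_Y:
  assumes v: "v \<in> carrier V" and F: "trilin V Z Y F"
  shows "sw (coact V v) (\<lambda>u h. sw (gH h) (\<lambda>z y. psum (dZ (Pr V u z)) (\<lambda>v a. F v a y))) =
    sw (coact V v) (\<lambda>u h. sw (gH h) (\<lambda>z y. F u z y))"
proof -
  note rules = tlD1[OF F] tlD2[OF F] tlD3[OF F] lf_\<omega>1 lf_\<omega>2 S_closed lf_mult_const H.lf_com[OF rV]
      lf_psum_inner[OF H.com_pol[OF rV]] lf_psum_inner[OF lZ.pol] lf_psum_inner[OF gH.pol] lZ.linfun gH.linfun
  have "sw (coact V v) (\<lambda>u h. sw (gH h) (\<lambda>z y. psum (dZ (Pr V u z)) (\<lambda>v a. F v a y))) =
     sw (coact V v) (\<lambda>u h. sw (gH h) (\<lambda>z y. sw (coact V u) (\<lambda>u' h'.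
       sw (gH h') (\<lambda>z' y'. \<omega> (y' \<otimes>\<^bsub>Y\<^esub> S z) * F u' z' y))))"
    by (intro psum_cong[OF H.com_pol[OF rV v]] psum_cong[OF gH.pol] psum_Pr[OF rV]) (assumption | rule rules)+
  also have "\<dots> = sw (coact V v) (\<lambda>u h. sw (coact V u) (\<lambda>u' h'. sw (gH h) (\<lambda>z y.
       sw (gH h') (\<lambda>z' y'. \<omega> (y' \<otimes>\<^bsub>Y\<^esub> S z) * F u' z' y))))"
    by (intro psum_cong[OF H.com_pol[OF rV v]] psum_swap)
  also have "\<dots> = sw (coact V v) (\<lambda>u x. sw (comult H x) (\<lambda>h' h. sw (gH h) (\<lambda>z y.
       sw (gH h') (\<lambda>z' y'. \<omega> (y' \<otimes>\<^bsub>Y\<^esub> S z) * F u z' y))))"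
    by (rule H.com_coassoc[OF rV v], rule tlI) (assumption | rule rules)+
  also have "\<dots> = sw (coact V v) (\<lambda>u x. sw (gH x) (\<lambda>w y. sw (lZ w) (\<lambda>h' z.
       sw (gH h') (\<lambda>z' y'. \<omega> (y' \<otimes>\<^bsub>Y\<^esub> S z) * F u z' y))))"
    by (intro psum_cong[OF H.com_pol[OF rV v]] H_HZY[symmetric] tlI) (assumption | rule rules)+
  also have "\<dots> = sw (coact V v) (\<lambda>u h. sw (gH h) (\<lambda>z y. F u z y))"
    by (intro psum_cong[OF H.com_pol[OF rV v]] psum_cong[OF gH.pol] galois_collapse) (assumption | rule rules)+
  finally show ?thesis .
qed

end

end

section \<open>Equivalence of the comodule categories\<close>

text \<open>The situation with the roles of \<open>H\<close>, \<open>Z\<close> and \<open>K\<close>, \<open>Y\<close> exchanged, and the compatibilities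
  between the two sides. The set of axioms is symmetric under the exchange, which halves the work.\<close>

locale galois_pair = F: galois H K Z Y sc tc lZ rZ gH gK S \<omega> eZ + G: galois K H Y Z sc tc lY rY gK gH T \<omega>' eY
  for H :: "('k::field, 'a) hopf" and K :: "('k, 'b) hopf"
    and Z :: "('k, 'z) module" and Y :: "('k, 'y) module"
    and sc :: "'k => 'u" and tc :: "(('u \<times> 'u) \<Rightarrow>\<^sub>0 'k) => 'u"
    and lZ rZ gH gK S \<omega> eZ lY rY T \<omega>' eY +
  assumes H_ZKY: "\<lbrakk>c \<in> carrier H; trilin Z K Y F1\<rbrakk> \<Longrightarrow>
      sw (gH c) (\<lambda>z y. sw (rZ z) (\<lambda>b k. F1 b k y)) =
      sw (gH c) (\<lambda>z y. sw (lY y) (\<lambda>k b. F1 z k b))"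
    and H_ZYH: "\<lbrakk>c \<in> carrier H; trilin Z Y H F2\<rbrakk> \<Longrightarrow>
      sw (gH c) (\<lambda>z y. sw (rY y) (\<lambda>b h. F2 z b h)) =
      sw (comult H c) (\<lambda>h h'. sw (gH h) (\<lambda>z y. F2 z y h'))"
    and H_antipode: "\<lbrakk>c \<in> carrier H; linfun Y g\<rbrakk> \<Longrightarrow>
      sw (gH c) (\<lambda>z y. g (S z \<otimes>\<^bsub>Y\<^esub> y)) = counit H c * g \<one>\<^bsub>Y\<^esub>"
    and K_YHZ: "\<lbrakk>k \<in> carrier K; trilin Y H Z F3\<rbrakk> \<Longrightarrow>
      sw (gK k) (\<lambda>y z. sw (rY y) (\<lambda>b h. F3 b h z)) =
      sw (gK k) (\<lambda>y z. sw (lZ z) (\<lambda>h b. F3 y h b))"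
    and K_YZK: "\<lbrakk>k \<in> carrier K; trilin Y Z K F4\<rbrakk> \<Longrightarrow>
      sw (gK k) (\<lambda>y z. sw (rZ z) (\<lambda>b k. F4 y b k)) =
      sw (comult K k) (\<lambda>k k'. sw (gK k) (\<lambda>y z. F4 y z k'))"
    and K_antipode': "\<lbrakk>k \<in> carrier K; linfun Z g'\<rbrakk> \<Longrightarrow>
      sw (gK k) (\<lambda>y z. g' (T y \<otimes>\<^bsub>Z\<^esub> z)) = counit K k * g' \<one>\<^bsub>Z\<^esub>"
begin

abbreviation "GF V \<equiv> G.FO (F.FO V)"

text \<open>The formula \<open>v \<mapsto> v\<^sub>0 \<otimes> z \<otimes> y\<close>. Again the projection is applied to \<open>v\<^sub>0 \<otimes> z\<close> only to move each summand into the
  cotensor product.\<close>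

definition eta :: "('k, 'u, 'a) comodule => 'u => 'u" where
  "eta V v = eval_tensor (G.amb (F.FO V)) (\<lambda>u h. eval_tensor (G.amb (F.FO V))
     (\<lambda>z y. G.zp (F.FO V) (F.Pr V u z) y) (rep (gH h))) (rep (coact V v))"

text \<open>The inverse \<open>v \<otimes> a \<otimes> b \<mapsto> \<omega>(S(a) b) v\<close>.\<close>

definition theta :: "('k, 'u, 'a) comodule => 'u => 'u" where
  "theta V x = eval_tensor V (\<lambda>m b. eval_tensor V (\<lambda>v a. \<omega> (S a \<otimes>\<^bsub>Y\<^esub> b) \<odot>\<^bsub>V\<^esub> v) (F.dZ m)) (G.dZ x)"

context
  fixes V assumes rV: "F.H.rc V"
begin

interpretation c: coding "F.FO V" Y eY
  by (intro coding.intro two_spaces.intro coding_axioms.intro F.vs_FO rV G.eZ F.Y.vs)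

lemma eta_term: "u \<in> carrier V ==> h \<in> carrier H ==> eval_tensor (G.amb (F.FO V))
     (\<lambda>z y. G.zp (F.FO V) (F.Pr V u z) y) (rep (gH h)) \<in> carrier (G.amb (F.FO V))"
  by (rule eval_tensor_closed[OF c.vec_space_coded F.gH.pol]) (auto intro: c.cp_closed F.Pr_closed rV)

lemma eta_amb: "v \<in> carrier V ==> eta V v \<in> carrier (G.amb (F.FO V))"
  unfolding eta_def by (rule eval_tensor_closed[OF c.vec_space_coded F.H.com_pol[OF rV]]) (assumption | rule eta_term)+

lemma psum_eta:
  assumes v: "v \<in> carrier V" and G: "\<And>y. y \<in> carrier Y ==> linfun (F.FO V) (\<lambda>m. G m y)"
    "\<And>m. m \<in> carrier (F.FO V) ==> linfun Y (\<lambda>y. G m y)"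
  shows "psum (G.dZ (eta V v)) (\<lambda>m y. G m y) = sw (coact V v) (\<lambda>u h. sw (gH h) (\<lambda>z y. G (F.Pr V u z) y))"
proof -
  have b: "bilin (F.FO V) Y G" by (rule blI[OF G])
  note l = c.lf_psum_dec[OF b]
  show ?thesis
    unfolding eta_def
    apply (subst lf_eval_tensor[OF c.vec_space_coded F.H.com_pol[OF rV v] l eta_term], assumption, assumption)
    apply (rule psum_cong[OF F.H.com_pol[OF rV v]])
    apply (subst lf_eval_tensor[OF c.vec_space_coded F.gH.pol l], assumption)
     apply (rule c.cp_closed[OF F.Pr_closed[OF rV]], assumption+)
    apply (rule psum_cong[OF F.gH.pol], assumption)
    apply (rule c.psum_cp[OF F.Pr_closed[OF rV] _ b], assumption+)
    done
qed

lemma eta_closed: assumes v: "v \<in> carrier V" shows "eta V v \<in> carrier (GF V)"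
proof -
  have "G.cotrel (F.FO V) (G.dZ (eta V v))"
    unfolding G.cotrel_def
  proof (intro allI impI)
    fix F assume F: "trilin (F.FO V) K Y F"
    note rules = tlD1[OF F] tlD2[OF F] tlD3[OF F] F.lf_Pr1[OF rV] F.lf_Pr2[OF rV] F.Pr_closed[OF rV] F.lf_coact_FO[OF rV]
      lf_psum_inner[OF F.coact_FO_pol[OF rV]] lf_psum_inner[OF G.lZ.pol] G.lZ.linfun F.rZ.linfun lf_psum_inner[OF F.rZ.pol]
    have "psum (G.dZ (eta V v)) (\<lambda>m b. sw (coact (F.FO V) m) (\<lambda>m' k. F m' k b)) =
      sw (coact V v) (\<lambda>u h. sw (gH h) (\<lambda>z y. sw (coact (F.FO V) (F.Pr V u z)) (\<lambda>m' k. F m' k y)))"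
      by (rule psum_eta[OF v]) (assumption | rule rules)+
    also have "\<dots> = sw (coact V v) (\<lambda>u h. sw (gH h) (\<lambda>z y. psum (F.dZ (F.Pr V u z)) (\<lambda>v a.
        sw (rZ a) (\<lambda>b k. F (F.Pr V v b) k y))))"
      by (intro psum_cong[OF F.H.com_pol[OF rV v]] psum_cong[OF F.gH.pol] F.coact_FO[OF rV]) (assumption | rule rules)+
    also have "\<dots> = sw (coact V v) (\<lambda>u h. sw (gH h) (\<lambda>z y. sw (rZ z) (\<lambda>b k. F (F.Pr V u b) k y)))"
      by (rule F.Pr_collapse_Y[OF rV v], rule tlI) (assumption | rule rules)+
    also have "\<dots> = sw (coact V v) (\<lambda>u h. sw (gH h) (\<lambda>z y. sw (lY y) (\<lambda>k b. F (F.Pr V u z) k b)))"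
      by (intro psum_cong[OF F.H.com_pol[OF rV v]] H_ZKY tlI) (assumption | rule rules)+
    also have "\<dots> = psum (G.dZ (eta V v)) (\<lambda>m b. sw (lY b) (\<lambda>k b'. F m k b'))"
      by (rule psum_eta[OF v, symmetric]) (assumption | rule rules)+
    finally show "psum (G.dZ (eta V v)) (\<lambda>m b. sw (coact (F.FO V) m) (\<lambda>m' k. F m' k b)) =
      psum (G.dZ (eta V v)) (\<lambda>m b. sw (lY b) (\<lambda>k b'. F m k b'))" .
  qed
  then show ?thesis using eta_amb[OF v] by (simp add: G.FO_sel)
qed

lemma lf_eta_psum:
  assumes G: "\<And>y. y \<in> carrier Y ==> linfun (F.FO V) (\<lambda>m. G m y)" "\<And>m. m \<in> carrier (F.FO V) ==> linfun Y (\<lambda>y. G m y)"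
  shows "linfun V (\<lambda>v. psum (G.dZ (eta V v)) (\<lambda>m y. G m y))"
  apply (subst lf_cong[OF psum_eta[OF _ G] F.H.com_vs[OF rV]], assumption, assumption, assumption)
  apply (assumption | rule F.H.lf_com[OF rV] lf_psum_inner[OF F.gH.pol] F.gH.linfun F.lf_Pr1[OF rV] F.lf_Pr2[OF rV] G F.Pr_closed[OF rV])+
  done

lemma rcG: "F.H.rc (GF V)"
  by (intro G.rc_FO F.rc_FO rV)

lemma eta_lin: "linear_map V (GF V) (eta V)"
proof -
  note vG = G.vs_FO[OF F.rc_FO[OF rV]] and vV = F.H.com_vs[OF rV]
  have "eta V (v \<oplus>\<^bsub>V\<^esub> w) = eta V v \<oplus>\<^bsub>GF V\<^esub> eta V w" if v: "v \<in> carrier V" and w: "w \<in> carrier V" for v w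
  proof (rule G.FO_eqI[OF F.rc_FO[OF rV]])
    fix F assume G: "\<And>y. y \<in> carrier Y ==> linfun (F.FO V) (\<lambda>m. F m y)" "\<And>m. m \<in> carrier (F.FO V) ==> linfun Y (\<lambda>y. F m y)"
    show "psum (G.dZ (eta V (v \<oplus>\<^bsub>V\<^esub> w))) (\<lambda>v a. F v a) = psum (G.dZ (eta V v \<oplus>\<^bsub>GF V\<^esub> eta V w)) (\<lambda>v a. F v a)"
      using v w by (simp add: lf_add[OF lf_eta_psum[OF G]] lf_add[OF G.lf_dZ[OF F.rc_FO[OF rV] G]] eta_closed)
  qed (simp_all add: v w eta_closed vs_add vG vV)
  moreover have "eta V (c \<odot>\<^bsub>V\<^esub> v) = c \<odot>\<^bsub>GF V\<^esub> eta V v" if v: "v \<in> carrier V" for v c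
  proof (rule G.FO_eqI[OF F.rc_FO[OF rV]])
    fix F assume G: "\<And>y. y \<in> carrier Y ==> linfun (F.FO V) (\<lambda>m. F m y)" "\<And>m. m \<in> carrier (F.FO V) ==> linfun Y (\<lambda>y. F m y)"
    show "psum (G.dZ (eta V (c \<odot>\<^bsub>V\<^esub> v))) (\<lambda>v a. F v a) = psum (G.dZ (c \<odot>\<^bsub>GF V\<^esub> eta V v)) (\<lambda>v a. F v a)"
      using v by (simp add: lf_smult[OF lf_eta_psum[OF G]] lf_smult[OF G.lf_dZ[OF F.rc_FO[OF rV] G]] eta_closed)
  qed (simp_all add: v eta_closed vs_smult vG vV)
  ultimately show ?thesis using eta_closed by (auto simp: linear_map_def)
qed

lemma cm_eta: "F.H.colin V (eta V) (GF V)"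
proof (rule F.H.cmI[OF rV rcG eta_lin])
  note rF = F.rc_FO[OF rV]
  fix v G assume v: "v \<in> carrier V" and G: "bilin (GF V) H G"
  note rules = blD1[OF G] blD2[OF G] G.lf_Pr1[OF rF] G.lf_Pr2[OF rF] G.Pr_closed[OF rF] F.lf_Pr1[OF rV] F.lf_Pr2[OF rV] F.Pr_closed[OF rV]
    G.rZ.linfun lf_psum_inner[OF G.rZ.pol] F.gH.linfun lf_psum_inner[OF F.gH.pol]
    F.lf_Pr1[OF rV G.lf_Pr1[OF rF]] F.lf_Pr2[OF rV G.lf_Pr1[OF rF]]
  have "sw (coact (GF V) (eta V v)) (\<lambda>w a. G w a) = psum (G.dZ (eta V v)) (\<lambda>m b. sw (rY b) (\<lambda>b h. G (G.Pr (F.FO V) m b) h))"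
    by (rule G.coact_FO[OF rF eta_closed[OF v]]) (assumption | rule rules)+
  also have "\<dots> = sw (coact V v) (\<lambda>u x. sw (gH x) (\<lambda>z y. sw (rY y) (\<lambda>b h. G (G.Pr (F.FO V) (F.Pr V u z) b) h)))"
    by (rule psum_eta[OF v]) (assumption | rule rules)+
  also have "\<dots> = sw (coact V v) (\<lambda>u x. sw (comult H x) (\<lambda>h h'. sw (gH h) (\<lambda>z y. G (G.Pr (F.FO V) (F.Pr V u z) y) h')))"
    by (intro psum_cong[OF F.H.com_pol[OF rV v]] H_ZYH tlI) (assumption | rule rules)+
  also have "\<dots> = sw (coact V v) (\<lambda>u h'. sw (coact V u) (\<lambda>u' h. sw (gH h) (\<lambda>z y. G (G.Pr (F.FO V) (F.Pr V u' z) y) h')))"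
    by (rule F.H.com_coassoc[OF rV v, symmetric], rule tlI) (assumption | rule rules)+
  also have "\<dots> = sw (coact V v) (\<lambda>u h'. psum (G.dZ (eta V u)) (\<lambda>m b. G (G.Pr (F.FO V) m b) h'))"
    by (intro psum_cong[OF F.H.com_pol[OF rV v]] psum_eta[symmetric]) (assumption | rule rules)+
  also have "\<dots> = sw (coact V v) (\<lambda>u h'. G (eta V u) h')"
    by (intro psum_cong[OF F.H.com_pol[OF rV v]] G.lf_FO_eq[OF rF, symmetric] eta_closed) (assumption | rule rules)+
  finally show "sw (coact (GF V) (eta V v)) (\<lambda>w a. G w a) = sw (coact V v) (\<lambda>u h'. G (eta V u) h')" .
qed

lemma theta_term: "m \<in> carrier (F.FO V) ==> b \<in> carrier Y ==>
  eval_tensor V (\<lambda>v a. \<omega> (S a \<otimes>\<^bsub>Y\<^esub> b) \<odot>\<^bsub>V\<^esub> v) (F.dZ m) \<in> carrier V"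
  by (rule eval_tensor_closed[OF F.H.com_vs[OF rV] F.dZ_pol[OF rV]]) (auto intro: vs_smult F.H.com_vs rV)

lemma theta_closed: "x \<in> carrier (GF V) ==> theta V x \<in> carrier V"
  unfolding theta_def
  by (rule eval_tensor_closed[OF F.H.com_vs[OF rV] G.dZ_pol[OF F.rc_FO[OF rV]] theta_term])

lemma lf_theta: assumes x: "x \<in> carrier (GF V)" and f: "linfun V f"
  shows "f (theta V x) = psum (G.dZ x) (\<lambda>m b. psum (F.dZ m) (\<lambda>v a. \<omega> (S a \<otimes>\<^bsub>Y\<^esub> b) * f v))"
  unfolding theta_def
  apply (subst lf_eval_tensor[OF F.H.com_vs[OF rV] G.dZ_pol[OF F.rc_FO[OF rV] x] f theta_term], assumption, assumption)
  apply (rule psum_cong[OF G.dZ_pol[OF F.rc_FO[OF rV] x]])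
  apply (subst lf_eval_tensor[OF F.H.com_vs[OF rV] F.dZ_pol[OF rV] f], assumption)
   apply (rule vs_smult[OF F.H.com_vs[OF rV]], assumption)
  apply (rule psum_cong[OF F.dZ_pol[OF rV]], assumption)
  apply (rule lf_smult[OF f], assumption)
  done

lemma lf_\<omega>S1: "b \<in> carrier Y ==> linfun Z (\<lambda>a. \<omega> (S a \<otimes>\<^bsub>Y\<^esub> b))"
  by (rule F.lf_S[OF F.Y.lf_mult1[OF F.\<omega>_lf]])

lemma lf_\<omega>S2: "a \<in> carrier Z ==> linfun Y (\<lambda>b. \<omega> (S a \<otimes>\<^bsub>Y\<^esub> b))"
  by (rule F.Y.lf_mult2[OF F.\<omega>_lf F.S_closed])

text \<open>This is \<open>S(z) y = \<epsilon>(h) 1\<close> for \<open>z \<otimes> y\<close> coming from \<open>h\<close>, followed by the counit law of \<open>V\<close>.\<close>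

lemma theta_eta: assumes v: "v \<in> carrier V" shows "theta V (eta V v) = v"
proof (rule vs_eqI[OF F.H.com_vs[OF rV] theta_closed[OF eta_closed[OF v]] v])
  fix f assume f: "linfun V f"
  note rules = lf_mult_const f lf_\<omega>S1 lf_\<omega>S2 lf_psum_inner[OF F.dZ_pol[OF rV]] F.lf_dZ[OF rV]
  have "f (theta V (eta V v)) = psum (G.dZ (eta V v)) (\<lambda>m b. psum (F.dZ m) (\<lambda>v a. \<omega> (S a \<otimes>\<^bsub>Y\<^esub> b) * f v))"
    by (rule lf_theta[OF eta_closed[OF v] f])
  also have "\<dots> = sw (coact V v) (\<lambda>u h. sw (gH h) (\<lambda>z y. psum (F.dZ (F.Pr V u z)) (\<lambda>v a. \<omega> (S a \<otimes>\<^bsub>Y\<^esub> y) * f v)))"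
    by (rule psum_eta[OF v]) (assumption | rule rules)+
  also have "\<dots> = sw (coact V v) (\<lambda>u h. sw (gH h) (\<lambda>z y. \<omega> (S z \<otimes>\<^bsub>Y\<^esub> y) * f u))"
    by (rule F.Pr_collapse_Y[OF rV v], rule tlI) (assumption | rule rules)+
  also have "\<dots> = sw (coact V v) (\<lambda>u h. counit H h * f u)"
    unfolding psum_mult_right using H_antipode[OF _ F.\<omega>_lf]
    by (intro psum_cong[OF F.H.com_pol[OF rV v]]) (simp add: F.\<omega>_one)
  also have "\<dots> = f v" by (rule F.H.com_counit[OF rV v f])
  finally show "f (theta V (eta V v)) = f v" .
qed

text \<open>The two cotensor relations and the two laws \<open>Z_ZYZ\<close> move all factors to the last leg, where \<open>S(a) b\<close> collapses
  to a counit.\<close>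

lemma eta_theta: assumes x: "x \<in> carrier (GF V)" shows "eta V (theta V x) = x"
proof (rule G.FO_eqI[OF F.rc_FO[OF rV] eta_closed[OF theta_closed[OF x]] x])
  note rF = F.rc_FO[OF rV]
  fix G assume G: "\<And>y. y \<in> carrier Y ==> linfun (F.FO V) (\<lambda>m. G m y)" "\<And>m. m \<in> carrier (F.FO V) ==> linfun Y (\<lambda>y. G m y)"
  let ?F = "\<lambda>v z y. G (F.Pr V v z) y"
  note rules = G lf_mult_const lf_\<omega>S1 lf_\<omega>S2 lf_psum_inner[OF F.dZ_pol[OF rV]] F.lf_dZ[OF rV]
    lf_psum_inner[OF F.gH.pol] F.gH.linfun lf_psum_inner[OF F.gK.pol] F.gK.linfun F.lf_Pr1[OF rV] F.lf_Pr2[OF rV] F.Pr_closed[OF rV]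
  note pG = G.dZ_pol[OF rF x] and pF = F.dZ_pol[OF rV]
  have "psum (G.dZ (eta V (theta V x))) (\<lambda>v a. G v a) =
    psum (G.dZ x) (\<lambda>m b. psum (F.dZ m) (\<lambda>v a. \<omega> (S a \<otimes>\<^bsub>Y\<^esub> b) * psum (G.dZ (eta V v)) (\<lambda>m y. G m y)))"
    by (rule lf_theta[OF x]) (rule lf_eta_psum[OF G])
  also have "\<dots> = psum (G.dZ x) (\<lambda>m b. psum (F.dZ m) (\<lambda>v a. sw (coact V v) (\<lambda>u h. sw (gH h) (\<lambda>z y. \<omega> (S a \<otimes>\<^bsub>Y\<^esub> b) * ?F u z y))))"
    unfolding psum_mult_left by (intro psum_cong[OF pG] psum_cong[OF pF] arg_cong2[where f = "(*)"] refl psum_eta G)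
  also have "\<dots> = psum (G.dZ x) (\<lambda>m b. psum (F.dZ m) (\<lambda>v a. sw (lZ a) (\<lambda>h a'. sw (gH h) (\<lambda>z y. \<omega> (S a' \<otimes>\<^bsub>Y\<^esub> b) * ?F v z y))))"
    by (intro psum_cong[OF pG] F.FO_cotrel[OF rV]) (assumption | rule rules)+
  also have "\<dots> = psum (G.dZ x) (\<lambda>m b. psum (F.dZ m) (\<lambda>v a. sw (rZ a) (\<lambda>z k. sw (gK k) (\<lambda>y a'. \<omega> (S a' \<otimes>\<^bsub>Y\<^esub> b) * ?F v z y))))"
    by (intro psum_cong[OF pG] psum_cong[OF pF] F.Z_ZYZ tlI) (assumption | rule rules)+
  also have "\<dots> = psum (G.dZ x) (\<lambda>m b. sw (coact (F.FO V) m) (\<lambda>m' k. psum (F.dZ m') (\<lambda>v z. sw (gK k) (\<lambda>y a'. \<omega> (S a' \<otimes>\<^bsub>Y\<^esub> b) * ?F v z y))))"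
    by (intro psum_cong[OF pG] F.coact_FO_amb[OF rV, symmetric]) (assumption | rule rules)+
  also have "\<dots> = psum (G.dZ x) (\<lambda>m b. sw (lY b) (\<lambda>k b'. psum (F.dZ m) (\<lambda>v z. sw (gK k) (\<lambda>y a'. \<omega> (S a' \<otimes>\<^bsub>Y\<^esub> b') * ?F v z y))))"
    by (rule G.FO_cotrel[OF rF x]) (assumption | rule rules)+
  also have "\<dots> = psum (G.dZ x) (\<lambda>m b. psum (F.dZ m) (\<lambda>v z. sw (lY b) (\<lambda>k b'. sw (gK k) (\<lambda>y a'. \<omega> (S a' \<otimes>\<^bsub>Y\<^esub> b') * ?F v z y))))"
    by (intro psum_cong[OF pG] psum_swap)
  also have "\<dots> = psum (G.dZ x) (\<lambda>m b. psum (F.dZ m) (\<lambda>v z. sw (rY b) (\<lambda>y h. sw (gH h) (\<lambda>a' b'. \<omega> (S a' \<otimes>\<^bsub>Y\<^esub> b') * ?F v z y))))"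
    by (intro psum_cong[OF pG] psum_cong[OF pF] G.Z_ZYZ tlI) (assumption | rule rules)+
  also have "\<dots> = psum (G.dZ x) (\<lambda>m b. psum (F.dZ m) (\<lambda>v z. sw (rY b) (\<lambda>y h. counit H h * ?F v z y)))"
    unfolding psum_mult_right using H_antipode[OF _ F.\<omega>_lf]
    by (intro psum_cong[OF pG] psum_cong[OF pF] psum_cong[OF G.rZ.pol]) (simp_all add: F.\<omega>_one)
  also have "\<dots> = psum (G.dZ x) (\<lambda>m b. psum (F.dZ m) (\<lambda>v z. ?F v z b))"
    by (intro psum_cong[OF pG] psum_cong[OF pF] G.Z_counit) (assumption | rule rules)+
  also have "\<dots> = psum (G.dZ x) (\<lambda>m b. G m b)"
    by (intro psum_cong[OF pG] F.lf_FO_eq[OF rV, symmetric] G)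
  finally show "psum (G.dZ (eta V (theta V x))) (\<lambda>v a. G v a) = psum (G.dZ x) (\<lambda>m b. G m b)" .
qed

lemma cm_theta: "F.H.colin (GF V) (theta V) V"
  by (rule F.H.iso_arrI(2)[OF cm_eta]) (simp_all add: theta_closed theta_eta eta_theta)

lemma iso_eta: "iso_arr F.H.CC V (GF V) (F.H.arrow V (eta V) (GF V))"
  by (rule F.H.iso_arrI(1)[OF cm_eta, where g = "theta V"]) (simp_all add: theta_closed theta_eta eta_theta)

lemma iso_theta: "iso_arr F.H.CC (GF V) V (F.H.arrow (GF V) (theta V) V)"
  by (rule F.H.iso_arrI(1)[OF cm_theta, where g = "eta V"]) (simp_all add: eta_closed theta_eta eta_theta)

end

lemma eta_natural:
  assumes f: "F.H.colin V f W" and v: "v \<in> carrier V"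
  shows "eta W (f v) = G.fm (F.FO W) (F.fm W f) (eta V v)"
proof -
  note R = F.H.cm_rc[OF f] and Rf = F.H.cm_closed[OF f v] and cF = F.cm_fm[OF f]
  show ?thesis
  proof (rule G.FO_eqI[OF F.rc_FO[OF R(2)] eta_closed[OF R(2) Rf] G.fm_closed[OF cF eta_closed[OF R(1) v]]])
    fix G assume G: "\<And>y. y \<in> carrier Y ==> linfun (F.FO W) (\<lambda>m. G m y)" "\<And>m. m \<in> carrier (F.FO W) ==> linfun Y (\<lambda>y. G m y)"
    note rules = G F.lf_Pr1[OF R(2)] F.lf_Pr2[OF R(2)] F.Pr_closed[OF R(2)] F.gH.linfun lf_psum_inner[OF F.gH.pol]
      lf_linear_map[OF F.fm_lin[OF f]] F.fm_closed[OF f]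
    have "psum (G.dZ (eta W (f v))) (\<lambda>m y. G m y) = sw (coact W (f v)) (\<lambda>u h. sw (gH h) (\<lambda>z y. G (F.Pr W u z) y))"
      by (rule psum_eta[OF R(2) Rf G])
    also have "\<dots> = sw (coact V v) (\<lambda>u h. sw (gH h) (\<lambda>z y. G (F.Pr W (f u) z) y))"
      by (rule F.H.cm_coact[OF f v]) (assumption | rule rules)+
    also have "\<dots> = sw (coact V v) (\<lambda>u h. sw (gH h) (\<lambda>z y. G (F.fm W f (F.Pr V u z)) y))"
      by (intro psum_cong[OF F.H.com_pol[OF R(1) v]] psum_cong[OF F.gH.pol]) (simp_all add: F.fm_Pr[OF f])
    also have "\<dots> = psum (G.dZ (eta V v)) (\<lambda>m y. G (F.fm W f m) y)"
      by (rule psum_eta[OF R(1) v, symmetric]) (assumption | rule rules)+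
    also have "\<dots> = psum (G.dZ (G.fm (F.FO W) (F.fm W f) (eta V v))) (\<lambda>m y. G m y)"
      by (rule G.psum_fm[OF cF eta_closed[OF R(1) v] G, symmetric])
    finally show "psum (G.dZ (eta W (f v))) (\<lambda>m y. G m y) = psum (G.dZ (G.fm (F.FO W) (F.fm W f) (eta V v))) (\<lambda>m y. G m y)" .
  qed
qed

lemma eta_natural_iso:
  "natural_iso F.H.CC F.H.CC id id (G.FO \<circ> F.FO) (G.FA \<circ> F.FA) (\<lambda>V. F.H.arrow V (eta V) (GF V))"
  unfolding natural_iso_def
proof (intro conjI ballI allI)
  show "iso_arr F.H.CC (id V) ((G.FO \<circ> F.FO) V) (F.H.arrow V (eta V) (GF V))" if "V \<in> Obj F.H.CC" for V
    using that by (simp add: F.H.Obj_CC iso_eta)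
  fix V W A assume "A \<in> Hom F.H.CC V W"
  then obtain f where f: "A = F.H.arrow V f W" "F.H.colin V f W" by (rule F.H.HomE)
  note R = F.H.cm_rc[OF f(2)]
  show "F.H.arrow W (eta W) (GF W) \<cdot>\<^bsub>F.H.CC\<^esub> id A = (G.FA \<circ> F.FA) A \<cdot>\<^bsub>F.H.CC\<^esub> F.H.arrow V (eta V) (GF V)"
    unfolding f(1) id_apply o_apply F.FA_ar[OF f(2)] G.FA_ar[OF F.cm_fm[OF f(2)]] F.H.Comp_CC[OF f(2)] F.H.Comp_CC[OF cm_eta[OF R(1)]]
    by (rule F.H.ar_eqI) (rule eta_natural[OF f(2)])
qed

lemma theta_natural_iso:
  "natural_iso F.H.CC F.H.CC (G.FO \<circ> F.FO) (G.FA \<circ> F.FA) id id (\<lambda>V. F.H.arrow (GF V) (theta V) V)"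
  unfolding natural_iso_def
proof (intro conjI ballI allI)
  show "iso_arr F.H.CC ((G.FO \<circ> F.FO) V) (id V) (F.H.arrow (GF V) (theta V) V)" if "V \<in> Obj F.H.CC" for V
    using that by (simp add: F.H.Obj_CC iso_theta)
  fix V W A assume "A \<in> Hom F.H.CC V W"
  then obtain f where f: "A = F.H.arrow V f W" "F.H.colin V f W" by (rule F.H.HomE)
  note R = F.H.cm_rc[OF f(2)] and cG = G.cm_fm[OF F.cm_fm[OF f(2)]]
  have pw: "theta W (G.fm (F.FO W) (F.fm W f) x) = f (theta V x)" if x: "x \<in> carrier (GF V)" for x
    using eta_natural[OF f(2) theta_closed[OF R(1) x]] theta_eta[OF R(2) F.H.cm_closed[OF f(2) theta_closed[OF R(1) x]]]
    by (simp add: eta_theta[OF R(1) x])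
  show "F.H.arrow (GF W) (theta W) W \<cdot>\<^bsub>F.H.CC\<^esub> (G.FA \<circ> F.FA) A = id A \<cdot>\<^bsub>F.H.CC\<^esub> F.H.arrow (GF V) (theta V) V"
    unfolding f(1) id_apply o_apply F.FA_ar[OF f(2)] G.FA_ar[OF F.cm_fm[OF f(2)]] F.H.Comp_CC[OF cG] F.H.Comp_CC[OF cm_theta[OF R(1)]]
    by (rule F.H.ar_eqI) (rule pw)
qed

lemma swap: "galois_pair K H Y Z sc tc lY rY gK gH T \<omega>' eY lZ rZ S \<omega> eZ"
  by (intro galois_pair.intro galois_pair_axioms.intro F.galois_axioms G.galois_axioms)
    (fact K_YHZ K_YZK K_antipode' H_ZKY H_ZYH H_antipode)+

theorem equivalence_F: "equivalence_functor F.H.CC F.K.CC F.FO F.FA"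
proof -
  interpret s: galois_pair K H Y Z sc tc lY rY gK gH T \<omega>' eY lZ rZ S \<omega> eZ by (rule swap)
  show ?thesis
    unfolding equivalence_functor_def
    using F.functor_F G.functor_F eta_natural_iso s.theta_natural_iso by blast
qed

end

section \<open>The monoidal structure of the cotensor functor\<close>

text \<open>The maps are algebra homomorphisms, and \<open>S\<close> reverses products.\<close>

locale galois_monoidal = galois H K Z Y sc tc lZ rZ gH gK S \<omega> eZ
  for H :: "('k::field, 'a) hopf" and K :: "('k, 'b) hopf"
    and Z :: "('k, 'z) module" and Y :: "('k, 'y) module"
    and sc :: "'k => 'u" and tc :: "(('u \<times> 'u) \<Rightarrow>\<^sub>0 'k) => 'u"
    and lZ rZ gH gK S \<omega> eZ +
  assumes lZ_mult: "\<lbrakk>a \<in> carrier Z; b \<in> carrier Z; bilin H Z G1\<rbrakk> \<Longrightarrow> sw (lZ (a \<otimes>\<^bsub>Z\<^esub> b)) G1 =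
      sw (lZ a) (\<lambda>h c. sw (lZ b) (\<lambda>h' c'. G1 (h \<otimes>\<^bsub>H\<^esub> h') (c \<otimes>\<^bsub>Z\<^esub> c')))"
    and rZ_mult: "\<lbrakk>a \<in> carrier Z; b \<in> carrier Z; bilin Z K G2\<rbrakk> \<Longrightarrow> sw (rZ (a \<otimes>\<^bsub>Z\<^esub> b)) G2 =
      sw (rZ a) (\<lambda>c k. sw (rZ b) (\<lambda>c' k'. G2 (c \<otimes>\<^bsub>Z\<^esub> c') (k \<otimes>\<^bsub>K\<^esub> k')))"
    and gH_mult: "\<lbrakk>h \<in> carrier H; h' \<in> carrier H; bilin Z Y G3\<rbrakk> \<Longrightarrow> sw (gH (h \<otimes>\<^bsub>H\<^esub> h')) G3 =
      sw (gH h) (\<lambda>z y. sw (gH h') (\<lambda>z' y'. G3 (z \<otimes>\<^bsub>Z\<^esub> z') (y \<otimes>\<^bsub>Y\<^esub> y')))"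
    and lZ_one: "bilin H Z G1 ==> sw (lZ \<one>\<^bsub>Z\<^esub>) G1 = G1 \<one>\<^bsub>H\<^esub> \<one>\<^bsub>Z\<^esub>"
    and rZ_one: "bilin Z K G2 ==> sw (rZ \<one>\<^bsub>Z\<^esub>) G2 = G2 \<one>\<^bsub>Z\<^esub> \<one>\<^bsub>K\<^esub>"
    and gH_one: "bilin Z Y G3 ==> sw (gH \<one>\<^bsub>H\<^esub>) G3 = G3 \<one>\<^bsub>Z\<^esub> \<one>\<^bsub>Y\<^esub>"
    and S_mult: "\<lbrakk>a \<in> carrier Z; b \<in> carrier Z\<rbrakk> \<Longrightarrow> S (a \<otimes>\<^bsub>Z\<^esub> b) = S b \<otimes>\<^bsub>Y\<^esub> S a"
    and S_one: "S \<one>\<^bsub>Z\<^esub> = \<one>\<^bsub>Y\<^esub>"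
begin

text \<open>The argument of \<open>galois_collapse\<close> with \<open>y S(b)\<close> and \<open>z\<close> still inside a bilinear functional, as is needed when
  \<open>y S(b)\<close> sits in the middle of a product.\<close>

lemma galois_collapse_bl:
  assumes a: "a \<in> carrier Z" and E: "bilin Y Z E"
  shows "sw (lZ a) (\<lambda>h b. sw (gH h) (\<lambda>z y. E (y \<otimes>\<^bsub>Y\<^esub> S b) z)) = E \<one>\<^bsub>Y\<^esub> a"
proof -
  note rules = blD1[OF E] blD2[OF E] Y.lf_mult1 Y.lf_mult2[THEN lf_S] S_closed Y.mult_closed
  have "sw (lZ a) (\<lambda>h b. sw (gH h) (\<lambda>z y. E (y \<otimes>\<^bsub>Y\<^esub> S b) z)) =
    sw (rZ a) (\<lambda>z k. sw (gK k) (\<lambda>y b. E (y \<otimes>\<^bsub>Y\<^esub> S b) z))"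
    by (rule Z_ZYZ[OF a], rule tlI) (assumption | rule rules)+
  also have "\<dots> = sw (rZ a) (\<lambda>z k. counit K k * E \<one>\<^bsub>Y\<^esub> z)"
    by (intro psum_cong[OF rZ.pol[OF a]] K_antipode blD1[OF E])
  also have "\<dots> = E \<one>\<^bsub>Y\<^esub> a" by (rule Z_counit[OF a blD2[OF E Y.one_closed]])
  finally show ?thesis .
qed

lemma coding_Z: "H.rc V ==> coding V Z eZ"
  by (intro coding.intro two_spaces.intro coding_axioms.intro H.com_vs eZ Z.vs)

subsection \<open>The unit\<close>

definition phi0 :: "'u => 'u" where
  "phi0 x = zp H.I x \<one>\<^bsub>Z\<^esub>"

lemma I_carrier: "carrier K.I = carrier H.I"
  by (simp add: H.I_sel K.I_sel)

context
begin

interpretation c: coding H.I Z eZ by (rule coding_Z[OF H.rc_I])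

lemma psum_phi0: assumes x: "x \<in> carrier H.I"
   and F: "\<And>a. a \<in> carrier Z ==> linfun H.I (\<lambda>v. F v a)" "\<And>v. v \<in> carrier H.I ==> linfun Z (\<lambda>a. F v a)"
  shows "psum (dZ (phi0 x)) (\<lambda>v a. F v a) = F x \<one>\<^bsub>Z\<^esub>"
  unfolding phi0_def by (rule c.psum_cp[OF x Z.one_closed blI[OF F]])

lemma phi0_closed: assumes x: "x \<in> carrier H.I" shows "phi0 x \<in> carrier (FO H.I)"
proof -
  have "cotrel H.I (dZ (phi0 x))"
    unfolding cotrel_def
  proof (intro allI impI)
    fix F assume F: "trilin H.I H Z F"
    note rules = tlD1[OF F] tlD2[OF F] tlD3[OF F] lZ.linfun lf_psum_inner[OF lZ.pol] H.lf_com[OF H.rc_I]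
      lf_psum_inner[OF H.com_pol[OF H.rc_I]] Z.one_closed x
    have "psum (dZ (phi0 x)) (\<lambda>v a. sw (coact H.I v) (\<lambda>u h. F u h a)) = sw (coact H.I x) (\<lambda>u h. F u h \<one>\<^bsub>Z\<^esub>)"
      by (rule psum_phi0[OF x]) (assumption | rule rules)+
    also have "\<dots> = F x \<one>\<^bsub>H\<^esub> \<one>\<^bsub>Z\<^esub>"
      by (rule H.psum_coact_I[OF x]) (assumption | rule rules)+
    also have "\<dots> = sw (lZ \<one>\<^bsub>Z\<^esub>) (\<lambda>h b. F x h b)"
      by (rule lZ_one[symmetric], rule blI) (assumption | rule rules)+
    also have "\<dots> = psum (dZ (phi0 x)) (\<lambda>v a. sw (lZ a) (\<lambda>h b. F v h b))"
      by (rule psum_phi0[OF x, symmetric]) (assumption | rule rules)+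
    finally show "psum (dZ (phi0 x)) (\<lambda>v a. sw (coact H.I v) (\<lambda>u h. F u h a)) =
       psum (dZ (phi0 x)) (\<lambda>v a. sw (lZ a) (\<lambda>h b. F v h b))" .
  qed
  then show ?thesis using c.cp_closed[OF x Z.one_closed] by (simp add: FO_sel phi0_def)
qed

lemma phi0_lin: "linear_map K.I (FO H.I) phi0"
proof -
  have "linear_map H.I (amb H.I) phi0"
    unfolding phi0_def by (rule linear_mapI_lf[OF H.vs_I c.vec_space_coded])
      (auto intro: c.cp_closed Z.one_closed blD1[OF c.bl_cp])
  then show ?thesis
    using phi0_closed unfolding linear_map_def I_carrier by (simp add: FO_sel H.I_sel K.I_sel)
qed

lemma phi0_Pr: assumes x: "x \<in> carrier H.I" shows "Pr H.I x \<one>\<^bsub>Z\<^esub> = phi0 x"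
proof (rule vs_eqI[OF vs_FO[OF H.rc_I] Pr_closed[OF H.rc_I x Z.one_closed] phi0_closed[OF x]])
  fix f assume f: "linfun (FO H.I) f"
  have "f (phi0 x) = psum (dZ (phi0 x)) (\<lambda>v a. f (Pr H.I v a))"
    by (rule lf_FO_eq[OF H.rc_I phi0_closed[OF x] f])
  also have "\<dots> = f (Pr H.I x \<one>\<^bsub>Z\<^esub>)"
    by (rule psum_phi0[OF x]) (assumption | rule lf_Pr1[OF H.rc_I f] lf_Pr2[OF H.rc_I f])+
  finally show "f (Pr H.I x \<one>\<^bsub>Z\<^esub>) = f (phi0 x)" by (rule sym)
qed

lemma cm_phi0: "K.colin K.I phi0 (FO H.I)"
proof (rule K.cmI[OF K.rc_I rc_FO[OF H.rc_I] phi0_lin])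
  fix x G assume x: "x \<in> carrier K.I" and G: "bilin (FO H.I) K G"
  have x': "x \<in> carrier H.I" using x by (simp add: I_carrier)
  note rules = blD1[OF G] blD2[OF G] lf_Pr1[OF H.rc_I] lf_Pr2[OF H.rc_I] Pr_closed[OF H.rc_I] rZ.linfun lf_psum_inner[OF rZ.pol] Z.one_closed x'
  have "sw (coact (FO H.I) (phi0 x)) (\<lambda>w a. G w a) = psum (dZ (phi0 x)) (\<lambda>v a. sw (rZ a) (\<lambda>b k. G (Pr H.I v b) k))"
    by (rule coact_FO[OF H.rc_I phi0_closed[OF x']]) (assumption | rule rules)+
  also have "\<dots> = sw (rZ \<one>\<^bsub>Z\<^esub>) (\<lambda>b k. G (Pr H.I x b) k)"
    by (rule psum_phi0[OF x']) (assumption | rule rules)+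
  also have "\<dots> = G (Pr H.I x \<one>\<^bsub>Z\<^esub>) \<one>\<^bsub>K\<^esub>"
    by (rule rZ_one, rule blI) (assumption | rule rules)+
  also have "\<dots> = G (phi0 x) \<one>\<^bsub>K\<^esub>" by (simp add: phi0_Pr x')
  also have "\<dots> = sw (coact K.I x) (\<lambda>u a. G (phi0 u) a)"
    by (rule K.psum_coact_I[OF x, symmetric])
      (auto intro: lf_linear_map[OF phi0_lin] blD1[OF G] blD2[OF G] simp: I_carrier phi0_closed)
  finally show "sw (coact (FO H.I) (phi0 x)) (\<lambda>w a. G w a) = sw (coact K.I x) (\<lambda>u a. G (phi0 u) a)" .
qed

lemma iso_phi0: "iso_arr K.CC K.I (FO H.I) (K.arrow K.I phi0 (FO H.I))"
proof (rule K.iso_arrI(1)[OF cm_phi0])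
  let ?i = "inv_into UNIV sc"
  let ?g = "\<lambda>y. sc (psum (dZ y) (\<lambda>v a. ?i v * \<omega> (S a)))"
  note r = lf_mult_const H.lf_inv_sc lf_S[OF \<omega>_lf]
  show "?g y \<in> carrier K.I" for y by (rule K.sc_closed)
  show "?g (phi0 x) = x" if "x \<in> carrier K.I" for x
  proof -
    have x: "x \<in> carrier H.I" using that by (simp add: I_carrier)
    have "psum (dZ (phi0 x)) (\<lambda>v a. ?i v * \<omega> (S a)) = ?i x * \<omega> (S \<one>\<^bsub>Z\<^esub>)"
      by (rule psum_phi0[OF x]) (assumption | rule r)+
    then show ?thesis using x by (auto simp: S_one \<omega>_one H.I_sel H.sc)
  qed
  show "phi0 (?g y) = y" if y: "y \<in> carrier (FO H.I)" for y
  proof (rule FO_eqI[OF H.rc_I phi0_closed[OF H.sc_closed] y])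
    fix F assume F: "\<And>a. a \<in> carrier Z ==> linfun H.I (\<lambda>v. F v a)" "\<And>v. v \<in> carrier H.I ==> linfun Z (\<lambda>a. F v a)"
    note rules = F lf_\<omega>1 lf_\<omega>2 S_closed lf_mult_const lf_psum_inner[OF gH.pol] gH.linfun
    have 1: "F v \<one>\<^bsub>Z\<^esub> = ?i v * F (sc 1) \<one>\<^bsub>Z\<^esub>" if "v \<in> carrier H.I" for v
      by (rule H.lf_I[OF F(1)[OF Z.one_closed] that])
    have "psum (dZ (phi0 (?g y))) (\<lambda>v a. F v a) = F (?g y) \<one>\<^bsub>Z\<^esub>"
      by (rule psum_phi0[OF H.sc_closed]) (rule F, assumption)+
    also have "\<dots> = psum (dZ y) (\<lambda>v a. ?i v * \<omega> (S a)) * F (sc 1) \<one>\<^bsub>Z\<^esub>"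
      by (subst 1) (simp_all add: H.sc_closed H.inv_sc)
    also have "\<dots> = psum (dZ y) (\<lambda>v a. \<omega> (\<one>\<^bsub>Y\<^esub> \<otimes>\<^bsub>Y\<^esub> S a) * F v \<one>\<^bsub>Z\<^esub>)"
      unfolding psum_mult_right[symmetric]
      by (rule psum_cong[OF dZ_pol[OF H.rc_I y]]) (simp add: 1 Y.l_one S_closed)
    also have "\<dots> = psum (dZ y) (\<lambda>v a. sw (coact H.I v) (\<lambda>u h. sw (gH h) (\<lambda>z y. \<omega> (y \<otimes>\<^bsub>Y\<^esub> S a) * F u z)))"
    proof (rule psum_cong[OF dZ_pol[OF H.rc_I y]])
      fix v a assume v: "v \<in> carrier H.I" and a: "a \<in> carrier Z"
      have "\<omega> (\<one>\<^bsub>Y\<^esub> \<otimes>\<^bsub>Y\<^esub> S a) * F v \<one>\<^bsub>Z\<^esub> = sw (gH \<one>\<^bsub>H\<^esub>) (\<lambda>z y. \<omega> (y \<otimes>\<^bsub>Y\<^esub> S a) * F v z)"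
        by (rule gH_one[symmetric], rule blI) (assumption | rule rules v a)+
      also have "\<dots> = sw (coact H.I v) (\<lambda>u h. sw (gH h) (\<lambda>z y. \<omega> (y \<otimes>\<^bsub>Y\<^esub> S a) * F u z))"
        by (rule H.psum_coact_I[OF v, symmetric]) (assumption | rule rules a H.one_closed)+
      finally show "\<omega> (\<one>\<^bsub>Y\<^esub> \<otimes>\<^bsub>Y\<^esub> S a) * F v \<one>\<^bsub>Z\<^esub> = sw (coact H.I v) (\<lambda>u h. sw (gH h) (\<lambda>z y. \<omega> (y \<otimes>\<^bsub>Y\<^esub> S a) * F u z))" .
    qed
    also have "\<dots> = psum (dZ y) (\<lambda>v a. psum (dZ (Pr H.I v a)) (\<lambda>v a. F v a))"
      by (intro psum_cong[OF dZ_pol[OF H.rc_I y]] psum_Pr[OF H.rc_I, symmetric] F)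
    also have "\<dots> = psum (dZ y) (\<lambda>v a. F v a)" by (rule Pr_collapse'[OF H.rc_I y blI[OF F]])
    finally show "psum (dZ (phi0 (?g y))) (\<lambda>v a. F v a) = psum (dZ y) (\<lambda>v a. F v a)" .
  qed
qed

end

subsection \<open>Tensor products\<close>

text \<open>The isomorphism \<open>(v \<otimes> a) \<otimes> (w \<otimes> b) \<mapsto> (v \<otimes> w) \<otimes> ab\<close>, first as a bilinear map.\<close>

definition phi2 :: "('k, 'u, 'a) comodule => ('k, 'u, 'a) comodule => 'u => 'u => 'u" where
  "phi2 V W x y = eval_tensor (amb (H.ten V W)) (\<lambda>v a. eval_tensor (amb (H.ten V W))
     (\<lambda>w b. zp (H.ten V W) (H.tp V W v w) (a \<otimes>\<^bsub>Z\<^esub> b)) (dZ y)) (dZ x)"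

definition phi :: "('k, 'u, 'a) comodule => ('k, 'u, 'a) comodule => 'u => 'u" where
  "phi V W = coded_lift tc (FO (H.ten V W)) (phi2 V W)"

text \<open>The inverse of the monoidal structure: \<open>v \<otimes> w \<otimes> c\<close> goes to \<open>(v\<^sub>0 \<otimes> z) \<otimes> (w\<^sub>0 \<otimes> z') \<omega>(y y' S(c))\<close>, where \<open>z \<otimes> y\<close> and
  \<open>z' \<otimes> y'\<close> are the images of \<open>v\<^sub>1\<close> and \<open>w\<^sub>1\<close>.\<close>

definition psi_term :: "('k, 'u, 'a) comodule => ('k, 'u, 'a) comodule => 'u => 'u => 'z => 'u" where
  "psi_term V W v w c = (let T = K.ten (FO V) (FO W) in
     eval_tensor T (\<lambda>v0 h. eval_tensor T (\<lambda>z y. eval_tensor T (\<lambda>w0 h'. eval_tensor T (\<lambda>z' y'.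
       \<omega> ((y \<otimes>\<^bsub>Y\<^esub> y') \<otimes>\<^bsub>Y\<^esub> S c) \<odot>\<^bsub>T\<^esub> K.tp (FO V) (FO W) (Pr V v0 z) (Pr W w0 z')) (rep (gH h'))) (rep (coact W w)))
       (rep (gH h))) (rep (coact V v)))"

definition psi :: "('k, 'u, 'a) comodule => ('k, 'u, 'a) comodule => 'u => 'u" where
  "psi V W t = (let T = K.ten (FO V) (FO W) in
     eval_tensor T (\<lambda>m c. eval_tensor T (\<lambda>v w. psi_term V W v w c) (H.de m)) (dZ t))"

context
  fixes V W assumes rV: "H.rc V" and rW: "H.rc W"
begin

interpretation c: coding "H.ten V W" Z eZ by (intro coding_Z H.rc_ten rV rW)

lemma rT: "H.rc (H.ten V W)" by (intro H.rc_ten rV rW)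

lemma rK: "K.rc (FO V)" "K.rc (FO W)" "K.rc (FO (H.ten V W))" by (intro rc_FO rT rV rW)+

lemma phi2_term: "v \<in> carrier V ==> a \<in> carrier Z ==> y \<in> carrier (FO W) ==> eval_tensor (amb (H.ten V W))
     (\<lambda>w b. zp (H.ten V W) (H.tp V W v w) (a \<otimes>\<^bsub>Z\<^esub> b)) (dZ y) \<in> carrier (amb (H.ten V W))"
  by (rule eval_tensor_closed[OF c.vec_space_coded dZ_pol[OF rW]])
    (assumption | rule c.cp_closed H.tp_closed rV rW Z.mult_closed)+

lemma phi2_amb: "x \<in> carrier (FO V) ==> y \<in> carrier (FO W) ==> phi2 V W x y \<in> carrier (amb (H.ten V W))"
  unfolding phi2_def by (rule eval_tensor_closed[OF c.vec_space_coded dZ_pol[OF rV]]) (assumption | rule phi2_term)+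

lemma psum_phi2:
  assumes x: "x \<in> carrier (FO V)" and y: "y \<in> carrier (FO W)"
   and F: "\<And>a. a \<in> carrier Z ==> linfun (H.ten V W) (\<lambda>v. F v a)" "\<And>v. v \<in> carrier (H.ten V W) ==> linfun Z (\<lambda>a. F v a)"
  shows "psum (dZ (phi2 V W x y)) (\<lambda>m c. F m c) = psum (dZ x) (\<lambda>v a. psum (dZ y) (\<lambda>w b. F (H.tp V W v w) (a \<otimes>\<^bsub>Z\<^esub> b)))"
proof -
  have b: "bilin (H.ten V W) Z F" by (rule blI[OF F])
  note l = c.lf_psum_dec[OF b]
  show ?thesis
    unfolding phi2_def
    apply (subst lf_eval_tensor[OF c.vec_space_coded dZ_pol[OF rV x] l])
     apply (rule phi2_term[OF _ _ y], assumption, assumption)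
    apply (rule psum_cong[OF dZ_pol[OF rV x]])
    apply (subst lf_eval_tensor[OF c.vec_space_coded dZ_pol[OF rW y] l])
     apply (assumption | rule c.cp_closed H.tp_closed rV rW Z.mult_closed)+
    apply (rule psum_cong[OF dZ_pol[OF rW y]])
    apply (rule c.psum_cp[OF _ _ b])
     apply (assumption | rule H.tp_closed rV rW Z.mult_closed)+
    done
qed

lemma phi2_closed: assumes x: "x \<in> carrier (FO V)" and y: "y \<in> carrier (FO W)" shows "phi2 V W x y \<in> carrier (FO (H.ten V W))"
proof -
  have "cotrel (H.ten V W) (dZ (phi2 V W x y))"
    unfolding cotrel_def
  proof (intro allI impI)
    fix F assume F: "trilin (H.ten V W) H Z F"
    note rules = tlD1[OF F] tlD2[OF F] tlD3[OF F] lZ.linfun lf_psum_inner[OF lZ.pol] H.lf_com[OF rV] H.lf_com[OF rW] H.lf_coact_ten[OF rV rW]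
      lf_psum_inner[OF H.com_pol[OF rV]] lf_psum_inner[OF H.com_pol[OF rW]] lf_psum_inner[OF H.coact_ten_pol[OF rV rW]]
      lf_psum_inner[OF dZ_pol[OF rV x]] lf_psum_inner[OF dZ_pol[OF rW y]]
      H.lf_tp1[OF rV rW] H.lf_tp2[OF rV rW] H.tp_closed[OF rV rW] H.lf_mult1 H.lf_mult2 H.mult_closed Z.lf_mult1 Z.lf_mult2 Z.mult_closed
    note px = dZ_pol[OF rV x] and py = dZ_pol[OF rW y]
    have "psum (dZ (phi2 V W x y)) (\<lambda>v a. sw (coact (H.ten V W) v) (\<lambda>u h. F u h a)) =
       psum (dZ x) (\<lambda>v a. psum (dZ y) (\<lambda>w b. sw (coact (H.ten V W) (H.tp V W v w)) (\<lambda>u h. F u h (a \<otimes>\<^bsub>Z\<^esub> b))))"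
      by (rule psum_phi2[OF x y]) (assumption | rule rules)+
    also have "\<dots> = psum (dZ x) (\<lambda>v a. psum (dZ y) (\<lambda>w b. sw (coact V v) (\<lambda>v0 v1. sw (coact W w) (\<lambda>w0 w1.
       F (H.tp V W v0 w0) (v1 \<otimes>\<^bsub>H\<^esub> w1) (a \<otimes>\<^bsub>Z\<^esub> b)))))"
      by (intro psum_cong[OF px] psum_cong[OF py] H.ten_coact_tp[OF rV rW]) (assumption | rule rules)+
    also have "\<dots> = psum (dZ x) (\<lambda>v a. sw (coact V v) (\<lambda>v0 v1. psum (dZ y) (\<lambda>w b. sw (coact W w) (\<lambda>w0 w1.
       F (H.tp V W v0 w0) (v1 \<otimes>\<^bsub>H\<^esub> w1) (a \<otimes>\<^bsub>Z\<^esub> b)))))"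
      by (intro psum_cong[OF px] psum_swap)
    also have "\<dots> = psum (dZ x) (\<lambda>v a. sw (lZ a) (\<lambda>h a'. psum (dZ y) (\<lambda>w b. sw (coact W w) (\<lambda>w0 w1.
       F (H.tp V W v w0) (h \<otimes>\<^bsub>H\<^esub> w1) (a' \<otimes>\<^bsub>Z\<^esub> b)))))"
      by (rule FO_cotrel[OF rV x]) (assumption | rule rules)+
    also have "\<dots> = psum (dZ x) (\<lambda>v a. sw (lZ a) (\<lambda>h a'. psum (dZ y) (\<lambda>w b. sw (lZ b) (\<lambda>h' b'.
       F (H.tp V W v w) (h \<otimes>\<^bsub>H\<^esub> h') (a' \<otimes>\<^bsub>Z\<^esub> b')))))"
      by (intro psum_cong[OF px] psum_cong[OF lZ.pol] FO_cotrel[OF rW y]) (assumption | rule rules)+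
    also have "\<dots> = psum (dZ x) (\<lambda>v a. psum (dZ y) (\<lambda>w b. sw (lZ a) (\<lambda>h a'. sw (lZ b) (\<lambda>h' b'.
       F (H.tp V W v w) (h \<otimes>\<^bsub>H\<^esub> h') (a' \<otimes>\<^bsub>Z\<^esub> b')))))"
      by (intro psum_cong[OF px] psum_swap)
    also have "\<dots> = psum (dZ x) (\<lambda>v a. psum (dZ y) (\<lambda>w b. sw (lZ (a \<otimes>\<^bsub>Z\<^esub> b)) (\<lambda>h c. F (H.tp V W v w) h c)))"
      by (intro psum_cong[OF px] psum_cong[OF py] lZ_mult[symmetric] blI) (assumption | rule rules)+
    also have "\<dots> = psum (dZ (phi2 V W x y)) (\<lambda>v a. sw (lZ a) (\<lambda>h b. F v h b))"
      by (rule psum_phi2[OF x y, symmetric]) (assumption | rule rules)+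
    finally show "psum (dZ (phi2 V W x y)) (\<lambda>v a. sw (coact (H.ten V W) v) (\<lambda>u h. F u h a)) =
       psum (dZ (phi2 V W x y)) (\<lambda>v a. sw (lZ a) (\<lambda>h b. F v h b))" .
  qed
  then show ?thesis using phi2_amb[OF x y] by (simp add: FO_sel)
qed

lemma lf_phi2: assumes x: "x \<in> carrier (FO V)" and y: "y \<in> carrier (FO W)" and f: "linfun (FO (H.ten V W)) f"
  shows "f (phi2 V W x y) = psum (dZ x) (\<lambda>v a. psum (dZ y) (\<lambda>w b. f (Pr (H.ten V W) (H.tp V W v w) (a \<otimes>\<^bsub>Z\<^esub> b))))"
  unfolding lf_FO_eq[OF rT phi2_closed[OF x y] f]
  by (rule psum_phi2[OF x y]) (assumption | rule lf_Pr1[OF rT f] lf_Pr2[OF rT f])+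

lemma bmap_phi2: "bmap (FO V) (FO W) (FO (H.ten V W)) (phi2 V W)"
proof (rule bmapI[OF phi2_closed])
  fix f assume f: "linfun (FO (H.ten V W)) f"
  note rules = lf_Pr1[OF rT f] lf_Pr2[OF rT f] H.lf_tp1[OF rV rW] H.lf_tp2[OF rV rW] H.tp_closed[OF rV rW] Z.lf_mult1 Z.lf_mult2 Z.mult_closed
    lf_dZ[OF rV] lf_dZ[OF rW] lf_psum_inner[OF dZ_pol[OF rV]] lf_psum_inner[OF dZ_pol[OF rW]]
    H.lf_tp1[OF rV rW lf_Pr1[OF rT f]] H.lf_tp2[OF rV rW lf_Pr1[OF rT f]] Z.lf_mult1[OF lf_Pr2[OF rT f]] Z.lf_mult2[OF lf_Pr2[OF rT f]]
  show "linfun (FO V) (\<lambda>x. f (phi2 V W x y))" if y: "y \<in> carrier (FO W)" for y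
    by (subst lf_cong[OF lf_phi2[OF _ y f] vs_FO[OF rV]], assumption) (assumption | rule rules y)+
  show "linfun (FO W) (\<lambda>y. f (phi2 V W x y))" if x: "x \<in> carrier (FO V)" for x
    by (subst lf_cong[OF lf_phi2[OF x _ f] vs_FO[OF rW]], assumption) (assumption | rule rules x)+
qed

lemma phi_lin: "linear_map (K.ten (FO V) (FO W)) (FO (H.ten V W)) (phi V W)"
  unfolding phi_def by (intro K.ten_lift_lin rK vs_FO[OF rT] bmap_phi2)

lemma phi_tp: "x \<in> carrier (FO V) ==> y \<in> carrier (FO W) ==> phi V W (K.tp (FO V) (FO W) x y) = phi2 V W x y"
  unfolding phi_def by (intro K.ten_lift_tp rK vs_FO[OF rT] bmap_phi2)

lemma cm_phi: "K.colin (K.ten (FO V) (FO W)) (phi V W) (FO (H.ten V W))"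
  unfolding K.colin_def
proof (intro conjI K.comodule_map_tenI K.rc_ten rK phi_lin)
  fix x y G assume x: "x \<in> carrier (FO V)" and y: "y \<in> carrier (FO W)" and G: "bilin (FO (H.ten V W)) K G"
  note gp1 = lf_Pr1[OF rT blD1[OF G]] and gp2 = lf_Pr2[OF rT blD1[OF G]]
  note rules = blD2[OF G] gp1 gp2 Pr_closed[OF rT] H.lf_tp1[OF rV rW] H.lf_tp2[OF rV rW] H.tp_closed[OF rV rW]
    H.lf_tp1[OF rV rW gp1] H.lf_tp2[OF rV rW gp1] Z.lf_mult1[OF gp2] Z.lf_mult2[OF gp2]
    Z.lf_mult1 Z.lf_mult2 Z.mult_closed K.lf_mult1 K.lf_mult2 K.mult_closed rZ.linfun lf_psum_inner[OF rZ.pol]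
    lf_dZ[OF rV] lf_dZ[OF rW] lf_psum_inner[OF dZ_pol[OF rV]] lf_psum_inner[OF dZ_pol[OF rW]]
    lf_coact_FO[OF rV] lf_coact_FO[OF rW] lf_psum_inner[OF coact_FO_pol[OF rV]] lf_psum_inner[OF coact_FO_pol[OF rW]] x y
  let ?P = "\<lambda>v w c k. G (Pr (H.ten V W) (H.tp V W v w) c) k"
  note px = dZ_pol[OF rV x] and py = dZ_pol[OF rW y]
  note cx = coact_FO_pol[OF rV x] and cy = coact_FO_pol[OF rW y]
  have "sw (coact (FO (H.ten V W)) (phi V W (K.tp (FO V) (FO W) x y))) (\<lambda>u a. G u a) =
    psum (dZ (phi2 V W x y)) (\<lambda>m c. sw (rZ c) (\<lambda>b k. G (Pr (H.ten V W) m b) k))"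
    unfolding phi_tp[OF x y] by (rule coact_FO[OF rT phi2_closed[OF x y]]) (assumption | rule blD1[OF G] blD2[OF G])+
  also have "\<dots> = psum (dZ x) (\<lambda>v a. psum (dZ y) (\<lambda>w b. sw (rZ (a \<otimes>\<^bsub>Z\<^esub> b)) (\<lambda>c k. ?P v w c k)))"
    by (rule psum_phi2[OF x y]) (assumption | rule rules)+
  also have "\<dots> = psum (dZ x) (\<lambda>v a. psum (dZ y) (\<lambda>w b. sw (rZ a) (\<lambda>a' k. sw (rZ b) (\<lambda>b' k'. ?P v w (a' \<otimes>\<^bsub>Z\<^esub> b') (k \<otimes>\<^bsub>K\<^esub> k')))))"
    by (intro psum_cong[OF px] psum_cong[OF py] rZ_mult blI) (assumption | rule rules)+
  also have "\<dots> = psum (dZ x) (\<lambda>v a. sw (rZ a) (\<lambda>a' k. psum (dZ y) (\<lambda>w b. sw (rZ b) (\<lambda>b' k'. ?P v w (a' \<otimes>\<^bsub>Z\<^esub> b') (k \<otimes>\<^bsub>K\<^esub> k')))))"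
    by (intro psum_cong[OF px] psum_swap)
  also have "\<dots> = psum (dZ x) (\<lambda>v a. sw (rZ a) (\<lambda>a' k. sw (coact (FO W) y) (\<lambda>y0 y1. psum (dZ y0) (\<lambda>w b. ?P v w (a' \<otimes>\<^bsub>Z\<^esub> b) (k \<otimes>\<^bsub>K\<^esub> y1)))))"
    by (intro psum_cong[OF px] psum_cong[OF rZ.pol] coact_FO_amb[OF rW y, symmetric]) (assumption | rule rules)+
  also have "\<dots> = sw (coact (FO V) x) (\<lambda>x0 x1. psum (dZ x0) (\<lambda>v a. sw (coact (FO W) y) (\<lambda>y0 y1. psum (dZ y0) (\<lambda>w b. ?P v w (a \<otimes>\<^bsub>Z\<^esub> b) (x1 \<otimes>\<^bsub>K\<^esub> y1)))))"
    by (rule coact_FO_amb[OF rV x, symmetric]) (assumption | rule rules)+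
  also have "\<dots> = sw (coact (FO V) x) (\<lambda>x0 x1. sw (coact (FO W) y) (\<lambda>y0 y1. psum (dZ x0) (\<lambda>v a. psum (dZ y0) (\<lambda>w b. ?P v w (a \<otimes>\<^bsub>Z\<^esub> b) (x1 \<otimes>\<^bsub>K\<^esub> y1)))))"
    by (intro psum_cong[OF cx] psum_swap)
  also have "\<dots> = sw (coact (FO V) x) (\<lambda>x0 x1. sw (coact (FO W) y) (\<lambda>y0 y1. G (phi V W (K.tp (FO V) (FO W) x0 y0)) (x1 \<otimes>\<^bsub>K\<^esub> y1)))"
    by (intro psum_cong[OF cx] psum_cong[OF cy]) (simp add: phi_tp lf_phi2[OF _ _ blD1[OF G]] K.mult_closed)
  finally show "sw (coact (FO (H.ten V W)) (phi V W (K.tp (FO V) (FO W) x y))) (\<lambda>u a. G u a) =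
    sw (coact (FO V) x) (\<lambda>x0 x1. sw (coact (FO W) y) (\<lambda>y0 y1. G (phi V W (K.tp (FO V) (FO W) x0 y0)) (x1 \<otimes>\<^bsub>K\<^esub> y1)))" .
qed

lemma vT: "vec_space (K.ten (FO V) (FO W))" by (intro K.vs_ten rK)

abbreviation "ktp \<equiv> K.tp (FO V) (FO W)"

lemma psi_term_closed: "v \<in> carrier V ==> w \<in> carrier W ==> c \<in> carrier Z ==> psi_term V W v w c \<in> carrier (K.ten (FO V) (FO W))"
  unfolding psi_term_def Let_def
  by (assumption | rule eval_tensor_closed[OF vT H.com_pol[OF rV]] eval_tensor_closed[OF vT H.com_pol[OF rW]]
      eval_tensor_closed[OF vT gH.pol] vs_smult[OF vT] K.tp_closed[OF rK(1,2)] Pr_closed[OF rV] Pr_closed[OF rW])+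

lemma lf_psi_term:
  assumes v: "v \<in> carrier V" and w: "w \<in> carrier W" and c: "c \<in> carrier Z" and f: "linfun (K.ten (FO V) (FO W)) f"
  shows "f (psi_term V W v w c) = sw (coact V v) (\<lambda>v0 h. sw (gH h) (\<lambda>z y. sw (coact W w) (\<lambda>w0 h'. sw (gH h') (\<lambda>z' y'.
       \<omega> ((y \<otimes>\<^bsub>Y\<^esub> y') \<otimes>\<^bsub>Y\<^esub> S c) * f (ktp (Pr V v0 z) (Pr W w0 z'))))))"
proof -
  note cl = eval_tensor_closed[OF vT H.com_pol[OF rW]]
      eval_tensor_closed[OF vT gH.pol] vs_smult[OF vT] K.tp_closed[OF rK(1,2)] Pr_closed[OF rV] Pr_closed[OF rW] w
  show ?thesis
    unfolding psi_term_def Let_def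
    apply (subst lf_eval_tensor[OF vT H.com_pol[OF rV v] f])
     apply (assumption | rule cl)+
    apply (rule psum_cong[OF H.com_pol[OF rV v]])
    apply (subst lf_eval_tensor[OF vT gH.pol f], assumption)
     apply (assumption | rule cl)+
    apply (rule psum_cong[OF gH.pol], assumption)
    apply (subst lf_eval_tensor[OF vT H.com_pol[OF rW w] f])
     apply (assumption | rule cl)+
    apply (rule psum_cong[OF H.com_pol[OF rW w]])
    apply (subst lf_eval_tensor[OF vT gH.pol f], assumption)
     apply (assumption | rule cl)+
    apply (rule psum_cong[OF gH.pol], assumption)
    apply (rule lf_smult[OF f])
    apply (assumption | rule cl)+
    done
qed

lemma psi_closed: "t \<in> carrier (FO (H.ten V W)) ==> psi V W t \<in> carrier (K.ten (FO V) (FO W))"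
  unfolding psi_def Let_def
  by (assumption | rule eval_tensor_closed[OF vT dZ_pol[OF rT]] eval_tensor_closed[OF vT H.ten_dec_pol[OF rV rW]] psi_term_closed)+

lemma lf_psi: assumes t: "t \<in> carrier (FO (H.ten V W))" and f: "linfun (K.ten (FO V) (FO W)) f"
  shows "f (psi V W t) = psum (dZ t) (\<lambda>m c. psum (H.de m) (\<lambda>v w. f (psi_term V W v w c)))"
  unfolding psi_def Let_def
  apply (subst lf_eval_tensor[OF vT dZ_pol[OF rT t] f])
   apply (assumption | rule eval_tensor_closed[OF vT H.ten_dec_pol[OF rV rW]] psi_term_closed)+
  apply (rule psum_cong[OF dZ_pol[OF rT t]])
  apply (rule lf_eval_tensor[OF vT H.ten_dec_pol[OF rV rW] f], assumption)
  apply (assumption | rule psi_term_closed)+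
  done

lemma lf_\<omega>3: "y' \<in> carrier Y ==> s \<in> carrier Y ==> linfun Y (\<lambda>y. \<omega> ((y \<otimes>\<^bsub>Y\<^esub> y') \<otimes>\<^bsub>Y\<^esub> s))"
  "y \<in> carrier Y ==> s \<in> carrier Y ==> linfun Y (\<lambda>y'. \<omega> ((y \<otimes>\<^bsub>Y\<^esub> y') \<otimes>\<^bsub>Y\<^esub> s))"
  "y \<in> carrier Y ==> y' \<in> carrier Y ==> linfun Z (\<lambda>c. \<omega> ((y \<otimes>\<^bsub>Y\<^esub> y') \<otimes>\<^bsub>Y\<^esub> S c))"
  by (rule Y.lf_mult1[OF lf_\<omega>1] Y.lf_mult2[OF lf_\<omega>1] lf_\<omega>2 Y.mult_closed rV | assumption)+

context
  fixes f assumes f: "linfun (K.ten (FO V) (FO W)) f"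
begin

lemmas fP = lf_Pr1[OF rV K.lf_tp1[OF rK(1,2) f]] lf_Pr2[OF rV K.lf_tp1[OF rK(1,2) f]]
    lf_Pr1[OF rW K.lf_tp2[OF rK(1,2) f]] lf_Pr2[OF rW K.lf_tp2[OF rK(1,2) f]]

lemmas psi_rules = fP lf_mult_const lf_\<omega>3 S_closed Y.mult_closed Pr_closed[OF rV] Pr_closed[OF rW] H.lf_com[OF rV] H.lf_com[OF rW] gH.linfun lf_psum_inner[OF gH.pol]
    lf_psum_inner[OF H.com_pol[OF rV]] lf_psum_inner[OF H.com_pol[OF rW]]

lemma lf_psi_term_v: "w \<in> carrier W ==> c \<in> carrier Z ==> linfun V (\<lambda>v. f (psi_term V W v w c))"
  by (subst lf_cong[OF lf_psi_term[OF _ _ _ f] H.com_vs[OF rV]], assumption, assumption, assumption)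
    (assumption | rule psi_rules)+

lemma lf_psi_term_w: "v \<in> carrier V ==> c \<in> carrier Z ==> linfun W (\<lambda>w. f (psi_term V W v w c))"
  by (subst lf_cong[OF lf_psi_term[OF _ _ _ f] H.com_vs[OF rW]], assumption, assumption, assumption)
    (assumption | rule psi_rules)+

lemma lf_psi_term_c: "v \<in> carrier V ==> w \<in> carrier W ==> linfun Z (\<lambda>c. f (psi_term V W v w c))"
  by (subst lf_cong[OF lf_psi_term[OF _ _ _ f] Z.vs], assumption, assumption, assumption)
    (assumption | rule psi_rules)+

lemma lf_psi_lin: "linfun (FO (H.ten V W)) (\<lambda>t. f (psi V W t))"
  apply (subst lf_cong[OF lf_psi[OF _ f] vs_FO[OF rT]], assumption)
  apply (rule lf_dZ[OF rT])
   apply (rule H.lf_de[OF rV rW], rule blI, rule lf_psi_term_v, assumption, assumption, rule lf_psi_term_w, assumption, assumption)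
  apply (rule lf_psum_inner[OF H.ten_dec_pol[OF rV rW]], assumption, rule lf_psi_term_c, assumption, assumption)
  done

end

lemma psi_lin: "linear_map (FO (H.ten V W)) (K.ten (FO V) (FO W)) (psi V W)"
  by (rule linear_mapI_lf[OF vs_FO[OF rT] vT]) (rule psi_closed lf_psi_lin, assumption)+

text \<open>Since \<open>gH\<close> is multiplicative, the composite is the projection for the comodule \<open>V \<otimes> W\<close>.\<close>

lemma phi_psi: assumes t: "t \<in> carrier (FO (H.ten V W))" shows "phi V W (psi V W t) = t"
proof (rule FO_eqI[OF rT linear_map_closed[OF phi_lin psi_closed[OF t]] t])
  fix F assume F: "\<And>a. a \<in> carrier Z ==> linfun (H.ten V W) (\<lambda>v. F v a)" "\<And>v. v \<in> carrier (H.ten V W) ==> linfun Z (\<lambda>a. F v a)"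
  let ?L = "\<lambda>s. psum (dZ (phi V W s)) (\<lambda>m c. F m c)"
  have L: "linfun (K.ten (FO V) (FO W)) ?L" by (rule lf_linear_map[OF phi_lin lf_dZ[OF rT F]])
  note pt = dZ_pol[OF rT t] and pm = H.ten_dec_pol[OF rV rW]
  note rules = F lf_mult_const lf_\<omega>3 lf_\<omega>1 lf_\<omega>2 S_closed Y.mult_closed Pr_closed[OF rV] Pr_closed[OF rW] H.lf_com[OF rV] H.lf_com[OF rW] gH.linfun lf_psum_inner[OF gH.pol]
    lf_psum_inner[OF H.com_pol[OF rV]] lf_psum_inner[OF H.com_pol[OF rW]] H.lf_tp1[OF rV rW] H.lf_tp2[OF rV rW] H.tp_closed[OF rV rW]
    Z.lf_mult1 Z.lf_mult2 Z.mult_closed lf_psum_inner[OF dZ_pol[OF rV]] lf_psum_inner[OF dZ_pol[OF rW]] lf_dZ[OF rV] lf_dZ[OF rW]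
    H.lf_coact_ten[OF rV rW]
  let ?FT = "\<lambda>u x c. sw (gH x) (\<lambda>z y. \<omega> (y \<otimes>\<^bsub>Y\<^esub> S c) * F u z)"
  have trm: "?L (psi_term V W v w c) = sw (coact (H.ten V W) (H.tp V W v w)) (\<lambda>u x. ?FT u x c)"
    if v: "v \<in> carrier V" and w: "w \<in> carrier W" and c: "c \<in> carrier Z" for v w c
  proof -
    note p1 = psum_cong[OF H.com_pol[OF rV v]] and p2 = psum_cong[OF gH.pol] and p3 = psum_cong[OF H.com_pol[OF rW w]]
    have "?L (psi_term V W v w c) = sw (coact V v) (\<lambda>v0 h. sw (gH h) (\<lambda>z y. sw (coact W w) (\<lambda>w0 h'. sw (gH h') (\<lambda>z' y'.
       \<omega> ((y \<otimes>\<^bsub>Y\<^esub> y') \<otimes>\<^bsub>Y\<^esub> S c) * ?L (ktp (Pr V v0 z) (Pr W w0 z'))))))"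
      by (rule lf_psi_term[OF v w c L])
    also have "\<dots> = sw (coact V v) (\<lambda>v0 h. sw (gH h) (\<lambda>z y. sw (coact W w) (\<lambda>w0 h'. sw (gH h') (\<lambda>z' y'.
       psum (dZ (Pr V v0 z)) (\<lambda>v a. psum (dZ (Pr W w0 z')) (\<lambda>w b. \<omega> ((y \<otimes>\<^bsub>Y\<^esub> y') \<otimes>\<^bsub>Y\<^esub> S c) * F (H.tp V W v w) (a \<otimes>\<^bsub>Z\<^esub> b)))))))"
      unfolding psum_mult_left
      by (intro p1 p2 p3 arg_cong2[where f = "(*)"] refl)
        (simp_all add: phi_tp Pr_closed[OF rV] Pr_closed[OF rW] psum_phi2[OF _ _ F])
    also have "\<dots> = sw (coact V v) (\<lambda>v0 h. sw (gH h) (\<lambda>z y. sw (coact W w) (\<lambda>w0 h'. 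
       psum (dZ (Pr V v0 z)) (\<lambda>v a. sw (gH h') (\<lambda>z' y'. psum (dZ (Pr W w0 z')) (\<lambda>w b. \<omega> ((y \<otimes>\<^bsub>Y\<^esub> y') \<otimes>\<^bsub>Y\<^esub> S c) * F (H.tp V W v w) (a \<otimes>\<^bsub>Z\<^esub> b)))))))"
      by (intro p1 p2 p3 psum_swap)
    also have "\<dots> = sw (coact V v) (\<lambda>v0 h. sw (gH h) (\<lambda>z y. 
       psum (dZ (Pr V v0 z)) (\<lambda>v a. sw (coact W w) (\<lambda>w0 h'. sw (gH h') (\<lambda>z' y'. psum (dZ (Pr W w0 z')) (\<lambda>w b. \<omega> ((y \<otimes>\<^bsub>Y\<^esub> y') \<otimes>\<^bsub>Y\<^esub> S c) * F (H.tp V W v w) (a \<otimes>\<^bsub>Z\<^esub> b)))))))"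
      by (intro p1 p2 psum_swap)
    also have "\<dots> = sw (coact V v) (\<lambda>v0 h. sw (gH h) (\<lambda>z y. 
       sw (coact W w) (\<lambda>w0 h'. sw (gH h') (\<lambda>z' y'. psum (dZ (Pr W w0 z')) (\<lambda>w b. \<omega> ((y \<otimes>\<^bsub>Y\<^esub> y') \<otimes>\<^bsub>Y\<^esub> S c) * F (H.tp V W v0 w) (z \<otimes>\<^bsub>Z\<^esub> b))))))"
      by (rule Pr_collapse_Y[OF rV v], rule tlI) (assumption | rule rules w c)+
    also have "\<dots> = sw (coact V v) (\<lambda>v0 h. sw (gH h) (\<lambda>z y. 
       sw (coact W w) (\<lambda>w0 h'. sw (gH h') (\<lambda>z' y'. \<omega> ((y \<otimes>\<^bsub>Y\<^esub> y') \<otimes>\<^bsub>Y\<^esub> S c) * F (H.tp V W v0 w0) (z \<otimes>\<^bsub>Z\<^esub> z')))))"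
      by (intro p1 p2 Pr_collapse_Y[OF rW w] tlI) (assumption | rule rules c)+
    also have "\<dots> = sw (coact V v) (\<lambda>v0 h. sw (coact W w) (\<lambda>w0 h'. sw (gH h) (\<lambda>z y. 
       sw (gH h') (\<lambda>z' y'. \<omega> ((y \<otimes>\<^bsub>Y\<^esub> y') \<otimes>\<^bsub>Y\<^esub> S c) * F (H.tp V W v0 w0) (z \<otimes>\<^bsub>Z\<^esub> z')))))"
      by (intro p1 psum_swap)
    also have "\<dots> = sw (coact V v) (\<lambda>v0 h. sw (coact W w) (\<lambda>w0 h'. ?FT (H.tp V W v0 w0) (h \<otimes>\<^bsub>H\<^esub> h') c))"
      by (intro p1 p3 gH_mult[symmetric] blI) (assumption | rule rules c)+
    also have "\<dots> = sw (coact (H.ten V W) (H.tp V W v w)) (\<lambda>u x. ?FT u x c)"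
      by (rule H.ten_coact_tp[OF rV rW v w, symmetric]) (assumption | rule rules c)+
    finally show ?thesis .
  qed
  have "psum (dZ (phi V W (psi V W t))) (\<lambda>m c. F m c) = psum (dZ t) (\<lambda>m c. psum (H.de m) (\<lambda>v w. ?L (psi_term V W v w c)))"
    by (rule lf_psi[OF t L])
  also have "\<dots> = psum (dZ t) (\<lambda>m c. psum (H.de m) (\<lambda>v w. sw (coact (H.ten V W) (H.tp V W v w)) (\<lambda>u x. ?FT u x c)))"
    by (intro psum_cong[OF pt] psum_cong[OF pm] trm)
  also have "\<dots> = psum (dZ t) (\<lambda>m c. sw (coact (H.ten V W) m) (\<lambda>u x. ?FT u x c))"
    by (intro psum_cong[OF pt] H.lf_ten_eq[OF rV rW, symmetric]) (assumption | rule rules)+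
  also have "\<dots> = psum (dZ t) (\<lambda>m c. psum (dZ (Pr (H.ten V W) m c)) (\<lambda>m c. F m c))"
    by (intro psum_cong[OF pt] psum_Pr[OF rT, symmetric] F)
  also have "\<dots> = psum (dZ t) (\<lambda>m c. F m c)" by (rule Pr_collapse'[OF rT t blI[OF F]])
  finally show "psum (dZ (phi V W (psi V W t))) (\<lambda>m c. F m c) = psum (dZ t) (\<lambda>m c. F m c)" .
qed

text \<open>Because \<open>S(ab) = S(b) S(a)\<close>, the factor \<open>y' S(b)\<close> collapses first and \<open>y S(a)\<close> after it.\<close>

lemma psi_phi2: assumes x: "x \<in> carrier (FO V)" and y: "y \<in> carrier (FO W)" shows "psi V W (phi2 V W x y) = ktp x y"
proof (rule vs_eqI[OF vT psi_closed[OF phi2_closed[OF x y]] K.tp_closed[OF rK(1,2) x y]])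
  fix f assume f: "linfun (K.ten (FO V) (FO W)) f"
  note px = psum_cong[OF dZ_pol[OF rV x]] and py = psum_cong[OF dZ_pol[OF rW y]]
  let ?f = "\<lambda>v z w z'. f (ktp (Pr V v z) (Pr W w z'))"
  note rules = psi_rules[OF f] lf_\<omega>1 lf_\<omega>2 lf_S Y.lf_mult1 Y.lf_mult2 lf_psum_inner[OF dZ_pol[OF rW y]] lf_psum_inner[OF dZ_pol[OF rV x]]
    lZ.linfun lf_psum_inner[OF lZ.pol] Y.one_closed
  have "f (psi V W (phi2 V W x y)) = psum (dZ (phi2 V W x y)) (\<lambda>m c. psum (H.de m) (\<lambda>v w. f (psi_term V W v w c)))"
    by (rule lf_psi[OF phi2_closed[OF x y] f])
  also have "\<dots> = psum (dZ x) (\<lambda>v a. psum (dZ y) (\<lambda>w b. psum (H.de (H.tp V W v w)) (\<lambda>v w. f (psi_term V W v w (a \<otimes>\<^bsub>Z\<^esub> b)))))"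
    by (rule psum_phi2[OF x y])
      (assumption | rule H.lf_de[OF rV rW] blI lf_psi_term_v[OF f] lf_psi_term_w[OF f] lf_psi_term_c[OF f] lf_psum_inner[OF H.ten_dec_pol[OF rV rW]])+
  also have "\<dots> = psum (dZ x) (\<lambda>v a. psum (dZ y) (\<lambda>w b. f (psi_term V W v w (a \<otimes>\<^bsub>Z\<^esub> b))))"
    by (intro px py H.ten_psum_tp[OF rV rW] blI lf_psi_term_v[OF f] lf_psi_term_w[OF f] Z.mult_closed)
  also have "\<dots> = psum (dZ x) (\<lambda>v a. psum (dZ y) (\<lambda>w b. sw (coact V v) (\<lambda>v0 h. sw (gH h) (\<lambda>z s. sw (coact W w) (\<lambda>w0 h'. sw (gH h') (\<lambda>z' s'.
       \<omega> ((s \<otimes>\<^bsub>Y\<^esub> (s' \<otimes>\<^bsub>Y\<^esub> S b)) \<otimes>\<^bsub>Y\<^esub> S a) * ?f v0 z w0 z'))))))"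
    by (intro px py, subst lf_psi_term[OF _ _ Z.mult_closed f], assumption+)
      (intro psum_cong[OF H.com_pol[OF rV]] psum_cong[OF gH.pol] psum_cong[OF H.com_pol[OF rW]] arg_cong2[where f = "(*)"] refl,
        simp_all add: S_mult Y.assoc S_closed Y.mult_closed)
  also have "\<dots> = psum (dZ x) (\<lambda>v a. sw (coact V v) (\<lambda>v0 h. psum (dZ y) (\<lambda>w b. sw (gH h) (\<lambda>z s. sw (coact W w) (\<lambda>w0 h'. sw (gH h') (\<lambda>z' s'.
       \<omega> ((s \<otimes>\<^bsub>Y\<^esub> (s' \<otimes>\<^bsub>Y\<^esub> S b)) \<otimes>\<^bsub>Y\<^esub> S a) * ?f v0 z w0 z'))))))"
    by (intro px psum_swap)
  also have "\<dots> = psum (dZ x) (\<lambda>v a. sw (coact V v) (\<lambda>v0 h. sw (gH h) (\<lambda>z s. psum (dZ y) (\<lambda>w b. sw (coact W w) (\<lambda>w0 h'. sw (gH h') (\<lambda>z' s'.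
       \<omega> ((s \<otimes>\<^bsub>Y\<^esub> (s' \<otimes>\<^bsub>Y\<^esub> S b)) \<otimes>\<^bsub>Y\<^esub> S a) * ?f v0 z w0 z'))))))"
    by (intro px psum_cong[OF H.com_pol[OF rV]] psum_swap)
  also have "\<dots> = psum (dZ x) (\<lambda>v a. sw (coact V v) (\<lambda>v0 h. sw (gH h) (\<lambda>z s. psum (dZ y) (\<lambda>w b. sw (lZ b) (\<lambda>h' b'. sw (gH h') (\<lambda>z' s'.
       \<omega> ((s \<otimes>\<^bsub>Y\<^esub> (s' \<otimes>\<^bsub>Y\<^esub> S b')) \<otimes>\<^bsub>Y\<^esub> S a) * ?f v0 z w z'))))))"
    by (intro px psum_cong[OF H.com_pol[OF rV]] psum_cong[OF gH.pol] FO_cotrel[OF rW y]) (assumption | rule rules)+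
  also have "\<dots> = psum (dZ x) (\<lambda>v a. sw (coact V v) (\<lambda>v0 h. sw (gH h) (\<lambda>z s. psum (dZ y) (\<lambda>w b.
       \<omega> ((s \<otimes>\<^bsub>Y\<^esub> \<one>\<^bsub>Y\<^esub>) \<otimes>\<^bsub>Y\<^esub> S a) * ?f v0 z w b))))"
    by (intro px psum_cong[OF H.com_pol[OF rV]] psum_cong[OF gH.pol] py
        galois_collapse_bl[where E = "\<lambda>t z'. \<omega> ((_ \<otimes>\<^bsub>Y\<^esub> t) \<otimes>\<^bsub>Y\<^esub> S _) * ?f _ _ _ z'"] blI) (assumption | rule rules)+
  also have "\<dots> = psum (dZ x) (\<lambda>v a. sw (lZ a) (\<lambda>h a'. sw (gH h) (\<lambda>z s. psum (dZ y) (\<lambda>w b.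
       \<omega> ((s \<otimes>\<^bsub>Y\<^esub> \<one>\<^bsub>Y\<^esub>) \<otimes>\<^bsub>Y\<^esub> S a') * ?f v z w b))))"
    by (rule FO_cotrel[OF rV x]) (assumption | rule rules)+
  also have "\<dots> = psum (dZ x) (\<lambda>v a. sw (lZ a) (\<lambda>h a'. sw (gH h) (\<lambda>z s. psum (dZ y) (\<lambda>w b.
       \<omega> (s \<otimes>\<^bsub>Y\<^esub> S a') * ?f v z w b))))"
    by (intro px py psum_cong[OF lZ.pol] psum_cong[OF gH.pol]) (simp_all add: Y.r_one)
  also have "\<dots> = psum (dZ x) (\<lambda>v a. psum (dZ y) (\<lambda>w b. \<omega> \<one>\<^bsub>Y\<^esub> * ?f v a w b))"
    by (intro px galois_collapse_bl[where E = "\<lambda>t z. psum (dZ y) (\<lambda>w b. \<omega> t * ?f _ z w b)"] blI)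
      (assumption | rule rules \<omega>_lf)+
  also have "\<dots> = psum (dZ x) (\<lambda>v a. f (ktp (Pr V v a) y))"
    unfolding \<omega>_one mult_1_left
    by (intro px lf_FO_eq[OF rW y, symmetric] K.lf_tp2[OF rK(1,2) f] Pr_closed[OF rV])
  also have "\<dots> = f (ktp x y)"
    by (intro lf_FO_eq[OF rV x, symmetric] K.lf_tp1[OF rK(1,2) f] y)
  finally show "f (psi V W (phi2 V W x y)) = f (ktp x y)" .
qed

end

end

context galois_monoidal
begin

lemma psi_phi:
  assumes R: "H.rc V" "H.rc W" and s: "s \<in> carrier (K.ten (FO V) (FO W))"
  shows "psi V W (phi V W s) = s"
  by (rule K.ten_lin_eqI[OF rc_FO[OF R(1)] rc_FO[OF R(2)] linear_map_comp[OF phi_lin[OF R] psi_lin[OF R]] linear_map_id vT[OF R] _ s])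
    (simp add: phi_tp[OF R] psi_phi2[OF R])

lemma iso_phi:
  assumes R: "H.rc V" "H.rc W"
  shows "iso_arr K.CC (K.ten (FO V) (FO W)) (FO (H.ten V W)) (K.arrow (K.ten (FO V) (FO W)) (phi V W) (FO (H.ten V W)))"
  by (rule K.iso_arrI(1)[OF cm_phi[OF R], where g = "psi V W"])
    (simp_all add: psi_closed[OF R] psi_phi[OF R] phi_psi[OF R])

lemma phi2_natural:
  assumes f: "H.colin V f V'" and g: "H.colin W g W'" and x: "x \<in> carrier (FO V)" and y: "y \<in> carrier (FO W)"
  shows "phi2 V' W' (fm V' f x) (fm W' g y) = fm (H.ten V' W') (H.tmap V' W' f g) (phi2 V W x y)"
proof -
  note R = H.cm_rc[OF f] H.cm_rc[OF g]
  note fg = H.cm_tmap[OF f g]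
  note c = fm_closed[OF f x] fm_closed[OF g y] phi2_closed[OF R(1,3) x y]
  show ?thesis
  proof (rule FO_eqI[OF H.rc_ten[OF R(2,4)] phi2_closed[OF R(2,4) c(1,2)] fm_closed[OF fg c(3)]])
    fix F assume F: "\<And>a. a \<in> carrier Z ==> linfun (H.ten V' W') (\<lambda>v. F v a)" "\<And>v. v \<in> carrier (H.ten V' W') ==> linfun Z (\<lambda>a. F v a)"
    note rules = F H.lf_tp1[OF R(2,4)] H.lf_tp2[OF R(2,4)] H.tp_closed[OF R(2,4)] Z.lf_mult1 Z.lf_mult2 Z.mult_closed H.cm_closed[OF f] H.cm_closed[OF g]
      lf_psum_inner[OF dZ_pol[OF R(4) c(2)]] lf_psum_inner[OF dZ_pol[OF R(3) y]] lf_linear_map[OF H.cm_lin[OF fg]] H.cm_closed[OF fg]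
      lf_dZ[OF R(4)] x y c lf_linear_map[OF H.cm_lin[OF f] H.lf_tp1[OF R(2,4)]]
    have "psum (dZ (phi2 V' W' (fm V' f x) (fm W' g y))) (\<lambda>v a. F v a) =
      psum (dZ (fm V' f x)) (\<lambda>v a. psum (dZ (fm W' g y)) (\<lambda>w b. F (H.tp V' W' v w) (a \<otimes>\<^bsub>Z\<^esub> b)))"
      by (rule psum_phi2[OF R(2,4) c(1,2) F])
    also have "\<dots> = psum (dZ x) (\<lambda>v a. psum (dZ (fm W' g y)) (\<lambda>w b. F (H.tp V' W' (f v) w) (a \<otimes>\<^bsub>Z\<^esub> b)))"
      by (rule psum_fm[OF f x]) (assumption | rule rules)+
    also have "\<dots> = psum (dZ x) (\<lambda>v a. psum (dZ y) (\<lambda>w b. F (H.tp V' W' (f v) (g w)) (a \<otimes>\<^bsub>Z\<^esub> b)))"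
      by (intro psum_cong[OF dZ_pol[OF R(1) x]] psum_fm[OF g y]) (assumption | rule rules)+
    also have "\<dots> = psum (dZ x) (\<lambda>v a. psum (dZ y) (\<lambda>w b. F (H.tmap V' W' f g (H.tp V W v w)) (a \<otimes>\<^bsub>Z\<^esub> b)))"
      by (intro psum_cong[OF dZ_pol[OF R(1) x]] psum_cong[OF dZ_pol[OF R(3) y]])
        (simp add: H.tmap_tp R H.cm_lin[OF f] H.cm_lin[OF g])
    also have "\<dots> = psum (dZ (phi2 V W x y)) (\<lambda>m c. F (H.tmap V' W' f g m) c)"
      by (rule psum_phi2[OF R(1,3) x y, symmetric]) (assumption | rule rules)+
    also have "\<dots> = psum (dZ (fm (H.ten V' W') (H.tmap V' W' f g) (phi2 V W x y))) (\<lambda>v a. F v a)"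
      by (rule psum_fm[OF fg c(3) F, symmetric])
    finally show "psum (dZ (phi2 V' W' (fm V' f x) (fm W' g y))) (\<lambda>v a. F v a) =
       psum (dZ (fm (H.ten V' W') (H.tmap V' W' f g) (phi2 V W x y))) (\<lambda>v a. F v a)" .
  qed
qed

lemma phi_natural:
  assumes f: "H.colin V f V'" and g: "H.colin W g W'" and s: "s \<in> carrier (K.ten (FO V) (FO W))"
  shows "phi V' W' (K.tmap (FO V') (FO W') (fm V' f) (fm W' g) s) = fm (H.ten V' W') (H.tmap V' W' f g) (phi V W s)"
proof -
  note R = H.cm_rc[OF f] H.cm_rc[OF g]
  note Rf = rc_FO[OF R(1)] rc_FO[OF R(2)] rc_FO[OF R(3)] rc_FO[OF R(4)]
  note c1 = K.cm_comp[OF K.cm_tmap[OF cm_fm[OF f] cm_fm[OF g]] cm_phi[OF R(2,4)]]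
    and c2 = K.cm_comp[OF cm_phi[OF R(1,3)] cm_fm[OF H.cm_tmap[OF f g]]]
  show ?thesis
    by (rule K.ten_lin_eqI[OF Rf(1,3) K.cm_lin[OF c1] K.cm_lin[OF c2] vs_FO[OF H.rc_ten[OF R(2,4)]] _ s])
      (simp add: K.tmap_tp Rf fm_lin[OF f] fm_lin[OF g] phi_tp R fm_closed[OF f] fm_closed[OF g] phi2_natural[OF f g])
qed

lemma phi2_assoc:
  assumes R: "H.rc U" "H.rc V" "H.rc W" and x: "x \<in> carrier (FO U)" and y: "y \<in> carrier (FO V)" and z: "z \<in> carrier (FO W)"
  shows "fm (H.ten U (H.ten V W)) (H.asc U V W) (phi2 (H.ten U V) W (phi2 U V x y) z) = phi2 U (H.ten V W) x (phi2 V W y z)"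
proof -
  note Rt = H.rc_ten[OF R(1,2)] H.rc_ten[OF R(2,3)]
  note cA = H.cm_asc[OF R]
  note xy = phi2_closed[OF R(1,2) x y] and yz = phi2_closed[OF R(2,3) y z]
  note L = phi2_closed[OF Rt(1) R(3) xy z] and Rr = phi2_closed[OF R(1) Rt(2) x yz]
  note px = psum_cong[OF dZ_pol[OF R(1) x]] and py = psum_cong[OF dZ_pol[OF R(2) y]] and pz = psum_cong[OF dZ_pol[OF R(3) z]]
  show ?thesis
  proof (rule FO_eqI[OF H.cm_rc(2)[OF cA] fm_closed[OF cA L] Rr])
    fix F assume F: "\<And>a. a \<in> carrier Z ==> linfun (H.ten U (H.ten V W)) (\<lambda>v. F v a)" "\<And>v. v \<in> carrier (H.ten U (H.ten V W)) ==> linfun Z (\<lambda>a. F v a)"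
    have Fa: "linfun (H.ten (H.ten U V) W) (\<lambda>v. F (H.asc U V W v) a)" if "a \<in> carrier Z" for a
      by (rule lf_linear_map[OF H.cm_lin[OF cA] F(1)[OF that]])
    note rules = F(2) Fa H.cm_closed[OF cA] F(1) H.lf_tp1[OF Rt(1) R(3)] H.lf_tp2[OF Rt(1) R(3)] H.tp_closed[OF Rt(1) R(3)]
      H.lf_tp1[OF R(1) Rt(2)] H.lf_tp2[OF R(1) Rt(2)] H.tp_closed[OF R(1) Rt(2)] H.lf_tp1[OF R(2,3)] H.lf_tp2[OF R(2,3)] H.tp_closed[OF R(2,3)]
      H.lf_tp1[OF R(1,2)] H.lf_tp2[OF R(1,2)] H.tp_closed[OF R(1,2)]
      Z.lf_mult1 Z.lf_mult2 Z.mult_closed lf_psum_inner[OF dZ_pol[OF R(3) z]] lf_psum_inner[OF dZ_pol[OF R(2) y]]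
      H.lf_tp1[OF Rt(1) R(3) Fa]
    have "psum (dZ (fm (H.ten U (H.ten V W)) (H.asc U V W) (phi2 (H.ten U V) W (phi2 U V x y) z))) (\<lambda>v a. F v a) =
      psum (dZ (phi2 (H.ten U V) W (phi2 U V x y) z)) (\<lambda>m d. F (H.asc U V W m) d)"
      by (rule psum_fm[OF cA L F])
    also have "\<dots> = psum (dZ (phi2 U V x y)) (\<lambda>m d. psum (dZ z) (\<lambda>w c. F (H.asc U V W (H.tp (H.ten U V) W m w)) (d \<otimes>\<^bsub>Z\<^esub> c)))"
      by (rule psum_phi2[OF Rt(1) R(3) xy z]) (assumption | rule rules)+
    also have "\<dots> = psum (dZ x) (\<lambda>u a. psum (dZ y) (\<lambda>v b. psum (dZ z) (\<lambda>w c. F (H.asc U V W (H.tp (H.ten U V) W (H.tp U V u v) w)) ((a \<otimes>\<^bsub>Z\<^esub> b) \<otimes>\<^bsub>Z\<^esub> c))))"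
      by (rule psum_phi2[OF R(1,2) x y]) (assumption | rule rules)+
    also have "\<dots> = psum (dZ x) (\<lambda>u a. psum (dZ y) (\<lambda>v b. psum (dZ z) (\<lambda>w c. F (H.tp U (H.ten V W) u (H.tp V W v w)) (a \<otimes>\<^bsub>Z\<^esub> (b \<otimes>\<^bsub>Z\<^esub> c)))))"
      by (intro px py pz) (simp add: H.asc_tp R Z.assoc)
    also have "\<dots> = psum (dZ x) (\<lambda>u a. psum (dZ (phi2 V W y z)) (\<lambda>m d. F (H.tp U (H.ten V W) u m) (a \<otimes>\<^bsub>Z\<^esub> d)))"
      by (intro px psum_phi2[OF R(2,3) y z, symmetric]) (assumption | rule rules)+
    also have "\<dots> = psum (dZ (phi2 U (H.ten V W) x (phi2 V W y z))) (\<lambda>v a. F v a)"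
      by (rule psum_phi2[OF R(1) Rt(2) x yz F, symmetric])
    finally show "psum (dZ (fm (H.ten U (H.ten V W)) (H.asc U V W) (phi2 (H.ten U V) W (phi2 U V x y) z))) (\<lambda>v a. F v a) =
      psum (dZ (phi2 U (H.ten V W) x (phi2 V W y z))) (\<lambda>v a. F v a)" .
  qed
qed

lemma psum_dZ_smult:
  assumes R: "H.rc V" and x: "x \<in> carrier (FO V)"
    and F: "\<And>a. a \<in> carrier Z ==> linfun V (\<lambda>v. F v a)" "\<And>v. v \<in> carrier V ==> linfun Z (\<lambda>a. F v a)"
  shows "psum (dZ x) (\<lambda>v a. F (k \<odot>\<^bsub>V\<^esub> v) a) = psum (dZ (k \<odot>\<^bsub>FO V\<^esub> x)) (\<lambda>v a. F v a)"
proof -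
  have "psum (dZ x) (\<lambda>v a. F (k \<odot>\<^bsub>V\<^esub> v) a) = k * psum (dZ x) (\<lambda>v a. F v a)"
    unfolding psum_mult_left[symmetric]
    by (rule psum_cong[OF dZ_pol[OF R x]]) (rule lf_smult[OF F(1)])
  also have "\<dots> = psum (dZ (k \<odot>\<^bsub>FO V\<^esub> x)) (\<lambda>v a. F v a)"
    by (rule lf_smult[OF lf_dZ[OF R F] x, symmetric])
  finally show ?thesis .
qed

lemma phi2_lunit:
  assumes R: "H.rc V" and c: "c \<in> carrier H.I" and x: "x \<in> carrier (FO V)"
  shows "fm V (H.lun V) (phi2 H.I V (phi0 c) x) = inv_into UNIV sc c \<odot>\<^bsub>FO V\<^esub> x"
proof -
  note cl = H.cm_lun[OF R]
  note p = phi2_closed[OF H.rc_I R phi0_closed[OF c] x]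
  show ?thesis
  proof (rule FO_eqI[OF R fm_closed[OF cl p] vs_smult[OF vs_FO[OF R] x]])
    fix F assume F: "\<And>a. a \<in> carrier Z ==> linfun V (\<lambda>v. F v a)" "\<And>v. v \<in> carrier V ==> linfun Z (\<lambda>a. F v a)"
    have Fl: "linfun (H.ten H.I V) (\<lambda>v. F (H.lun V v) a)" if "a \<in> carrier Z" for a
      by (rule lf_linear_map[OF H.cm_lin[OF cl] F(1)[OF that]])
    note rules = F(2) Fl H.cm_closed[OF cl] F(1) H.tp_closed[OF H.rc_I R] H.lf_tp1[OF H.rc_I R Fl]
      Z.lf_mult1 Z.lf_mult2 Z.mult_closed lf_psum_inner[OF dZ_pol[OF R x]]
    have "psum (dZ (fm V (H.lun V) (phi2 H.I V (phi0 c) x))) (\<lambda>v a. F v a) =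
      psum (dZ (phi2 H.I V (phi0 c) x)) (\<lambda>m d. F (H.lun V m) d)"
      by (rule psum_fm[OF cl p F])
    also have "\<dots> = psum (dZ (phi0 c)) (\<lambda>v a. psum (dZ x) (\<lambda>w b. F (H.lun V (H.tp H.I V v w)) (a \<otimes>\<^bsub>Z\<^esub> b)))"
      by (rule psum_phi2[OF H.rc_I R phi0_closed[OF c] x]) (assumption | rule rules)+
    also have "\<dots> = psum (dZ x) (\<lambda>w b. F (H.lun V (H.tp H.I V c w)) (\<one>\<^bsub>Z\<^esub> \<otimes>\<^bsub>Z\<^esub> b))"
      by (rule psum_phi0[OF c]) (assumption | rule rules)+
    also have "\<dots> = psum (dZ x) (\<lambda>w b. F (inv_into UNIV sc c \<odot>\<^bsub>V\<^esub> w) b)"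
      by (rule psum_cong[OF dZ_pol[OF R x]]) (simp add: H.lun_tp[OF R c] Z.l_one)
    also have "\<dots> = psum (dZ (inv_into UNIV sc c \<odot>\<^bsub>FO V\<^esub> x)) (\<lambda>v a. F v a)"
      by (rule psum_dZ_smult[OF R x F])
    finally show "psum (dZ (fm V (H.lun V) (phi2 H.I V (phi0 c) x))) (\<lambda>v a. F v a) =
      psum (dZ (inv_into UNIV sc c \<odot>\<^bsub>FO V\<^esub> x)) (\<lambda>v a. F v a)" .
  qed
qed

lemma phi2_runit:
  assumes R: "H.rc V" and c: "c \<in> carrier H.I" and x: "x \<in> carrier (FO V)"
  shows "fm V (H.run V) (phi2 V H.I x (phi0 c)) = inv_into UNIV sc c \<odot>\<^bsub>FO V\<^esub> x"
proof -
  note cl = H.cm_run[OF R]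
  note p = phi2_closed[OF R H.rc_I x phi0_closed[OF c]]
  show ?thesis
  proof (rule FO_eqI[OF R fm_closed[OF cl p] vs_smult[OF vs_FO[OF R] x]])
    fix F assume F: "\<And>a. a \<in> carrier Z ==> linfun V (\<lambda>v. F v a)" "\<And>v. v \<in> carrier V ==> linfun Z (\<lambda>a. F v a)"
    have Fl: "linfun (H.ten V H.I) (\<lambda>v. F (H.run V v) a)" if "a \<in> carrier Z" for a
      by (rule lf_linear_map[OF H.cm_lin[OF cl] F(1)[OF that]])
    note rules = F(2) Fl H.cm_closed[OF cl] F(1) H.tp_closed[OF R H.rc_I] H.lf_tp2[OF R H.rc_I Fl]
      Z.lf_mult1 Z.lf_mult2 Z.mult_closed
    have "psum (dZ (fm V (H.run V) (phi2 V H.I x (phi0 c)))) (\<lambda>v a. F v a) =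
      psum (dZ (phi2 V H.I x (phi0 c))) (\<lambda>m d. F (H.run V m) d)"
      by (rule psum_fm[OF cl p F])
    also have "\<dots> = psum (dZ x) (\<lambda>v a. psum (dZ (phi0 c)) (\<lambda>w b. F (H.run V (H.tp V H.I v w)) (a \<otimes>\<^bsub>Z\<^esub> b)))"
      by (rule psum_phi2[OF R H.rc_I x phi0_closed[OF c]]) (assumption | rule rules)+
    also have "\<dots> = psum (dZ x) (\<lambda>v a. F (H.run V (H.tp V H.I v c)) (a \<otimes>\<^bsub>Z\<^esub> \<one>\<^bsub>Z\<^esub>))"
      by (intro psum_cong[OF dZ_pol[OF R x]] psum_phi0[OF c]) (assumption | rule rules)+
    also have "\<dots> = psum (dZ x) (\<lambda>w b. F (inv_into UNIV sc c \<odot>\<^bsub>V\<^esub> w) b)"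
      by (rule psum_cong[OF dZ_pol[OF R x]]) (simp add: H.run_tp[OF R c] Z.r_one)
    also have "\<dots> = psum (dZ (inv_into UNIV sc c \<odot>\<^bsub>FO V\<^esub> x)) (\<lambda>v a. F v a)"
      by (rule psum_dZ_smult[OF R x F])
    finally show "psum (dZ (fm V (H.run V) (phi2 V H.I x (phi0 c)))) (\<lambda>v a. F v a) =
      psum (dZ (inv_into UNIV sc c \<odot>\<^bsub>FO V\<^esub> x)) (\<lambda>v a. F v a)" .
  qed
qed

text \<open>The coherence laws hold on pure tensors because they reduce to the associativity of the product of \<open>Z\<close> and to
  its unit laws.\<close>

theorem monoidal_F:
  "monoidal_functor H.CC K.CC FO FA (K.arrow K.I phi0 (FO H.I))
     (\<lambda>V W. K.arrow (K.ten (FO V) (FO W)) (phi V W) (FO (H.ten V W)))"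
proof (intro monoidal_functor.intro monoidal_functor_axioms.intro H.monoidal_category_CC K.monoidal_category_CC functor_F)
  note sel = H.Obj_CC H.TensO_CC H.Unit_CC K.TensO_CC K.Unit_CC
  show "iso_arr K.CC (Unit K.CC) (FO (Unit H.CC)) (K.arrow K.I phi0 (FO H.I))"
    unfolding sel by (rule iso_phi0)
  show "iso_arr K.CC (FO X \<boxtimes>\<^bsub>K.CC\<^esub> FO Y) (FO (X \<boxtimes>\<^bsub>H.CC\<^esub> Y)) (K.arrow (K.ten (FO X) (FO Y)) (phi X Y) (FO (H.ten X Y)))"
    if "X \<in> Obj H.CC" "Y \<in> Obj H.CC" for X Y
    using that unfolding sel by (simp add: iso_phi)
  show "K.arrow (K.ten (FO X') (FO Y')) (phi X' Y') (FO (H.ten X' Y')) \<cdot>\<^bsub>K.CC\<^esub> (FA f \<boxdot>\<^bsub>K.CC\<^esub> FA g) =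
      FA (f \<boxdot>\<^bsub>H.CC\<^esub> g) \<cdot>\<^bsub>K.CC\<^esub> K.arrow (K.ten (FO X) (FO Y)) (phi X Y) (FO (H.ten X Y))"
    if A: "f \<in> Hom H.CC X X'" "g \<in> Hom H.CC Y Y'" for f g X X' Y Y'
  proof -
    obtain a where a: "f = H.arrow X a X'" "H.colin X a X'" using A(1) by (rule H.HomE)
    obtain b where b: "g = H.arrow Y b Y'" "H.colin Y b Y'" using A(2) by (rule H.HomE)
    note R = H.cm_rc[OF a(2)] H.cm_rc[OF b(2)]
    show ?thesis
      unfolding a b FA_ar[OF a(2)] FA_ar[OF b(2)] H.TensA_CC[OF a(2) b(2)] K.TensA_CC[OF cm_fm[OF a(2)] cm_fm[OF b(2)]]
        FA_ar[OF H.cm_tmap[OF a(2) b(2)]] K.Comp_CC[OF K.cm_tmap[OF cm_fm[OF a(2)] cm_fm[OF b(2)]]] K.Comp_CC[OF cm_phi[OF R(1,3)]]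
      by (rule K.ar_eqI) (rule phi_natural[OF a(2) b(2)])
  qed
  show "FA (Assoc H.CC X Y Z) \<cdot>\<^bsub>K.CC\<^esub> K.arrow (K.ten (FO (X \<boxtimes>\<^bsub>H.CC\<^esub> Y)) (FO Z)) (phi (X \<boxtimes>\<^bsub>H.CC\<^esub> Y) Z) (FO (H.ten (X \<boxtimes>\<^bsub>H.CC\<^esub> Y) Z)) \<cdot>\<^bsub>K.CC\<^esub>
        (K.arrow (K.ten (FO X) (FO Y)) (phi X Y) (FO (H.ten X Y)) \<boxdot>\<^bsub>K.CC\<^esub> Id K.CC (FO Z)) =
      K.arrow (K.ten (FO X) (FO (Y \<boxtimes>\<^bsub>H.CC\<^esub> Z))) (phi X (Y \<boxtimes>\<^bsub>H.CC\<^esub> Z)) (FO (H.ten X (Y \<boxtimes>\<^bsub>H.CC\<^esub> Z))) \<cdot>\<^bsub>K.CC\<^esub>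
        (Id K.CC (FO X) \<boxdot>\<^bsub>K.CC\<^esub> K.arrow (K.ten (FO Y) (FO Z)) (phi Y Z) (FO (H.ten Y Z))) \<cdot>\<^bsub>K.CC\<^esub> Assoc K.CC (FO X) (FO Y) (FO Z)"
    if "X \<in> Obj H.CC" "Y \<in> Obj H.CC" "Z \<in> Obj H.CC" for X Y Z
  proof -
    have R: "H.rc X" "H.rc Y" "H.rc Z" using that by (simp_all add: sel)
    note Rt = H.rc_ten[OF R(1,2)] H.rc_ten[OF R(2,3)]
    note Rf = rc_FO[OF R(1)] rc_FO[OF R(2)] rc_FO[OF R(3)]
    note p12 = cm_phi[OF R(1,2)] and p23 = cm_phi[OF R(2,3)]
    note c1 = K.cm_tmap[OF p12 K.cm_id[OF Rf(3)]] and c2 = cm_phi[OF Rt(1) R(3)] and c3 = cm_fm[OF H.cm_asc[OF R]]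
    note d1 = K.cm_asc[OF Rf] and d2 = K.cm_tmap[OF K.cm_id[OF Rf(1)] p23] and d3 = cm_phi[OF R(1) Rt(2)]
    note k = K.cm_id[OF Rf(3)] K.cm_id[OF Rf(1)]
    have pw: "fm (H.ten X (H.ten Y Z)) (H.asc X Y Z) (phi (H.ten X Y) Z (K.tmap (FO (H.ten X Y)) (FO Z) (phi X Y) (\<lambda>x. x) t)) =
       phi X (H.ten Y Z) (K.tmap (FO X) (FO (H.ten Y Z)) (\<lambda>x. x) (phi Y Z) (K.asc (FO X) (FO Y) (FO Z) t))"
      if t: "t \<in> carrier (K.ten (K.ten (FO X) (FO Y)) (FO Z))" for t
      by (rule K.ten3_lin_eqI[OF Rf K.cm_lin[OF K.cm_comp[OF K.cm_comp[OF c1 c2] c3]] K.cm_lin[OF K.cm_comp[OF K.cm_comp[OF d1 d2] d3]] _ _ t])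
        (simp_all add: vs_FO H.rc_ten R Rf rc_FO K.rc_ten K.tmap_tp K.asc_tp phi_lin K.lin_id K.tp_closed phi_tp phi2_closed phi2_assoc)
    show ?thesis
      unfolding sel H.Assoc_CC K.Assoc_CC K.Id_CC FA_ar[OF H.cm_asc[OF R]] K.TensA_CC[OF p12 k(1)] K.TensA_CC[OF k(2) p23]
        K.Comp_CC[OF c1] K.Comp_CC[OF c2] K.Comp_CC[OF d1] K.Comp_CC[OF d2]
      by (rule K.ar_eqI) (rule pw)
  qed
  show "FA (LUnit H.CC X) \<cdot>\<^bsub>K.CC\<^esub> K.arrow (K.ten (FO (Unit H.CC)) (FO X)) (phi (Unit H.CC) X) (FO (H.ten (Unit H.CC) X)) \<cdot>\<^bsub>K.CC\<^esub>
      (K.arrow K.I phi0 (FO H.I) \<boxdot>\<^bsub>K.CC\<^esub> Id K.CC (FO X)) = LUnit K.CC (FO X)" if "X \<in> Obj H.CC" for X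
  proof -
    have R: "H.rc X" using that by (simp add: sel)
    note Rf = rc_FO[OF R] and RI = rc_FO[OF H.rc_I]
    note k = K.cm_id[OF Rf]
    note c1 = K.cm_tmap[OF cm_phi0 k] and c2 = cm_phi[OF H.rc_I R] and c3 = cm_fm[OF H.cm_lun[OF R]]
    have pw: "fm X (H.lun X) (phi H.I X (K.tmap (FO H.I) (FO X) phi0 (\<lambda>x. x) t)) = K.lun (FO X) t"
      if t: "t \<in> carrier (K.ten K.I (FO X))" for t
      by (rule K.ten_lin_eqI[OF K.rc_I Rf K.cm_lin[OF K.cm_comp[OF K.cm_comp[OF c1 c2] c3]] K.lun_lin[OF Rf] vs_FO[OF R] _ t])
        (simp add: K.tmap_tp K.rc_I Rf RI phi0_lin K.lin_id phi_tp H.rc_I R phi0_closed I_carrier K.lun_tp phi2_lunit)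
    show ?thesis
      unfolding sel H.LUnit_CC K.LUnit_CC K.Id_CC FA_ar[OF H.cm_lun[OF R]] K.TensA_CC[OF cm_phi0 k]
        K.Comp_CC[OF c1] K.Comp_CC[OF c2]
      by (rule K.ar_eqI) (rule pw)
  qed
  show "FA (RUnit H.CC X) \<cdot>\<^bsub>K.CC\<^esub> K.arrow (K.ten (FO X) (FO (Unit H.CC))) (phi X (Unit H.CC)) (FO (H.ten X (Unit H.CC))) \<cdot>\<^bsub>K.CC\<^esub>
      (Id K.CC (FO X) \<boxdot>\<^bsub>K.CC\<^esub> K.arrow K.I phi0 (FO H.I)) = RUnit K.CC (FO X)" if "X \<in> Obj H.CC" for X
  proof -
    have R: "H.rc X" using that by (simp add: sel)
    note Rf = rc_FO[OF R] and RI = rc_FO[OF H.rc_I]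
    note k = K.cm_id[OF Rf]
    note c1 = K.cm_tmap[OF k cm_phi0] and c2 = cm_phi[OF R H.rc_I] and c3 = cm_fm[OF H.cm_run[OF R]]
    have pw: "fm X (H.run X) (phi X H.I (K.tmap (FO X) (FO H.I) (\<lambda>x. x) phi0 t)) = K.run (FO X) t"
      if t: "t \<in> carrier (K.ten (FO X) K.I)" for t
      by (rule K.ten_lin_eqI[OF Rf K.rc_I K.cm_lin[OF K.cm_comp[OF K.cm_comp[OF c1 c2] c3]] K.run_lin[OF Rf] vs_FO[OF R] _ t])
        (simp add: K.tmap_tp K.rc_I Rf RI phi0_lin K.lin_id phi_tp H.rc_I R phi0_closed I_carrier K.run_tp phi2_runit)
    show ?thesis
      unfolding sel H.RUnit_CC K.RUnit_CC K.Id_CC FA_ar[OF H.cm_run[OF R]] K.TensA_CC[OF k cm_phi0]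
        K.Comp_CC[OF c1] K.Comp_CC[OF c2]
      by (rule K.ar_eqI) (rule pw)
  qed
qed

end

section \<open>Algebras given by generators and relations\<close>

definition alg_hom :: "('k::field, 'a, 'x) module_scheme => ('k, 'b, 'y) module_scheme => ('a => 'b) => bool" where
  "alg_hom A B h \<longleftrightarrow> linear_map A B h \<and>
     (\<forall>a\<in>carrier A. \<forall>b\<in>carrier A. h (a \<otimes>\<^bsub>A\<^esub> b) = h a \<otimes>\<^bsub>B\<^esub> h b) \<and> h \<one>\<^bsub>A\<^esub> = \<one>\<^bsub>B\<^esub>"

lemma alg_hom_lin: "alg_hom A B h ==> linear_map A B h"
  and alg_hom_mult: "alg_hom A B h ==> a \<in> carrier A ==> b \<in> carrier A ==> h (a \<otimes>\<^bsub>A\<^esub> b) = h a \<otimes>\<^bsub>B\<^esub> h b"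
  and alg_hom_one: "alg_hom A B h ==> h \<one>\<^bsub>A\<^esub> = \<one>\<^bsub>B\<^esub>"
  by (simp_all add: alg_hom_def)

lemma tensor_same2:
  assumes "carrier V' = carrier V" "add V' = add V" "smult V' = smult V"
    "carrier W' = carrier W" "add W' = add W" "smult W' = smult W"
  shows "tensor V' W' = tensor V W" "pure V' W' = pure V W"
proof -
  have "tensor_class V' W' = tensor_class V W"
    by (rule ext) (simp add: tensor_class_def tensor_relators_def assms)
  then show "tensor V' W' = tensor V W" "pure V' W' = pure V W"
    by (simp_all add: tensor_def pure_def assms fun_eq_iff)
qed

subsection \<open>Tensor products, opposites and the ground field\<close>

locale two_algebras = B: kalg B + C: kalg C
  for B :: "('k::field, 'b, 'x) module_scheme" and C :: "('k, 'c, 'y) module_scheme"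
begin

sublocale two_spaces B C
  by (rule two_spaces.intro) (rule B.vs, rule C.vs)

abbreviation "TA \<equiv> tensor_algebra B C"

lemma TA_sel: "carrier TA = carrier (tensor B C)" "add TA = add (tensor B C)" "smult TA = smult (tensor B C)"
  "zero TA = zero (tensor B C)" "one TA = pure B C \<one>\<^bsub>B\<^esub> \<one>\<^bsub>C\<^esub>"
  "X \<otimes>\<^bsub>TA\<^esub> Y = tensor_lift (tensor B C) (\<lambda>a b.
               tensor_lift (tensor B C) (\<lambda>a' b'. pure B C (a \<otimes>\<^bsub>B\<^esub> a') (b \<otimes>\<^bsub>C\<^esub> b')) Y) X"
  by (simp_all add: tensor_algebra_def)

lemma lf_TA: "linfun TA f \<longleftrightarrow> linfun (tensor B C) f"
  by (rule lf_same) (rule TA_sel)+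

lemma TA_term: "Y \<in> carrier TA ==> a \<in> carrier B ==> b \<in> carrier C ==>
   tensor_lift (tensor B C) (\<lambda>a' b'. pure B C (a \<otimes>\<^bsub>B\<^esub> a') (b \<otimes>\<^bsub>C\<^esub> b')) Y \<in> carrier (tensor B C)"
  unfolding tensor_lift_def TA_sel
  by (rule eval_tensor_closed[OF vec_space_tensor rep_pol]) (auto intro: pure_closed B.mult_closed C.mult_closed)

lemma TA_mult_closed: "X \<in> carrier TA ==> Y \<in> carrier TA ==> X \<otimes>\<^bsub>TA\<^esub> Y \<in> carrier TA"
  unfolding TA_sel(6) unfolding tensor_lift_def[of _ _ X] unfolding TA_sel(1)
  by (rule eval_tensor_closed[OF vec_space_tensor rep_pol]) (auto intro: TA_term simp: TA_sel)

lemma lf_TA_mult: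
  assumes X: "X \<in> carrier TA" and Y: "Y \<in> carrier TA" and f: "linfun TA f"
  shows "f (X \<otimes>\<^bsub>TA\<^esub> Y) = sw X (\<lambda>a b. sw Y (\<lambda>a' b'. f (pure B C (a \<otimes>\<^bsub>B\<^esub> a') (b \<otimes>\<^bsub>C\<^esub> b'))))"
proof -
  have X': "X \<in> carrier (tensor B C)" and Y': "Y \<in> carrier (tensor B C)" and f': "linfun (tensor B C) f"
    using X Y f by (simp_all add: TA_sel lf_TA)
  show ?thesis
    unfolding TA_sel(6)
    apply (subst tensor_lift_def, subst lf_eval_tensor[OF vec_space_tensor rep_pol[OF X'] f'])
     apply (rule TA_term[OF Y], assumption, assumption)
    apply (rule psum_cong[OF rep_pol[OF X']])
    apply (subst tensor_lift_def, subst lf_eval_tensor[OF vec_space_tensor rep_pol[OF Y'] f'])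
     apply (auto intro: pure_closed B.mult_closed C.mult_closed)
    done
qed

lemma psum_TA_mult:
  assumes X: "X \<in> carrier TA" and Y: "Y \<in> carrier TA" and F: "bilin B C F"
  shows "sw (X \<otimes>\<^bsub>TA\<^esub> Y) F = sw X (\<lambda>a b. sw Y (\<lambda>a' b'. F (a \<otimes>\<^bsub>B\<^esub> a') (b \<otimes>\<^bsub>C\<^esub> b')))"
proof -
  have X': "X \<in> carrier (tensor B C)" and Y': "Y \<in> carrier (tensor B C)" using X Y by (simp_all add: TA_sel)
  have "sw (X \<otimes>\<^bsub>TA\<^esub> Y) F = sw X (\<lambda>a b. sw Y (\<lambda>a' b'. sw (pure B C (a \<otimes>\<^bsub>B\<^esub> a') (b \<otimes>\<^bsub>C\<^esub> b')) F))"
    by (rule lf_TA_mult[OF X Y]) (simp add: lf_TA lf_psum_rep[OF F])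
  also have "\<dots> = sw X (\<lambda>a b. sw Y (\<lambda>a' b'. F (a \<otimes>\<^bsub>B\<^esub> a') (b \<otimes>\<^bsub>C\<^esub> b')))"
    by (intro psum_cong[OF rep_pol[OF X']] psum_cong[OF rep_pol[OF Y']] psum_pure[OF _ _ F] B.mult_closed C.mult_closed)
  finally show ?thesis .
qed

lemma lf_pure1': "linfun TA (\<lambda>x. E x) ==> c \<in> carrier C ==> linfun B (\<lambda>b. E (pure B C b c))"
  unfolding lf_TA by (rule blD1[OF bl_pure])

lemma lf_pure2': "linfun TA (\<lambda>x. E x) ==> b \<in> carrier B ==> linfun C (\<lambda>c. E (pure B C b c))"
  unfolding lf_TA by (rule blD2[OF bl_pure])

text \<open>The laws are verified on representatives: pairing a product with a bilinear functional gives an iterated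
  sum over both factors, and such sums can be exchanged freely.\<close>

lemma kalg_TA: "kalg TA"
proof (rule kalg.intro)
  show vs: "vec_space TA" by (rule vec_space_same[OF vec_space_tensor]) (rule TA_sel)+
  show "\<one>\<^bsub>TA\<^esub> \<in> carrier TA" by (simp add: TA_sel pure_closed B.one_closed C.one_closed)
  note rep' = rep_pol[folded TA_sel(1)]
  note rules = B.lf_mult1 B.lf_mult2 C.lf_mult1 C.lf_mult2 B.mult_closed C.mult_closed lf_pure1' lf_pure2' lf_psum_inner[OF rep']
  show "bmap TA TA TA (\<lambda>a b. a \<otimes>\<^bsub>TA\<^esub> b)"
  proof (rule bmapI[OF TA_mult_closed])
    fix f assume f: "linfun TA f"
    note f1 = lf_pure1'[OF f] lf_pure2'[OF f]
    show "linfun TA (\<lambda>X. f (X \<otimes>\<^bsub>TA\<^esub> Y))" if Y: "Y \<in> carrier TA" for Y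
      apply (subst lf_cong[OF lf_TA_mult[OF _ Y f] vs], assumption)
      apply (subst lf_TA, rule lf_psum_rep, rule blI)
       apply (assumption | rule Y f1 B.lf_mult1[OF f1(1)] rules)+
      done
    show "linfun TA (\<lambda>Y. f (X \<otimes>\<^bsub>TA\<^esub> Y))" if X: "X \<in> carrier TA" for X
      apply (subst lf_cong[OF lf_TA_mult[OF X _ f] vs], assumption)
      apply (rule lf_psum_inner[OF rep'[OF X]])
      apply (subst lf_TA, rule lf_psum_rep, rule blI)
       apply (assumption | rule X f1 rules)+
      done
  qed
  note cl = TA_mult_closed[unfolded TA_sel(1)]
  show "(X \<otimes>\<^bsub>TA\<^esub> Y) \<otimes>\<^bsub>TA\<^esub> U = X \<otimes>\<^bsub>TA\<^esub> (Y \<otimes>\<^bsub>TA\<^esub> U)" if c: "X \<in> carrier TA" "Y \<in> carrier TA" "U \<in> carrier TA" for X Y U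
  proof (rule tensor_eqI)
    fix F assume F: "bilin B C F"
    note rules = rules blD1[OF F] blD2[OF F] c
    have "sw ((X \<otimes>\<^bsub>TA\<^esub> Y) \<otimes>\<^bsub>TA\<^esub> U) F = sw (X \<otimes>\<^bsub>TA\<^esub> Y) (\<lambda>a b. sw U (\<lambda>a' b'. F (a \<otimes>\<^bsub>B\<^esub> a') (b \<otimes>\<^bsub>C\<^esub> b')))"
      by (intro psum_TA_mult TA_mult_closed c F)
    also have "\<dots> = sw X (\<lambda>a b. sw Y (\<lambda>a1 b1. sw U (\<lambda>a' b'. F ((a \<otimes>\<^bsub>B\<^esub> a1) \<otimes>\<^bsub>B\<^esub> a') ((b \<otimes>\<^bsub>C\<^esub> b1) \<otimes>\<^bsub>C\<^esub> b'))))"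
      by (intro psum_TA_mult c blI) (assumption | rule rules)+
    also have "\<dots> = sw X (\<lambda>a b. sw Y (\<lambda>a1 b1. sw U (\<lambda>a' b'. F (a \<otimes>\<^bsub>B\<^esub> (a1 \<otimes>\<^bsub>B\<^esub> a')) (b \<otimes>\<^bsub>C\<^esub> (b1 \<otimes>\<^bsub>C\<^esub> b')))))"
      by (intro psum_cong[OF rep'[OF c(1)]] psum_cong[OF rep'[OF c(2)]] psum_cong[OF rep'[OF c(3)]])
        (simp add: B.assoc C.assoc)
    also have "\<dots> = sw X (\<lambda>a b. sw (Y \<otimes>\<^bsub>TA\<^esub> U) (\<lambda>a' b'. F (a \<otimes>\<^bsub>B\<^esub> a') (b \<otimes>\<^bsub>C\<^esub> b')))"
      by (intro psum_cong[OF rep'[OF c(1)]] psum_TA_mult[symmetric] c blI) (assumption | rule rules)+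
    also have "\<dots> = sw (X \<otimes>\<^bsub>TA\<^esub> (Y \<otimes>\<^bsub>TA\<^esub> U)) F"
      by (intro psum_TA_mult[symmetric] TA_mult_closed c F)
    finally show "sw ((X \<otimes>\<^bsub>TA\<^esub> Y) \<otimes>\<^bsub>TA\<^esub> U) F = sw (X \<otimes>\<^bsub>TA\<^esub> (Y \<otimes>\<^bsub>TA\<^esub> U)) F" .
  qed (use c in \<open>auto intro!: cl simp: TA_sel(1)\<close>)
  have one: "\<one>\<^bsub>TA\<^esub> \<in> carrier TA" by (simp add: TA_sel pure_closed B.one_closed C.one_closed)
  show "\<one>\<^bsub>TA\<^esub> \<otimes>\<^bsub>TA\<^esub> X = X" if X: "X \<in> carrier TA" for X
  proof (rule tensor_eqI)
    fix F assume F: "bilin B C F"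
    note rules = rules blD1[OF F] blD2[OF F] X B.one_closed C.one_closed
    have "sw (\<one>\<^bsub>TA\<^esub> \<otimes>\<^bsub>TA\<^esub> X) F = sw (pure B C \<one>\<^bsub>B\<^esub> \<one>\<^bsub>C\<^esub>) (\<lambda>a b. sw X (\<lambda>a' b'. F (a \<otimes>\<^bsub>B\<^esub> a') (b \<otimes>\<^bsub>C\<^esub> b')))"
      unfolding TA_sel(5)[symmetric] by (intro psum_TA_mult one X F)
    also have "\<dots> = sw X (\<lambda>a' b'. F (\<one>\<^bsub>B\<^esub> \<otimes>\<^bsub>B\<^esub> a') (\<one>\<^bsub>C\<^esub> \<otimes>\<^bsub>C\<^esub> b'))"
      by (intro psum_pure B.one_closed C.one_closed blI) (assumption | rule rules)+
    also have "\<dots> = sw X F"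
      by (intro psum_cong[OF rep'[OF X]]) (simp add: B.l_one C.l_one)
    finally show "sw (\<one>\<^bsub>TA\<^esub> \<otimes>\<^bsub>TA\<^esub> X) F = sw X F" .
  qed (use X one in \<open>auto intro!: cl simp: TA_sel(1)\<close>)
  show "X \<otimes>\<^bsub>TA\<^esub> \<one>\<^bsub>TA\<^esub> = X" if X: "X \<in> carrier TA" for X
  proof (rule tensor_eqI)
    fix F assume F: "bilin B C F"
    note rules = rules blD1[OF F] blD2[OF F] X B.one_closed C.one_closed
    have "sw (X \<otimes>\<^bsub>TA\<^esub> \<one>\<^bsub>TA\<^esub>) F = sw X (\<lambda>a b. sw (pure B C \<one>\<^bsub>B\<^esub> \<one>\<^bsub>C\<^esub>) (\<lambda>a' b'. F (a \<otimes>\<^bsub>B\<^esub> a') (b \<otimes>\<^bsub>C\<^esub> b')))"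
      unfolding TA_sel(5)[symmetric] by (intro psum_TA_mult one X F)
    also have "\<dots> = sw X (\<lambda>a b. F (a \<otimes>\<^bsub>B\<^esub> \<one>\<^bsub>B\<^esub>) (b \<otimes>\<^bsub>C\<^esub> \<one>\<^bsub>C\<^esub>))"
      by (intro psum_cong[OF rep'[OF X]] psum_pure B.one_closed C.one_closed blI) (assumption | rule rules)+
    also have "\<dots> = sw X F"
      by (intro psum_cong[OF rep'[OF X]]) (simp add: B.r_one C.r_one)
    finally show "sw (X \<otimes>\<^bsub>TA\<^esub> \<one>\<^bsub>TA\<^esub>) F = sw X F" .
  qed (use X one in \<open>auto intro!: cl simp: TA_sel(1)\<close>)
qed

end

lemma kalg_opposite:
  assumes "kalg A" shows "kalg (opposite_algebra A)"
proof -
  interpret kalg A by (rule assms)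
  let ?O = "opposite_algebra A"
  have same: "carrier ?O = carrier A" "add ?O = add A" "smult ?O = smult A" "zero ?O = zero A" "one ?O = one A"
    "mult ?O = (\<lambda>x y. y \<otimes>\<^bsub>A\<^esub> x)"
    by (simp_all add: opposite_algebra_def)
  have l: "linfun ?O f \<longleftrightarrow> linfun A f" for f by (rule lf_same) (rule same)+
  have "bmap ?O ?O ?O (\<lambda>x y. y \<otimes>\<^bsub>A\<^esub> x)" using mult_bmap by (simp add: bmap_def bilin_def l same)
  then show ?thesis
    using vec_space_same[OF vs same(1-4)] one_closed assoc l_one r_one by (intro kalg.intro) (simp_all add: same)
qed

lemma scalar_sel: "carrier scalar_algebra = UNIV" "x \<oplus>\<^bsub>scalar_algebra\<^esub> y = x + y" "x \<odot>\<^bsub>scalar_algebra\<^esub> y = x * y"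
  "\<zero>\<^bsub>scalar_algebra\<^esub> = 0" "\<one>\<^bsub>scalar_algebra\<^esub> = 1" "x \<otimes>\<^bsub>scalar_algebra\<^esub> y = x * y"
  by (simp_all add: scalar_algebra_def univ_ring_def ring.defs module.defs)

lemma kalg_scalar: "kalg (scalar_algebra :: ('k::field, 'k) module)"
proof (rule kalg.intro)
  show "vec_space scalar_algebra"
    by (rule vec_spaceI_sep[where \<Phi> = "{\<lambda>x. x}"]) (auto simp: scalar_sel linfun_def)
  have l: "linfun scalar_algebra (\<lambda>x. f (x * c))" "linfun scalar_algebra (\<lambda>x. f (c * x))" if "linfun scalar_algebra f" for f and c :: 'k
    using that lf_smult[OF that, of _ c] by (auto simp: linfun_def scalar_sel algebra_simps)
  let ?s = "scalar_algebra :: ('k, 'k) module"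
  show "bmap ?s ?s ?s (\<lambda>a b. a \<otimes>\<^bsub>?s\<^esub> b)"
    by (rule bmapI) (simp_all add: scalar_sel l)
qed (simp_all add: scalar_sel algebra_simps)

subsection \<open>Evaluation of noncommutative polynomials\<close>

lemma univ_ring_uminus: "\<ominus>\<^bsub>univ_ring\<^esub> (x :: 'r::ring_1) = - x"
  by (rule abelian_group.minus_equality[OF ring.is_abelian_group[OF ring_univ_ring]]) simp_all

lemma lin_ext_sum: "lin_ext f (\<Sum>i\<in>I. p i) = (\<Sum>i\<in>I. lin_ext f (p i))"
  by (induction I rule: infinite_finite_induct) (simp_all add: lin_ext_add)

lemma lin_ext_mult:
  fixes p q :: "('x::monoid_add) \<Rightarrow>\<^sub>0 'k::field"
  shows "lin_ext g (p * q) = lin_ext (\<lambda>u. lin_ext (\<lambda>v. g (u + v)) q) p"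
proof -
  have "p * q = (\<Sum>u\<in>pkeys p. \<Sum>v\<in>pkeys q. Poly_Mapping.single (u + v) (plk p u * plk q v))"
    by (subst poly_mapping_sum_singles[of p], subst poly_mapping_sum_singles[of q])
      (simp only: sum_distrib_left sum_distrib_right mult_single, rule sum.swap)
  then show ?thesis
    by (simp add: lin_ext_sum) (simp add: lin_ext_def sum_distrib_left mult.assoc)
qed

lemma formal_scale_mult_left: "formal_scale c p * q = formal_scale c (p * q :: ('x::monoid_add) \<Rightarrow>\<^sub>0 'k::field)"
  and formal_scale_mult_right: "p * formal_scale c q = formal_scale c (p * q)"
proof -
  have eq: "p = q" if "\<And>f. lin_ext f p = lin_ext f q" for p q :: "'y \<Rightarrow>\<^sub>0 'k"
  proof (rule poly_mapping_eqI)
    fix k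
    have l: "lin_ext (\<lambda>x. if x = k then 1 else 0) p = plk p k" for p :: "'y \<Rightarrow>\<^sub>0 'k"
      by (simp add: lin_ext_def if_distrib in_keys_iff cong: if_cong)
    show "plk p k = plk q k" using that[of "\<lambda>x. if x = k then 1 else 0"] by (simp add: l)
  qed
  show "formal_scale c p * q = formal_scale c (p * q)"
    by (rule eq) (simp add: lin_ext_mult lin_ext_scale)
  show "p * formal_scale c q = formal_scale c (p * q)"
    by (rule eq) (simp add: lin_ext_mult lin_ext_scale, simp add: lin_ext_def sum_distrib_left mult.left_commute)
qed

lemma const_eq: "const c = formal_scale c 1"
  unfolding const_def by (simp add: formal_scale_single flip: single_one)

lemma const_mult: "const c * p = formal_scale c p" "p * const c = formal_scale c p"
  by (simp_all add: const_eq formal_scale_mult_left formal_scale_mult_right)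

context kalg
begin

lemma mult_zero: "a \<in> carrier A ==> a \<otimes> \<zero> = \<zero>" "a \<in> carrier A ==> \<zero> \<otimes> a = \<zero>"
  by (rule vs_eqI[OF vs];
      auto intro!: mult_closed vs_zero[OF vs] simp: lf_zero[OF vs] lf_zero[OF vs lf_mult1] lf_zero[OF vs lf_mult2])+

definition wval :: "('g => 'a) => 'g word => 'a" where
  "wval f w = foldr (\<lambda>x y. f x \<otimes> y) (letters w) \<one>"

text \<open>The value of a functional on the evaluation of a noncommutative polynomial. It is a linear
  function of the polynomial, which makes relations easy to test.\<close>

definition pval :: "('g => 'a) => ('a => 'k) => ('g, 'k) free_algebra => 'k" where
  "pval f \<phi> = lin_ext (\<lambda>w. \<phi> (wval f w))"

context
  fixes f :: "'g => 'a" assumes f: "\<And>x. f x \<in> carrier A"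
begin

lemma foldr_closed: "foldr (\<lambda>x y. f x \<otimes> y) xs \<one> \<in> carrier A"
  by (induction xs) (auto intro: one_closed mult_closed f)

lemma wval_closed: "wval f w \<in> carrier A"
  unfolding wval_def by (rule foldr_closed)

lemma wval_plus: "wval f (u + v) = wval f u \<otimes> wval f v"
proof -
  have "foldr (\<lambda>x y. f x \<otimes> y) (xs @ ys) \<one> = foldr (\<lambda>x y. f x \<otimes> y) xs \<one> \<otimes> foldr (\<lambda>x y. f x \<otimes> y) ys \<one>" for xs ys
    by (induction xs) (simp_all add: l_one foldr_closed assoc f)
  then show ?thesis by (simp add: wval_def plus_word_def)
qed

lemma eval_free_closed: "eval_free A f p \<in> carrier A"
  unfolding eval_free_def wval_def[symmetric] by (intro vs_finsum[OF vs] vs_smult[OF vs] wval_closed)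

lemma lf_eval_free: "linfun A \<phi> ==> \<phi> (eval_free A f p) = pval f \<phi> p"
  unfolding eval_free_def wval_def[symmetric] pval_def lin_ext_def
  by (subst lf_finsum[OF vs]) (auto intro!: vs_smult[OF vs] wval_closed simp: lf_smult wval_closed)

lemma eval_free_mult: "eval_free A f (p * q) = eval_free A f p \<otimes> eval_free A f q"
proof (rule vs_eqI[OF vs])
  fix \<phi> assume \<phi>: "linfun A \<phi>"
  have "\<phi> (eval_free A f p \<otimes> eval_free A f q) = pval f (\<lambda>x. \<phi> (x \<otimes> eval_free A f q)) p"
    by (rule lf_eval_free) (rule lf_mult1[OF \<phi> eval_free_closed])
  also have "\<dots> = lin_ext (\<lambda>u. pval f (\<lambda>y. \<phi> (wval f u \<otimes> y)) q) p"
    unfolding pval_def[of f "\<lambda>x. \<phi> (x \<otimes> eval_free A f q)"]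
    by (subst lf_eval_free[OF lf_mult2[OF \<phi> wval_closed]]) (rule refl)
  also have "\<dots> = pval f \<phi> (p * q)"
    by (simp add: pval_def lin_ext_mult wval_plus)
  finally show "\<phi> (eval_free A f (p * q)) = \<phi> (eval_free A f p \<otimes> eval_free A f q)"
    by (simp add: lf_eval_free[OF \<phi>])
qed (intro eval_free_closed mult_closed)+

lemma eval_free_add: "eval_free A f (p + q) = eval_free A f p \<oplus> eval_free A f q"
  by (rule vs_eqI[OF vs]) (auto intro!: eval_free_closed vs_add[OF vs] simp: lf_add eval_free_closed lf_eval_free pval_def lin_ext_add)

lemma eval_free_scale: "eval_free A f (formal_scale c p) = c \<odot> eval_free A f p"
  by (rule vs_eqI[OF vs]) (auto intro!: eval_free_closed vs_smult[OF vs] simp: lf_smult eval_free_closed lf_eval_free pval_def lin_ext_scale)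

lemma eval_free_one: "eval_free A f 1 = \<one>"
  by (rule vs_eqI[OF vs])
    (auto intro!: eval_free_closed one_closed simp: lf_eval_free pval_def wval_def zero_word_def simp flip: single_one)

lemma eval_free_var: "eval_free A f (var x) = f x"
  by (rule vs_eqI[OF vs])
    (auto intro!: eval_free_closed f simp: lf_eval_free pval_def wval_def var_def r_one f)

lemma eval_free_zero: "eval_free A f 0 = \<zero>"
  by (rule vs_eqI[OF vs]) (auto intro!: eval_free_closed vs_zero[OF vs] simp: lf_eval_free pval_def lf_zero[OF vs])

lemma pval_var2: "pval f \<phi> (var x * var y) = \<phi> (f x \<otimes> f y)"
  by (simp add: pval_def lin_ext_mult var_def wval_def plus_word_def r_one f)

lemma pval_one: "pval f \<phi> 1 = \<phi> \<one>"
  by (simp add: pval_def wval_def zero_word_def flip: single_one)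

lemma pval_lin: "pval f \<phi> (p + q) = pval f \<phi> p + pval f \<phi> q" "pval f \<phi> (p - q) = pval f \<phi> p - pval f \<phi> q"
  "pval f \<phi> (formal_scale c p) = c * pval f \<phi> p" "pval f \<phi> (\<Sum>i\<in>I. g i) = (\<Sum>i\<in>I. pval f \<phi> (g i))" "pval f \<phi> 0 = 0"
  by (simp_all add: pval_def lin_ext_add lin_ext_diff lin_ext_scale lin_ext_sum)

text \<open>The polynomials that evaluate to zero form a two-sided ideal.\<close>

lemma eval_free_ideal:
  assumes R: "\<And>r. r \<in> R ==> eval_free A f r = \<zero>" and p: "p \<in> Idl\<^bsub>univ_ring\<^esub> R"
  shows "eval_free A f p = \<zero>"
proof -
  interpret U: ring "univ_ring :: ('g, 'k) free_algebra ring" by (rule ring_univ_ring)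
  have z: "\<phi> (eval_free A f p) = 0" if "linfun A \<phi>" "eval_free A f p = \<zero>" for \<phi> p
    using that by (simp add: lf_zero[OF vs])
  have m: "eval_free A f (q * p) = \<zero>" "eval_free A f (p * q) = \<zero>" if p: "eval_free A f p = \<zero>" for p q
    by (simp_all add: eval_free_mult p mult_zero eval_free_closed)
  have "ideal {p. eval_free A f p = \<zero>} (univ_ring :: ('g, 'k) free_algebra ring)"
  proof (rule idealI[OF ring_univ_ring])
    show "subgroup {p. eval_free A f p = \<zero>} (add_monoid (univ_ring :: ('g, 'k) free_algebra ring))"
    proof
      fix x y assume "x \<in> {p. eval_free A f p = \<zero>}" "y \<in> {p. eval_free A f p = \<zero>}"
      then have "eval_free A f (x + y) = \<zero>"
        by (intro vs_eqI[OF vs]) (auto intro!: eval_free_closed vs_zero[OF vs] vs_add[OF vs] simp: eval_free_add lf_add lf_zero[OF vs] vs_zero[OF vs])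
      then show "x \<otimes>\<^bsub>add_monoid univ_ring\<^esub> y \<in> {p. eval_free A f p = \<zero>}" by simp
    next
      fix x assume x: "x \<in> {p. eval_free A f p = \<zero>}"
      have "inv\<^bsub>add_monoid univ_ring\<^esub> x = - x"
        unfolding a_inv_def[symmetric] by (rule univ_ring_uminus)
      moreover have "eval_free A f (- x) = \<zero>"
      proof (rule vs_eqI[OF vs eval_free_closed vs_zero[OF vs]])
        fix \<phi> assume \<phi>: "linfun A \<phi>"
        have "pval f \<phi> x = 0" using x lf_eval_free[OF \<phi>, of x] by (simp add: lf_zero[OF vs \<phi>])
        then show "\<phi> (eval_free A f (- x)) = \<phi> \<zero>"
          by (simp add: lf_eval_free[OF \<phi>] lf_zero[OF vs \<phi>] pval_def lin_ext_uminus)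
      qed
      ultimately show "inv\<^bsub>add_monoid univ_ring\<^esub> x \<in> {p. eval_free A f p = \<zero>}" by simp
    qed (simp_all add: eval_free_zero)
  qed (simp_all add: m)
  then have "Idl\<^bsub>univ_ring\<^esub> R \<subseteq> {p. eval_free A f p = \<zero>}"
    by (rule U.genideal_minimal) (auto simp: R)
  then show ?thesis using p by blast
qed

end

end

subsection \<open>The universal property\<close>

text \<open>Both the presented algebras themselves and the Hopf algebra records built on them satisfy these equations.\<close>

locale presented =
  fixes X :: "('k::field, ('x, 'k) free_algebra set, 'z) module_scheme" and R :: "('x, 'k) free_algebra set"
  assumes sel: "carrier X = range (residue_class R)"
    "\<And>p q. residue_class R p \<oplus>\<^bsub>X\<^esub> residue_class R q = residue_class R (p + q)"
    "\<And>p q. residue_class R p \<otimes>\<^bsub>X\<^esub> residue_class R q = residue_class R (p * q)"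
    "\<And>c p. c \<odot>\<^bsub>X\<^esub> residue_class R p = residue_class R (formal_scale c p)"
    "\<one>\<^bsub>X\<^esub> = residue_class R 1" "\<zero>\<^bsub>X\<^esub> = residue_class R 0"
begin

abbreviation "cls \<equiv> residue_class R"

lemma ideal_R: "ideal (Idl\<^bsub>univ_ring\<^esub> R) univ_ring"
  by (rule ring.genideal_ideal[OF ring_univ_ring]) simp

lemma cls_eq_iff: "cls p = cls q \<longleftrightarrow> p - q \<in> Idl\<^bsub>univ_ring\<^esub> R"
proof -
  interpret ideal "Idl\<^bsub>univ_ring\<^esub> R" univ_ring by (rule ideal_R)
  have "p \<ominus>\<^bsub>univ_ring\<^esub> q = p - q" by (simp add: a_minus_def univ_ring_uminus)
  then show ?thesis
    unfolding residue_class_def using quotient_eq_iff_same_a_r_cos[OF ideal_R, of p q] by simp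
qed

lemma cls_self: "p \<in> cls p"
proof -
  interpret ideal "Idl\<^bsub>univ_ring\<^esub> R" univ_ring by (rule ideal_R)
  show ?thesis unfolding residue_class_def by (rule a_rcos_self) simp
qed

lemma cls_memD: "q \<in> cls p ==> cls q = cls p"
  unfolding cls_eq_iff by (auto simp: residue_class_def a_r_coset_def r_coset_def)

lemma cls_rep: "cls (rep (cls p)) = cls p"
  by (rule cls_memD[OF rep_in]) (use cls_self in blast)

lemma cls_closed: "cls p \<in> carrier X"
  by (simp add: sel)

lemma vs_X: "vec_space X"
proof (rule moduleI[OF cring_univ_ring])
  show "abelian_group X"
  proof (rule abelian_groupI)
    fix x assume "x \<in> carrier X"
    then obtain p where "x = cls p" by (auto simp: sel)
    then show "\<exists>y\<in>carrier X. y \<oplus>\<^bsub>X\<^esub> x = \<zero>\<^bsub>X\<^esub>"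
      by (intro bexI[of _ "cls (- p)"]) (simp_all add: sel)
  qed (auto simp: sel add_ac)
qed (auto simp: sel formal.scale_left_distrib formal.scale_right_distrib)

lemma lf_cls: "linfun X f ==> f (cls (p + q)) = f (cls p) + f (cls q)" "linfun X f ==> f (cls (formal_scale c p)) = c * f (cls p)"
  using lf_add[of X f "cls p" "cls q"] lf_smult[of X f "cls p" c] by (simp_all add: sel)

lemma kalg_X: "kalg X"
proof (rule kalg.intro)
  show "vec_space X" by (rule vs_X)
  show "bmap X X X (\<lambda>a b. a \<otimes>\<^bsub>X\<^esub> b)"
    by (rule bmapI) (auto simp: sel linfun_def distrib_left distrib_right formal_scale_mult_left formal_scale_mult_right)
qed (auto simp: sel mult.assoc)

sublocale X: kalg X by (rule kalg_X)

text \<open>Monomials are built by multiplying with generators on the left, and they span.\<close>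

lemma gen_induct [consumes 1, case_names one var add smult]:
  assumes a: "a \<in> carrier X" and one: "P \<one>\<^bsub>X\<^esub>"
    and var: "\<And>x a. a \<in> carrier X ==> P a ==> P (cls (var x) \<otimes>\<^bsub>X\<^esub> a)"
    and add: "\<And>a b. a \<in> carrier X ==> b \<in> carrier X ==> P a ==> P b ==> P (a \<oplus>\<^bsub>X\<^esub> b)"
    and smult: "\<And>c a. a \<in> carrier X ==> P a ==> P (c \<odot>\<^bsub>X\<^esub> a)"
  shows "P a"
proof -
  have w: "P (cls (Poly_Mapping.single (Word xs) 1))" for xs
  proof (induction xs)
    case Nil
    have "Poly_Mapping.single (Word []) 1 = (1 :: ('x, 'k) free_algebra)"
      by (simp flip: single_one add: zero_word_def)
    then show ?case using one by (simp add: sel)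
  next
    case (Cons x xs)
    have "var x * Poly_Mapping.single (Word xs) 1 = (Poly_Mapping.single (Word (x # xs)) 1 :: ('x, 'k) free_algebra)"
      by (simp add: var_def mult_single plus_word_def)
    then show ?case using var[OF cls_closed Cons, of x] by (simp add: sel)
  qed
  have z: "P (cls 0)"
    using smult[OF X.one_closed one, of 0] by (simp add: sel)
  have s: "P (cls (Poly_Mapping.single u c))" for u c
    using smult[OF cls_closed w, of c "letters u"] by (simp add: sel formal_scale_single)
  have "P (cls (\<Sum>u\<in>U. Poly_Mapping.single u (g u)))" for U g
    by (induction U rule: infinite_finite_induct) (use z s add[OF cls_closed cls_closed] in \<open>auto simp: sel\<close>)
  then have "P (cls p)" for p by (subst poly_mapping_sum_singles[of p])
  then show ?thesis using a by (auto simp: sel)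
qed

context
  fixes B :: "('k, 'b, 'y) module_scheme" and f :: "'x => 'b"
  assumes B: "kalg B" and f: "\<And>x. f x \<in> carrier B"
    and R: "\<And>r \<phi>. r \<in> R ==> linfun B \<phi> ==> kalg.pval B f \<phi> r = 0"
begin

interpretation B: kalg B by (rule B)

lemma induced_cls: "induced_hom B f (cls p) = eval_free B f p"
proof -
  have R': "eval_free B f r = \<zero>\<^bsub>B\<^esub>" if "r \<in> R" for r
    by (rule vs_eqI[OF B.vs])
      (auto intro!: B.eval_free_closed f vs_zero[OF B.vs] simp: B.lf_eval_free[of f] f R[OF that] lf_zero[OF B.vs])
  let ?r = "rep (cls p)"
  have "?r - p \<in> Idl\<^bsub>univ_ring\<^esub> R" using cls_rep[of p] by (simp add: cls_eq_iff)
  then have z: "eval_free B f (?r - p) = \<zero>\<^bsub>B\<^esub>" by (rule B.eval_free_ideal[OF f R', rotated])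
  have "eval_free B f ?r = eval_free B f p"
  proof (rule vs_eqI[OF B.vs])
    fix \<phi> assume \<phi>: "linfun B \<phi>"
    have "\<phi> (eval_free B f (?r - p)) = 0" using z \<phi> by (simp add: lf_zero[OF B.vs])
    then show "\<phi> (eval_free B f ?r) = \<phi> (eval_free B f p)"
      by (simp add: B.lf_eval_free[of f, OF f \<phi>] B.pval_lin[of f, OF f])
  qed (auto intro!: B.eval_free_closed f)
  then show ?thesis by (simp add: induced_hom_def)
qed

lemma induced_alg_hom: "alg_hom X B (induced_hom B f)"
  unfolding alg_hom_def linear_map_def
  by (auto simp: sel induced_cls B.eval_free_mult[of f, OF f] B.eval_free_add[of f, OF f] B.eval_free_scale[of f, OF f]
      B.eval_free_one[of f, OF f] intro!: B.eval_free_closed f)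

lemma induced_var: "induced_hom B f (cls (var x)) = f x"
  by (simp add: induced_cls B.eval_free_var[of f, OF f])

end

end

lemma presented_algebra_sel:
  fixes R :: "('x, 'k::field) free_algebra set"
  shows "carrier (presented_algebra R) = range (residue_class R)"
    "residue_class R p \<oplus>\<^bsub>presented_algebra R\<^esub> residue_class R q = residue_class R (p + q)"
    "residue_class R p \<otimes>\<^bsub>presented_algebra R\<^esub> residue_class R q = residue_class R (p * q)"
    "c \<odot>\<^bsub>presented_algebra R\<^esub> residue_class R p = residue_class R (formal_scale c p)"
    "\<one>\<^bsub>presented_algebra R\<^esub> = residue_class R 1" "\<zero>\<^bsub>presented_algebra R\<^esub> = residue_class R 0"
proof -
  let ?J = "Idl\<^bsub>univ_ring\<^esub> R"
  interpret ideal ?J univ_ring by (rule ring.genideal_ideal[OF ring_univ_ring]) simp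
  have Q: "carrier (presented_algebra R) = carrier (univ_ring Quot ?J)" "add (presented_algebra R) = add (univ_ring Quot ?J)"
    "mult (presented_algebra R) = mult (univ_ring Quot ?J)" "one (presented_algebra R) = one (univ_ring Quot ?J)"
    "zero (presented_algebra R) = zero (univ_ring Quot ?J)"
    "smult (presented_algebra R) = (\<lambda>c X. residue_class R (const c) \<otimes>\<^bsub>univ_ring Quot ?J\<^esub> X)"
    by (simp_all add: presented_algebra_def Let_def ring.defs module.defs)
  show "carrier (presented_algebra R) = range (residue_class R)"
    unfolding Q FactRing_def A_RCOSETS_def RCOSETS_def a_r_coset_def residue_class_def by auto
  show "residue_class R p \<oplus>\<^bsub>presented_algebra R\<^esub> residue_class R q = residue_class R (p + q)"
    unfolding Q residue_class_def by (simp add: FactRing_simps a_rcos_sum)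
  show "residue_class R p \<otimes>\<^bsub>presented_algebra R\<^esub> residue_class R q = residue_class R (p * q)"
    unfolding Q residue_class_def by (simp add: FactRing_simps rcoset_mult_add)
  show "c \<odot>\<^bsub>presented_algebra R\<^esub> residue_class R p = residue_class R (formal_scale c p)"
    unfolding Q residue_class_def by (simp add: FactRing_simps rcoset_mult_add const_mult)
  show "\<one>\<^bsub>presented_algebra R\<^esub> = residue_class R 1"
    unfolding Q residue_class_def by (simp add: FactRing_simps)
  show "\<zero>\<^bsub>presented_algebra R\<^esub> = residue_class R 0"
    unfolding Q residue_class_def using a_rcos_const[of 0] additive_subgroup.zero_closed[OF is_additive_subgroup]
    by (simp add: FactRing_simps)
qed

lemma presented_algebra_presented: "presented (presented_algebra R) R"
  by (rule presented.intro) (rule presented_algebra_sel)+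

section \<open>Matrices preserving bilinear forms\<close>

lemma sum_swap3: "(\<Sum>a\<in>A. \<Sum>l\<in>L. \<Sum>m\<in>M. f a l m) = (\<Sum>l\<in>L. \<Sum>m\<in>M. \<Sum>a\<in>A. f a l m)"
  by (subst sum.swap) (intro sum.cong refl sum.swap)

text \<open>The matrix \<open>u\<close> is an isometry in \<open>A\<close> from the form \<open>F\<close> to the form \<open>E\<close>: \<open>\<^sup>tu E u = F\<close> and \<open>u F\<inverse> \<^sup>tu = E\<inverse>\<close>, stated
  entry by entry and tested on functionals.\<close>

definition bil_mat :: "('k::field, 'a, 'x) module_scheme => 'k ^ 'm ^ 'm => 'k ^ 'n ^ 'n => ('m::finite => 'n::finite => 'a) => bool" where
  "bil_mat A E F u \<longleftrightarrow> (\<forall>i j. u i j \<in> carrier A) \<and> (\<forall>\<phi>. linfun A \<phi> \<longrightarrow>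
     (\<forall>i j. (\<Sum>a\<in>UNIV. \<Sum>b\<in>UNIV. E $ a $ b * \<phi> (u a i \<otimes>\<^bsub>A\<^esub> u b j)) = F $ i $ j * \<phi> \<one>\<^bsub>A\<^esub>) \<and>
     (\<forall>i j. (\<Sum>a\<in>UNIV. \<Sum>b\<in>UNIV. matrix_inv F $ a $ b * \<phi> (u i a \<otimes>\<^bsub>A\<^esub> u j b)) = matrix_inv E $ i $ j * \<phi> \<one>\<^bsub>A\<^esub>))"

lemma bil_matD:
  assumes "bil_mat A E F u"
  shows "u i j \<in> carrier A"
    "linfun A \<phi> ==> (\<Sum>a\<in>UNIV. \<Sum>b\<in>UNIV. E $ a $ b * \<phi> (u a k \<otimes>\<^bsub>A\<^esub> u b l)) = F $ k $ l * \<phi> \<one>\<^bsub>A\<^esub>"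
    "linfun A \<phi> ==> (\<Sum>a\<in>UNIV. \<Sum>b\<in>UNIV. matrix_inv F $ a $ b * \<phi> (u i' a \<otimes>\<^bsub>A\<^esub> u j' b)) = matrix_inv E $ i' $ j' * \<phi> \<one>\<^bsub>A\<^esub>"
  using assms by (auto simp: bil_mat_def)

lemma inv_entries:
  fixes E :: "'k::field ^ 'n ^ 'n"
  assumes "invertible E"
  shows "(\<Sum>b\<in>UNIV. matrix_inv E $ a $ b * E $ b $ c) = (if a = c then 1 else 0)"
    "(\<Sum>b\<in>UNIV. E $ a $ b * matrix_inv E $ b $ c) = (if a = c then 1 else 0)"
proof -
  have "matrix_inv E ** E = mat 1" "E ** matrix_inv E = mat 1"
    using someI_ex[OF assms[unfolded invertible_def]] by (simp_all add: matrix_inv_def)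
  then show "(\<Sum>b\<in>UNIV. matrix_inv E $ a $ b * E $ b $ c) = (if a = c then 1 else 0)"
    "(\<Sum>b\<in>UNIV. E $ a $ b * matrix_inv E $ b $ c) = (if a = c then 1 else 0)"
    by (simp_all add: vec_eq_iff matrix_matrix_mult_def mat_def)
qed

lemma matrix_inv_eqI:
  fixes A :: "'k::field ^ 'n ^ 'n"
  assumes e: "A ** B = mat 1" "B ** A = mat 1"
  shows "matrix_inv A = B"
proof -
  have i: "invertible A" using e unfolding invertible_def by blast
  have l: "matrix_inv A ** A = mat 1"
    by (simp add: vec_eq_iff matrix_matrix_mult_def mat_def inv_entries(1)[OF i])
  then have "matrix_inv A = (matrix_inv A ** A) ** B"
    unfolding matrix_mul_assoc[symmetric] e(1) by simp
  then show ?thesis using l by simp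
qed

text \<open>On generators all structure maps are such matrix products, with factors from different algebras.\<close>

definition mprod :: "('k::field, 'b, 'x) module_scheme => ('k, 'c, 'y) module_scheme => ('i => 'l::finite => 'b) => ('l => 'j => 'c)
    => 'i => 'j => ('k, 'b, 'c) tens" where
  "mprod B C v w i j = (\<Oplus>\<^bsub>tensor B C\<^esub>l\<in>UNIV. pure B C (v i l) (w l j))"

context two_algebras
begin

context
  fixes v :: "'i => 'l::finite => 'b" and w :: "'l => 'j => 'c"
  assumes v: "\<And>i l. v i l \<in> carrier B" and w: "\<And>l j. w l j \<in> carrier C"
begin

lemma mprod_closed: "mprod B C v w i j \<in> carrier TA"
  unfolding mprod_def TA_sel by (rule vs_finsum[OF vec_space_tensor]) (rule pure_closed[OF v w])

lemma lf_mprod: "linfun TA \<phi> ==> \<phi> (mprod B C v w i j) = (\<Sum>l\<in>UNIV. \<phi> (pure B C (v i l) (w l j)))"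
  unfolding mprod_def by (rule lf_finsum[OF vec_space_tensor]) (auto simp: lf_TA intro: pure_closed v w)

lemma psum_mprod: "bilin B C F ==> sw (mprod B C v w i j) F = (\<Sum>l\<in>UNIV. F (v i l) (w l j))"
  by (subst lf_mprod) (auto simp: lf_TA lf_psum_rep psum_pure v w)

lemma lf_mprod_mult:
  assumes \<phi>: "linfun TA \<phi>"
  shows "\<phi> (mprod B C v w i j \<otimes>\<^bsub>TA\<^esub> mprod B C v w i' j') =
     (\<Sum>l\<in>UNIV. \<Sum>l'\<in>UNIV. \<phi> (pure B C (v i l \<otimes>\<^bsub>B\<^esub> v i' l') (w l j \<otimes>\<^bsub>C\<^esub> w l' j')))"
proof -
  note rules = lf_pure1'[OF \<phi>] lf_pure2'[OF \<phi>] B.lf_mult1 B.lf_mult2 C.lf_mult1 C.lf_mult2 B.mult_closed C.mult_closed v w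
    B.lf_mult1[OF lf_pure1'[OF \<phi>]] B.lf_mult2[OF lf_pure1'[OF \<phi>]] C.lf_mult1[OF lf_pure2'[OF \<phi>]] C.lf_mult2[OF lf_pure2'[OF \<phi>]]
  have "\<phi> (mprod B C v w i j \<otimes>\<^bsub>TA\<^esub> mprod B C v w i' j') = sw (mprod B C v w i j) (\<lambda>a b. sw (mprod B C v w i' j')
     (\<lambda>a' b'. \<phi> (pure B C (a \<otimes>\<^bsub>B\<^esub> a') (b \<otimes>\<^bsub>C\<^esub> b'))))"
    by (rule lf_TA_mult[OF mprod_closed mprod_closed \<phi>])
  also have "\<dots> = sw (mprod B C v w i j) (\<lambda>a b. \<Sum>l'\<in>UNIV. \<phi> (pure B C (a \<otimes>\<^bsub>B\<^esub> v i' l') (b \<otimes>\<^bsub>C\<^esub> w l' j')))"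
    by (intro psum_cong[OF rep_pol[OF mprod_closed[unfolded TA_sel(1)]]] psum_mprod blI) (assumption | rule rules)+
  also have "\<dots> = (\<Sum>l'\<in>UNIV. \<Sum>l\<in>UNIV. \<phi> (pure B C (v i l \<otimes>\<^bsub>B\<^esub> v i' l') (w l j \<otimes>\<^bsub>C\<^esub> w l' j')))"
    unfolding psum_sum by (intro sum.cong refl psum_mprod blI) (assumption | rule rules)+
  finally show ?thesis by (subst sum.swap)
qed

end

lemma sum4_factor:
  fixes P :: "'p::finite => 'p => 'q::finite => 'q => 'k"
  shows "(\<Sum>a\<in>UNIV. \<Sum>b\<in>UNIV. e a b * (\<Sum>l\<in>UNIV. \<Sum>l'\<in>UNIV. P a b l l')) =
    (\<Sum>l\<in>UNIV. \<Sum>l'\<in>UNIV. \<Sum>a\<in>UNIV. \<Sum>b\<in>UNIV. e a b * P a b l l')"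
proof -
  have "(\<Sum>a\<in>UNIV. \<Sum>b\<in>UNIV. e a b * (\<Sum>l\<in>UNIV. \<Sum>l'\<in>UNIV. P a b l l')) =
    (\<Sum>a\<in>UNIV. \<Sum>l\<in>UNIV. \<Sum>l'\<in>UNIV. \<Sum>b\<in>UNIV. e a b * P a b l l')"
    unfolding sum_distrib_left by (rule sum.cong[OF refl], rule sum_swap3)
  also have "\<dots> = (\<Sum>l\<in>UNIV. \<Sum>l'\<in>UNIV. \<Sum>a\<in>UNIV. \<Sum>b\<in>UNIV. e a b * P a b l l')"
    by (rule sum_swap3)
  finally show ?thesis .
qed

text \<open>Isometries compose: the entries of \<open>v\<close> and \<open>w\<close> commute with each other in the tensor product, so the two
  relations can be applied one after the other.\<close>

lemma bil_mat_mprod: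
  assumes v: "bil_mat B E F v" and w: "bil_mat C F G w"
  shows "bil_mat TA E G (mprod B C v w)"
proof -
  note cv = bil_matD(1)[OF v] and cw = bil_matD(1)[OF w]
  note cl = mprod_closed[of v w, OF cv cw] and mult = lf_mprod_mult[of v w, OF cv cw]
  show ?thesis
    unfolding bil_mat_def
  proof (intro conjI allI impI cl)
    fix \<phi> i j assume \<phi>: "linfun TA \<phi>"
    let ?p = "\<lambda>b c. \<phi> (pure B C b c)"
    have "(\<Sum>a\<in>UNIV. \<Sum>b\<in>UNIV. E $ a $ b * \<phi> (mprod B C v w a i \<otimes>\<^bsub>TA\<^esub> mprod B C v w b j)) =
      (\<Sum>l\<in>UNIV. \<Sum>l'\<in>UNIV. \<Sum>a\<in>UNIV. \<Sum>b\<in>UNIV. E $ a $ b * ?p (v a l \<otimes>\<^bsub>B\<^esub> v b l') (w l i \<otimes>\<^bsub>C\<^esub> w l' j))"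
      unfolding mult[OF \<phi>] by (rule sum4_factor)
    also have "\<dots> = (\<Sum>l\<in>UNIV. \<Sum>l'\<in>UNIV. F $ l $ l' * ?p \<one>\<^bsub>B\<^esub> (w l i \<otimes>\<^bsub>C\<^esub> w l' j))"
      by (intro sum.cong refl bil_matD(2)[OF v] lf_pure1'[OF \<phi>] C.mult_closed cw)
    also have "\<dots> = G $ i $ j * ?p \<one>\<^bsub>B\<^esub> \<one>\<^bsub>C\<^esub>"
      by (rule bil_matD(2)[OF w lf_pure2'[OF \<phi> B.one_closed]])
    finally show "(\<Sum>a\<in>UNIV. \<Sum>b\<in>UNIV. E $ a $ b * \<phi> (mprod B C v w a i \<otimes>\<^bsub>TA\<^esub> mprod B C v w b j)) = G $ i $ j * \<phi> \<one>\<^bsub>TA\<^esub>"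
      by (simp add: TA_sel)
  next
    fix \<phi> i j assume \<phi>: "linfun TA \<phi>"
    let ?p = "\<lambda>b c. \<phi> (pure B C b c)"
    have "(\<Sum>a\<in>UNIV. \<Sum>b\<in>UNIV. matrix_inv G $ a $ b * \<phi> (mprod B C v w i a \<otimes>\<^bsub>TA\<^esub> mprod B C v w j b)) =
      (\<Sum>l\<in>UNIV. \<Sum>l'\<in>UNIV. \<Sum>a\<in>UNIV. \<Sum>b\<in>UNIV. matrix_inv G $ a $ b * ?p (v i l \<otimes>\<^bsub>B\<^esub> v j l') (w l a \<otimes>\<^bsub>C\<^esub> w l' b))"
      unfolding mult[OF \<phi>] by (rule sum4_factor)
    also have "\<dots> = (\<Sum>l\<in>UNIV. \<Sum>l'\<in>UNIV. matrix_inv F $ l $ l' * ?p (v i l \<otimes>\<^bsub>B\<^esub> v j l') \<one>\<^bsub>C\<^esub>)"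
      by (intro sum.cong refl bil_matD(3)[OF w] lf_pure2'[OF \<phi>] B.mult_closed cv)
    also have "\<dots> = matrix_inv E $ i $ j * ?p \<one>\<^bsub>B\<^esub> \<one>\<^bsub>C\<^esub>"
      by (rule bil_matD(3)[OF v lf_pure1'[OF \<phi> C.one_closed]])
    finally show "(\<Sum>a\<in>UNIV. \<Sum>b\<in>UNIV. matrix_inv G $ a $ b * \<phi> (mprod B C v w i a \<otimes>\<^bsub>TA\<^esub> mprod B C v w j b)) = matrix_inv E $ i $ j * \<phi> \<one>\<^bsub>TA\<^esub>"
      by (simp add: TA_sel)
  qed
qed

end

lemma bil_mat_unit:
  fixes E :: "'k::field ^ 'n ^ 'n"
  shows "bil_mat (scalar_algebra :: ('k, 'k) module) E E (\<lambda>i j. if i = j then 1 else 0)"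
proof -
  have u1: "(\<Sum>a\<in>UNIV. \<Sum>b\<in>UNIV. e a b * \<phi> ((if a = i then 1 else 0) * (if b = j then 1 else 0))) = e i j * \<phi> 1"
    if "linfun (scalar_algebra :: ('k, 'k) module) \<phi>" for e :: "'n => 'n => 'k" and \<phi> i j
  proof -
    have z: "\<phi> 0 = 0" using lf_zero[OF kalg.vs[OF kalg_scalar] that] by (simp add: scalar_sel)
    have "(\<Sum>a\<in>UNIV. \<Sum>b\<in>UNIV. e a b * \<phi> ((if a = i then 1 else 0) * (if b = j then 1 else 0))) =
      (\<Sum>a\<in>UNIV. \<Sum>b\<in>UNIV. if b = j then (if a = i then e a b * \<phi> 1 else 0) else 0)"
      by (intro sum.cong refl) (auto simp: z)
    also have "\<dots> = e i j * \<phi> 1" by simp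
    finally show ?thesis .
  qed
  have u2: "(\<Sum>a\<in>UNIV. \<Sum>b\<in>UNIV. e a b * \<phi> ((if i = a then 1 else 0) * (if j = b then 1 else 0))) = e i j * \<phi> 1"
    if "linfun (scalar_algebra :: ('k, 'k) module) \<phi>" for e :: "'n => 'n => 'k" and \<phi> i j
    using u1[OF that, of e i j] by (simp add: eq_commute[of i] eq_commute[of j])
  show ?thesis
    unfolding bil_mat_def scalar_sel
    by (intro conjI allI impI UNIV_I) (rule u1[where e = "\<lambda>a b. E $ a $ b"], assumption,
        rule u2[where e = "\<lambda>a b. matrix_inv E $ a $ b"])
qed

text \<open>The matrix \<open>E\<inverse> \<^sup>ty F\<close>. It is inverse to \<open>y\<close>, because the two relations of \<open>y\<close> say just this.\<close>

definition anti_mat :: "('k::field, 'a, 'x) module_scheme => 'k ^ 'm ^ 'm => 'k ^ 'n ^ 'n => ('n::finite => 'm::finite => 'a) => 'm => 'n => 'a" where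
  "anti_mat A E F y i j = (\<Oplus>\<^bsub>A\<^esub>c\<in>UNIV. \<Oplus>\<^bsub>A\<^esub>d\<in>UNIV. (matrix_inv E $ i $ c * F $ d $ j) \<odot>\<^bsub>A\<^esub> y d c)"

context kalg
begin

context
  fixes E :: "'k ^ 'm ^ 'm" and F :: "'k ^ 'n ^ 'n" and y :: "'n::finite => 'm::finite => 'a"
  assumes E: "invertible E" and F: "invertible F" and y: "bil_mat A F E y"
begin

lemma anti_closed: "anti_mat A E F y i j \<in> carrier A"
  unfolding anti_mat_def by (intro vs_finsum[OF vs] vs_smult[OF vs] bil_matD(1)[OF y])

lemma lf_anti: "linfun A \<phi> ==> \<phi> (anti_mat A E F y i j) = (\<Sum>c\<in>UNIV. \<Sum>d\<in>UNIV. (matrix_inv E $ i $ c * F $ d $ j) * \<phi> (y d c))"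
  unfolding anti_mat_def
  by (subst lf_finsum[OF vs], assumption) (auto intro!: vs_finsum[OF vs] vs_smult[OF vs] bil_matD(1)[OF y]
      simp: lf_finsum[OF vs] vs_smult[OF vs] bil_matD(1)[OF y] lf_smult)

lemma anti_right: "linfun A \<phi> ==> (\<Sum>l\<in>UNIV. \<phi> (y i l \<otimes> anti_mat A E F y l j)) = (if i = j then \<phi> \<one> else 0)"
proof -
  assume \<phi>: "linfun A \<phi>"
  have "(\<Sum>l\<in>UNIV. \<phi> (y i l \<otimes> anti_mat A E F y l j)) = (\<Sum>l\<in>UNIV. \<Sum>c\<in>UNIV. \<Sum>d\<in>UNIV. (matrix_inv E $ l $ c * F $ d $ j) * \<phi> (y i l \<otimes> y d c))"
    by (intro sum.cong refl lf_anti lf_mult2[OF \<phi>] bil_matD(1)[OF y])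
  also have "\<dots> = (\<Sum>l\<in>UNIV. \<Sum>d\<in>UNIV. \<Sum>c\<in>UNIV. (matrix_inv E $ l $ c * F $ d $ j) * \<phi> (y i l \<otimes> y d c))"
    by (intro sum.cong refl sum.swap)
  also have "\<dots> = (\<Sum>d\<in>UNIV. \<Sum>l\<in>UNIV. \<Sum>c\<in>UNIV. (matrix_inv E $ l $ c * F $ d $ j) * \<phi> (y i l \<otimes> y d c))"
    by (rule sum.swap)
  also have "\<dots> = (\<Sum>d\<in>UNIV. F $ d $ j * (\<Sum>l\<in>UNIV. \<Sum>c\<in>UNIV. matrix_inv E $ l $ c * \<phi> (y i l \<otimes> y d c)))"
    by (simp add: sum_distrib_left ac_simps)
  also have "\<dots> = (\<Sum>d\<in>UNIV. F $ d $ j * (matrix_inv F $ i $ d * \<phi> \<one>))"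
    by (intro sum.cong refl arg_cong2[where f = "(*)"] bil_matD(3)[OF y \<phi>])
  also have "\<dots> = (\<Sum>d\<in>UNIV. matrix_inv F $ i $ d * F $ d $ j) * \<phi> \<one>"
    by (simp add: sum_distrib_right mult.assoc mult.left_commute)
  also have "\<dots> = (if i = j then \<phi> \<one> else 0)" by (simp add: inv_entries[OF F])
  finally show ?thesis .
qed

lemma anti_left: "linfun A \<phi> ==> (\<Sum>l\<in>UNIV. \<phi> (anti_mat A E F y i l \<otimes> y l j)) = (if i = j then \<phi> \<one> else 0)"
proof -
  assume \<phi>: "linfun A \<phi>"
  have "(\<Sum>l\<in>UNIV. \<phi> (anti_mat A E F y i l \<otimes> y l j)) = (\<Sum>l\<in>UNIV. \<Sum>c\<in>UNIV. \<Sum>d\<in>UNIV. (matrix_inv E $ i $ c * F $ d $ l) * \<phi> (y d c \<otimes> y l j))"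
    by (intro sum.cong refl lf_anti lf_mult1[OF \<phi>] bil_matD(1)[OF y])
  also have "\<dots> = (\<Sum>c\<in>UNIV. \<Sum>l\<in>UNIV. \<Sum>d\<in>UNIV. (matrix_inv E $ i $ c * F $ d $ l) * \<phi> (y d c \<otimes> y l j))"
    by (rule sum.swap)
  also have "\<dots> = (\<Sum>c\<in>UNIV. \<Sum>d\<in>UNIV. \<Sum>l\<in>UNIV. (matrix_inv E $ i $ c * F $ d $ l) * \<phi> (y d c \<otimes> y l j))"
    by (intro sum.cong refl sum.swap)
  also have "\<dots> = (\<Sum>c\<in>UNIV. matrix_inv E $ i $ c * (\<Sum>d\<in>UNIV. \<Sum>l\<in>UNIV. F $ d $ l * \<phi> (y d c \<otimes> y l j)))"
    by (simp add: sum_distrib_left mult.assoc)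
  also have "\<dots> = (\<Sum>c\<in>UNIV. matrix_inv E $ i $ c * (E $ c $ j * \<phi> \<one>))"
    by (intro sum.cong refl arg_cong2[where f = "(*)"] bil_matD(2)[OF y \<phi>])
  also have "\<dots> = (\<Sum>c\<in>UNIV. matrix_inv E $ i $ c * E $ c $ j) * \<phi> \<one>"
    by (simp add: sum_distrib_right mult.assoc)
  also have "\<dots> = (if i = j then \<phi> \<one> else 0)" by (simp add: inv_entries[OF E])
  finally show ?thesis .
qed

end

end

text \<open>The transpose in \<open>anti_mat\<close> reverses products, which is why the inverse isometry lives in the opposite
  algebra. Each relation reduces to one of the two inverse laws after the scalar matrices
  have cancelled.\<close>

lemma bil_mat_anti:
  fixes A :: "('k::field, 'a) module" (structure)
    and E :: "'k ^ 'm::finite ^ 'm" and F :: "'k ^ 'n::finite ^ 'n" and y :: "'n => 'm => 'a"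
  assumes A: "kalg A" and E: "invertible E" and F: "invertible F" and y: "bil_mat A F E y"
  shows "bil_mat (opposite_algebra A) E F (anti_mat A E F y)"
proof -
  interpret kalg A by (rule A)
  note anti_closed = anti_closed[OF E F y] and lf_anti = lf_anti[OF E F y]
    and anti_right = anti_right[OF E F y] and anti_left = anti_left[OF E F y]
  let ?O = "opposite_algebra A" and ?s = "anti_mat A E F y"
  have same: "carrier ?O = carrier A" "add ?O = add A" "smult ?O = smult A" "one ?O = one A"
    "mult ?O = (\<lambda>x y. y \<otimes>\<^bsub>A\<^esub> x)"
    by (simp_all add: opposite_algebra_def)
  have l: "linfun ?O f \<longleftrightarrow> linfun A f" for f by (rule lf_same) (rule same)+
  have r1: "(\<Sum>b\<in>UNIV. E $ a $ b * \<psi> (?s b j)) = (\<Sum>d\<in>UNIV. F $ d $ j * \<psi> (y d a))"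
    if \<psi>: "linfun A \<psi>" for \<psi> a j
  proof -
    have "(\<Sum>b\<in>UNIV. E $ a $ b * \<psi> (?s b j)) = (\<Sum>b\<in>UNIV. \<Sum>c\<in>UNIV. (E $ a $ b * matrix_inv E $ b $ c) * (\<Sum>d\<in>UNIV. F $ d $ j * \<psi> (y d c)))"
      by (simp add: lf_anti[OF \<psi>] sum_distrib_left mult.assoc)
    also have "\<dots> = (\<Sum>c\<in>UNIV. (\<Sum>b\<in>UNIV. E $ a $ b * matrix_inv E $ b $ c) * (\<Sum>d\<in>UNIV. F $ d $ j * \<psi> (y d c)))"
      by (subst sum.swap) (simp add: sum_distrib_right)
    also have "\<dots> = (\<Sum>d\<in>UNIV. F $ d $ j * \<psi> (y d a))"
      by (simp add: inv_entries(2)[OF E] if_distrib[of "\<lambda>x. x * _"] cong: if_cong)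
    finally show ?thesis .
  qed
  have r2: "(\<Sum>a\<in>UNIV. matrix_inv F $ a $ b * \<psi> (?s i a)) = (\<Sum>c\<in>UNIV. matrix_inv E $ i $ c * \<psi> (y b c))"
    if \<psi>: "linfun A \<psi>" for \<psi> b i
  proof -
    have "(\<Sum>a\<in>UNIV. matrix_inv F $ a $ b * \<psi> (?s i a)) =
      (\<Sum>a\<in>UNIV. \<Sum>d\<in>UNIV. (F $ d $ a * matrix_inv F $ a $ b) * (\<Sum>c\<in>UNIV. matrix_inv E $ i $ c * \<psi> (y d c)))"
      unfolding lf_anti[OF \<psi>] sum_distrib_left
      by (intro sum.cong refl, subst sum.swap) (simp add: ac_simps)
    also have "\<dots> = (\<Sum>d\<in>UNIV. (\<Sum>a\<in>UNIV. F $ d $ a * matrix_inv F $ a $ b) * (\<Sum>c\<in>UNIV. matrix_inv E $ i $ c * \<psi> (y d c)))"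
      by (subst sum.swap) (simp add: sum_distrib_right)
    also have "\<dots> = (\<Sum>c\<in>UNIV. matrix_inv E $ i $ c * \<psi> (y b c))"
      by (simp add: inv_entries(2)[OF F] if_distrib[of "\<lambda>x. x * _"] cong: if_cong)
    finally show ?thesis .
  qed
  show ?thesis
    unfolding bil_mat_def l same
  proof (intro conjI allI impI anti_closed)
    fix \<phi> i j assume \<phi>: "linfun A \<phi>"
    have "(\<Sum>a\<in>UNIV. \<Sum>b\<in>UNIV. E $ a $ b * \<phi> (?s b j \<otimes> ?s a i)) = (\<Sum>a\<in>UNIV. \<Sum>d\<in>UNIV. F $ d $ j * \<phi> (y d a \<otimes> ?s a i))"
      by (intro sum.cong refl r1 lf_mult1[OF \<phi>] anti_closed)
    also have "\<dots> = (\<Sum>d\<in>UNIV. F $ d $ j * (\<Sum>a\<in>UNIV. \<phi> (y d a \<otimes> ?s a i)))"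
      by (subst sum.swap) (simp add: sum_distrib_left)
    also have "\<dots> = F $ i $ j * \<phi> \<one>"
      by (simp add: anti_right[OF \<phi>] if_distrib[of "\<lambda>x. _ * x"] cong: if_cong)
    finally show "(\<Sum>a\<in>UNIV. \<Sum>b\<in>UNIV. E $ a $ b * \<phi> (?s b j \<otimes> ?s a i)) = F $ i $ j * \<phi> \<one>" .
    fix i j
    have "(\<Sum>a\<in>UNIV. \<Sum>b\<in>UNIV. matrix_inv F $ a $ b * \<phi> (?s j b \<otimes> ?s i a)) = (\<Sum>b\<in>UNIV. \<Sum>a\<in>UNIV. matrix_inv F $ a $ b * \<phi> (?s j b \<otimes> ?s i a))"
      by (rule sum.swap)
    also have "\<dots> = (\<Sum>b\<in>UNIV. \<Sum>c\<in>UNIV. matrix_inv E $ i $ c * \<phi> (?s j b \<otimes> y b c))"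
      by (intro sum.cong refl r2 lf_mult2[OF \<phi>] anti_closed)
    also have "\<dots> = (\<Sum>c\<in>UNIV. matrix_inv E $ i $ c * (\<Sum>b\<in>UNIV. \<phi> (?s j b \<otimes> y b c)))"
      by (subst sum.swap) (simp add: sum_distrib_left)
    also have "\<dots> = matrix_inv E $ i $ j * \<phi> \<one>"
      by (simp add: anti_left[OF \<phi>] if_distrib[of "\<lambda>x. _ * x"] cong: if_cong)
    finally show "(\<Sum>a\<in>UNIV. \<Sum>b\<in>UNIV. matrix_inv F $ a $ b * \<phi> (?s j b \<otimes> ?s i a)) = matrix_inv E $ i $ j * \<phi> \<one>" .
  qed
qed



section \<open>Algebras generated by the entries of a matrix\<close>

locale matrix_algebra = kalg A for A :: "('k::field, 'a, 'x) module_scheme" (structure) +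
  fixes u :: "'i => 'j => 'a"
  assumes gen_closed: "u i j \<in> carrier A"
    and matrix_induct: "\<And>P a. \<lbrakk>a \<in> carrier A; P \<one>; \<And>i j a. a \<in> carrier A ==> P a ==> P (u i j \<otimes> a);
      \<And>a b. a \<in> carrier A ==> b \<in> carrier A ==> P a ==> P b ==> P (a \<oplus> b);
      \<And>c a. a \<in> carrier A ==> P a ==> P (c \<odot> a)\<rbrakk> \<Longrightarrow> P a"
begin

lemma functional_induct:
  assumes a: "a \<in> carrier A" and linfun: "\<And>p. p \<in> \<Phi> ==> linfun A (f p)" "\<And>p. p \<in> \<Phi> ==> linfun A (g p)"
    and one: "\<And>p. p \<in> \<Phi> ==> f p \<one> = g p \<one>"
    and gen: "\<And>i j a p. a \<in> carrier A ==> (\<And>p. p \<in> \<Phi> ==> f p a = g p a) ==> p \<in> \<Phi> ==> f p (u i j \<otimes> a) = g p (u i j \<otimes> a)"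
    and p: "p \<in> \<Phi>"
  shows "f p a = g p a"
proof -
  have "\<forall>p\<in>\<Phi>. f p a = g p a"
  proof (rule matrix_induct[OF a])
    fix a b assume "a \<in> carrier A" "b \<in> carrier A" "\<forall>p\<in>\<Phi>. f p a = g p a" "\<forall>p\<in>\<Phi>. f p b = g p b"
    then show "\<forall>p\<in>\<Phi>. f p (a \<oplus> b) = g p (a \<oplus> b)" by (simp add: lf_add[OF linfun(1)] lf_add[OF linfun(2)])
  next
    fix c a assume "a \<in> carrier A" "\<forall>p\<in>\<Phi>. f p a = g p a"
    then show "\<forall>p\<in>\<Phi>. f p (c \<odot> a) = g p (c \<odot> a)" by (simp add: lf_smult[OF linfun(1)] lf_smult[OF linfun(2)])
  qed (use one gen in auto)
  then show ?thesis using p by blast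
qed

end

text \<open>A homomorphism \<open>A \<rightarrow> B \<otimes> C\<close> which sends a matrix over \<open>A\<close> to the product of matrices over \<open>B\<close> and \<open>C\<close>. All structure maps
  between the algebras \<open>B(E, F)\<close> have this form.\<close>

locale matrix_comult = two_algebras B C + A: kalg A
  for B :: "('k::field, 'b, 'x) module_scheme" and C :: "('k, 'c, 'y) module_scheme"
    and A :: "('k, 'a, 'z) module_scheme" +
  fixes u :: "'i => 'j => 'a" and v :: "'i => 'l::finite => 'b" and w :: "'l => 'j => 'c"
    and d :: "'a => ('k, 'b, 'c) tens"
  assumes hom: "alg_hom A (tensor_algebra B C) d"
    and u: "u i j \<in> carrier A" and v: "v i l \<in> carrier B" and w: "w l j \<in> carrier C"
    and gen: "d (u i j) = mprod B C v w i j"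
begin

sublocale tensor_valued B C A d
proof
  show "linear_map A (tensor B C) d"
    using alg_hom_lin[OF hom] by (simp add: linear_map_def TA_sel)
qed

lemma d_closed: "a \<in> carrier A ==> d a \<in> carrier TA"
  using closed by (simp add: TA_sel)

lemma psum_mult: "a \<in> carrier A ==> b \<in> carrier A ==> bilin B C F ==> sw (d (a \<otimes>\<^bsub>A\<^esub> b)) F =
   sw (d a) (\<lambda>x y. sw (d b) (\<lambda>x' y'. F (x \<otimes>\<^bsub>B\<^esub> x') (y \<otimes>\<^bsub>C\<^esub> y')))"
  by (simp add: alg_hom_mult[OF hom] psum_TA_mult d_closed)

lemma psum_one: "bilin B C F ==> sw (d \<one>\<^bsub>A\<^esub>) F = F \<one>\<^bsub>B\<^esub> \<one>\<^bsub>C\<^esub>"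
  by (simp add: alg_hom_one[OF hom] TA_sel psum_pure B.one_closed C.one_closed)

lemma psum_gen:
  assumes a: "a \<in> carrier A" and F: "bilin B C F"
  shows "sw (d (u i j \<otimes>\<^bsub>A\<^esub> a)) F = (\<Sum>l\<in>UNIV. sw (d a) (\<lambda>b c. F (v i l \<otimes>\<^bsub>B\<^esub> b) (w l j \<otimes>\<^bsub>C\<^esub> c)))"
  unfolding psum_mult[OF u a F] gen
  by (rule psum_mprod[OF v w], rule blI)
    (rule lf_psum_inner[OF pol[OF a]], (assumption | rule B.lf_mult1 C.lf_mult1 blD1[OF F] blD2[OF F] B.mult_closed C.mult_closed v w)+)+

end

text \<open>All coassociativity laws at once. On generators both sides are the product of three matrices \<open>x\<close>, \<open>y\<close> and \<open>w\<close>. The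
  induction over products of generators is carried out for all trilinear functionals
  simultaneously, as multiplication by a generator changes the functional.\<close>

lemma matrix_coassoc:
  assumes A: "matrix_algebra A u"
    and d1: "matrix_comult P Q A u v w d1" and e1: "matrix_comult B C P v x y e1"
    and d2: "matrix_comult B R A u x z d2" and e2: "matrix_comult C Q R z y w e2"
    and a: "a \<in> carrier A" and F: "trilin B C Q F"
  shows "sw (d1 a) (\<lambda>p q. sw (e1 p) (\<lambda>b c. F b c q)) =
    sw (d2 a) (\<lambda>b r. sw (e2 r) (\<lambda>c q. F b c q))"
proof -
  interpret A: matrix_algebra A u by (rule A)
  interpret d1: matrix_comult P Q A u v w d1 by (rule d1)
  interpret e1: matrix_comult B C P v x y e1 by (rule e1)
  interpret d2: matrix_comult B R A u x z d2 by (rule d2)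
  interpret e2: matrix_comult C Q R z y w e2 by (rule e2)
  note pols = lf_psum_inner[OF e1.pol] lf_psum_inner[OF e2.pol]
  show ?thesis
  proof (rule A.functional_induct[where \<Phi> = "{F. trilin B C Q F}" and
      f = "\<lambda>F a. sw (d1 a) (\<lambda>p q. sw (e1 p) (\<lambda>b c. F b c q))" and
      g = "\<lambda>F a. sw (d2 a) (\<lambda>b r. sw (e2 r) (\<lambda>c q. F b c q))", OF a])
    fix F assume "F \<in> {F. trilin B C Q F}"
    then have F: "trilin B C Q F" by simp
    note rules = tlD1[OF F] tlD2[OF F] tlD3[OF F] d1.B.one_closed d1.C.one_closed e1.B.one_closed d2.C.one_closed
       e1.C.one_closed d1.v d1.w d2.v d2.w e1.v e1.w e2.v e2.w
      d1.B.lf_mult2 d1.C.lf_mult2 e1.B.lf_mult2 d2.C.lf_mult2 e1.C.lf_mult2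
      d1.B.mult_closed d1.C.mult_closed e1.B.mult_closed d2.C.mult_closed e1.C.mult_closed
    show "linfun A (\<lambda>a. sw (d1 a) (\<lambda>p q. sw (e1 p) (\<lambda>b c. F b c q)))"
      by (assumption | rule d1.linfun e1.linfun pols rules)+
    show "linfun A (\<lambda>a. sw (d2 a) (\<lambda>b r. sw (e2 r) (\<lambda>c q. F b c q)))"
      by (assumption | rule d2.linfun e2.linfun pols rules)+
    have "sw (d1 \<one>\<^bsub>A\<^esub>) (\<lambda>p q. sw (e1 p) (\<lambda>b c. F b c q)) = sw (e1 \<one>\<^bsub>P\<^esub>) (\<lambda>b c. F b c \<one>\<^bsub>Q\<^esub>)"
      by (rule d1.psum_one, rule blI) (assumption | rule d1.linfun e1.linfun pols rules)+
    also have "\<dots> = F \<one>\<^bsub>B\<^esub> \<one>\<^bsub>C\<^esub> \<one>\<^bsub>Q\<^esub>"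
      by (rule e1.psum_one, rule blI) (assumption | rule rules)+
    also have "\<dots> = sw (e2 \<one>\<^bsub>R\<^esub>) (\<lambda>c q. F \<one>\<^bsub>B\<^esub> c q)"
      by (rule e2.psum_one[symmetric], rule blI) (assumption | rule rules)+
    also have "\<dots> = sw (d2 \<one>\<^bsub>A\<^esub>) (\<lambda>b r. sw (e2 r) (\<lambda>c q. F b c q))"
      by (rule d2.psum_one[symmetric], rule blI) (assumption | rule d2.linfun e2.linfun pols rules)+
    finally show "sw (d1 \<one>\<^bsub>A\<^esub>) (\<lambda>p q. sw (e1 p) (\<lambda>b c. F b c q)) =
      sw (d2 \<one>\<^bsub>A\<^esub>) (\<lambda>b r. sw (e2 r) (\<lambda>c q. F b c q))" .
    fix i j a assume a: "a \<in> carrier A"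
      and IH: "\<And>F. F \<in> {F. trilin B C Q F} ==> sw (d1 a) (\<lambda>p q. sw (e1 p) (\<lambda>b c. F b c q)) =
        sw (d2 a) (\<lambda>b r. sw (e2 r) (\<lambda>c q. F b c q))"
    have "sw (d1 (u i j \<otimes>\<^bsub>A\<^esub> a)) (\<lambda>p q. sw (e1 p) (\<lambda>b c. F b c q)) =
      (\<Sum>l\<in>UNIV. sw (d1 a) (\<lambda>p q. sw (e1 (v i l \<otimes>\<^bsub>P\<^esub> p)) (\<lambda>b c. F b c (w l j \<otimes>\<^bsub>Q\<^esub> q))))"
      by (rule d1.psum_gen[OF a], rule blI) (assumption | rule d1.linfun e1.linfun pols rules)+
    also have "\<dots> = (\<Sum>l\<in>UNIV. sw (d1 a) (\<lambda>p q. \<Sum>m\<in>UNIV. sw (e1 p) (\<lambda>b c. F (x i m \<otimes>\<^bsub>B\<^esub> b) (y m l \<otimes>\<^bsub>C\<^esub> c) (w l j \<otimes>\<^bsub>Q\<^esub> q))))"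
      by (intro sum.cong refl psum_cong[OF d1.pol[OF a]] e1.psum_gen blI) (assumption | rule rules)+
    also have "\<dots> = (\<Sum>l\<in>UNIV. \<Sum>m\<in>UNIV. sw (d1 a) (\<lambda>p q. sw (e1 p) (\<lambda>b c. F (x i m \<otimes>\<^bsub>B\<^esub> b) (y m l \<otimes>\<^bsub>C\<^esub> c) (w l j \<otimes>\<^bsub>Q\<^esub> q))))"
      by (simp only: psum_sum)
    also have "\<dots> = (\<Sum>l\<in>UNIV. \<Sum>m\<in>UNIV. sw (d2 a) (\<lambda>b r. sw (e2 r) (\<lambda>c q. F (x i m \<otimes>\<^bsub>B\<^esub> b) (y m l \<otimes>\<^bsub>C\<^esub> c) (w l j \<otimes>\<^bsub>Q\<^esub> q))))"
    proof (intro sum.cong refl)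
      fix l m
      have "trilin B C Q (\<lambda>b c q. F (x i m \<otimes>\<^bsub>B\<^esub> b) (y m l \<otimes>\<^bsub>C\<^esub> c) (w l j \<otimes>\<^bsub>Q\<^esub> q))"
        by (rule tlI) (assumption | rule rules e1.B.lf_mult2[OF tlD1[OF F]] e1.C.lf_mult2[OF tlD2[OF F]] d1.C.lf_mult2[OF tlD3[OF F]])+
      then show "sw (d1 a) (\<lambda>p q. sw (e1 p) (\<lambda>b c. F (x i m \<otimes>\<^bsub>B\<^esub> b) (y m l \<otimes>\<^bsub>C\<^esub> c) (w l j \<otimes>\<^bsub>Q\<^esub> q))) =
         sw (d2 a) (\<lambda>b r. sw (e2 r) (\<lambda>c q. F (x i m \<otimes>\<^bsub>B\<^esub> b) (y m l \<otimes>\<^bsub>C\<^esub> c) (w l j \<otimes>\<^bsub>Q\<^esub> q)))"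
        using IH by blast
    qed
    also have "\<dots> = (\<Sum>m\<in>UNIV. sw (d2 a) (\<lambda>b r. \<Sum>l\<in>UNIV. sw (e2 r) (\<lambda>c q. F (x i m \<otimes>\<^bsub>B\<^esub> b) (y m l \<otimes>\<^bsub>C\<^esub> c) (w l j \<otimes>\<^bsub>Q\<^esub> q))))"
      by (subst sum.swap) (simp only: psum_sum)
    also have "\<dots> = (\<Sum>m\<in>UNIV. sw (d2 a) (\<lambda>b r. sw (e2 (z m j \<otimes>\<^bsub>R\<^esub> r)) (\<lambda>c q. F (x i m \<otimes>\<^bsub>B\<^esub> b) c q)))"
      by (intro sum.cong refl psum_cong[OF d2.pol[OF a]] e2.psum_gen[symmetric] blI) (assumption | rule rules)+
    also have "\<dots> = sw (d2 (u i j \<otimes>\<^bsub>A\<^esub> a)) (\<lambda>b r. sw (e2 r) (\<lambda>c q. F b c q))"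
      by (rule d2.psum_gen[OF a, symmetric], rule blI) (assumption | rule d2.linfun e2.linfun pols rules)+
    finally show "sw (d1 (u i j \<otimes>\<^bsub>A\<^esub> a)) (\<lambda>p q. sw (e1 p) (\<lambda>b c. F b c q)) =
      sw (d2 (u i j \<otimes>\<^bsub>A\<^esub> a)) (\<lambda>b r. sw (e2 r) (\<lambda>c q. F b c q))" .
  qed (use F in simp)
qed

definition matrix_counit :: "('k::field, 'b, 'x) module_scheme => ('i => 'i => 'b) => ('b => 'k) => bool" where
  "matrix_counit B v \<epsilon> \<longleftrightarrow> alg_hom B scalar_algebra \<epsilon> \<and> (\<forall>i j. \<epsilon> (v i j) = (if i = j then 1 else 0))"

lemma matrix_counitD:
  assumes "matrix_counit B v \<epsilon>"
  shows "linfun B \<epsilon>" "a \<in> carrier B ==> b \<in> carrier B ==> \<epsilon> (a \<otimes>\<^bsub>B\<^esub> b) = \<epsilon> a * \<epsilon> b" "\<epsilon> \<one>\<^bsub>B\<^esub> = 1"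
    "\<epsilon> (v i j) = (if i = j then 1 else 0)"
  using assms by (auto simp: matrix_counit_def alg_hom_def linear_map_def scalar_sel linfun_def)

lemma matrix_counit_left:
  assumes A: "matrix_algebra A u" and d: "matrix_comult B A A u v u d" and \<epsilon>: "matrix_counit B v \<epsilon>"
    and a: "a \<in> carrier A" and g: "linfun A g"
  shows "sw (d a) (\<lambda>b c. \<epsilon> b * g c) = g a"
proof -
  interpret A: matrix_algebra A u by (rule A)
  interpret d: matrix_comult B A A u v u d by (rule d)
  note E = matrix_counitD[OF \<epsilon>]
  show ?thesis
  proof (rule A.functional_induct[where \<Phi> = "{g. linfun A g}" and f = "\<lambda>g a. sw (d a) (\<lambda>b c. \<epsilon> b * g c)" and g = "\<lambda>g a. g a", OF a])
    fix g assume "g \<in> {g. linfun A g}"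
    then have g: "linfun A g" by simp
    note rules = lf_mult_const E(1) g A.lf_mult2[OF g] d.u
    show "linfun A (\<lambda>a. sw (d a) (\<lambda>b c. \<epsilon> b * g c))" by (assumption | rule d.linfun rules)+
    show "sw (d \<one>\<^bsub>A\<^esub>) (\<lambda>b c. \<epsilon> b * g c) = g \<one>\<^bsub>A\<^esub>"
      by (subst d.psum_one, rule blI) (assumption | rule rules | simp add: E)+
    fix i j a assume a: "a \<in> carrier A" and IH: "\<And>g. g \<in> {g. linfun A g} ==> sw (d a) (\<lambda>b c. \<epsilon> b * g c) = g a"
    have "sw (d (u i j \<otimes>\<^bsub>A\<^esub> a)) (\<lambda>b c. \<epsilon> b * g c) = (\<Sum>l\<in>UNIV. sw (d a) (\<lambda>b c. \<epsilon> (v i l \<otimes>\<^bsub>B\<^esub> b) * g (u l j \<otimes>\<^bsub>A\<^esub> c)))"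
      by (rule d.psum_gen[OF a], rule blI) (assumption | rule rules)+
    also have "\<dots> = (\<Sum>l\<in>UNIV. sw (d a) (\<lambda>b c. (if i = l then 1 else 0) * (\<epsilon> b * g (u l j \<otimes>\<^bsub>A\<^esub> c))))"
      by (intro sum.cong refl psum_cong[OF d.pol[OF a]]) (simp add: E d.v)
    also have "\<dots> = (\<Sum>l\<in>UNIV. (if i = l then 1 else 0) * g (u l j \<otimes>\<^bsub>A\<^esub> a))"
      unfolding psum_mult_left using IH A.lf_mult2[OF g d.u] by simp
    also have "\<dots> = g (u i j \<otimes>\<^bsub>A\<^esub> a)" by (simp add: if_distrib[of "\<lambda>x. x * _"] cong: if_cong)
    finally show "sw (d (u i j \<otimes>\<^bsub>A\<^esub> a)) (\<lambda>b c. \<epsilon> b * g c) = g (u i j \<otimes>\<^bsub>A\<^esub> a)" .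
  qed (use g in auto)
qed

lemma matrix_counit_right:
  assumes A: "matrix_algebra A u" and d: "matrix_comult A B A u u v d" and \<epsilon>: "matrix_counit B v \<epsilon>"
    and a: "a \<in> carrier A" and g: "linfun A g"
  shows "sw (d a) (\<lambda>b c. \<epsilon> c * g b) = g a"
proof -
  interpret A: matrix_algebra A u by (rule A)
  interpret d: matrix_comult A B A u u v d by (rule d)
  note E = matrix_counitD[OF \<epsilon>]
  show ?thesis
  proof (rule A.functional_induct[where \<Phi> = "{g. linfun A g}" and f = "\<lambda>g a. sw (d a) (\<lambda>b c. \<epsilon> c * g b)" and g = "\<lambda>g a. g a", OF a])
    fix g assume "g \<in> {g. linfun A g}"
    then have g: "linfun A g" by simp
    note rules = lf_mult_const E(1) g A.lf_mult2[OF g] d.u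
    show "linfun A (\<lambda>a. sw (d a) (\<lambda>b c. \<epsilon> c * g b))" by (assumption | rule d.linfun rules)+
    show "sw (d \<one>\<^bsub>A\<^esub>) (\<lambda>b c. \<epsilon> c * g b) = g \<one>\<^bsub>A\<^esub>"
      by (subst d.psum_one, rule blI) (assumption | rule rules | simp add: E)+
    fix i j a assume a: "a \<in> carrier A" and IH: "\<And>g. g \<in> {g. linfun A g} ==> sw (d a) (\<lambda>b c. \<epsilon> c * g b) = g a"
    have "sw (d (u i j \<otimes>\<^bsub>A\<^esub> a)) (\<lambda>b c. \<epsilon> c * g b) = (\<Sum>l\<in>UNIV. sw (d a) (\<lambda>b c. \<epsilon> (v l j \<otimes>\<^bsub>B\<^esub> c) * g (u i l \<otimes>\<^bsub>A\<^esub> b)))"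
      by (rule d.psum_gen[OF a], rule blI) (assumption | rule rules)+
    also have "\<dots> = (\<Sum>l\<in>UNIV. sw (d a) (\<lambda>b c. (if l = j then 1 else 0) * (\<epsilon> c * g (u i l \<otimes>\<^bsub>A\<^esub> b))))"
      by (intro sum.cong refl psum_cong[OF d.pol[OF a]]) (simp add: E d.w)
    also have "\<dots> = (\<Sum>l\<in>UNIV. (if l = j then 1 else 0) * g (u i l \<otimes>\<^bsub>A\<^esub> a))"
      unfolding psum_mult_left using IH A.lf_mult2[OF g d.u] by simp
    also have "\<dots> = g (u i j \<otimes>\<^bsub>A\<^esub> a)" by (simp add: if_distrib[of "\<lambda>x. x * _"] cong: if_cong)
    finally show "sw (d (u i j \<otimes>\<^bsub>A\<^esub> a)) (\<lambda>b c. \<epsilon> c * g b) = g (u i j \<otimes>\<^bsub>A\<^esub> a)" .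
  qed (use g in auto)
qed

text \<open>Induction over products of generators: \<open>S\<close> reverses the order of factors, so that the factor contributed by
  the shorter product is innermost and cancels first. The functional must therefore vary.\<close>

lemma matrix_antipode_right:
  assumes A: "matrix_algebra A u" and d: "matrix_comult Y Z A u y z d" and \<epsilon>: "matrix_counit A u \<epsilon>"
    and S: "linear_map Z Y S" "S \<one>\<^bsub>Z\<^esub> = \<one>\<^bsub>Y\<^esub>" "\<And>a b. a \<in> carrier Z ==> b \<in> carrier Z ==> S (a \<otimes>\<^bsub>Z\<^esub> b) = S b \<otimes>\<^bsub>Y\<^esub> S a"
    and inv: "\<And>\<phi> i j. linfun Y \<phi> ==> (\<Sum>l\<in>UNIV. \<phi> (y i l \<otimes>\<^bsub>Y\<^esub> S (z l j))) = (if i = j then \<phi> \<one>\<^bsub>Y\<^esub> else 0)"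
    and a: "a \<in> carrier A" and g: "linfun Y g"
  shows "sw (d a) (\<lambda>y z. g (y \<otimes>\<^bsub>Y\<^esub> S z)) = \<epsilon> a * g \<one>\<^bsub>Y\<^esub>"
proof -
  interpret A: matrix_algebra A u by (rule A)
  interpret d: matrix_comult Y Z A u y z d by (rule d)
  note E = matrix_counitD[OF \<epsilon>]
  note SS = lf_linear_map[OF S(1)] linear_map_closed[OF S(1)]
  show ?thesis
  proof (rule A.functional_induct[where \<Phi> = "{g. linfun Y g}" and f = "\<lambda>g a. sw (d a) (\<lambda>y z. g (y \<otimes>\<^bsub>Y\<^esub> S z))"
       and g = "\<lambda>g a. \<epsilon> a * g \<one>\<^bsub>Y\<^esub>", OF a])
    fix g assume "g \<in> {g. linfun Y g}"
    then have g: "linfun Y g" by simp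
    note rules = d.B.lf_mult1[OF g] SS d.B.lf_mult2[OF g, THEN SS(1)]
    show "linfun A (\<lambda>a. sw (d a) (\<lambda>y z. g (y \<otimes>\<^bsub>Y\<^esub> S z)))" by (assumption | rule d.linfun rules)+
    show "linfun A (\<lambda>a. \<epsilon> a * g \<one>\<^bsub>Y\<^esub>)" by (rule lf_mult_const E)+
    show "sw (d \<one>\<^bsub>A\<^esub>) (\<lambda>y z. g (y \<otimes>\<^bsub>Y\<^esub> S z)) = \<epsilon> \<one>\<^bsub>A\<^esub> * g \<one>\<^bsub>Y\<^esub>"
      by (subst d.psum_one, rule blI) (assumption | rule rules | simp add: E S d.B.l_one d.B.one_closed)+
    fix i j a assume a: "a \<in> carrier A" and IH: "\<And>g. g \<in> {g. linfun Y g} ==> sw (d a) (\<lambda>y z. g (y \<otimes>\<^bsub>Y\<^esub> S z)) = \<epsilon> a * g \<one>\<^bsub>Y\<^esub>"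
    have "sw (d (u i j \<otimes>\<^bsub>A\<^esub> a)) (\<lambda>y z. g (y \<otimes>\<^bsub>Y\<^esub> S z)) =
      (\<Sum>l\<in>UNIV. sw (d a) (\<lambda>b c. g ((y i l \<otimes>\<^bsub>Y\<^esub> b) \<otimes>\<^bsub>Y\<^esub> S (z l j \<otimes>\<^bsub>Z\<^esub> c))))"
      by (rule d.psum_gen[OF a], rule blI) (assumption | rule rules)+
    also have "\<dots> = (\<Sum>l\<in>UNIV. sw (d a) (\<lambda>b c. g (y i l \<otimes>\<^bsub>Y\<^esub> ((b \<otimes>\<^bsub>Y\<^esub> S c) \<otimes>\<^bsub>Y\<^esub> S (z l j)))))"
      by (intro sum.cong refl psum_cong[OF d.pol[OF a]]) (simp add: S d.w d.v SS d.B.assoc d.B.mult_closed)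
    also have "\<dots> = (\<Sum>l\<in>UNIV. \<epsilon> a * g (y i l \<otimes>\<^bsub>Y\<^esub> (\<one>\<^bsub>Y\<^esub> \<otimes>\<^bsub>Y\<^esub> S (z l j))))"
    proof (intro sum.cong refl)
      fix l
      have "linfun Y (\<lambda>t. g (y i l \<otimes>\<^bsub>Y\<^esub> (t \<otimes>\<^bsub>Y\<^esub> S (z l j))))"
        by (rule d.B.lf_mult1[OF d.B.lf_mult2[OF g d.v]]) (rule SS d.w)+
      then show "sw (d a) (\<lambda>b c. g (y i l \<otimes>\<^bsub>Y\<^esub> ((b \<otimes>\<^bsub>Y\<^esub> S c) \<otimes>\<^bsub>Y\<^esub> S (z l j)))) = \<epsilon> a * g (y i l \<otimes>\<^bsub>Y\<^esub> (\<one>\<^bsub>Y\<^esub> \<otimes>\<^bsub>Y\<^esub> S (z l j)))"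
        using IH[of "\<lambda>t. g (y i l \<otimes>\<^bsub>Y\<^esub> (t \<otimes>\<^bsub>Y\<^esub> S (z l j)))"] by blast
    qed
    also have "\<dots> = \<epsilon> a * (\<Sum>l\<in>UNIV. g (y i l \<otimes>\<^bsub>Y\<^esub> S (z l j)))"
      by (simp add: sum_distrib_left d.B.l_one SS d.w)
    also have "\<dots> = \<epsilon> (u i j \<otimes>\<^bsub>A\<^esub> a) * g \<one>\<^bsub>Y\<^esub>"
      unfolding inv[OF g] by (simp add: E d.u a)
    finally show "sw (d (u i j \<otimes>\<^bsub>A\<^esub> a)) (\<lambda>y z. g (y \<otimes>\<^bsub>Y\<^esub> S z)) = \<epsilon> (u i j \<otimes>\<^bsub>A\<^esub> a) * g \<one>\<^bsub>Y\<^esub>" .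
  qed (use g in auto)
qed

text \<open>Here the factors of the new generator are innermost and cancel at once.\<close>

lemma matrix_antipode_left:
  assumes A: "matrix_algebra A u" and d: "matrix_comult Z Y A u z y d" and \<epsilon>: "matrix_counit A u \<epsilon>"
    and S: "linear_map Z Y S" "S \<one>\<^bsub>Z\<^esub> = \<one>\<^bsub>Y\<^esub>" "\<And>a b. a \<in> carrier Z ==> b \<in> carrier Z ==> S (a \<otimes>\<^bsub>Z\<^esub> b) = S b \<otimes>\<^bsub>Y\<^esub> S a"
    and inv: "\<And>\<phi> i j. linfun Y \<phi> ==> (\<Sum>l\<in>UNIV. \<phi> (S (z i l) \<otimes>\<^bsub>Y\<^esub> y l j)) = (if i = j then \<phi> \<one>\<^bsub>Y\<^esub> else 0)"
    and a: "a \<in> carrier A" and g: "linfun Y g"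
  shows "sw (d a) (\<lambda>z y. g (S z \<otimes>\<^bsub>Y\<^esub> y)) = \<epsilon> a * g \<one>\<^bsub>Y\<^esub>"
proof -
  interpret A: matrix_algebra A u by (rule A)
  interpret d: matrix_comult Z Y A u z y d by (rule d)
  note E = matrix_counitD[OF \<epsilon>]
  note SS = lf_linear_map[OF S(1)] linear_map_closed[OF S(1)]
  show ?thesis
  proof (rule A.functional_induct[where \<Phi> = "{g}" and f = "\<lambda>g a. sw (d a) (\<lambda>z y. g (S z \<otimes>\<^bsub>Y\<^esub> y))"
       and g = "\<lambda>g a. \<epsilon> a * g \<one>\<^bsub>Y\<^esub>", OF a])
    fix g' assume "g' \<in> {g}"
    then have g': "g' = g" by simp
    note rules = d.C.lf_mult2[OF g] SS d.C.lf_mult1[OF g, THEN SS(1)]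
    show "linfun A (\<lambda>a. sw (d a) (\<lambda>z y. g' (S z \<otimes>\<^bsub>Y\<^esub> y)))" unfolding g' by (assumption | rule d.linfun rules)+
    show "linfun A (\<lambda>a. \<epsilon> a * g' \<one>\<^bsub>Y\<^esub>)" by (rule lf_mult_const E)+
    show "sw (d \<one>\<^bsub>A\<^esub>) (\<lambda>z y. g' (S z \<otimes>\<^bsub>Y\<^esub> y)) = \<epsilon> \<one>\<^bsub>A\<^esub> * g' \<one>\<^bsub>Y\<^esub>"
      unfolding g' by (subst d.psum_one, rule blI) (assumption | rule rules | simp add: E S d.C.l_one d.C.one_closed)+
    fix i j a assume a: "a \<in> carrier A" and IH: "\<And>g'. g' \<in> {g} ==> sw (d a) (\<lambda>z y. g' (S z \<otimes>\<^bsub>Y\<^esub> y)) = \<epsilon> a * g' \<one>\<^bsub>Y\<^esub>"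
    have "sw (d (u i j \<otimes>\<^bsub>A\<^esub> a)) (\<lambda>z y. g (S z \<otimes>\<^bsub>Y\<^esub> y)) =
      (\<Sum>l\<in>UNIV. sw (d a) (\<lambda>b c. g (S (z i l \<otimes>\<^bsub>Z\<^esub> b) \<otimes>\<^bsub>Y\<^esub> (y l j \<otimes>\<^bsub>Y\<^esub> c))))"
      by (rule d.psum_gen[OF a], rule blI) (assumption | rule rules)+
    also have "\<dots> = sw (d a) (\<lambda>b c. \<Sum>l\<in>UNIV. g (S b \<otimes>\<^bsub>Y\<^esub> ((S (z i l) \<otimes>\<^bsub>Y\<^esub> y l j) \<otimes>\<^bsub>Y\<^esub> c)))"
      unfolding psum_sum
      by (intro sum.cong refl psum_cong[OF d.pol[OF a]]) (simp add: S d.w d.v SS d.C.assoc d.C.mult_closed)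
    also have "\<dots> = sw (d a) (\<lambda>b c. (if i = j then 1 else 0) * g (S b \<otimes>\<^bsub>Y\<^esub> c))"
    proof (rule psum_cong[OF d.pol[OF a]])
      fix b c assume b: "b \<in> carrier Z" and c: "c \<in> carrier Y"
      have "linfun Y (\<lambda>t. g (S b \<otimes>\<^bsub>Y\<^esub> (t \<otimes>\<^bsub>Y\<^esub> c)))" by (rule d.C.lf_mult1[OF d.C.lf_mult2[OF g SS(2)[OF b]] c])
      from inv[OF this, of i j]
      show "(\<Sum>l\<in>UNIV. g (S b \<otimes>\<^bsub>Y\<^esub> ((S (z i l) \<otimes>\<^bsub>Y\<^esub> y l j) \<otimes>\<^bsub>Y\<^esub> c))) = (if i = j then 1 else 0) * g (S b \<otimes>\<^bsub>Y\<^esub> c)"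
        by (simp add: d.C.l_one c)
    qed
    also have "\<dots> = \<epsilon> (u i j \<otimes>\<^bsub>A\<^esub> a) * g \<one>\<^bsub>Y\<^esub>"
      unfolding psum_mult_left using IH by (simp add: E d.u a)
    finally show "sw (d (u i j \<otimes>\<^bsub>A\<^esub> a)) (\<lambda>z y. g' (S z \<otimes>\<^bsub>Y\<^esub> y)) = \<epsilon> (u i j \<otimes>\<^bsub>A\<^esub> a) * g' \<one>\<^bsub>Y\<^esub>"
      unfolding g' .
  qed (use g in auto)
qed

section \<open>Universal algebras of bilinear forms\<close>

context presented
begin

lemma pval_cls:
  assumes \<phi>: "linfun X \<phi>"
  shows "X.pval (\<lambda>x. cls (var x)) \<phi> p = \<phi> (cls p)"
proof -
  have w: "foldr (\<lambda>x y. cls (var x) \<otimes>\<^bsub>X\<^esub> y) xs \<one>\<^bsub>X\<^esub> = cls (Poly_Mapping.single (Word xs) 1)" for xs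
  proof (induction xs)
    case Nil
    have "Poly_Mapping.single (Word []) 1 = (1 :: ('x, 'k) free_algebra)"
      by (simp flip: single_one add: zero_word_def)
    then show ?case by (simp add: sel)
  next
    case (Cons x xs)
    then show ?case by (simp add: sel var_def mult_single plus_word_def)
  qed
  have w': "X.wval (\<lambda>x. cls (var x)) u = cls (Poly_Mapping.single u 1)" for u
    using w[of "letters u"] by (simp add: X.wval_def)
  have z: "\<phi> (cls 0) = 0" using lf_zero[OF X.vs \<phi>] by (simp add: sel)
  have "\<phi> (cls (\<Sum>u\<in>U. Poly_Mapping.single u (g u))) = (\<Sum>u\<in>U. g u * \<phi> (cls (Poly_Mapping.single u 1)))" for U g
  proof (induction U rule: infinite_finite_induct)
    case (insert u U)
    have "\<phi> (cls (Poly_Mapping.single u (g u))) = g u * \<phi> (cls (Poly_Mapping.single u 1))"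
      using lf_cls(2)[OF \<phi>, of "g u" "Poly_Mapping.single u 1"] by (simp add: formal_scale_single)
    then show ?case using insert by (simp add: lf_cls(1)[OF \<phi>])
  qed (simp_all add: z)
  then show ?thesis
    unfolding X.pval_def w' lin_ext_def by (subst (3) poly_mapping_sum_singles[of p]) simp
qed

lemma relation_cls: "r \<in> R ==> linfun X \<phi> ==> X.pval (\<lambda>x. cls (var x)) \<phi> r = 0"
proof -
  assume r: "r \<in> R" and \<phi>: "linfun X \<phi>"
  have "r \<in> Idl\<^bsub>univ_ring\<^esub> R" using ring.genideal_self[OF ring_univ_ring, of R] r by auto
  then have "cls r = \<zero>\<^bsub>X\<^esub>" unfolding sel cls_eq_iff by simp
  then show "X.pval (\<lambda>x. cls (var x)) \<phi> r = 0" by (simp add: pval_cls[OF \<phi>] lf_zero[OF X.vs \<phi>])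
qed

end

text \<open>The isometry relations for the generators, imposed on one linear functional of the free algebra.\<close>

definition form_rel :: "'k::field ^ 'm ^ 'm => 'k ^ 'n ^ 'n => ('m => 'n => 'g) => (('g, 'k) free_algebra => 'k) => bool" where
  "form_rel E F x \<Lambda> \<longleftrightarrow>
     (\<forall>i j. (\<Sum>a\<in>UNIV. \<Sum>b\<in>UNIV. E $ a $ b * \<Lambda> (var (x a i) * var (x b j))) = F $ i $ j * \<Lambda> 1) \<and>
     (\<forall>i j. (\<Sum>a\<in>UNIV. \<Sum>b\<in>UNIV. matrix_inv F $ a $ b * \<Lambda> (var (x i a) * var (x j b))) = matrix_inv E $ i $ j * \<Lambda> 1)"

text \<open>A presentation, by whatever relators, of the algebra of a generic isometry \<open>x\<close> from \<open>F\<close> to \<open>E\<close>. Only the linear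
  span of the relators matters, and it is described by the functionals that vanish on them; thus \<open>B(E)\<close>,
  the quantum group and the linking algebras can be treated alike.\<close>

locale form_algebra = presented X R
  for X :: "('k::field, ('x, 'k) free_algebra set, 'z) module_scheme" and R :: "('x, 'k) free_algebra set" +
  fixes E :: "'k ^ 'm::finite ^ 'm" and F :: "'k ^ 'n::finite ^ 'n" and x :: "'m => 'n => 'x"
  assumes E: "invertible E" and F: "invertible F" and x_bij: "bij (\<lambda>(i, j). x i j)"
    and relators: "\<And>h. (\<forall>r\<in>R. lin_ext h r = 0) \<longleftrightarrow> form_rel E F x (lin_ext h)"
begin

definition "gm i j = cls (var (x i j))"

definition hom_of :: "('k, 'b, 'y) module_scheme => ('m => 'n => 'b) => ('x, 'k) free_algebra set => 'b" where
  "hom_of B v = induced_hom B (\<lambda>g. case inv_into UNIV (\<lambda>(i, j). x i j) g of (i, j) => v i j)"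

lemma x_surj: "\<exists>i j. g = x i j"
proof -
  have "g \<in> range (\<lambda>(i, j). x i j)" using x_bij by (simp add: bij_def)
  then show ?thesis by auto
qed

lemma inv_x: "(case inv_into UNIV (\<lambda>(i, j). x i j) (x i j) of (i, j) => v i j) = v i j"
  using inv_into_f_f[OF bij_is_inj[OF x_bij], of "(i, j)"] by simp

lemma relators_bil_mat:
  assumes B: "kalg B" and f: "\<And>g. f g \<in> carrier B"
  shows "(\<forall>\<phi>. linfun B \<phi> \<longrightarrow> (\<forall>r\<in>R. kalg.pval B f \<phi> r = 0)) \<longleftrightarrow> bil_mat B E F (\<lambda>i j. f (x i j))"
proof -
  interpret B: kalg B by (rule B)
  have "(\<forall>r\<in>R. B.pval f \<phi> r = 0) \<longleftrightarrow> form_rel E F x (B.pval f \<phi>)" for \<phi>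
    unfolding B.pval_def by (rule relators)
  then show ?thesis
    by (auto simp: form_rel_def bil_mat_def B.pval_one[OF f] B.pval_var2[OF f] f)
qed

lemma gm_closed: "gm i j \<in> carrier X"
  by (simp add: gm_def cls_closed)

lemma bil_mat_gm: "bil_mat X E F gm"
  unfolding gm_def using relation_cls
  by (subst relators_bil_mat[OF X.kalg_axioms, of "\<lambda>g. cls (var g)", symmetric]) (auto simp: cls_closed)

sublocale mx: matrix_algebra X gm
proof
  fix P a
  assume "a \<in> carrier X" "P \<one>\<^bsub>X\<^esub>" "\<And>i j a. a \<in> carrier X ==> P a ==> P (gm i j \<otimes>\<^bsub>X\<^esub> a)"
    "\<And>a b. a \<in> carrier X ==> b \<in> carrier X ==> P a ==> P b ==> P (a \<oplus>\<^bsub>X\<^esub> b)"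
    "\<And>c a. a \<in> carrier X ==> P a ==> P (c \<odot>\<^bsub>X\<^esub> a)"
  then show "P a"
    by (induction a rule: gen_induct) (use x_surj in \<open>auto simp: gm_def, metis\<close>)
qed (rule gm_closed)

lemma lift:
  assumes B: "kalg B" and v: "bil_mat B E F v" and f: "\<And>i j. f (x i j) = v i j"
  shows "alg_hom X B (induced_hom B f)" "induced_hom B f (gm i j) = v i j"
proof -
  have f': "f g \<in> carrier B" for g using x_surj[of g] bil_matD(1)[OF v] f by metis
  have "bil_mat B E F (\<lambda>i j. f (x i j))" using v by (simp add: f)
  then have r: "kalg.pval B f \<phi> r = 0" if "r \<in> R" "linfun B \<phi>" for r \<phi>
    using relators_bil_mat[OF B, where f = f, OF f'] that by blast
  show "alg_hom X B (induced_hom B f)" by (rule induced_alg_hom[OF B f' r])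
  show "induced_hom B f (gm i j) = v i j"
    unfolding gm_def f[symmetric] by (rule induced_var[OF B f' r])
qed

lemma matrix_comult_lift:
  assumes B: "kalg B" and C: "kalg C" and v: "bil_mat B E G v" and w: "bil_mat C G F w"
    and f: "\<And>i j. f (x i j) = mprod B C v w i j"
  shows "matrix_comult B C X gm v w (induced_hom (tensor_algebra B C) f)"
proof -
  interpret BC: two_algebras B C by (rule two_algebras.intro[OF B C])
  note l = lift[OF BC.kalg_TA BC.bil_mat_mprod[OF v w] f]
  show ?thesis
    by (intro matrix_comult.intro matrix_comult_axioms.intro BC.two_algebras_axioms X.kalg_axioms l gm_closed
        bil_matD(1)[OF v] bil_matD(1)[OF w])
qed

lemma hom_of:
  assumes "kalg B" "bil_mat B E F v"
  shows "alg_hom X B (hom_of B v)" "hom_of B v (gm i j) = v i j"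
  unfolding hom_of_def by (rule lift[OF assms inv_x])+

lemma matrix_comult_hom_of:
  assumes "kalg B" "kalg C" "bil_mat B E G v" "bil_mat C G F w"
  shows "matrix_comult B C X gm v w (hom_of (tensor_algebra B C) (mprod B C v w))"
  unfolding hom_of_def by (rule matrix_comult_lift[OF assms inv_x])

end

subsection \<open>The algebras \<open>B(E, F)\<close>\<close>

definition gen_rel :: "'k::field ^ 'm ^ 'm => 'k ^ 'n ^ 'n => ('m \<times> 'n, 'k) free_algebra set" where
  "gen_rel E F =
     {(\<Sum>a\<in>UNIV. \<Sum>b\<in>UNIV. formal_scale (E $ a $ b) (var (a, i) * var (b, j))) - formal_scale (F $ i $ j) 1 | i j. True} \<union>
     {(\<Sum>a\<in>UNIV. \<Sum>b\<in>UNIV. formal_scale (matrix_inv F $ a $ b) (var (i, a) * var (j, b))) - formal_scale (matrix_inv E $ i $ j) 1 | i j. True}"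

lemma form_algebra_gen_rel:
  fixes E :: "'k::field ^ 'm::finite ^ 'm" and F :: "'k ^ 'n::finite ^ 'n"
  assumes "invertible E" "invertible F"
  shows "form_algebra (presented_algebra (gen_rel E F)) (gen_rel E F) E F (\<lambda>i j. (i, j))"
proof (intro form_algebra.intro form_algebra_axioms.intro presented_algebra_presented assms)
  fix h :: "('m \<times> 'n) word => 'k"
  show "(\<forall>r\<in>gen_rel E F. lin_ext h r = 0) \<longleftrightarrow> form_rel E F (\<lambda>i j. (i, j)) (lin_ext h)"
    unfolding gen_rel_def form_rel_def ball_Un
    by (intro arg_cong2[where f = "(\<and>)"]) (fastforce simp: lin_ext_diff lin_ext_sum lin_ext_scale)+
qed (simp add: bij_def inj_on_def)

subsection \<open>The Hopf algebra \<open>B(E)\<close>\<close>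

lemma inverse_solve:
  fixes M N :: "'i::finite => 'i => 'k::field"
  assumes MN: "\<And>a c. (\<Sum>b\<in>UNIV. M a b * N b c) = (if a = c then 1 else 0)"
    and NM: "\<And>a c. (\<Sum>b\<in>UNIV. N a b * M b c) = (if a = c then 1 else 0)"
  shows "(\<forall>i j. (\<Sum>a\<in>UNIV. N i a * X a j) = (if i = j then t else 0)) \<longleftrightarrow> (\<forall>i j. X i j = M i j * t)"
proof (intro iffI allI)
  fix i j assume *: "\<forall>i j. (\<Sum>a\<in>UNIV. N i a * X a j) = (if i = j then t else 0)"
  have "X i j = (\<Sum>a\<in>UNIV. (\<Sum>b\<in>UNIV. M i b * N b a) * X a j)"
    by (simp add: MN if_distrib[of "\<lambda>x. x * _"] cong: if_cong)
  also have "\<dots> = (\<Sum>b\<in>UNIV. M i b * (\<Sum>a\<in>UNIV. N b a * X a j))"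
    by (simp add: sum_distrib_left sum_distrib_right mult.assoc) (rule sum.swap)
  also have "\<dots> = M i j * t"
    by (simp add: * if_distrib[of "\<lambda>x. _ * x"] cong: if_cong)
  finally show "X i j = M i j * t" .
next
  fix i j assume *: "\<forall>i j. X i j = M i j * t"
  have "(\<Sum>a\<in>UNIV. N i a * X a j) = (\<Sum>a\<in>UNIV. N i a * M a j) * t"
    by (simp add: * sum_distrib_right mult.assoc)
  then show "(\<Sum>a\<in>UNIV. N i a * X a j) = (if i = j then t else 0)" by (simp add: NM)
qed

lemma B_relators_entries:
  fixes E :: "'k::field ^ 'n ^ 'n"
  shows "lin_ext h ((B_antipode_matrix E ** generic_matrix - mat 1) $ i $ j) =
      (\<Sum>a\<in>UNIV. matrix_inv E $ i $ a * (\<Sum>b\<in>UNIV. \<Sum>c\<in>UNIV. E $ b $ c * lin_ext h (var (b, a) * var (c, j))))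
        - (if i = j then lin_ext h 1 else 0)" (is ?th1)
    "lin_ext h ((generic_matrix ** B_antipode_matrix E - mat 1) $ i $ j) =
      (\<Sum>d\<in>UNIV. E $ d $ j * (\<Sum>b\<in>UNIV. \<Sum>c\<in>UNIV. matrix_inv E $ b $ c * lin_ext h (var (i, b) * var (d, c))))
        - (if i = j then lin_ext h 1 else 0)" (is ?th2)
proof -
  note defs = matrix_matrix_mult_def transpose_def mat_def generic_matrix_def const_matrix_def B_antipode_matrix_def
  note simps = sum_distrib_left sum_distrib_right const_mult formal_scale_mult_left formal_scale_mult_right
    lin_ext_diff lin_ext_sum lin_ext_scale mult.assoc
  have "lin_ext h ((B_antipode_matrix E ** generic_matrix) $ i $ j) =
    (\<Sum>c\<in>UNIV. \<Sum>b\<in>UNIV. \<Sum>a\<in>UNIV. matrix_inv E $ i $ a * (E $ b $ c * lin_ext h (var (b, a) * var (c, j))))"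
    by (simp add: defs simps) (simp add: mult.left_commute)
  also have "\<dots> = (\<Sum>b\<in>UNIV. \<Sum>a\<in>UNIV. \<Sum>c\<in>UNIV. matrix_inv E $ i $ a * (E $ b $ c * lin_ext h (var (b, a) * var (c, j))))"
    by (rule sum_swap3)
  also have "\<dots> = (\<Sum>a\<in>UNIV. matrix_inv E $ i $ a * (\<Sum>b\<in>UNIV. \<Sum>c\<in>UNIV. E $ b $ c * lin_ext h (var (b, a) * var (c, j))))"
    by (subst sum.swap) (simp add: sum_distrib_left)
  finally show ?th1 by (simp add: lin_ext_diff mat_def)
  have "lin_ext h ((generic_matrix ** B_antipode_matrix E) $ i $ j) =
    (\<Sum>b\<in>UNIV. \<Sum>d\<in>UNIV. \<Sum>c\<in>UNIV. E $ d $ j * (matrix_inv E $ b $ c * lin_ext h (var (i, b) * var (d, c))))"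
    by (simp add: defs simps)
  also have "\<dots> = (\<Sum>d\<in>UNIV. E $ d $ j * (\<Sum>b\<in>UNIV. \<Sum>c\<in>UNIV. matrix_inv E $ b $ c * lin_ext h (var (i, b) * var (d, c))))"
    by (subst sum.swap) (simp add: sum_distrib_left)
  finally show ?th2 by (simp add: lin_ext_diff mat_def)
qed

text \<open>The matrices \<open>S(a) a - 1\<close> and \<open>a S(a) - 1\<close> arise from the isometry relations on multiplying by the scalar matrices \<open>E\<inverse>\<close>
  and \<open>E\<close>, which can be undone.\<close>

lemma B_relators_form_rel:
  fixes E :: "'k::field ^ 'n ^ 'n"
  assumes E: "invertible E"
  shows "(\<forall>r\<in>B_relators E. lin_ext h r = 0) \<longleftrightarrow> form_rel E E (\<lambda>i j. (i, j)) (lin_ext h)"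
proof -
  note I = inv_entries[OF E]
  have I': "(\<Sum>b\<in>UNIV. matrix_inv E $ b $ a * E $ c $ b) = (if a = c then 1 else 0)"
      "(\<Sum>b\<in>UNIV. E $ b $ a * matrix_inv E $ c $ b) = (if a = c then 1 else 0)" for a c
    using I(1)[of c a] I(2)[of c a] by (simp_all only: mult.commute[of "matrix_inv E $ _ $ _"] eq_commute[of c a])
  have "(\<forall>r\<in>B_relators E. lin_ext h r = 0) \<longleftrightarrow>
    (\<forall>i j. lin_ext h ((B_antipode_matrix E ** generic_matrix - mat 1) $ i $ j) = 0) \<and>
    (\<forall>i j. lin_ext h ((generic_matrix ** B_antipode_matrix E - mat 1) $ i $ j) = 0)"
    unfolding B_relators_def ball_Un by blast
  moreover have "(\<forall>i j. lin_ext h ((B_antipode_matrix E ** generic_matrix - mat 1) $ i $ j) = 0) \<longleftrightarrow>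
    (\<forall>i j. (\<Sum>a\<in>UNIV. \<Sum>b\<in>UNIV. E $ a $ b * lin_ext h (var (a, i) * var (b, j))) = E $ i $ j * lin_ext h 1)"
    unfolding B_relators_entries right_minus_eq
    by (rule inverse_solve) (rule I)+
  moreover have "(\<forall>i j. lin_ext h ((generic_matrix ** B_antipode_matrix E - mat 1) $ i $ j) = 0) \<longleftrightarrow>
    (\<forall>i j. (\<Sum>a\<in>UNIV. \<Sum>b\<in>UNIV. matrix_inv E $ a $ b * lin_ext h (var (i, a) * var (j, b))) = matrix_inv E $ i $ j * lin_ext h 1)"
  proof -
    have "(\<forall>i j. (\<Sum>d\<in>UNIV. E $ d $ i * (\<Sum>b\<in>UNIV. \<Sum>c\<in>UNIV. matrix_inv E $ b $ c * lin_ext h (var (j, b) * var (d, c)))) = (if i = j then lin_ext h 1 else 0)) \<longleftrightarrow>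
      (\<forall>i j. (\<Sum>b\<in>UNIV. \<Sum>c\<in>UNIV. matrix_inv E $ b $ c * lin_ext h (var (j, b) * var (i, c))) = matrix_inv E $ j $ i * lin_ext h 1)"
      by (rule inverse_solve[where M = "\<lambda>i j. matrix_inv E $ j $ i" and N = "\<lambda>i d. E $ d $ i"
          and X = "\<lambda>d j. \<Sum>b\<in>UNIV. \<Sum>c\<in>UNIV. matrix_inv E $ b $ c * lin_ext h (var (j, b) * var (d, c))"])
        (rule I')+
    note main = this
    have s1: "(\<forall>i j. f i j = (if i = j then t else 0)) \<longleftrightarrow> (\<forall>i j. f j i = (if i = j then t else 0))"
      for f :: "'n => 'n => 'k" and t
      by (simp only: all_comm[where P = "\<lambda>i j. f i j = (if i = j then t else 0)"] eq_commute[where 'a = 'n])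
    have s2: "(\<forall>i j. f i j = g i j) \<longleftrightarrow> (\<forall>i j. f j i = g j i)" for f g :: "'n => 'n => 'k"
      by (rule all_comm)
    show ?thesis unfolding B_relators_entries right_minus_eq
      by (rule trans[OF s1], rule trans[OF main], rule s2)
  qed
  ultimately show ?thesis unfolding form_rel_def by blast
qed

subsection \<open>The quantum special linear group\<close>

text \<open>The form whose isometries are the points of \<open>SL\<^sub>q(2)\<close>.\<close>

definition sl_form :: "'k::field => 'k ^ 2 ^ 2" where
  "sl_form q = vector [vector [0, 1], vector [- inverse q, 0]]"

definition sl_gen :: "2 => 2 => sl2_gen" where
  "sl_gen i j = (if i = 1 then (if j = 1 then GenA else GenB) else (if j = 1 then GenC else GenD))"

lemma sl_gen_simps [simp]: "sl_gen 1 1 = GenA" "sl_gen 1 2 = GenB" "sl_gen 2 1 = GenC" "sl_gen 2 2 = GenD"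
  by (simp_all add: sl_gen_def)

lemma sl_form_inverse:
  assumes "q \<noteq> 0"
  shows "invertible (sl_form q)" "matrix_inv (sl_form q) = vector [vector [0, - q], vector [1, 0]]"
proof -
  let ?N = "vector [vector [0, - q], vector [1, 0]] :: 'a ^ 2 ^ 2"
  have e: "sl_form q ** ?N = mat 1" "?N ** sl_form q = mat 1"
    using assms by (simp_all add: sl_form_def vec_eq_iff matrix_matrix_mult_def mat_def sum_2 forall_2)
  then show "invertible (sl_form q)" unfolding invertible_def by blast
  show "matrix_inv (sl_form q) = ?N" by (rule matrix_inv_eqI[OF e])
qed

text \<open>The seven relations of \<open>SL\<^sub>q(2)\<close> and the eight isometry relations, as linear conditions on the values of a
  functional at \<open>1\<close>, written \<open>t\<close>, and at products of two generators. Either set determines \<open>ad\<close>, \<open>da\<close> and \<open>cb\<close> in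
  terms of \<open>bc\<close> and \<open>t\<close>.\<close>

lemma sl_scalar_relations:
  fixes q ba ab db bd ca ac dc cd bc cb ad da t :: "'k::field"
  assumes "q \<noteq> 0"
  shows "(ba - q * ab = 0 \<and> db - q * bd = 0 \<and> ca - q * ac = 0 \<and> dc - q * cd = 0 \<and> bc - cb = 0 \<and>
     ad - da - (inverse q - q) * bc = 0 \<and> ad - inverse q * bc - t = 0) \<longleftrightarrow>
     ((ac - inverse q * ca = 0 \<and> ad - inverse q * cb = t) \<and> bc - inverse q * da = - inverse q * t \<and> bd - inverse q * db = 0) \<and>
     ((ba - q * ab = 0 \<and> bc - q * ad = - q * t) \<and> da - q * cb = t \<and> dc - q * cd = 0)"
proof -
  have qq: "q * (inverse q * x) = x" "inverse q * (q * x) = x" for x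
    using assms by (simp_all flip: mult.assoc)
  have s: "inverse q * x = inverse q * y \<longleftrightarrow> x = y" "q * x = q * y \<longleftrightarrow> x = y" for x y using assms by simp_all
  have c: "x - inverse q * y = 0 \<longleftrightarrow> y - q * x = 0" for x y
    using s(1)[of y "q * x"] unfolding qq by auto
  have d: "bc - inverse q * da = - inverse q * t \<longleftrightarrow> da = t + q * bc"
    using s(1)[of da "t + q * bc"] unfolding distrib_left qq by (auto simp: algebra_simps)
  have e: "bc - q * ad = - q * t \<longleftrightarrow> ad = t + inverse q * bc"
    using s(2)[of ad "t + inverse q * bc"] unfolding distrib_left qq by (auto simp: algebra_simps)
  have f: "ad - inverse q * cb = t \<longleftrightarrow> ad = t + inverse q * cb" for cb by (auto simp: algebra_simps)
  have g: "da - q * cb = t \<longleftrightarrow> da = t + q * cb" by (auto simp: algebra_simps)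
  have h: "ad - da - (inverse q - q) * bc = 0 \<and> ad - inverse q * bc - t = 0 \<longleftrightarrow> da = t + q * bc \<and> ad = t + inverse q * bc"
    by (auto simp: algebra_simps)
  have i: "t + inverse q * bc = t + inverse q * cb \<longleftrightarrow> bc = cb" using assms by simp
  have b: "bc - cb = 0 \<longleftrightarrow> bc = cb" by simp
  show ?thesis unfolding c d e f g h b using i by auto
qed

lemma SLq2_relators_form_rel:
  assumes q: "q \<noteq> 0"
  shows "(\<forall>r\<in>SLq2_relators q. lin_ext h r = 0) \<longleftrightarrow> form_rel (sl_form q) (sl_form q) sl_gen (lin_ext h)"
proof -
  let ?L = "\<lambda>x y. lin_ext h (var x * var y)"
  have "(\<forall>r\<in>SLq2_relators q. lin_ext h r = 0) \<longleftrightarrow>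
    (?L GenB GenA - q * ?L GenA GenB = 0 \<and> ?L GenD GenB - q * ?L GenB GenD = 0 \<and> ?L GenC GenA - q * ?L GenA GenC = 0 \<and>
     ?L GenD GenC - q * ?L GenC GenD = 0 \<and> ?L GenB GenC - ?L GenC GenB = 0 \<and>
     ?L GenA GenD - ?L GenD GenA - (inverse q - q) * ?L GenB GenC = 0 \<and> ?L GenA GenD - inverse q * ?L GenB GenC - lin_ext h 1 = 0)"
    by (simp add: SLq2_relators_def Let_def const_mult formal_scale_mult_left lin_ext_diff lin_ext_scale)
  moreover have "form_rel (sl_form q) (sl_form q) sl_gen (lin_ext h) \<longleftrightarrow>
    ((?L GenA GenC - inverse q * ?L GenC GenA = 0 \<and> ?L GenA GenD - inverse q * ?L GenC GenB = lin_ext h 1) \<and>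
      ?L GenB GenC - inverse q * ?L GenD GenA = - inverse q * lin_ext h 1 \<and> ?L GenB GenD - inverse q * ?L GenD GenB = 0) \<and>
     ((?L GenB GenA - q * ?L GenA GenB = 0 \<and> ?L GenB GenC - q * ?L GenA GenD = - q * lin_ext h 1) \<and>
      ?L GenD GenA - q * ?L GenC GenB = lin_ext h 1 \<and> ?L GenD GenC - q * ?L GenC GenD = 0)"
    unfolding form_rel_def sl_form_inverse(2)[OF q]
    by (simp add: sl_form_def sum_2 forall_2 algebra_simps)
  ultimately show ?thesis using sl_scalar_relations[OF q] by simp
qed

section \<open>The two Hopf algebras and the linking bi-Galois object\<close>

lemma tensor_algebra_same:
  assumes "carrier V' = carrier V" "add V' = add V" "smult V' = smult V" "mult V' = mult V" "one V' = one V"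
    "carrier W' = carrier W" "add W' = add W" "smult W' = smult W" "mult W' = mult W" "one W' = one W"
  shows "tensor_algebra V' W' = tensor_algebra V W"
  unfolding tensor_algebra_def tensor_same2[OF assms(1-3,6-8)] assms(4,5,9,10) ..

lemma mprod_same:
  assumes "carrier V' = carrier V" "add V' = add V" "smult V' = smult V"
    "carrier W' = carrier W" "add W' = add W" "smult W' = smult W"
  shows "mprod V' W' v w = mprod V W v w"
  unfolding mprod_def tensor_same2[OF assms] ..

locale form_hopf = form_algebra H R E E x
  for H :: "('k::field, ('x, 'k) free_algebra set) hopf" and R :: "('x, 'k) free_algebra set"
    and E :: "'k ^ 'n::finite ^ 'n" and x :: "'n => 'n => 'x" +
  assumes comult: "matrix_comult H H H gm gm gm (comult H)" and counit: "matrix_counit H gm (counit H)"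
begin

sublocale c: matrix_comult H H H gm gm gm "comult H"
  by (rule comult)

sublocale bialgebra H
proof (intro bialgebra.intro bialgebra_axioms.intro)
  note co = matrix_coassoc[OF mx.matrix_algebra_axioms comult comult comult comult]
  show "sw (comult H a) (\<lambda>x z. sw (comult H x) (\<lambda>u v. F u v z)) =
      sw (comult H a) (\<lambda>x y. sw (comult H y) (\<lambda>v w. F x v w))"
    if "a \<in> carrier H" "trilin H H H F" for a F by (rule co[OF that])
  show "sw (comult H a) (\<lambda>x y. counit H x * f y) = f a" if "a \<in> carrier H" "linfun H f" for a f
    by (rule matrix_counit_left[OF mx.matrix_algebra_axioms comult counit that])
  show "sw (comult H a) (\<lambda>x y. counit H y * f x) = f a" if "a \<in> carrier H" "linfun H f" for a f
    by (rule matrix_counit_right[OF mx.matrix_algebra_axioms comult counit that])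
qed (use matrix_counitD[OF counit] c.lin c.psum_mult c.psum_one X.kalg_axioms in auto)

end

lemma presented_hopf_sel:
  "carrier (presented_hopf R \<Delta> \<epsilon> S) = carrier (presented_algebra R)"
  "mult (presented_hopf R \<Delta> \<epsilon> S) = mult (presented_algebra R)"
  "one (presented_hopf R \<Delta> \<epsilon> S) = one (presented_algebra R)"
  "zero (presented_hopf R \<Delta> \<epsilon> S) = zero (presented_algebra R)"
  "add (presented_hopf R \<Delta> \<epsilon> S) = add (presented_algebra R)"
  "smult (presented_hopf R \<Delta> \<epsilon> S) = smult (presented_algebra R)"
  "comult (presented_hopf R \<Delta> \<epsilon> S) = induced_hom (tensor_algebra (presented_algebra R) (presented_algebra R)) \<Delta>"
  "counit (presented_hopf R \<Delta> \<epsilon> S) = induced_hom scalar_algebra \<epsilon>"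
  by (simp_all add: presented_hopf_def Let_def module.defs hopf.defs)

text \<open>The Hopf algebra record evaluates its comultiplication in the tensor square of the plain presented algebra; this
  is the tensor square of the record itself, as both have the same operations.\<close>

lemma form_hopf_presented:
  fixes R :: "('x, 'k::field) free_algebra set" and E :: "'k ^ 'n::finite ^ 'n" and x :: "'n => 'n => 'x"
  defines "g \<equiv> \<lambda>i j. residue_class R (var (x i j))"
  assumes E: "invertible E" and x: "bij (\<lambda>(i, j). x i j)"
    and rel: "\<And>h. (\<forall>r\<in>R. lin_ext h r = 0) \<longleftrightarrow> form_rel E E x (lin_ext h)"
    and \<Delta>: "\<And>i j. \<Delta> (x i j) = mprod (presented_algebra R) (presented_algebra R) g g i j"
    and \<epsilon>: "\<And>i j. \<epsilon> (x i j) = (if i = j then 1 else 0)"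
  shows "form_hopf (presented_hopf R \<Delta> \<epsilon> S) R E x"
proof -
  let ?H = "presented_hopf R \<Delta> \<epsilon> S" and ?A = "presented_algebra R"
  note same = presented_hopf_sel(1,5,6)[of R \<Delta> \<epsilon> S]
  have p: "presented ?H R"
    by (rule presented.intro) (simp_all only: presented_hopf_sel presented_algebra_sel)
  interpret F: form_algebra ?H R E E x
    by (intro form_algebra.intro form_algebra_axioms.intro p E x rel)
  have g: "F.gm = g" by (intro ext) (simp add: F.gm_def g_def)
  have "matrix_comult ?H ?H ?H F.gm F.gm F.gm (induced_hom (tensor_algebra ?H ?H) \<Delta>)"
    by (rule F.matrix_comult_lift[OF F.X.kalg_axioms F.X.kalg_axioms F.bil_mat_gm F.bil_mat_gm])
      (simp only: \<Delta> g mprod_same[OF same same])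
  then have c: "matrix_comult ?H ?H ?H F.gm F.gm F.gm (comult ?H)"
    by (simp only: presented_hopf_sel(7) tensor_algebra_same[OF presented_hopf_sel(1,5,6,2,3) presented_hopf_sel(1,5,6,2,3)])
  have "matrix_counit ?H F.gm (counit ?H)"
    unfolding matrix_counit_def presented_hopf_sel(8)
    using F.lift[OF kalg_scalar bil_mat_unit \<epsilon>] by blast
  with c show ?thesis
    by (intro form_hopf.intro form_hopf_axioms.intro F.form_algebra_axioms)
qed

lemma form_hopf_B:
  fixes E :: "'k::field ^ 'n ^ 'n"
  assumes E: "invertible E"
  shows "form_hopf (B_hopf E) (B_relators E) E (\<lambda>i j. (i, j))"
  unfolding B_hopf_def Let_def
  by (rule form_hopf_presented[OF E _ B_relators_form_rel[OF E]]) (simp_all add: bij_def inj_on_def mprod_def)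

lemma form_hopf_SLq2:
  assumes q: "q \<noteq> 0"
  shows "form_hopf (SLq2_hopf q) (SLq2_relators q) (sl_form q) sl_gen"
proof -
  let ?R = "SLq2_relators q" and ?A = "presented_algebra (SLq2_relators q)"
  let ?T = "tensor ?A ?A"
  interpret P: presented ?A ?R by (rule presented_algebra_presented)
  interpret AA: two_algebras ?A ?A by (rule two_algebras.intro[OF P.kalg_X P.kalg_X])
  let ?g = "\<lambda>i j. residue_class ?R (var (sl_gen i j))"
  have m: "pure ?A ?A (?g i 1) (?g 1 j) \<oplus>\<^bsub>?T\<^esub> pure ?A ?A (?g i 2) (?g 2 j) = mprod ?A ?A ?g ?g i j" for i j
  proof (rule vs_eqI[OF AA.vec_space_tensor])
    fix \<phi> assume \<phi>: "linfun ?T \<phi>"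
    show "\<phi> (pure ?A ?A (?g i 1) (?g 1 j) \<oplus>\<^bsub>?T\<^esub> pure ?A ?A (?g i 2) (?g 2 j)) = \<phi> (mprod ?A ?A ?g ?g i j)"
      using \<phi> by (simp only: lf_add[OF \<phi>] AA.pure_closed P.cls_closed AA.lf_mprod[of ?g ?g, OF P.cls_closed P.cls_closed] AA.lf_TA sum_2)
  next
    show "mprod ?A ?A ?g ?g i j \<in> carrier ?T"
      using AA.mprod_closed[of ?g ?g, OF P.cls_closed P.cls_closed] by (simp add: AA.TA_sel)
  qed (intro vs_add[OF AA.vec_space_tensor] AA.pure_closed P.cls_closed)
  have b: "bij (\<lambda>(i, j). sl_gen i j)"
  proof -
    have "inj (\<lambda>(i, j). sl_gen i j)"
    proof (rule injI, clarify)
      fix i j i' j' assume e: "sl_gen i j = sl_gen i' j'"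
      show "i = i' \<and> j = j'"
        using exhaust_2[of i] exhaust_2[of j] exhaust_2[of i'] exhaust_2[of j'] e by (auto simp: sl_gen_def split: if_splits)
    qed
    moreover have "g \<in> range (\<lambda>(i, j). sl_gen i j)" for g
      by (cases g) (force intro: image_eqI[of _ _ "(1, 1)"] image_eqI[of _ _ "(1, 2)"] image_eqI[of _ _ "(2, 1)"] image_eqI[of _ _ "(2, 2)"])+
    ultimately show ?thesis unfolding bij_def by blast
  qed
  have all: "P i j" if "P 1 1" "P 1 2" "P 2 1" "P 2 2" for P and i j :: 2
    using exhaust_2[of i] exhaust_2[of j] that by auto
  show ?thesis
    unfolding SLq2_hopf_def Let_def
    apply (rule form_hopf_presented[OF sl_form_inverse(1)[OF q] b SLq2_relators_form_rel[OF q]])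
    subgoal for i j unfolding m[symmetric] using exhaust_2[of i] exhaust_2[of j] by auto
    subgoal for i j using exhaust_2[of i] exhaust_2[of j] by auto
    done
qed

text \<open>The forms \<open>E\<close> and \<open>F\<close> with their Hopf algebras \<open>H\<close>, \<open>K\<close> and the linking algebras \<open>Z = B(E, F)\<close>, \<open>Y = B(F, E)\<close>. The
  situation is symmetric; the prefix \<open>s\<close> refers to the exchanged roles.\<close>

locale form_torsor = H: form_hopf H RH E xH + K: form_hopf K RK F xK
    + Z: form_algebra Z RZ E F xZ + Y: form_algebra Y RY F E xY
  for H :: "('k::field, ('h, 'k) free_algebra set) hopf" and RH and E :: "'k ^ 'm::finite ^ 'm" and xH
    and K :: "('k, ('g, 'k) free_algebra set) hopf" and RK and F :: "'k ^ 'n::finite ^ 'n" and xK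
    and Z :: "('k, ('z, 'k) free_algebra set) module" and RZ and xZ
    and Y :: "('k, ('y, 'k) free_algebra set) module" and RY and xY
begin

definition "coL = Z.hom_of (tensor_algebra H Z) (mprod H Z H.gm Z.gm)"
definition "coR = Z.hom_of (tensor_algebra Z K) (mprod Z K Z.gm K.gm)"
definition "split = H.hom_of (tensor_algebra Z Y) (mprod Z Y Z.gm Y.gm)"
definition "anti = Z.hom_of (opposite_algebra Y) (anti_mat Y E F Y.gm)"

lemma mc_coL: "matrix_comult H Z Z Z.gm H.gm Z.gm coL"
  unfolding coL_def by (rule Z.matrix_comult_hom_of[OF H.X.kalg_axioms Z.X.kalg_axioms H.bil_mat_gm Z.bil_mat_gm])

lemma mc_coR: "matrix_comult Z K Z Z.gm Z.gm K.gm coR"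
  unfolding coR_def by (rule Z.matrix_comult_hom_of[OF Z.X.kalg_axioms K.X.kalg_axioms Z.bil_mat_gm K.bil_mat_gm])

lemma mc_split: "matrix_comult Z Y H H.gm Z.gm Y.gm split"
  unfolding split_def by (rule H.matrix_comult_hom_of[OF Z.X.kalg_axioms Y.X.kalg_axioms Z.bil_mat_gm Y.bil_mat_gm])

lemma anti_hom: "alg_hom Z (opposite_algebra Y) anti" "anti (Z.gm i j) = anti_mat Y E F Y.gm i j"
  unfolding anti_def
  by (rule Z.hom_of[OF kalg_opposite[OF Y.X.kalg_axioms] bil_mat_anti[OF Y.X.kalg_axioms Z.E Z.F Y.bil_mat_gm]])+

lemma anti_lin: "linear_map Z Y anti"
  using alg_hom_lin[OF anti_hom(1)] by (simp add: linear_map_def opposite_algebra_def)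

lemma anti_one: "anti \<one>\<^bsub>Z\<^esub> = \<one>\<^bsub>Y\<^esub>"
  using alg_hom_one[OF anti_hom(1)] by (simp add: opposite_algebra_def)

lemma anti_mult: "a \<in> carrier Z ==> b \<in> carrier Z ==> anti (a \<otimes>\<^bsub>Z\<^esub> b) = anti b \<otimes>\<^bsub>Y\<^esub> anti a"
  using alg_hom_mult[OF anti_hom(1)] by (simp add: opposite_algebra_def)

lemma split_antipode:
  assumes "c \<in> carrier H" "linfun Y g"
  shows "sw (split c) (\<lambda>z y. g (anti z \<otimes>\<^bsub>Y\<^esub> y)) = counit H c * g \<one>\<^bsub>Y\<^esub>"
  by (rule matrix_antipode_left[OF H.mx.matrix_algebra_axioms mc_split H.counit anti_lin anti_one anti_mult _ assms])
    (simp_all add: anti_hom(2) Y.X.anti_left[OF Z.E Z.F Y.bil_mat_gm])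

end

sublocale form_torsor \<subseteq> s: form_torsor K RK F xK H RH E xH Y RY xY Z RZ xZ
  by (intro form_torsor.intro K.form_hopf_axioms H.form_hopf_axioms Y.form_algebra_axioms Z.form_algebra_axioms)

context form_torsor
begin

lemma split_antipode':
  assumes "k \<in> carrier K" "linfun Y g"
  shows "sw (s.split k) (\<lambda>y z. g (y \<otimes>\<^bsub>Y\<^esub> anti z)) = counit K k * g \<one>\<^bsub>Y\<^esub>"
  by (rule matrix_antipode_right[OF K.mx.matrix_algebra_axioms s.mc_split K.counit anti_lin anti_one anti_mult _ assms])
    (simp_all add: anti_hom(2) Y.X.anti_right[OF Z.E Z.F Y.bil_mat_gm])

lemma mixed_coassoc:
  "\<lbrakk>c \<in> carrier H; trilin Z K Y F1\<rbrakk> \<Longrightarrow>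
      sw (split c) (\<lambda>z y. sw (coR z) (\<lambda>b k. F1 b k y)) =
      sw (split c) (\<lambda>z y. sw (s.coL y) (\<lambda>k b. F1 z k b))"
  "\<lbrakk>c \<in> carrier H; trilin Z Y H F2\<rbrakk> \<Longrightarrow>
      sw (split c) (\<lambda>z y. sw (s.coR y) (\<lambda>b h. F2 z b h)) =
      sw (comult H c) (\<lambda>h h'. sw (split h) (\<lambda>z y. F2 z y h'))"
proof -
  note A = H.mx.matrix_algebra_axioms
  show "\<lbrakk>c \<in> carrier H; trilin Z K Y F1\<rbrakk> \<Longrightarrow>
      sw (split c) (\<lambda>z y. sw (coR z) (\<lambda>b k. F1 b k y)) =
      sw (split c) (\<lambda>z y. sw (s.coL y) (\<lambda>k b. F1 z k b))"
    by (rule matrix_coassoc[OF A mc_split mc_coR mc_split s.mc_coL])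
  show "\<lbrakk>c \<in> carrier H; trilin Z Y H F2\<rbrakk> \<Longrightarrow>
      sw (split c) (\<lambda>z y. sw (s.coR y) (\<lambda>b h. F2 z b h)) =
      sw (comult H c) (\<lambda>h h'. sw (split h) (\<lambda>z y. F2 z y h'))"
    by (rule matrix_coassoc[OF A H.comult mc_split mc_split s.mc_coR, symmetric])
qed

context
  fixes sc :: "'k => 'u" and tc :: "(('u \<times> 'u) \<Rightarrow>\<^sub>0 'k) => 'u"
    and eZ :: "(('u \<times> ('z, 'k) free_algebra set) \<Rightarrow>\<^sub>0 'k) => 'u" and \<omega> :: "('y, 'k) free_algebra set => 'k"
  assumes sc: "inj sc" and tc: "inj tc" and eZ: "codes Z eZ" and \<omega>: "linfun Y \<omega>" "\<omega> \<one>\<^bsub>Y\<^esub> = 1"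
begin

lemma galois_coL: "galois H K Z Y sc tc coL coR split s.split anti \<omega> eZ"
proof -
  interpret L: matrix_comult H Z Z Z.gm H.gm Z.gm coL by (rule mc_coL)
  interpret R: matrix_comult Z K Z Z.gm Z.gm K.gm coR by (rule mc_coR)
  interpret D: matrix_comult Z Y H H.gm Z.gm Y.gm split by (rule mc_split)
  interpret D': matrix_comult Y Z K K.gm Y.gm Z.gm s.split by (rule s.mc_split)
  note HA = H.mx.matrix_algebra_axioms and ZA = Z.mx.matrix_algebra_axioms
  show ?thesis
  proof (intro galois.intro galois_axioms.intro comod_cat.intro comod_cat_axioms.intro sc tc eZ \<omega> anti_lin
      H.bialgebra_axioms K.bialgebra_axioms Z.X.kalg_axioms Y.X.kalg_axioms
      L.tensor_valued_axioms R.tensor_valued_axioms D.tensor_valued_axioms D'.tensor_valued_axioms)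
  qed ((rule matrix_coassoc[OF HA mc_split mc_coL H.comult mc_split], assumption+)
      | (rule matrix_coassoc[OF ZA mc_coL mc_split mc_coR s.mc_split], assumption+)
      | (rule matrix_coassoc[OF ZA mc_coR mc_coL mc_coL mc_coR], assumption+)
      | (rule matrix_coassoc[OF ZA mc_coR mc_coR mc_coR K.comult], assumption+)
      | (rule matrix_counit_right[OF ZA mc_coR K.counit], assumption+)
      | (rule split_antipode', assumption+))+
qed

lemma galois_monoidal_coL: "galois_monoidal H K Z Y sc tc coL coR split s.split anti \<omega> eZ"
proof -
  interpret L: matrix_comult H Z Z Z.gm H.gm Z.gm coL by (rule mc_coL)
  interpret R: matrix_comult Z K Z Z.gm Z.gm K.gm coR by (rule mc_coR)
  interpret D: matrix_comult Z Y H H.gm Z.gm Y.gm split by (rule mc_split)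
  show ?thesis
    by (intro galois_monoidal.intro galois_monoidal_axioms.intro galois_coL anti_one anti_mult)
      (assumption | rule L.psum_mult R.psum_mult D.psum_mult L.psum_one R.psum_one D.psum_one)+
qed

end

text \<open>A functional on \<open>Y\<close> yields one on \<open>Z\<close> by composition with \<open>anti\<close>, so that nothing is lost in passing to the
  exchanged roles.\<close>

lemma monoidally_equivalent_torsor:
  fixes sc :: "'k => 'u" and tc :: "(('u \<times> 'u) \<Rightarrow>\<^sub>0 'k) => 'u"
    and eZ :: "(('u \<times> ('z, 'k) free_algebra set) \<Rightarrow>\<^sub>0 'k) => 'u"
    and eY :: "(('u \<times> ('y, 'k) free_algebra set) \<Rightarrow>\<^sub>0 'k) => 'u"
  assumes sc: "inj sc" and tc: "inj tc" and eZ: "codes Z eZ" and eY: "codes Y eY" and \<omega>: "linfun Y \<omega>" "\<omega> \<one>\<^bsub>Y\<^esub> = 1"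
  shows "monoidally_equivalent (Comod sc tc H) (Comod sc tc K)"
proof -
  have \<omega>': "linfun Z (\<lambda>z. \<omega> (anti z))" "\<omega> (anti \<one>\<^bsub>Z\<^esub>) = 1"
    by (rule lf_linear_map[OF anti_lin \<omega>(1)]) (simp add: anti_one \<omega>(2))
  note swapped = form_torsor.galois_coL[OF s.form_torsor_axioms] form_torsor.mixed_coassoc[OF s.form_torsor_axioms]
  interpret M: galois_monoidal H K Z Y sc tc coL coR split s.split anti \<omega> eZ
    by (rule galois_monoidal_coL[OF sc tc eZ \<omega>])
  interpret P: galois_pair H K Z Y sc tc coL coR split s.split anti \<omega> eZ s.coL s.coR s.anti "\<lambda>z. \<omega> (anti z)" eY
    by (intro galois_pair.intro galois_pair_axioms.intro galois_coL swapped(1) sc tc eZ eY \<omega> \<omega>')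
      (assumption | rule mixed_coassoc swapped(2,3) split_antipode s.split_antipode)+
  show ?thesis
    unfolding monoidally_equivalent_def
    using M.H.monoidal_category_CC M.K.monoidal_category_CC M.monoidal_F P.equivalence_F by blast
qed

end

section \<open>The linking algebra is not zero\<close>

lemma lin_ext_swap: "lin_ext (\<lambda>u. lin_ext (\<lambda>v. f u v) r) p = lin_ext (\<lambda>v. lin_ext (\<lambda>u. f u v) p) r"
  unfolding lin_ext_def by (simp add: sum_distrib_left mult.left_commute) (rule sum.swap)

text \<open>Write \<open>x\<^sub>i\<close> and \<open>y\<^sub>i\<close> for the entries of the two rows of the generic isometry from \<open>E\<close> to \<open>sl_form q\<close>. The first set of
  relations amounts to \<open>y\<^sub>i x\<^sub>j = q x\<^sub>i y\<^sub>j - q E\<^sub>i\<^sub>j\<close>. Acting on a functional \<open>L\<close> on words in the \<open>x\<^sub>i\<close>, the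
  generator \<open>y\<^sub>i\<close> gives the value of \<open>L\<close> at \<open>y\<^sub>i w\<close>, computed by moving \<open>y\<^sub>i\<close> through \<open>w\<close> with this rule
  and replacing it by the scalar \<open>\<eta>\<^sub>i\<close> at the end.\<close>

primrec yact :: "'k::field ^ 'n ^ 'n => 'k => ('n => 'k) => 'n list => ('n list => 'k) => 'n => 'k" where
  "yact E q \<eta> [] = (\<lambda>L i. \<eta> i * L [])"
| "yact E q \<eta> (j # w) = (\<lambda>L i. q * yact E q \<eta> w (\<lambda>v. L (i # v)) j - q * E $ i $ j * L w)"

lemma yact_sum: "yact E q \<eta> w (\<lambda>v. \<Sum>u\<in>U. c u * M u v) j = (\<Sum>u\<in>U. c u * yact E q \<eta> w (M u) j)"
  by (induction w arbitrary: M j)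
    (simp_all add: sum_distrib_left right_diff_distrib sum_subtractf mult.left_commute)

locale isotropic_action =
  fixes E :: "'k::field ^ 'n ^ 'n" and q :: 'k and \<eta> :: "'n => 'k"
  assumes E: "invertible E"
    and q: "q\<^sup>2 + (\<Sum>a\<in>UNIV. \<Sum>b\<in>UNIV. E $ a $ b * matrix_inv E $ a $ b) * q + 1 = 0"
    and iso: "(\<Sum>a\<in>UNIV. \<Sum>b\<in>UNIV. matrix_inv E $ a $ b * (\<eta> a * \<eta> b)) = 0"
begin

text \<open>Summation against \<open>G = E\<inverse>\<close>. The second set of relations says that \<open>G(x, x)\<close> and \<open>G(y, y)\<close> vanish, \<open>G(x, y) = -q\<close> and
  \<open>G(y, x) = 1\<close>.\<close>

definition gs :: "('n => 'n => 'k) => 'k" where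
  "gs P = (\<Sum>x\<in>UNIV. matrix_inv E $ fst x $ snd x * P (fst x) (snd x))"

lemma gs_sum: "gs P = (\<Sum>a\<in>UNIV. \<Sum>b\<in>UNIV. matrix_inv E $ a $ b * P a b)"
  unfolding gs_def UNIV_Times_UNIV[symmetric] sum.cartesian_product by (simp add: split_beta)

lemma gs_mult: "gs (\<lambda>a b. c * P a b) = c * gs P"
  by (simp add: gs_def sum_distrib_left mult.left_commute)

lemma gs_diff: "gs (\<lambda>a b. P a b - Q a b) = gs P - gs Q"
  by (simp add: gs_def sum_subtractf algebra_simps)

lemma gs_E1: "gs (\<lambda>a b. E $ b $ j * f a) = f j"
proof -
  have "gs (\<lambda>a b. E $ b $ j * f a) = (\<Sum>a\<in>UNIV. (\<Sum>b\<in>UNIV. matrix_inv E $ a $ b * E $ b $ j) * f a)"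
    by (simp add: gs_sum sum_distrib_right mult.assoc)
  then show ?thesis by (simp add: inv_entries(1)[OF E] if_distrib[of "\<lambda>x. x * _"] cong: if_cong)
qed

lemma gs_E2: "gs (\<lambda>a b. E $ i $ a * f b) = f i"
proof -
  have "gs (\<lambda>a b. E $ i $ a * f b) = (\<Sum>b\<in>UNIV. (\<Sum>a\<in>UNIV. E $ i $ a * matrix_inv E $ a $ b) * f b)"
    unfolding gs_sum by (subst sum.swap) (simp add: sum_distrib_right mult.assoc mult.left_commute)
  then show ?thesis by (simp add: inv_entries(2)[OF E] if_distrib[of "\<lambda>x. x * _"] cong: if_cong)
qed

definition "\<tau> = gs (\<lambda>a b. E $ a $ b)"

lemma gs_E3: "gs (\<lambda>a b. E $ a $ b * t) = \<tau> * t"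
  using gs_mult[of t "\<lambda>a b. E $ a $ b"] by (simp add: \<tau>_def mult.commute)

lemma q_\<tau>: "q * q + q * \<tau> + 1 = 0"
  using q by (simp add: \<tau>_def gs_sum power2_eq_square mult.commute)

lemma gs_iso: "gs (\<lambda>a b. \<eta> a * \<eta> b) = 0"
  using iso by (simp add: gs_sum)

abbreviation "ya \<equiv> yact E q \<eta>"

lemma gs_ya: "gs (\<lambda>a b. ya w (M a b) j) = ya w (\<lambda>v. gs (\<lambda>a b. M a b v)) j"
  unfolding gs_def by (rule yact_sum[symmetric])

text \<open>The subspace cut out by \<open>G(x, x) = 0\<close> anywhere in a word and by \<open>G(x, y) = -q\<close> at its end, where \<open>y\<close> acts as
  \<open>\<eta>\<close>. It turns out to be invariant (\<open>adm_x\<close>, \<open>adm_y\<close>), and all relations hold on it.\<close>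

definition adm :: "('n list => 'k) set" where
  "adm = {L. (\<forall>u v. gs (\<lambda>a b. L (u @ a # b # v)) = 0) \<and> (\<forall>u. gs (\<lambda>a b. \<eta> b * L (u @ [a])) = - (q * L u))}"

lemma adm_xx: "L \<in> adm ==> gs (\<lambda>a b. L (u @ a # b # v)) = 0"
  and adm_end: "L \<in> adm ==> gs (\<lambda>a b. \<eta> b * L (u @ [a])) = - (q * L u)"
  by (auto simp: adm_def)

lemma adm_x: "L \<in> adm ==> (\<lambda>w. L (i # w)) \<in> adm"
  unfolding adm_def by (auto simp flip: append_Cons)

lemma ya_zero: "ya w (\<lambda>v. 0) j = 0"
  using yact_sum[of E q \<eta> w "\<lambda>_. 0" "\<lambda>_ _. 0" "{}" j] by simp

lemma rel_xx: "L \<in> adm ==> gs (\<lambda>a b. L (a # b # w)) = 0"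
  using adm_xx[of L "[]" w] by simp

text \<open>Moving \<open>y\<close> past one letter produces a term with \<open>G(x, x)\<close>, which vanishes.\<close>

lemma rel_xy: "L \<in> adm ==> gs (\<lambda>a b. ya w (\<lambda>v. L (a # v)) b) = - (q * L w)"
proof (cases w)
  case Nil
  assume "L \<in> adm" then show ?thesis using adm_end[of L "[]"] Nil by simp
next
  case (Cons j w')
  assume L: "L \<in> adm"
  have "gs (\<lambda>a b. ya w (\<lambda>v. L (a # v)) b) = q * gs (\<lambda>a b. ya w' (\<lambda>v. L (a # b # v)) j) - q * gs (\<lambda>a b. E $ b $ j * L (a # w'))"
    by (simp add: Cons gs_diff gs_mult mult.assoc)
  also have "\<dots> = - (q * L w)" by (simp add: gs_ya rel_xx[OF L] ya_zero gs_E1 Cons)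
  finally show ?thesis .
qed

text \<open>The commutation rule gives \<open>G(y, x) = q G(x, y) - q \<tau> = -q\<^sup>2 - q \<tau>\<close>, and this is \<open>1\<close> by the equation for \<open>q\<close>.\<close>

lemma rel_yx: "L \<in> adm ==> gs (\<lambda>a b. ya (b # w) L a) = L w"
proof -
  assume L: "L \<in> adm"
  have "gs (\<lambda>a b. ya (b # w) L a) = q * gs (\<lambda>a b. ya w (\<lambda>v. L (a # v)) b) - q * gs (\<lambda>a b. E $ a $ b * L w)"
    by (simp add: gs_diff gs_mult mult.assoc)
  also have "\<dots> = L w - (q * q + q * \<tau> + 1) * L w" unfolding rel_xy[OF L] gs_E3 by (simp add: algebra_simps)
  finally show ?thesis by (simp add: q_\<tau>)
qed

text \<open>At the end of a word this is the isotropy of \<open>\<eta>\<close>; moving past a letter reduces it to \<open>rel_yx\<close>.\<close>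

lemma rel_yy: "L \<in> adm ==> gs (\<lambda>a b. ya w (\<lambda>v. ya v L a) b) = 0"
proof (cases w)
  case Nil
  have "gs (\<lambda>a b. \<eta> b * (\<eta> a * L [])) = gs (\<lambda>a b. L [] * (\<eta> a * \<eta> b))"
    by (simp add: mult.commute mult.left_commute)
  then show ?thesis by (simp add: Nil gs_mult gs_iso)
next
  case (Cons j w')
  assume L: "L \<in> adm"
  have "gs (\<lambda>a b. ya w (\<lambda>v. ya v L a) b) = q * gs (\<lambda>a b. ya w' (\<lambda>v. ya (b # v) L a) j) - q * gs (\<lambda>a b. E $ b $ j * ya w' L a)"
    unfolding Cons yact.simps(2)[of E q \<eta> j w'] by (simp only: gs_diff gs_mult mult.assoc)
  also have "\<dots> = 0" unfolding gs_ya rel_yx[OF L] gs_E1 by simp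
  finally show ?thesis .
qed

text \<open>The equation for \<open>q\<close> is used once more, for \<open>G(x, x)\<close> at the front of a word; further inside, the claim follows
  by induction on the letters before it.\<close>

lemma adm_y: "L \<in> adm ==> (\<lambda>w. ya w L i) \<in> adm"
proof -
  have 1: "gs (\<lambda>a b. ya (u @ a # b # v) L i) = 0" if "L \<in> adm" for u v L i
    using that
  proof (induction u arbitrary: L i)
    case Nil
    note N = adm_x[OF Nil, of i]
    have "gs (\<lambda>a b. ya (a # b # v) L i) = q * (q * gs (\<lambda>a b. ya v (\<lambda>w. L (i # a # w)) b) - q * gs (\<lambda>a b. E $ a $ b * L (i # v)))
        - q * gs (\<lambda>a b. E $ i $ a * L (b # v))"
      by (simp add: gs_diff gs_mult mult.assoc)
    also have "\<dots> = - (q * q + q * \<tau> + 1) * (q * L (i # v))" unfolding rel_xy[OF N] gs_E2 gs_E3 by (simp add: algebra_simps)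
    finally show ?case by (simp add: q_\<tau>)
  next
    case (Cons j u)
    have "gs (\<lambda>a b. ya ((j # u) @ a # b # v) L i) = q * gs (\<lambda>a b. ya (u @ a # b # v) (\<lambda>w. L (i # w)) j) - q * E $ i $ j * gs (\<lambda>a b. L (u @ a # b # v))"
      by (simp add: gs_diff gs_mult)
    then show ?case by (simp add: Cons.IH[OF adm_x[OF Cons.prems]] adm_xx[OF Cons.prems])
  qed
  have 2: "gs (\<lambda>a b. \<eta> b * ya (u @ [a]) L i) = - (q * ya u L i)" if "L \<in> adm" for u L i
    using that
  proof (induction u arbitrary: L i)
    case Nil
    have "gs (\<lambda>a b. \<eta> b * ya [a] L i) = gs (\<lambda>a b. (q * L [i]) * (\<eta> a * \<eta> b) - q * (E $ i $ a * (\<eta> b * L [])))"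
      by (simp add: algebra_simps)
    then show ?case by (simp add: gs_diff gs_mult gs_iso gs_E2)
  next
    case (Cons j u)
    have "gs (\<lambda>a b. \<eta> b * ya ((j # u) @ [a]) L i) =
      gs (\<lambda>a b. q * (\<eta> b * ya (u @ [a]) (\<lambda>w. L (i # w)) j) - (q * E $ i $ j) * (\<eta> b * L (u @ [a])))"
      by (simp add: algebra_simps)
    also have "\<dots> = - (q * ya (j # u) L i)"
      by (simp add: gs_diff gs_mult Cons.IH[OF adm_x[OF Cons.prems]] adm_end[OF Cons.prems]) (simp add: algebra_simps)
    finally show ?case .
  qed
  show "L \<in> adm ==> (\<lambda>w. ya w L i) \<in> adm" using 1 2 by (auto simp: adm_def)
qed

definition gact :: "2 \<times> 'n => ('n list => 'k) => 'n list => 'k" where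
  "gact g L = (if fst g = 1 then (\<lambda>w. L (snd g # w)) else (\<lambda>w. ya w L (snd g)))"

lemma fold_gact_adm: "L \<in> adm ==> fold gact xs L \<in> adm"
  by (induction xs arbitrary: L) (simp_all add: gact_def adm_x adm_y)

text \<open>The action is linear in the functional. This is what makes the annihilator a right ideal.\<close>

lemma fold_gact_lin: "fold gact xs (\<lambda>w. lin_ext (\<lambda>u. M u w) p) w = lin_ext (\<lambda>u. fold gact xs (M u) w) p"
proof (induction xs arbitrary: M)
  case (Cons g xs)
  have "gact g (\<lambda>w. lin_ext (\<lambda>u. M u w) p) = (\<lambda>w. lin_ext (\<lambda>u. gact g (M u) w) p)"
    by (rule ext) (simp add: gact_def lin_ext_def yact_sum)
  then show ?case using Cons by simp
qed simp

lemma relations_vanish: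
  assumes q0: "q \<noteq> 0" and L: "L \<in> adm"
  shows "form_rel (sl_form q) E (\<lambda>i j. (i, j)) (lin_ext (\<lambda>u. fold gact (letters u) L w))"
proof -
  have g: "(\<Sum>a\<in>UNIV. \<Sum>b\<in>UNIV. matrix_inv E $ a $ b * P a b) = gs P" for P by (simp add: gs_sum)
  have 1: "ya w (\<lambda>v. L (i # v)) j - inverse q * ya (j # w) L i = E $ i $ j * L w" for i j
    using q0 by (simp add: right_diff_distrib flip: mult.assoc)
  have 2: "gs (\<lambda>a b. L (a # b # w)) = 0" "gs (\<lambda>a b. ya w (\<lambda>v. L (a # v)) b) = - (q * L w)"
    "gs (\<lambda>a b. q * ya w (\<lambda>v. L (a # v)) b - q * E $ a $ b * L w) = L w" "gs (\<lambda>a b. ya w (\<lambda>v. ya v L a) b) = 0"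
    using rel_xx[OF L] rel_xy[OF L] rel_yx[OF L] rel_yy[OF L] by simp_all
  show ?thesis
    unfolding form_rel_def sl_form_inverse(2)[OF q0]
    using 1 by (simp add: lin_ext_mult var_def plus_word_def g sl_form_def sum_2 forall_2 gact_def 2 zero_word_def flip: single_one)
qed

text \<open>The polynomials that annihilate the invariant subspace form a two-sided ideal, which contains the relators but
  not \<open>1\<close>.\<close>

lemma one_notin_ideal:
  assumes R: "\<And>h. form_rel (sl_form q) E (\<lambda>i j. (i, j)) (lin_ext h) ==> \<forall>r\<in>R. lin_ext h r = 0"
    and q0: "q \<noteq> 0" and L: "L \<in> adm" "L [] \<noteq> 0"
  shows "1 \<notin> Idl\<^bsub>univ_ring\<^esub> R"
proof -
  let ?a = "\<lambda>L p w. lin_ext (\<lambda>u. fold gact (letters u) L w) p"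
  let ?J = "{p. \<forall>L\<in>adm. \<forall>w. ?a L p w = 0}"
  interpret U: ring "univ_ring :: (2 \<times> 'n, 'k) free_algebra ring" by (rule ring_univ_ring)
  have l: "?a L (p * r) w = 0" if r: "r \<in> ?J" and L: "L \<in> adm" for p r L w
  proof -
    have "?a L (p * r) w = lin_ext (\<lambda>u. ?a (fold gact (letters u) L) r w) p"
      by (simp add: lin_ext_mult plus_word_def)
    also have "\<dots> = lin_ext (\<lambda>u. 0) p" using r fold_gact_adm[OF L] by simp
    finally show ?thesis by (simp add: lin_ext_def)
  qed
  have r: "?a L (r * p) w = 0" if r: "r \<in> ?J" and L: "L \<in> adm" for p r L w
  proof -
    have "?a L (r * p) w = lin_ext (\<lambda>v. fold gact (letters v) (\<lambda>w. ?a L r w) w) p"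
      unfolding fold_gact_lin by (subst lin_ext_swap) (simp add: lin_ext_mult plus_word_def)
    also have "\<dots> = lin_ext (\<lambda>v. 0) p"
    proof -
      have z: "fold gact xs (\<lambda>w. 0) w = 0" for xs w
        using fold_gact_lin[of xs "\<lambda>_ _. 0" 0 w] by simp
      show ?thesis using r L by (simp add: z)
    qed
    finally show ?thesis by (simp add: lin_ext_def)
  qed
  have "ideal ?J (univ_ring :: (2 \<times> 'n, 'k) free_algebra ring)"
  proof (rule idealI[OF ring_univ_ring])
    show "subgroup ?J (add_monoid (univ_ring :: (2 \<times> 'n, 'k) free_algebra ring))"
    proof
      fix x assume "x \<in> ?J"
      moreover have "inv\<^bsub>add_monoid univ_ring\<^esub> x = - x"
        unfolding a_inv_def[symmetric] by (rule univ_ring_uminus)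
      ultimately show "inv\<^bsub>add_monoid univ_ring\<^esub> x \<in> ?J" by (simp add: lin_ext_uminus)
    qed (simp_all add: lin_ext_add)
  qed (use l r in auto)
  then have "Idl\<^bsub>univ_ring\<^esub> R \<subseteq> ?J"
    by (rule U.genideal_minimal) (use R relations_vanish[OF q0] in auto)
  moreover have "1 \<notin> ?J"
    using L by (auto simp: zero_word_def simp flip: single_one intro!: bexI[of _ L] exI[of _ "[]"])
  ultimately show ?thesis by blast
qed

primrec wt :: "(nat => 'n => 'k) => nat => 'n list => 'k" where
  "wt \<mu> k [] = 1"
| "wt \<mu> k (i # w) = \<mu> k i * wt \<mu> (Suc k) w"

lemma wt_append: "wt \<mu> k (u @ v) = wt \<mu> k u * wt \<mu> (k + length u) v"
  by (induction u arbitrary: k) (simp_all add: mult.assoc)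

lemma gs_mult2: "gs (\<lambda>a b. P a b * c) = gs P * c"
  by (simp add: gs_def sum_distrib_right mult.assoc)

text \<open>The functional is a product of weights \<open>\<mu> k i\<close> of the letters \<open>i\<close> at the positions \<open>k\<close>. The two conditions become
  \<open>G(\<mu> k, \<mu> (k + 1)) = 0\<close> and \<open>G(\<mu> k, \<eta>) = -q\<close>. As \<open>\<eta>\<close> is isotropic, adding multiples of \<open>\<eta>\<close> to a suitable multiple
  of \<open>p\<close> preserves the second condition, and the multiples can be chosen one after the other to achieve
  the first.\<close>

lemma exists_adm:
  assumes p: "gs (\<lambda>a b. p a * \<eta> b) \<noteq> 0"
  obtains L where "L \<in> adm" "L [] \<noteq> 0"
proof -
  define t where "t = gs (\<lambda>a b. p a * \<eta> b)"
  define c where "c = - (q / t)"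
  \<comment> \<open>The recursion is \<open>G(\<mu> k, \<mu> (k + 1)) = 0\<close> solved for \<open>\<gamma> (k + 1)\<close>, and \<open>c\<close> normalises \<open>G(\<mu> k, \<eta>)\<close>.\<close>
  define \<gamma> where "\<gamma> = rec_nat 0 (\<lambda>k g. - (gs (\<lambda>a b. p a * p b) + g * gs (\<lambda>a b. \<eta> a * p b)) / t)"
  define \<mu> where "\<mu> = (\<lambda>k i. c * (p i + \<gamma> k * \<eta> i))"
  have add: "gs (\<lambda>a b. P a b + Q a b) = gs P + gs Q" for P Q
    by (simp add: gs_def sum.distrib distrib_left)
  have S: "\<gamma> (Suc k) * t = - (gs (\<lambda>a b. p a * p b) + \<gamma> k * gs (\<lambda>a b. \<eta> a * p b))" for k
    using p by (simp add: \<gamma>_def t_def)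
  have "gs (\<lambda>a b. \<mu> k a * \<mu> (Suc k) b) = gs (\<lambda>a b. (c * c) * ((p a * p b + \<gamma> k * (\<eta> a * p b)) + (\<gamma> (Suc k) * (p a * \<eta> b) + (\<gamma> k * \<gamma> (Suc k)) * (\<eta> a * \<eta> b))))" for k
    by (simp add: \<mu>_def algebra_simps)
  then have m: "gs (\<lambda>a b. \<mu> k a * \<mu> (Suc k) b) = 0" for k
    by (simp add: gs_mult add gs_iso S flip: t_def)
  have "gs (\<lambda>a b. \<eta> b * \<mu> k a) = gs (\<lambda>a b. c * (p a * \<eta> b) + (c * \<gamma> k) * (\<eta> a * \<eta> b))" for k
    by (simp add: \<mu>_def algebra_simps)
  then have e: "gs (\<lambda>a b. \<eta> b * \<mu> k a) = - q" for k
    using p unfolding gs_mult add gs_iso t_def[symmetric] by (simp add: c_def)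
  have "wt \<mu> 0 \<in> adm"
    unfolding adm_def
  proof (intro CollectI conjI allI)
    fix u v
    have "gs (\<lambda>a b. wt \<mu> 0 (u @ a # b # v)) = gs (\<lambda>a b. wt \<mu> 0 u * ((\<mu> (length u) a * \<mu> (Suc (length u)) b) * wt \<mu> (Suc (Suc (length u))) v))"
      by (simp add: wt_append mult.assoc)
    then show "gs (\<lambda>a b. wt \<mu> 0 (u @ a # b # v)) = 0" by (simp add: gs_mult gs_mult2 m)
    have "gs (\<lambda>a b. \<eta> b * wt \<mu> 0 (u @ [a])) = gs (\<lambda>a b. wt \<mu> 0 u * (\<eta> b * \<mu> (length u) a))"
      by (simp add: wt_append mult.left_commute)
    then show "gs (\<lambda>a b. \<eta> b * wt \<mu> 0 (u @ [a])) = - (q * wt \<mu> 0 u)" by (simp add: gs_mult e)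
  qed
  then show ?thesis by (rule that) simp
qed

end

text \<open>Restricted to the span of two basis vectors, the quadratic form is a binary one. Either the first basis vector is
  isotropic or the form is a polynomial of degree two in one coordinate, which has a root.\<close>

lemma exists_isotropic:
  fixes G :: "'n::finite => 'n => 'k::alg_closed_field"
  assumes "CARD('n) \<ge> 2"
  obtains \<eta> i where "\<eta> i \<noteq> 0" "(\<Sum>a\<in>UNIV. \<Sum>b\<in>UNIV. G a b * (\<eta> a * \<eta> b)) = 0"
proof -
  obtain i j :: 'n where ij: "i \<noteq> j"
  proof -
    have "\<not> is_singleton (UNIV :: 'n set)" using assms by (auto simp: is_singleton_altdef)
    then have "\<exists>i j :: 'n. i \<noteq> j" by (metis UNIV_I UNIV_eq_I is_singletonI singletonI)
    then show ?thesis using that by blast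
  qed
  have two: "(\<Sum>a\<in>UNIV. f a) = f i + f j" if "\<And>a. a \<noteq> i ==> a \<noteq> j ==> f a = 0" for f :: "'n => 'k"
  proof -
    have "(\<Sum>a\<in>UNIV. f a) = (\<Sum>a\<in>{i, j}. f a)" by (rule sum.mono_neutral_right) (use that in auto)
    then show ?thesis using ij by simp
  qed
  have ex: "(\<Sum>a\<in>UNIV. \<Sum>b\<in>UNIV. G a b * (\<eta> a * \<eta> b)) =
      (G i i * (\<eta> i * \<eta> i) + G i j * (\<eta> i * \<eta> j)) + (G j i * (\<eta> j * \<eta> i) + G j j * (\<eta> j * \<eta> j))"
    if "\<And>a. a \<noteq> i ==> a \<noteq> j ==> \<eta> a = 0" for \<eta>
  proof -
    have "(\<Sum>b\<in>UNIV. G a b * (\<eta> a * \<eta> b)) = G a i * (\<eta> a * \<eta> i) + G a j * (\<eta> a * \<eta> j)" for a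
      by (rule two) (simp add: that)
    then show ?thesis by (simp only:) (rule two, simp add: that)
  qed
  show ?thesis
  proof (cases "G i i = 0")
    case True
    let ?\<eta> = "\<lambda>a. if a = i then 1 else (0::'k)"
    show ?thesis by (rule that[of ?\<eta> i]) (use True ij in \<open>simp_all add: ex\<close>)
  next
    case False
    \<comment> \<open>The value of the form at \<open>s\<close> times the first basis vector plus the second.\<close>
    obtain s where s: "poly [:G j j, G i j + G j i, G i i:] s = 0"
      using alg_closed_imp_poly_has_root[of "[:G j j, G i j + G j i, G i i:]"] False by auto
    let ?\<eta> = "\<lambda>a. if a = i then s else if a = j then 1 else (0::'k)"
    have "(\<Sum>a\<in>UNIV. \<Sum>b\<in>UNIV. G a b * (?\<eta> a * ?\<eta> b)) = poly [:G j j, G i j + G j i, G i i:] s"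
      using ij by (subst ex) (auto simp: algebra_simps)
    then show ?thesis by (intro that[of ?\<eta> j]) (use s ij in auto)
  qed
qed

text \<open>For \<open>p\<close> a row of \<open>E\<close> the value \<open>G(p, \<eta>)\<close> is a coordinate of \<open>\<eta>\<close>, hence nonzero for some row.\<close>

lemma linking_algebra_functional:
  fixes E :: "'k::alg_closed_field ^ 'n ^ 'n"
  assumes card: "CARD('n) \<ge> 2" and E: "invertible E" and q: "q \<noteq> 0"
    and tr: "q\<^sup>2 + trace (E ** matrix_inv (transpose E)) * q + 1 = 0"
  obtains \<omega> where "linfun (presented_algebra (gen_rel (sl_form q) E)) \<omega>" "\<omega> \<one>\<^bsub>presented_algebra (gen_rel (sl_form q) E)\<^esub> = 1"
proof -
  let ?R = "gen_rel (sl_form q) E"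
  interpret Y: form_algebra "presented_algebra ?R" ?R "sl_form q" E "\<lambda>i j. (i, j)"
    by (rule form_algebra_gen_rel[OF sl_form_inverse(1)[OF q] E])
  have inv: "matrix_inv E ** E = mat 1" "E ** matrix_inv E = mat 1"
    by (simp_all add: vec_eq_iff matrix_matrix_mult_def mat_def inv_entries[OF E])
  have "matrix_inv (transpose E) = transpose (matrix_inv E)"
    by (rule matrix_inv_eqI) (simp_all add: inv transpose_mat flip: matrix_transpose_mul)
  then have t: "trace (E ** matrix_inv (transpose E)) = (\<Sum>a\<in>UNIV. \<Sum>b\<in>UNIV. E $ a $ b * matrix_inv E $ a $ b)"
    by (simp add: trace_def matrix_matrix_mult_def transpose_def)
  obtain \<eta> i where \<eta>: "\<eta> i \<noteq> 0" "(\<Sum>a\<in>UNIV. \<Sum>b\<in>UNIV. matrix_inv E $ a $ b * (\<eta> a * \<eta> b)) = 0"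
    by (rule exists_isotropic[OF card])
  interpret A: isotropic_action E q \<eta>
    by unfold_locales (use E tr \<eta> t in simp_all)
  have "A.gs (\<lambda>a b. E $ i $ a * \<eta> b) \<noteq> 0" using \<eta>(1) by (simp add: A.gs_E2)
  then obtain L where L: "L \<in> A.adm" "L [] \<noteq> 0" by (rule A.exists_adm)
  have "1 \<notin> Idl\<^bsub>univ_ring\<^esub> ?R"
    by (rule A.one_notin_ideal[OF _ q L]) (simp only: Y.relators)
  then have "Y.cls 1 \<noteq> Y.cls 0" unfolding Y.cls_eq_iff by simp
  then obtain f where f: "linfun (presented_algebra ?R) f" "f (Y.cls 1) \<noteq> f (Y.cls 0)"
    using vs_eqI[OF Y.X.vs Y.cls_closed Y.cls_closed] by blast
  have z: "f (Y.cls 0) = 0" using lf_zero[OF Y.X.vs f(1)] by (simp add: Y.sel)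
  show ?thesis
  proof (rule that)
    show "linfun (presented_algebra ?R) (\<lambda>x. inverse (f (Y.cls 1)) * f x)" by (rule lf_mult_const f(1))+
    show "inverse (f (Y.cls 1)) * f \<one>\<^bsub>presented_algebra ?R\<^esub> = 1" using f(2) by (simp add: Y.sel z)
  qed
qed

section \<open>Coding elements of cotensor products in the universe\<close>

definition push :: "('a => 'b) => ('a \<Rightarrow>\<^sub>0 'k::field) => 'b \<Rightarrow>\<^sub>0 'k" where
  "push f p = (\<Sum>x\<in>pkeys p. Poly_Mapping.single (f x) (plk p x))"

lemma lookup_push:
  assumes "inj_on f (insert y (pkeys p))"
  shows "plk (push f p) (f y) = plk p y"
proof -
  have "plk (push f p) (f y) = (\<Sum>x\<in>pkeys p. if x = y then plk p x else 0)"
    unfolding push_def lookup_sum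
    by (intro sum.cong refl) (use assms in \<open>auto simp: lookup_single when_def inj_on_def\<close>)
  then show ?thesis by (simp add: in_keys_iff)
qed

lemma push_inj_on: "inj_on f A ==> inj_on (push f) {p. pkeys p \<subseteq> A}"
proof (rule inj_onI)
  fix p q assume f: "inj_on f A" and "p \<in> {p. pkeys p \<subseteq> A}" "q \<in> {p. pkeys p \<subseteq> A}" and e: "push f p = push f q"
  then have k: "pkeys p \<subseteq> A" "pkeys q \<subseteq> A" by auto
  show "p = q"
  proof (rule poly_mapping_eqI)
    fix y show "plk p y = plk q y"
    proof (cases "y \<in> A")
      case True
      have "inj_on f (insert y (pkeys p))" "inj_on f (insert y (pkeys q))"
        using f k True by (auto simp: inj_on_def)
      then show ?thesis using lookup_push[of f y p] lookup_push[of f y q] e by simp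
    next
      case False
      then have "y \<notin> pkeys p" "y \<notin> pkeys q" using k by auto
      then show ?thesis by (simp add: in_keys_iff)
    qed
  qed
qed

text \<open>Iterating \<open>tc\<close> produces infinitely many elements of the universe, enough to code the words in finitely many
  generators.\<close>

primrec numeral_code :: "(('u \<times> 'u \<Rightarrow>\<^sub>0 'k::field) => 'u) => nat => 'u" where
  "numeral_code tc 0 = tc 0"
| "numeral_code tc (Suc n) = tc (Poly_Mapping.single (numeral_code tc n, numeral_code tc n) 1)"

lemma single_one_inj: "Poly_Mapping.single x (1::'k::field) = Poly_Mapping.single y 1 ==> x = y"
  by (metis lookup_single_eq lookup_single_not_eq zero_neq_one)

lemma single_one_nonzero: "Poly_Mapping.single x (1::'k::field) \<noteq> 0"
  by (metis lookup_single_eq lookup_zero zero_neq_one)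

lemma inj_numeral_code:
  assumes tc: "inj tc"
  shows "inj (numeral_code tc)"
proof (rule injI)
  fix m n assume "numeral_code tc m = numeral_code tc n"
  then show "m = n"
  proof (induction m arbitrary: n)
    case 0
    then show ?case by (cases n) (auto dest!: injD[OF tc] simp: single_one_nonzero dest: sym)
  next
    case (Suc m)
    then show ?case by (cases n) (auto dest!: injD[OF tc] single_one_inj simp: single_one_nonzero)
  qed
qed

text \<open>An element of the presented algebra is coded by a representing polynomial, whose words are in turn coded by
  elements of the universe; formal sums with good entries can then be pushed into the domain of \<open>tc\<close>. Wrapping
  the result in one more nonzero sum keeps it apart from \<open>tc 0\<close>, the common code of all other formal
  sums.\<close>

lemma exists_codes:
  fixes tc :: "('u \<times> 'u \<Rightarrow>\<^sub>0 'k::field) => 'u" and R :: "('x::countable, 'k) free_algebra set"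
  assumes tc: "inj tc"
  obtains e :: "('u \<times> ('x, 'k) free_algebra set \<Rightarrow>\<^sub>0 'k) => 'u" where "codes (presented_algebra R) e"
proof -
  let ?X = "presented_algebra R"
  interpret X: presented ?X R by (rule presented_algebra_presented)
  let ?w = "\<lambda>w :: 'x word. numeral_code tc (to_nat (letters w))"
  have "inj ?w"
    by (rule injI) (auto dest!: injD[OF inj_numeral_code[OF tc]] intro: word.expand)
  then have w: "inj (push (\<lambda>w. (?w w, ?w w)) :: ('x, 'k) free_algebra => _)"
    using push_inj_on[of "\<lambda>w. (?w w, ?w w)" UNIV] by (simp add: inj_on_def)
  define j where "j = (\<lambda>a. tc (push (\<lambda>w. (?w w, ?w w)) (rep a :: ('x, 'k) free_algebra)))"
  have j: "inj_on j (carrier ?X)"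
  proof (rule inj_onI)
    fix a b assume ab: "a \<in> carrier ?X" "b \<in> carrier ?X" "j a = j b"
    then have "rep a = rep b" using injD[OF w] injD[OF tc] unfolding j_def by blast
    moreover obtain p r where "a = X.cls p" "b = X.cls r" using ab(1,2) by (auto simp: X.sel)
    ultimately show "a = b" using X.cls_rep[of p] X.cls_rep[of r] by metis
  qed
  \<comment> \<open>The code of an element is injective on the carrier only, whence the restriction to formal sums over \<open>?A\<close>.\<close>
  let ?A = "{x. snd x \<in> carrier ?X} :: ('u \<times> ('x, 'k) free_algebra set) set"
  let ?G = "{p. pkeys p \<subseteq> ?A} :: ('u \<times> ('x, 'k) free_algebra set \<Rightarrow>\<^sub>0 'k) set"
  define h where "h = (\<lambda>p. tc (push (map_prod id j) p))"
  have "inj_on (map_prod id j) ?A"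
    using j by (auto simp: inj_on_def)
  then have h: "p = p'" if "p \<in> ?G" "p' \<in> ?G" "h p = h p'" for p p'
    using inj_onD[OF push_inj_on, of "map_prod id j" ?A p p'] that injD[OF tc] unfolding h_def by blast
  define e where "e = (\<lambda>p. tc (if p \<in> ?G then Poly_Mapping.single (h p, h p) 1 else 0))"
  have "codes ?X e"
    unfolding codes_def
  proof (intro allI impI)
    fix p :: "'u \<times> ('x, 'k) free_algebra set \<Rightarrow>\<^sub>0 'k"
    assume "\<forall>x\<in>pkeys p. snd x \<in> carrier ?X"
    then have p: "p \<in> ?G" by auto
    have good: "e p = tc (Poly_Mapping.single (h p, h p) 1)" if "p \<in> ?G" for p
      unfolding e_def by (simp only: that if_True)
    have bad: "e p = tc 0" if "p \<notin> ?G" for p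
      unfolding e_def by (simp only: that if_False)
    have "p' = p" if "e p' = e p" for p'
    proof (cases "p' \<in> ?G")
      case True
      have "Poly_Mapping.single (h p', h p') (1::'k) = Poly_Mapping.single (h p, h p) 1"
        using that unfolding good[OF p] good[OF True] by (rule injD[OF tc])
      then have "(h p', h p') = (h p, h p)" by (rule single_one_inj)
      then show ?thesis by (intro h[OF True p]) simp
    next
      case False
      have "0 = Poly_Mapping.single (h p, h p) (1::'k)"
        using that unfolding good[OF p] bad[OF False] by (rule injD[OF tc])
      then show ?thesis using single_one_nonzero[of "(h p, h p)", where 'k = 'k] by simp
    qed
    then show "inv_into UNIV e (e p) = p"
      unfolding inv_into_def by (intro some_equality) auto
  qed
  then show ?thesis by (rule that)
qed

section \<open>The monoidal equivalence\<close>

theorem theorem1p1: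
  fixes E :: "'k::alg_closed_field ^ 'n ^ 'n"
    and q :: 'k
    and sc :: "'k \<Rightarrow> 'u"
    and tc :: "(('u \<times> 'u) \<Rightarrow>\<^sub>0 'k) \<Rightarrow> 'u"
  assumes "CARD('n) \<ge> 2"
    and "invertible E"
    and "q \<noteq> 0"
    and "q\<^sup>2 + trace (E ** matrix_inv (transpose E)) * q + 1 = 0"
    and "inj sc" and "inj tc"
  shows "monoidally_equivalent (Comod sc tc (B_hopf E)) (Comod sc tc (SLq2_hopf q))"
proof -
  let ?F = "sl_form q"
  note F = sl_form_inverse(1)[OF \<open>q \<noteq> 0\<close>]
  interpret form_torsor "B_hopf E" "B_relators E" E "\<lambda>i j. (i, j)" "SLq2_hopf q" "SLq2_relators q" ?F sl_gen
    "presented_algebra (gen_rel E ?F)" "gen_rel E ?F" "\<lambda>i j. (i, j)"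
    "presented_algebra (gen_rel ?F E)" "gen_rel ?F E" "\<lambda>i j. (i, j)"
    by (intro form_torsor.intro form_hopf_B form_hopf_SLq2 form_algebra_gen_rel F assms(2,3))
  obtain eZ :: "(('u \<times> ('n \<times> 2, 'k) free_algebra set) \<Rightarrow>\<^sub>0 'k) \<Rightarrow> 'u" where eZ: "codes (presented_algebra (gen_rel E ?F)) eZ"
    by (rule exists_codes[OF \<open>inj tc\<close>])
  obtain eY :: "(('u \<times> (2 \<times> 'n, 'k) free_algebra set) \<Rightarrow>\<^sub>0 'k) \<Rightarrow> 'u" where eY: "codes (presented_algebra (gen_rel ?F E)) eY"
    by (rule exists_codes[OF \<open>inj tc\<close>])
  obtain \<omega> where \<omega>: "linfun (presented_algebra (gen_rel ?F E)) \<omega>" "\<omega> \<one>\<^bsub>presented_algebra (gen_rel ?F E)\<^esub> = 1"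
    by (rule linking_algebra_functional[OF assms(1-4)])
  show ?thesis
    by (rule monoidally_equivalent_torsor[OF \<open>inj sc\<close> \<open>inj tc\<close> eZ eY \<omega>])
qed

end
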